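(* Let $n\in\mathbb Z_{>0}$. Let $\Gamma$ be a subgroup of $\mathrm{Sp}_{2n}(\mathbb R)$ commensurable with $\mathrm{Sp}_{2n}(\mathbb Z)$, and let $(\rho,V)$ be an irreducible polynomial representation of $\mathrm{GL}_n(\mathbb C)$ of highest weight $\omega\in\mathbb Z^n$, where $\omega_1\geq\ldots\geq\omega_n>2n$. Then there exists a constant $c_\rho\in\mathbb C^\times$, depending only on $\rho$ (and not on $\Gamma$, $f$ or $v$), such that \[ \langle f(iI_n),v\rangle=c_\rho\,\langle f,P_{\Gamma,\rho}f_{1,v}\rangle_{S_\rho(\Gamma)},\qquad f\in S_\rho(\Gamma),\ v\in V. \]
   Context: $\mathcal H_n=\{z=x+iy\in M_n(\mathbb C): z^\top=z,\ y>0\}$ ($x,y$ real). $\mathrm{Sp}_{2n}(\mathbb R)=\{g\in\mathrm{GL}_{2n}(\mathbb R): g^\top J_ng=J_n\}$, $J_n=\begin{pmatrix}0&I_n\\-I_n&0\end{pmatrix}$, acts on $\mathcal H_n$ by $g.z=(Az+B)(Cz+D)^{-1}$ for $g=\begin{pmatrix}A&B\\C&D\end{pmatrix}$. $\Gamma$ is commensurable with $\mathrm{Sp}_{2n}(\mathbb Z)$ if $\Gamma\cap\mathrm{Sp}_{2n}(\mathbb Z)$ has finite index in both groups. The highest weight of $\rho$ is taken with respect to the upper-triangular Borel subgroup of $\mathrm{GL}_n(\mathbb C)$. $V$ carries a fixed Hermitian inner product $\langle\cdot,\cdot\rangle$ (linear in the first variable) for which $\rho|_{\mathrm U(n)}$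 is unitary; $\|\cdot\|$ is its norm. Slash action: $(f|_\rho g)(z)=\rho(Cz+D)^{-1}f(g.z)$ for $f:\mathcal H_n\to V$. $f_{1,v}:\mathcal H_n\to V$ is $f_{1,v}(z)=\rho\big(\tfrac1{2i}(z+iI_n)\big)^{-1}v$, and $P_{\Gamma,\rho}f=\sum_{\gamma\in\Gamma}f|_\rho\gamma$; for $f=f_{1,v}$ this series converges absolutely and locally uniformly and lies in $S_\rho(\Gamma)$. $S_\rho(\Gamma)$ is the finite-dimensional space of Siegel cusp forms of weight $\rho$ for $\Gamma$: the holomorphic functions $f:\mathcal H_n\to V$ such that $f|_\rho\gamma=f$ for all $\gamma\in\Gamma$ and $\sup_{z\in\mathcal H_n}\|\rho(y^{1/2})f(z)\|<\infty$ (since $\omega_n>0$, this is equivalent to the usual definition by Fourier expansions of $f|_\rho\delta$, $\delta\in\mathrm{Sp}_{2n}(\mathbb Z)$, being supported on positive definite matrices). It is equipped with the Petersson inner product \[ \langle f_1,f_2\rangle_{S_\rho(\Gamma)}=\frac1{|\Gamma\cap\{\pm I_{2n}\}|}\int_{\Gamma\backslash\mathcal H_n}\langle\rho(y^{1/2})f_1(z),\rho(y^{1/2})f_2(z)\rangle\,d\mathsf v(z), \] where $d\mathsf v(x+iy)=(\det y)^{-n-1}\prod_{1\leq r\leq s\leq n}dx_{r,s}\,dy_{r,s}$. *)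

theory Defs
  imports "HOL-Analysis.Analysis" "HOL-Algebra.Coset"
begin

abbreviation cmat :: "real^'n^'m \<Rightarrow> complex^'n^'m" where
  "cmat \<equiv> map_matrix complex_of_real"

abbreviation mscale :: "'a::times \<Rightarrow> 'a^'n^'m \<Rightarrow> 'a^'n^'m" where
  "mscale c \<equiv> map_matrix ((*) c)"

definition conj_transpose :: "complex^'n^'m \<Rightarrow> complex^'m^'n" where
  "conj_transpose A = transpose (map_matrix cnj A)"

definition unitary_matrix :: "complex^'n^'n \<Rightarrow> bool" where
  "unitary_matrix U \<longleftrightarrow> U ** conj_transpose U = mat 1 \<and> conj_transpose U ** U = mat 1"

definition sym_mat :: "'a^'n^'n \<Rightarrow> bool" where
  "sym_mat A \<longleftrightarrow> transpose A = A"

definition pos_def :: "real^'n^'n \<Rightarrow> bool" where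
  "pos_def y \<longleftrightarrow> sym_mat y \<and> (\<forall>v. v \<noteq> 0 \<longrightarrow> v \<bullet> (y *v v) > 0)"

text \<open>The positive definite square root; only meaningful for positive definite \<open>y\<close>,
  where it is unique.\<close>

definition sqrt_mat :: "real^'n^'n \<Rightarrow> real^'n^'n" where
  "sqrt_mat y = (THE s. pos_def s \<and> s ** s = y)"

text \<open>Matrices of size \<open>2n\<close> are indexed by \<open>'n + 'n\<close>, so that the \<open>n \<times> n\<close> blocks are
  selected by \<open>Inl\<close> and \<open>Inr\<close>.\<close>

definition blockA :: "'a^('n::finite+'n)^('n+'n) \<Rightarrow> 'a^'n^'n" where
  "blockA g = (\<chi> i j. g $ Inl i $ Inl j)"

definition blockB :: "'a^('n::finite+'n)^('n+'n) \<Rightarrow> 'a^'n^'n" where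
  "blockB g = (\<chi> i j. g $ Inl i $ Inr j)"

definition blockC :: "'a^('n::finite+'n)^('n+'n) \<Rightarrow> 'a^'n^'n" where
  "blockC g = (\<chi> i j. g $ Inr i $ Inl j)"

definition blockD :: "'a^('n::finite+'n)^('n+'n) \<Rightarrow> 'a^'n^'n" where
  "blockD g = (\<chi> i j. g $ Inr i $ Inr j)"

definition J_mat :: "real^('n::finite+'n)^('n+'n)" where
  "J_mat = (\<chi> r s. case (r, s) of
      (Inl i, Inr j) \<Rightarrow> (if i = j then 1 else 0)
    | (Inr i, Inl j) \<Rightarrow> (if i = j then -1 else 0)
    | _ \<Rightarrow> 0)"

definition Sp :: "(real^('n::finite+'n)^('n+'n)) monoid" where
  "Sp = \<lparr>carrier = {g. invertible g \<and> transpose g ** J_mat ** g = J_mat},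
         monoid.mult = (**), one = mat 1\<rparr>"

definition Sp_Z :: "(real^('n::finite+'n)^('n+'n)) set" where
  "Sp_Z = {g \<in> carrier Sp. \<forall>r s. g $ r $ s \<in> \<int>}"

definition finite_index :: "('a, 'b) monoid_scheme \<Rightarrow> 'a set \<Rightarrow> 'a set \<Rightarrow> bool" where
  "finite_index G H K \<longleftrightarrow> finite (rcosets\<^bsub>G\<lparr>carrier := K\<rparr>\<^esub> H)"

definition commensurable :: "('a, 'b) monoid_scheme \<Rightarrow> 'a set \<Rightarrow> 'a set \<Rightarrow> bool" where
  "commensurable G H K \<longleftrightarrow> finite_index G (H \<inter> K) H \<and> finite_index G (H \<inter> K) K"

definition siegel :: "(complex^'n^'n) set" where
  "siegel = {z. sym_mat z \<and> pos_def (map_matrix Im z)}"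

definition iI :: "complex^'n^'n" where
  "iI = mat \<i>"

definition autf :: "real^('n::finite+'n)^('n+'n) \<Rightarrow> complex^'n^'n \<Rightarrow> complex^'n^'n" where
  "autf g z = cmat (blockC g) ** z + cmat (blockD g)"

definition act :: "real^('n::finite+'n)^('n+'n) \<Rightarrow> complex^'n^'n \<Rightarrow> complex^'n^'n" where
  "act g z = (cmat (blockA g) ** z + cmat (blockB g)) ** matrix_inv (autf g z)"

text \<open>Coordinates on symmetric matrices are the entries with \<open>r \<le> s\<close>; the measure is
  \<open>(det y)\<^sup>-\<^sup>n\<^sup>-\<^sup>1 \<Prod>\<^sub>r\<^sub>\<le>\<^sub>s dx\<^sub>r\<^sub>s dy\<^sub>r\<^sub>s\<close> on the half space, regarded as a Borel measure on all
  complex matrices (zero outside the half space).\<close>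

definition upper_index :: "('n::linorder \<times> 'n) set" where
  "upper_index = {(r, s). r \<le> s}"

definition sym_of :: "('n::{finite,linorder} \<times> 'n \<Rightarrow> real) \<Rightarrow> real^'n::{finite,linorder}^'n::{finite,linorder}" where
  "sym_of x = (\<chi> r s. x (min r s, max r s))"

definition siegel_measure :: "(complex^'n::{finite,linorder}^'n::{finite,linorder}) measure" where
  "siegel_measure = density
     (distr ((\<Pi>\<^sub>M p\<in>upper_index. lborel) \<Otimes>\<^sub>M (\<Pi>\<^sub>M p\<in>upper_index. lborel)) borel
       (\<lambda>(x, y). cmat (sym_of x) + mscale \<i> (cmat (sym_of y))))
     (\<lambda>z. indicator siegel z * ennreal (1 / det (map_matrix Im z) ^ (CARD('n) + 1)))"

text \<open>A Borel set of representatives of the orbits of \<open>\<Gamma>\<close>, meeting each orbit exactly once.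
  For discrete \<open>\<Gamma>\<close> such sets exist, and the integral over \<open>\<Gamma>\<close>-orbits of an invariant function
  is its integral over any of them.\<close>

definition orbit_reps ::
  "(real^('n::finite+'n)^('n+'n)) set \<Rightarrow> (complex^'n^'n) set \<Rightarrow> bool" where
  "orbit_reps \<Gamma> F \<longleftrightarrow> F \<in> sets borel \<and> F \<subseteq> siegel \<and>
     (\<forall>z\<in>siegel. \<exists>!w. w \<in> F \<and> (\<exists>\<gamma>\<in>\<Gamma>. w = act \<gamma> z))"

definition quotient_integral ::
  "(real^('n::{finite,linorder}+'n)^('n::{finite,linorder}+'n)) set \<Rightarrow> (complex^'n::{finite,linorder}^'n::{finite,linorder} \<Rightarrow> complex) \<Rightarrow> complex" where
  "quotient_integral \<Gamma> h = (LINT z:(SOME F. orbit_reps \<Gamma> F)|siegel_measure. h z)"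

text \<open>The space \<open>V\<close> is \<open>complex^'d\<close>, and a representation is a map \<open>\<rho>\<close> into \<open>d \<times> d\<close> matrices,
  of which only the values on invertible matrices matter.\<close>

inductive complex_polynomial_fun :: "(complex^'n^'m \<Rightarrow> complex) \<Rightarrow> bool" where
  entry: "complex_polynomial_fun (\<lambda>g. g $ i $ j)"
| const: "complex_polynomial_fun (\<lambda>g. c)"
| add: "complex_polynomial_fun p \<Longrightarrow> complex_polynomial_fun q \<Longrightarrow>
          complex_polynomial_fun (\<lambda>g. p g + q g)"
| mult: "complex_polynomial_fun p \<Longrightarrow> complex_polynomial_fun q \<Longrightarrow>
          complex_polynomial_fun (\<lambda>g. p g * q g)"

definition polynomial_rep :: "(complex^'n^'n \<Rightarrow> complex^'d^'d) \<Rightarrow> bool" where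
  "polynomial_rep \<rho> \<longleftrightarrow>
     \<rho> (mat 1) = mat 1 \<and>
     (\<forall>g h. invertible g \<longrightarrow> invertible h \<longrightarrow> \<rho> (g ** h) = \<rho> g ** \<rho> h) \<and>
     (\<forall>i j. \<exists>p. complex_polynomial_fun p \<and> (\<forall>g. invertible g \<longrightarrow> \<rho> g $ i $ j = p g))"

text \<open>There is no condition that \<open>V\<close> be nonzero because \<open>complex^'d\<close> always is.\<close>

definition irreducible_rep :: "(complex^'n^'n \<Rightarrow> complex^'d^'d) \<Rightarrow> bool" where
  "irreducible_rep \<rho> \<longleftrightarrow>
     (\<forall>W. vec.subspace W \<and> (\<forall>g. invertible g \<longrightarrow> (\<forall>w\<in>W. \<rho> g *v w \<in> W))
          \<longrightarrow> W = {0} \<or> W = UNIV)"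

definition upper_triangular :: "complex^'n::{finite,linorder}^'n::{finite,linorder} \<Rightarrow> bool" where
  "upper_triangular b \<longleftrightarrow> (\<forall>i j. j < i \<longrightarrow> b $ i $ j = 0)"

definition highest_weight ::
  "(complex^'n::{finite,linorder}^'n::{finite,linorder} \<Rightarrow> complex^'d^'d) \<Rightarrow> ('n::{finite,linorder} \<Rightarrow> int) \<Rightarrow> bool" where
  "highest_weight \<rho> \<omega> \<longleftrightarrow>
     (\<exists>u. u \<noteq> 0 \<and> (\<forall>b. invertible b \<and> upper_triangular b \<longrightarrow>
        \<rho> b *v u = (\<Prod>i\<in>UNIV. (b $ i $ i) powi \<omega> i) *s u))"

definition hermitian_inner :: "(complex^'d \<Rightarrow> complex^'d \<Rightarrow> complex) \<Rightarrow> bool" where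
  "hermitian_inner ip \<longleftrightarrow>
     (\<forall>u v w. ip (u + v) w = ip u w + ip v w) \<and>
     (\<forall>c u w. ip (c *s u) w = c * ip u w) \<and>
     (\<forall>u v. ip v u = cnj (ip u v)) \<and>
     (\<forall>u. u \<noteq> 0 \<longrightarrow> Re (ip u u) > 0)"

definition unitary_on_U ::
  "(complex^'n^'n \<Rightarrow> complex^'d^'d) \<Rightarrow> (complex^'d \<Rightarrow> complex^'d \<Rightarrow> complex) \<Rightarrow> bool" where
  "unitary_on_U \<rho> ip \<longleftrightarrow>
     (\<forall>k. unitary_matrix k \<longrightarrow> (\<forall>u v. ip (\<rho> k *v u) (\<rho> k *v v) = ip u v))"

definition ip_norm :: "(complex^'d \<Rightarrow> complex^'d \<Rightarrow> complex) \<Rightarrow> complex^'d \<Rightarrow> real" where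
  "ip_norm ip u = sqrt (Re (ip u u))"

definition slash ::
  "(complex^'n^'n \<Rightarrow> complex^'d^'d) \<Rightarrow> (complex^'n^'n \<Rightarrow> complex^'d) \<Rightarrow>
   real^('n::finite+'n)^('n+'n) \<Rightarrow> complex^'n^'n \<Rightarrow> complex^'d" where
  "slash \<rho> f g z = matrix_inv (\<rho> (autf g z)) *v f (act g z)"

text \<open>The half space is open in the space of symmetric matrices but not in that of all
  matrices, so the complex-linear derivative is taken within the half space.\<close>

definition holomorphic_siegel :: "(complex^'n^'n \<Rightarrow> complex^'d) \<Rightarrow> bool" where
  "holomorphic_siegel f \<longleftrightarrow>
     (\<forall>z\<in>siegel. \<exists>L. (f has_derivative L) (at z within siegel) \<and>
        (\<forall>c w. L (mscale c w) = c *s L w))"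

definition weighted ::
  "(complex^'n^'n \<Rightarrow> complex^'d^'d) \<Rightarrow> (complex^'n^'n \<Rightarrow> complex^'d) \<Rightarrow>
   complex^'n^'n \<Rightarrow> complex^'d" where
  "weighted \<rho> f z = \<rho> (cmat (sqrt_mat (map_matrix Im z))) *v f z"

text \<open>Forms are functions on the half space: their values elsewhere are unconstrained and
  never used.\<close>

definition cusp_forms ::
  "(complex^'n^'n \<Rightarrow> complex^'d^'d) \<Rightarrow> (complex^'d \<Rightarrow> complex^'d \<Rightarrow> complex) \<Rightarrow>
   (real^('n::finite+'n)^('n+'n)) set \<Rightarrow> (complex^'n^'n \<Rightarrow> complex^'d) set" where
  "cusp_forms \<rho> ip \<Gamma> = {f. holomorphic_siegel f \<and>
     (\<forall>\<gamma>\<in>\<Gamma>. \<forall>z\<in>siegel. slash \<rho> f \<gamma> z = f z) \<and>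
     bdd_above ((\<lambda>z. ip_norm ip (weighted \<rho> f z)) ` siegel)}"

definition petersson ::
  "(complex^'n::{finite,linorder}^'n::{finite,linorder} \<Rightarrow> complex^'d^'d) \<Rightarrow>
   (complex^'d \<Rightarrow> complex^'d \<Rightarrow> complex) \<Rightarrow> (real^('n::{finite,linorder}+'n)^('n::{finite,linorder}+'n)) set \<Rightarrow>
   (complex^'n::{finite,linorder}^'n::{finite,linorder} \<Rightarrow> complex^'d) \<Rightarrow> (complex^'n::{finite,linorder}^'n::{finite,linorder} \<Rightarrow> complex^'d) \<Rightarrow> complex" where
  "petersson \<rho> ip \<Gamma> f1 f2 =
     1 / of_nat (card (\<Gamma> \<inter> {mat 1, - mat 1})) *
     quotient_integral \<Gamma> (\<lambda>z. ip (weighted \<rho> f1 z) (weighted \<rho> f2 z))"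

definition f_one ::
  "(complex^'n^'n \<Rightarrow> complex^'d^'d) \<Rightarrow> complex^'d \<Rightarrow> complex^'n^'n \<Rightarrow> complex^'d" where
  "f_one \<rho> v z = matrix_inv (\<rho> (mscale (1 / (2 * \<i>)) (z + iI))) *v v"

definition poincare ::
  "(complex^'n^'n \<Rightarrow> complex^'d^'d) \<Rightarrow> (real^('n::finite+'n)^('n+'n)) set \<Rightarrow>
   (complex^'n^'n \<Rightarrow> complex^'d) \<Rightarrow> complex^'n^'n \<Rightarrow> complex^'d" where
  "poincare \<rho> \<Gamma> f z = (\<Sum>\<^sub>\<infinity>\<gamma>\<in>\<Gamma>. slash \<rho> f \<gamma> z)"

end

theory Submission
  imports Defs "HOL-Library.List_Lexorder" "HOL-Complex_Analysis.Complex_Analysis"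
    "HOL-Computational_Algebra.Fundamental_Theorem_Algebra"
begin

text \<open>In the coordinate \<open>w = (z - i)(z + i)\<^sup>-\<^sup>1\<close> on the disc, the pairing of \<open>f\<close> with \<open>f\<^sub>1\<^sub>,\<^sub>v\<close>
  becomes \<open>\<langle>\<rho>(1 - w\<^sup>*w) F(w), v\<rangle>\<close>, where \<open>F(w) = \<rho>(1 - w)\<^sup>-\<^sup>1 f(z)\<close> is holomorphic with \<open>F(0) = f(iI)\<close>.
  The invariant measure and \<open>w\<^sup>*w\<close> do not change under the rotations \<open>w \<mapsto> t w\<close>, \<open>|t| = 1\<close>, so by the
  mean value property \<open>F(w)\<close> may be replaced by \<open>F(0)\<close> under the integral over the half space. What
  remains is \<open>\<langle>A f(iI), v\<rangle>\<close> with \<open>A = \<integral> \<rho>(1 - w\<^sup>*w)\<close>. This operator commutes with \<open>\<rho>(U(n))\<close>, hence is a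
  scalar by Schur's lemma and the Zariski density of the unitary group, and the scalar is positive
  because \<open>A\<close> is. Convergence comes from \<open>\<parallel>\<rho>(1 - w\<^sup>*w)\<parallel> = O(det(1 - w\<^sup>*w)\<^bsup>2n+1\<^esup>)\<close>, a consequence of
  \<open>\<omega>\<^sub>n > 2n\<close>: its square root dominates the pairing and is integrable. Unfolding the integral over
  \<open>\<Gamma>\<close>-orbits gives each point the multiplicity \<open>|\<Gamma> \<inter> {\<plusminus>1}|\<close>, since almost every stabilizer is central.\<close>

unbundle no Formal_Power_Series.fps_syntax

section \<open>Complex and real matrices\<close>

text \<open>The threshold 2n is that of one determinant power. One has det(1 - w^* w) = det(y)
  |det(1 - w)|^2, and the invariant measure carries det(y)^{-(n+1)}; half of the exponent 2n + 1
  thus leaves det(y)^{-1/2} dx dy, which is integrable on bounded sets of positive definite y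
  because each diagonal entry enters the determinant affinely. Only half of the exponent is
  available: a cusp form is merely bounded in the weighted norm, so Cauchy-Schwarz leaves the norm
  of \<open>f_one\<close>, whose square is O(det(1 - w^* w)^{2n+1}). Bounded sets do not exhaust the
  half space; points of the disc with det(1 - w) near 0 are rotated away from there, and by
  compactness finitely many rotations do. The mean value property enters as a limit of averages over
  roots of unity, so that only finite sums meet the integral. Density of the unitary group also
  shows that the adjoint of rho(g) is rho of the conjugate transpose of g, on which all
  manipulations of the pairing rest. Invariance of the measure needs the Jacobian of a congruence,
  which multiplicativity reduces to positive diagonal matrices.\<close>

lemma matrix_diff_ldistrib: "A ** (B - C) = A ** B - A ** (C::'a::ring_1^'n^'m)"
  by (simp add: vec_eq_iff matrix_matrix_mult_def right_diff_distrib sum_subtractf)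

lemma matrix_diff_rdistrib: "(B - C) ** A = B ** A - (C::'a::ring_1^'n^'m) ** A"
  by (simp add: vec_eq_iff matrix_matrix_mult_def left_diff_distrib sum_subtractf)

lemma matrix_neg_left [simp]: "(- A) ** B = - ((A::'a::ring_1^'n^'m) ** B)"
  by (simp add: vec_eq_iff matrix_matrix_mult_def sum_negf)

lemma matrix_neg_right [simp]: "A ** (- B) = - ((A::'a::ring_1^'n^'m) ** B)"
  by (simp add: vec_eq_iff matrix_matrix_mult_def sum_negf)

lemma matrix_mult_zero_left [simp]: "0 ** A = (0::'a::semiring_1^'n^'m)"
  by (simp add: vec_eq_iff matrix_matrix_mult_def)

lemma matrix_mult_zero_right [simp]: "A ** 0 = (0::'a::semiring_1^'n^'m)"
  by (simp add: vec_eq_iff matrix_matrix_mult_def)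

lemma matrix_add_rdistrib: "(B + C) ** A = B ** A + (C::'a::semiring_1^'n^'m) ** A"
  by (simp add: vec_eq_iff matrix_matrix_mult_def distrib_right sum.distrib)

lemmas mat_ring = matrix_add_ldistrib matrix_add_rdistrib matrix_diff_ldistrib
  matrix_diff_rdistrib matrix_mul_assoc [symmetric]

lemma mat_mult_left_nth: "(mat c ** A) $ i $ j = c * (A::'a::comm_ring_1^'n^'m) $ i $ j"
proof -
  have "(\<Sum>k\<in>UNIV. (if i = k then c else 0) * A $ k $ j) = (\<Sum>k\<in>{i}. c * A $ k $ j)"
    by (rule sum.mono_neutral_cong_right) auto
  then show ?thesis by (simp add: matrix_matrix_mult_def mat_def)
qed

lemma mscale_eq: "mscale c A = mat c ** (A::'a::comm_ring_1^'n^'m)"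
  by (simp add: vec_eq_iff mat_mult_left_nth)

lemma mat_commute: "A ** mat c = mat c ** (A::'a::comm_ring_1^'n^'n)"
proof -
  have "(A ** mat c) $ i $ j = c * A $ i $ j" for i j
  proof -
    have "(\<Sum>k\<in>UNIV. A $ i $ k * (if k = j then c else 0)) = (\<Sum>k\<in>{j}. c * A $ i $ k)"
      by (rule sum.mono_neutral_cong_right) auto
    then show ?thesis by (simp add: matrix_matrix_mult_def mat_def)
  qed
  then show ?thesis by (simp add: vec_eq_iff mat_mult_left_nth)
qed

lemma mat_mat [simp]: "mat a ** mat b = (mat (a * b) :: 'a::comm_ring_1^'n^'n)"
  by (simp add: vec_eq_iff mat_mult_left_nth) (simp add: mat_def)

lemma mat_add: "mat (a + b) = mat a + (mat b :: 'a::comm_ring_1^'n^'n)"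
  by (simp add: vec_eq_iff mat_def)

lemma mat_minus: "mat (- a) = - (mat a :: 'a::comm_ring_1^'n^'n)"
  by (simp add: vec_eq_iff mat_def)

lemma mat_vec: "mat c *v u = c *s (u::'a::comm_ring_1^'n)"
proof -
  have "(\<Sum>k\<in>UNIV. (if i = k then c else 0) * u $ k) = (\<Sum>k\<in>{i}. c * u $ k)" for i
    by (rule sum.mono_neutral_cong_right) auto
  then show ?thesis by (simp add: vec_eq_iff matrix_vector_mult_def mat_def)
qed

lemma det_mat: "det (mat c :: 'a::comm_ring_1^'n^'n) = c ^ CARD('n)"
  by (subst det_diagonal) (auto simp: mat_def)

lemma matrix_inv_cancel:
  fixes A :: "'a::semiring_1^'n^'m"
  assumes "invertible A"
  shows matrix_inv_right: "A ** matrix_inv A = mat 1"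
    and matrix_inv_left: "matrix_inv A ** A = mat 1"
proof -
  have "\<exists>A'. A ** A' = mat 1 \<and> A' ** A = mat 1"
    using assms by (simp add: invertible_def)
  from someI_ex [OF this] show "A ** matrix_inv A = mat 1" "matrix_inv A ** A = mat 1"
    by (simp_all add: matrix_inv_def)
qed

lemma matrix_inv_cancel_assoc:
  fixes A :: "'a::semiring_1^'n^'n"
  assumes "invertible A"
  shows "A ** (matrix_inv A ** X) = X" "matrix_inv A ** (A ** X) = X"
    "A *v (matrix_inv A *v x) = x" "matrix_inv A *v (A *v x) = x"
  using assms by (simp_all add: matrix_mul_assoc matrix_vector_mul_assoc matrix_inv_right matrix_inv_left)

lemma invertible_matrix_inv: "invertible A \<Longrightarrow> invertible (matrix_inv A)"
  unfolding invertible_def [of "matrix_inv A"] using matrix_inv_cancel by blast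

lemma invertibleI: "A ** B = mat 1 \<Longrightarrow> invertible (A::'a::field^'n^'n)"
  using invertible_right_inverse by blast

lemma matrix_inv_unique: "A ** B = mat 1 \<Longrightarrow> matrix_inv A = (B::'a::field^'n^'n)"
  by (metis invertibleI matrix_inv_left matrix_mul_assoc matrix_mul_lid matrix_mul_rid)

lemma matrix_inv_unique': "B ** A = mat 1 \<Longrightarrow> matrix_inv A = (B::'a::field^'n^'n)"
  using matrix_inv_unique matrix_left_right_inverse by blast

lemma matrix_inv_one [simp]: "matrix_inv (mat 1) = (mat 1 :: 'a::field^'n^'n)"
  by (rule matrix_inv_unique) simp

lemma matrix_inv_mult:
  assumes "invertible (A::'a::field^'n^'n)" "invertible (B::'a::field^'n^'n)"
  shows "matrix_inv (A ** B) = matrix_inv B ** matrix_inv A"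
  by (rule matrix_inv_unique) (simp add: assms matrix_mul_assoc [symmetric] matrix_inv_cancel_assoc matrix_inv_cancel)

lemma matrix_inv_inv: "invertible A \<Longrightarrow> matrix_inv (matrix_inv A) = (A::'a::field^'n^'n)"
  by (rule matrix_inv_unique) (simp add: matrix_inv_left)

lemma invertible_mat: "c \<noteq> 0 \<Longrightarrow> invertible (mat c :: 'a::field^'n^'n)"
  by (rule invertibleI [of _ "mat (1 / c)"]) simp

lemma matrix_inv_mat: "c \<noteq> 0 \<Longrightarrow> matrix_inv (mat c) = (mat (1 / c) :: 'a::field^'n^'n)"
  by (rule matrix_inv_unique) simp

lemma invertible_kernel: "(\<And>u. A *v u = 0 \<Longrightarrow> u = 0) \<Longrightarrow> invertible (A::'a::field^'n^'n)"
  using invertible_left_inverse matrix_left_invertible_ker by blast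

lemma transpose_add: "transpose (A + B) = transpose A + transpose B"
  by (simp add: vec_eq_iff transpose_def)

lemma transpose_diff: "transpose (A - B) = transpose A - transpose B"
  by (simp add: vec_eq_iff transpose_def)

lemma transpose_minus: "transpose (- A) = - transpose A"
  by (simp add: vec_eq_iff transpose_def)

lemma transpose_inv:
  "invertible A \<Longrightarrow> transpose (matrix_inv A) = matrix_inv (transpose (A::'a::field^'n^'n))"
  by (rule matrix_inv_unique' [symmetric]) (simp add: matrix_transpose_mul [symmetric] matrix_inv_right transpose_mat)

lemma invertible_transpose: "invertible A \<Longrightarrow> invertible (transpose (A::'a::field^'n^'n))"
  by (simp add: invertible_det_nz)

text \<open>Cramer's rule. Continuity of inversion and rationality of the Cayley transform along a
  line are both read off from this quotient of determinants.\<close>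

lemma matrix_inv_nth:
  fixes A :: "'a::field^'n^'n"
  assumes "det A \<noteq> 0"
  shows "matrix_inv A $ k $ l = det (\<chi> i j. if j = k then (if i = l then 1 else 0) else A $ i $ j) / det A"
proof -
  have "A *v (matrix_inv A *v axis l 1) = axis l 1"
    using assms by (simp add: invertible_det_nz matrix_inv_cancel_assoc)
  then have "matrix_inv A *v axis l 1 = (\<chi> k. det (\<chi> i j. if j = k then axis l 1 $ i else A $ i $ j) / det A)"
    by (subst (asm) cramer [OF assms])
  moreover have "(matrix_inv A *v axis l 1) $ k = matrix_inv A $ k $ l"
    by (simp add: matrix_vector_mult_def axis_def if_distrib [of "(*) _"] cong: if_cong)
  ultimately show ?thesis by (simp add: axis_def cong: if_cong)
qed

lemma cmat_mult: "cmat (A ** B) = cmat A ** cmat B"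
  by (simp add: vec_eq_iff matrix_matrix_mult_def)

lemma cmat_add: "cmat (A + B) = cmat A + cmat B"
  by (simp add: vec_eq_iff)

lemma cmat_diff: "cmat (A - B) = cmat A - cmat B"
  by (simp add: vec_eq_iff)

lemma cmat_minus: "cmat (- A) = - cmat A"
  by (simp add: vec_eq_iff)

lemma cmat_mat [simp]: "cmat (mat c) = mat (of_real c)"
  by (simp add: vec_eq_iff mat_def)

lemma cmat_zero [simp]: "cmat 0 = 0"
  by (simp add: vec_eq_iff)

lemma cmat_transpose: "cmat (transpose A) = transpose (cmat A)"
  by (simp add: vec_eq_iff transpose_def)

lemma det_cmat: "det (cmat A) = of_real (det (A::real^'n^'n))"
  by (simp add: det_def)

lemma invertible_cmat: "invertible (cmat A) \<longleftrightarrow> invertible (A::real^'n^'n)"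
  by (simp add: invertible_det_nz det_cmat)

lemma conj_transpose_nth [simp]: "conj_transpose A $ i $ j = cnj (A $ j $ i)"
  by (simp add: conj_transpose_def transpose_def)

lemma conj_transpose_mult: "conj_transpose (A ** B) = conj_transpose B ** conj_transpose A"
  by (simp add: vec_eq_iff matrix_matrix_mult_def mult.commute)

lemma conj_transpose_add: "conj_transpose (A + B) = conj_transpose A + conj_transpose B"
  by (simp add: vec_eq_iff)

lemma conj_transpose_diff: "conj_transpose (A - B) = conj_transpose A - conj_transpose B"
  by (simp add: vec_eq_iff)

lemma conj_transpose_mat [simp]: "conj_transpose (mat c) = mat (cnj c)"
  by (simp add: vec_eq_iff mat_def)

lemma conj_transpose_invol [simp]: "conj_transpose (conj_transpose A) = A"
  by (simp add: vec_eq_iff)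

lemma conj_transpose_cmat: "conj_transpose (cmat A) = cmat (transpose A)"
  by (simp add: vec_eq_iff transpose_def)

lemma det_conj_transpose: "det (conj_transpose A) = cnj (det (A::complex^'n^'n))"
proof -
  have "det (map_matrix cnj A) = cnj (det A)"
    by (simp add: det_def)
  then show ?thesis by (simp add: conj_transpose_def det_transpose)
qed

lemma invertible_conj_transpose: "invertible A \<Longrightarrow> invertible (conj_transpose (A::complex^'n^'n))"
  by (simp add: invertible_det_nz det_conj_transpose)

lemma conj_transpose_inv:
  "invertible A \<Longrightarrow> conj_transpose (matrix_inv A) = matrix_inv (conj_transpose (A::complex^'n^'n))"
  by (rule matrix_inv_unique' [symmetric]) (simp add: conj_transpose_mult [symmetric] matrix_inv_right)

section \<open>The standard Hermitian form\<close>

definition hdot :: "complex^'n \<Rightarrow> complex^'n \<Rightarrow> complex" where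
  "hdot u v = (\<Sum>i\<in>UNIV. u $ i * cnj (v $ i))"

lemma hdot_add_left: "hdot (u + v) w = hdot u w + hdot v w"
  by (simp add: hdot_def distrib_right sum.distrib)

lemma hdot_diff_left: "hdot (u - v) w = hdot u w - hdot v w"
  by (simp add: hdot_def left_diff_distrib sum_subtractf)

lemma hdot_scale_left: "hdot (c *s u) w = c * hdot u w"
  by (simp add: hdot_def sum_distrib_left mult.assoc)

lemma hdot_add_right: "hdot u (v + w) = hdot u v + hdot u w"
  by (simp add: hdot_def distrib_left sum.distrib)

lemma hdot_diff_right: "hdot u (v - w) = hdot u v - hdot u w"
  by (simp add: hdot_def right_diff_distrib sum_subtractf)

lemma hdot_scale_right: "hdot u (c *s w) = cnj c * hdot u w"
  by (simp add: hdot_def sum_distrib_left mult_ac)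

lemma hdot_zero [simp]: "hdot 0 v = 0" "hdot v 0 = 0"
  by (simp_all add: hdot_def)

lemma hdot_cnj: "cnj (hdot u v) = hdot v u"
  by (simp add: hdot_def mult.commute)

lemma hdot_self: "hdot u u = of_real ((norm u)\<^sup>2)"
  by (simp add: hdot_def norm_vec_def L2_set_def sum_nonneg complex_norm_square [symmetric])

lemma hdot_eq_0_iff [simp]: "hdot u u = 0 \<longleftrightarrow> u = 0"
  by (simp add: hdot_self)

lemma Re_hdot: "Re (hdot u v) = u \<bullet> v"
  by (simp add: hdot_def inner_vec_def inner_complex_def)

lemma hdot_adjoint: "hdot (A *v u) v = hdot u (conj_transpose A *v v)"
proof -
  have "hdot (A *v u) v = (\<Sum>i\<in>UNIV. \<Sum>j\<in>UNIV. A $ i $ j * u $ j * cnj (v $ i))"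
    by (simp add: hdot_def matrix_vector_mult_def sum_distrib_right)
  also have "\<dots> = (\<Sum>j\<in>UNIV. \<Sum>i\<in>UNIV. A $ i $ j * u $ j * cnj (v $ i))"
    by (rule sum.swap)
  also have "\<dots> = hdot u (conj_transpose A *v v)"
    by (simp add: hdot_def matrix_vector_mult_def sum_distrib_left mult_ac)
  finally show ?thesis .
qed

lemma norm_smult_vec: "norm (c *s (u::complex^'n)) = cmod c * norm u"
  by (simp add: norm_vec_def norm_mult L2_set_right_distrib)

section \<open>Continuity of the matrix operations\<close>

lemma continuous_on_matrix:
  "continuous_on S f \<longleftrightarrow> (\<forall>i j. continuous_on S (\<lambda>x. (f x :: 'b::topological_space^'n^'m) $ i $ j))"
proof
  assume "\<forall>i j. continuous_on S (\<lambda>x. f x $ i $ j)"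
  then have "continuous_on S (\<lambda>x. \<chi> i j. f x $ i $ j)"
    by (intro continuous_on_vec_lambda) auto
  then show "continuous_on S f" by simp
qed (auto intro!: continuous_intros)

lemma continuous_on_mmult [continuous_intros]:
  fixes f :: "'x::topological_space \<Rightarrow> 'a::real_normed_field^'n^'m"
  assumes "continuous_on S f" "continuous_on S g"
  shows "continuous_on S (\<lambda>x. f x ** g x)"
  unfolding continuous_on_matrix using assms
  by (auto simp: matrix_matrix_mult_def intro!: continuous_intros)

lemma continuous_on_mvmult [continuous_intros]:
  fixes f :: "'x::topological_space \<Rightarrow> 'a::real_normed_field^'n^'m"
  assumes "continuous_on S f" "continuous_on S g"
  shows "continuous_on S (\<lambda>x. f x *v g x)"
  using assms unfolding matrix_vector_mult_def
  by (auto intro!: continuous_intros continuous_on_vec_lambda)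

lemma continuous_on_det [continuous_intros]:
  fixes f :: "'x::topological_space \<Rightarrow> 'a::real_normed_field^'n^'n"
  assumes "continuous_on S f"
  shows "continuous_on S (\<lambda>x. det (f x))"
  unfolding det_def using assms by (auto intro!: continuous_intros)

lemma continuous_on_minv [continuous_intros]:
  fixes f :: "'x::topological_space \<Rightarrow> 'a::real_normed_field^'n^'n"
  assumes f: "continuous_on S f" and "\<And>x. x \<in> S \<Longrightarrow> invertible (f x)"
  shows "continuous_on S (\<lambda>x. matrix_inv (f x))"
  unfolding continuous_on_matrix
proof safe
  fix k l
  have nz: "det (f x) \<noteq> 0" if "x \<in> S" for x using assms that by (simp add: invertible_det_nz)
  have "continuous_on S (\<lambda>x. det (\<chi> i j. if j = k then (if i = l then 1 else 0) else f x $ i $ j) / det (f x))"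
  proof (intro continuous_on_divide continuous_on_det f ballI nz, unfold continuous_on_matrix, safe)
    fix i j
    show "continuous_on S (\<lambda>x. (\<chi> i j. if j = k then (if i = l then 1 else 0) else f x $ i $ j) $ i $ j)"
      using f by (cases "j = k") (auto intro!: continuous_intros)
  qed
  then show "continuous_on S (\<lambda>x. matrix_inv (f x) $ k $ l)"
    by (subst continuous_on_cong [OF refl matrix_inv_nth]) (use nz in auto)
qed

lemma continuous_on_map_matrix [continuous_intros]:
  assumes "continuous_on UNIV h" "continuous_on S f"
  shows "continuous_on S (\<lambda>x. map_matrix h (f x))"
  unfolding continuous_on_matrix
  using assms by (auto intro!: continuous_intros continuous_on_compose2 [OF assms(1)])

lemma continuous_on_transpose [continuous_intros]:
  "continuous_on S f \<Longrightarrow> continuous_on S (\<lambda>x. transpose (f x))"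
  unfolding continuous_on_matrix by (auto simp: transpose_def)

lemma continuous_on_conj_transpose [continuous_intros]:
  "continuous_on S f \<Longrightarrow> continuous_on S (\<lambda>x. conj_transpose (f x))"
  unfolding continuous_on_matrix by (auto intro!: continuous_intros)

lemma continuous_on_hdot [continuous_intros]:
  "continuous_on S f \<Longrightarrow> continuous_on S g \<Longrightarrow> continuous_on S (\<lambda>x. hdot (f x) (g x))"
  unfolding hdot_def by (auto intro!: continuous_intros)

section \<open>Positive definite matrices\<close>

text \<open>The minimum of q over the unit sphere is positive by compactness; homogeneity spreads it
  to all vectors.\<close>

lemma homogeneous_lower_bound:
  fixes q :: "'a::euclidean_space \<Rightarrow> real"
  assumes "continuous_on UNIV q" "\<And>v. v \<noteq> 0 \<Longrightarrow> q v > 0" "\<And>c v. q (c *\<^sub>R v) = c\<^sup>2 * q v"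
  shows "\<exists>m>0. \<forall>v. m * (norm v)\<^sup>2 \<le> q v"
proof -
  obtain b :: 'a where b: "norm b = 1" using vector_choose_size [of 1] by auto
  have "sphere (0::'a) 1 \<noteq> {}" using b by auto
  moreover have "continuous_on (sphere 0 1) q" using assms(1) continuous_on_subset by blast
  ultimately obtain u where u: "norm u = 1" "\<And>v. norm v = 1 \<Longrightarrow> q u \<le> q v"
    using continuous_attains_inf [OF compact_sphere, of 0 1 q] by auto
  have q0: "q 0 = 0" using assms(3) [of 0 0] by simp
  have "q u * (norm v)\<^sup>2 \<le> q v" for v
  proof (cases "v = 0")
    case False
    then have "q u \<le> q ((1 / norm v) *\<^sub>R v)" by (intro u) simp
    then show ?thesis using False by (simp add: assms(3) field_simps)
  qed (simp add: q0)
  moreover have "q u > 0" using u assms(2) [of u] by fastforce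
  ultimately show ?thesis by blast
qed

lemma pos_def_lower_bound:
  assumes "pos_def y"
  shows "\<exists>m>0. \<forall>v. m * (norm v)\<^sup>2 \<le> v \<bullet> (y *v v)"
proof (rule homogeneous_lower_bound)
  show "continuous_on UNIV (\<lambda>v. v \<bullet> (y *v v))" by (intro continuous_intros)
qed (use assms in \<open>auto simp: pos_def_def matrix_vector_mult_scaleR power2_eq_square\<close>)

lemma pos_def_invertible: "pos_def y \<Longrightarrow> invertible y"
  by (rule invertible_kernel) (metis inner_zero_right less_irrefl pos_def_def)

text \<open>The segment from the identity to y stays positive definite, so the determinant has no
  zero on it and keeps the sign it has at the identity.\<close>

lemma pos_def_det_pos:
  assumes "pos_def y"
  shows "det y > 0"
proof (rule ccontr)
  assume "\<not> det y > 0"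
  moreover have "continuous_on {0..1} (\<lambda>t. det ((1 - t) *\<^sub>R mat 1 + t *\<^sub>R y))"
    by (intro continuous_intros)
  ultimately obtain t :: real where t: "0 \<le> t" "t \<le> 1" "det ((1 - t) *\<^sub>R mat 1 + t *\<^sub>R y) = 0"
    using IVT2' [of "\<lambda>t. det ((1 - t) *\<^sub>R mat 1 + t *\<^sub>R y)" 1 0 0] by auto
  have "pos_def ((1 - t) *\<^sub>R mat 1 + t *\<^sub>R y)"
    unfolding pos_def_def
  proof safe
    show "sym_mat ((1 - t) *\<^sub>R mat 1 + t *\<^sub>R y)"
      using assms by (simp add: pos_def_def sym_mat_def vec_eq_iff transpose_def mat_def)
    fix v :: "real^'a" assume "v \<noteq> 0"
    then have "v \<bullet> (y *v v) > 0" "v \<bullet> v > 0" using assms by (auto simp: pos_def_def)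
    moreover have "v \<bullet> (((1 - t) *\<^sub>R mat 1 + t *\<^sub>R y) *v v) = (1 - t) * (v \<bullet> v) + t * (v \<bullet> (y *v v))"
      by (simp add: matrix_vector_mult_add_rdistrib scaleR_matrix_vector_assoc [symmetric] inner_add_right)
    moreover have "(1 - t) * (v \<bullet> v) + t * (v \<bullet> (y *v v)) > 0"
      using \<open>v \<bullet> v > 0\<close> \<open>v \<bullet> (y *v v) > 0\<close> t
      by (cases "t = 0") (auto intro: add_nonneg_pos)
    ultimately show "v \<bullet> (((1 - t) *\<^sub>R mat 1 + t *\<^sub>R y) *v v) > 0" by simp
  qed
  then show False using t pos_def_invertible invertible_det_nz by blast
qed

lemma norm_matrix_columns: "(norm (A::real^'n^'m))\<^sup>2 = (\<Sum>j\<in>UNIV. (norm (column j A))\<^sup>2)"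
proof -
  have "(norm A)\<^sup>2 = (\<Sum>i\<in>UNIV. \<Sum>j\<in>UNIV. (A $ i $ j)\<^sup>2)"
    by (simp add: norm_vec_def L2_set_def sum_nonneg)
  also have "\<dots> = (\<Sum>j\<in>UNIV. \<Sum>i\<in>UNIV. (A $ i $ j)\<^sup>2)" by (rule sum.swap)
  finally show ?thesis
    by (simp add: norm_vec_def L2_set_def sum_nonneg column_def)
qed

lemma norm_transpose: "norm (transpose A) = norm (A::real^'n^'m)"
proof -
  have "(\<Sum>i\<in>UNIV. \<Sum>j\<in>UNIV. (A $ j $ i)\<^sup>2) = (\<Sum>j\<in>UNIV. \<Sum>i\<in>UNIV. (A $ j $ i)\<^sup>2)" by (rule sum.swap)
  then show ?thesis
    by (simp add: norm_vec_def L2_set_def sum_nonneg transpose_def)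
qed

lemma column_mult: "column j (A ** B) = A *v column j B"
  by (simp add: vec_eq_iff column_def matrix_matrix_mult_def matrix_vector_mult_def)

text \<open>The norm of a matrix is the Euclidean norm of its entries, so it splits over the
  columns, and X acts on each column of Y separately.\<close>

lemma norm_mult_le_op:
  fixes X Y :: "real^'n^'n"
  assumes "\<And>v. norm (X *v v) \<le> r * norm v" "r \<ge> 0"
  shows "norm (X ** Y) \<le> r * norm Y"
proof -
  have "(norm (X ** Y))\<^sup>2 = (\<Sum>j\<in>UNIV. (norm (X *v column j Y))\<^sup>2)"
    by (simp add: norm_matrix_columns column_mult)
  also have "\<dots> \<le> (\<Sum>j\<in>UNIV. (r * norm (column j Y))\<^sup>2)"
    by (intro sum_mono power_mono assms) auto
  also have "\<dots> = (r * norm Y)\<^sup>2"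
    by (simp add: power_mult_distrib norm_matrix_columns [of Y] sum_distrib_left)
  finally show ?thesis using assms(2) by (simp add: abs_le_square_iff [symmetric])
qed

text \<open>No diagonalisation: after scaling, A = 1 - y/c has its form between 0 and r < 1, and X =
  (A + X^2)/2 has a solution by the contraction principle. Then (1 - X)^2 = 1 - A = y/c.\<close>

lemma sqrt_mat_exists:
  fixes y :: "real^'n^'n"
  assumes "pos_def y"
  shows "\<exists>s. pos_def s \<and> s ** s = y"
proof -
  obtain m where m: "m > 0" "\<And>v. m * (norm v)\<^sup>2 \<le> v \<bullet> (y *v v)"
    using pos_def_lower_bound [OF assms] by auto
  obtain c0 where c0: "\<And>v. norm (y *v v) \<le> norm v * c0"
    using bounded_linear.bounded [OF matrix_vector_mul_bounded_linear [of y]] by blast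
  define c where "c = max c0 m"
  have c: "c > 0" "c \<ge> m" using m by (auto simp: c_def)
  have yc: "v \<bullet> (y *v v) \<le> c * (norm v)\<^sup>2" for v
  proof -
    have "v \<bullet> (y *v v) \<le> norm v * norm (y *v v)" by (rule norm_cauchy_schwarz)
    also have "\<dots> \<le> norm v * (norm v * c)"
      using c0 [of v] by (intro mult_left_mono order_trans [OF c0]) (auto simp: c_def intro!: mult_left_mono)
    finally show ?thesis by (simp add: power2_eq_square mult_ac)
  qed
  define A where "A = mat 1 - (1 / c) *\<^sub>R y"
  \<comment> \<open>The lower bound m of y gives A at most 1 - m/c. Halving m keeps r positive even
    if m = c, so that division by r is possible below.\<close>
  define r where "r = 1 - m / (2 * c)"
  have r: "0 < r" "r < 1" using m c by (auto simp: r_def field_simps)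
  have symA: "transpose A = A"
    using assms by (simp add: A_def pos_def_def sym_mat_def vec_eq_iff transpose_def mat_def)
  have qA: "v \<bullet> (A *v v) = (norm v)\<^sup>2 - (v \<bullet> (y *v v)) / c" for v
    by (simp add: A_def matrix_vector_mult_diff_rdistrib scaleR_matrix_vector_assoc [symmetric]
        inner_diff_right power2_norm_eq_inner)
  have A0: "0 \<le> v \<bullet> (A *v v)" for v
    using yc [of v] c by (simp add: qA field_simps)
  have A1: "v \<bullet> (A *v v) \<le> r * (norm v)\<^sup>2" for v
  proof -
    have "m * (norm v)\<^sup>2 / c \<le> (v \<bullet> (y *v v)) / c"
      using m(2) c by (intro divide_right_mono) auto
    moreover have "0 \<le> m * (norm v)\<^sup>2 / (2 * c)" using m c by simp
    moreover have "r * (norm v)\<^sup>2 = (norm v)\<^sup>2 - m * (norm v)\<^sup>2 / c + m * (norm v)\<^sup>2 / (2 * c)"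
      using c by (simp add: r_def field_simps)
    ultimately show ?thesis by (simp add: qA)
  qed
  have swapA: "a \<bullet> (A *v b) = (A *v a) \<bullet> b" for a b
    by (metis dot_lmul_matrix symA vector_transpose_matrix)
  have Anorm: "norm (A *v v) \<le> r * norm v" for v
  proof -
    define u where "u = A *v v"
    have nu: "norm u * norm u = u \<bullet> u" by (metis power2_norm_eq_inner power2_eq_square)
    \<comment> \<open>Nonnegativity of the form A at v - u/r turns the bound on the form into a
      bound on the operator norm.\<close>
    have "0 \<le> (v - (1/r) *\<^sub>R u) \<bullet> (A *v (v - (1/r) *\<^sub>R u))" by (rule A0)
    also have "\<dots> = v \<bullet> (A *v v) - 2 * (norm u)\<^sup>2 / r + u \<bullet> (A *v u) / r\<^sup>2"
      using r by (simp add: matrix_vector_mult_diff_distrib matrix_vector_mult_scaleR inner_diff_left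
          inner_diff_right nu power2_eq_square swapA [of v u] u_def [symmetric] inner_commute field_simps)
    also have "\<dots> \<le> r * (norm v)\<^sup>2 - 2 * (norm u)\<^sup>2 / r + (norm u)\<^sup>2 / r"
    proof -
      have "u \<bullet> (A *v u) / r\<^sup>2 \<le> r * (norm u)\<^sup>2 / r\<^sup>2"
        by (intro divide_right_mono A1) simp
      then show ?thesis using A1 [of v] r by (simp add: power2_eq_square)
    qed
    finally have "(norm u)\<^sup>2 \<le> (r * norm v)\<^sup>2" using r by (simp add: field_simps power2_eq_square)
    then show ?thesis using r unfolding u_def [symmetric]
      by (meson less_eq_real_def mult_nonneg_nonneg norm_ge_zero power2_le_imp_le)
  qed
  define S where "S = {X::real^'n^'n. transpose X = X \<and> (\<forall>v. norm (X *v v) \<le> r * norm v)}"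
  have "closed S"
  proof -
    have "S = {X. transpose X = X} \<inter> (\<Inter>v. {X. norm (X *v v) \<le> r * norm v})" by (auto simp: S_def)
    moreover have "closed {X::real^'n^'n. transpose X = X}"
      by (intro closed_Collect_eq continuous_intros)
    moreover have "closed {X::real^'n^'n. norm (X *v v) \<le> r * norm v}" for v
      by (intro closed_Collect_le continuous_intros)
    ultimately show ?thesis by auto
  qed
  then have "complete S" by (simp add: complete_eq_closed)
  define f where "f X = (1/2) *\<^sub>R (A + X ** X)" for X
  have XX: "norm (X *v (X *v v)) \<le> r * norm v" if "X \<in> S" for X v
  proof -
    have "norm (X *v (X *v v)) \<le> r * (r * norm v)"
      using that r by (auto simp: S_def intro: order_trans mult_left_mono)
    also have "\<dots> \<le> 1 * (r * norm v)" using r by (intro mult_right_mono) auto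
    finally show ?thesis by simp
  qed
  have fS: "f ` S \<subseteq> S"
  proof safe
    fix X assume X: "X \<in> S"
    have "norm (f X *v v) \<le> r * norm v" for v
    proof -
      have "norm (f X *v v) = (1/2) * norm (A *v v + X *v (X *v v))"
        by (simp add: f_def scaleR_matrix_vector_assoc [symmetric] matrix_vector_mult_add_rdistrib matrix_vector_mul_assoc)
      also have "\<dots> \<le> (1/2) * (norm (A *v v) + norm (X *v (X *v v)))" by (intro mult_left_mono norm_triangle_ineq) auto
      also have "\<dots> \<le> r * norm v" using Anorm [of v] XX [OF X, of v] by simp
      finally show ?thesis .
    qed
    moreover have "transpose (f X) = f X"
      using X symA by (simp add: S_def f_def transpose_scalar transpose_add matrix_transpose_mul)
    ultimately show "f X \<in> S" by (simp add: S_def)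
  qed
  have "\<exists>!X\<in>S. f X = X"
  proof (rule Banach_fix [OF \<open>complete S\<close> _ _ _ fS, of r])
    show "S \<noteq> {}" using r by (auto simp: S_def intro!: exI [of _ 0] simp: vec_eq_iff transpose_def)
    show "dist (f X) (f Y) \<le> r * dist X Y" if "X \<in> S" "Y \<in> S" for X Y
    proof -
      have X: "transpose X = X" "\<And>v. norm (X *v v) \<le> r * norm v" and
        Y: "transpose Y = Y" "\<And>v. norm (Y *v v) \<le> r * norm v" using that by (auto simp: S_def)
      have "f X - f Y = (1/2) *\<^sub>R (X ** (X - Y) + (X - Y) ** Y)"
        by (simp add: f_def mat_ring scaleR_diff_right scaleR_add_right)
      then have "norm (f X - f Y) \<le> (1/2) * (norm (X ** (X - Y)) + norm ((X - Y) ** Y))"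
        by (simp add: norm_triangle_ineq)
      \<comment> \<open>\<open>norm_mult_le_op\<close> bounds products by their left factor;
        transposing moves Y to the left.\<close>
      also have "(X - Y) ** Y = transpose (Y ** transpose (X - Y))"
        by (simp add: matrix_transpose_mul Y)
      also have "(1/2) * (norm (X ** (X - Y)) + norm (transpose (Y ** transpose (X - Y)))) \<le> (1/2) * (r * norm (X - Y) + r * norm (X - Y))"
        using norm_mult_le_op [OF X(2), of "X - Y"] norm_mult_le_op [OF Y(2), of "transpose (X - Y)"] r
        by (simp add: norm_transpose)
      finally show ?thesis by (simp add: dist_norm)
    qed
  qed (use r in auto)
  then obtain X where X: "X \<in> S" "f X = X" by blast
  have Xsq: "A + X ** X = 2 *\<^sub>R X"
    using X(2) by (metis f_def scaleR_half_double scaleR_scaleR scaleR_2 scaleR_add_right)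
  have eq: "(mat 1 - X) ** (mat 1 - X) = (1 / c) *\<^sub>R y"
    using Xsq by (simp add: mat_ring A_def algebra_simps scaleR_2)
  define s where "s = sqrt c *\<^sub>R (mat 1 - X)"
  have "s ** s = y"
    using c eq by (simp add: s_def scalar_matrix_assoc [symmetric] matrix_scalar_ac)
  moreover have "pos_def s"
    unfolding pos_def_def
  proof safe
    show "sym_mat s" using X by (simp add: s_def sym_mat_def S_def transpose_scalar transpose_diff transpose_mat)
    fix v :: "real^'n" assume "v \<noteq> 0"
    have "v \<bullet> (X *v v) \<le> norm v * norm (X *v v)" by (rule norm_cauchy_schwarz)
    also have "\<dots> \<le> norm v * (r * norm v)" using X by (intro mult_left_mono) (auto simp: S_def)
    also have "\<dots> < norm v * norm v" using \<open>v \<noteq> 0\<close> r by simp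
    finally have "0 < v \<bullet> (v - X *v v)" by (simp add: inner_diff_right power2_norm_eq_inner [symmetric] power2_eq_square)
    then show "0 < v \<bullet> (s *v v)"
      using c by (simp add: s_def scaleR_matrix_vector_assoc [symmetric] matrix_vector_mult_diff_rdistrib)
  qed
  ultimately show ?thesis by blast
qed

text \<open>For d = s - t the equation reads s d + d t = 0. The trace of d (s d + d t) is the sum of
  the forms s and t over the columns of d, all of them nonnegative, so each column vanishes.\<close>

lemma sqrt_mat_unique:
  fixes s t :: "real^'n^'n"
  assumes "pos_def s" "pos_def t" "s ** s = t ** t"
  shows "s = t"
proof -
  define d where "d = s - t"
  have sym: "transpose d = d"
    using assms by (simp add: d_def pos_def_def sym_mat_def transpose_diff)
  have "s ** d + d ** t = 0"
    using assms(3) by (simp add: d_def mat_ring)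
  then have "d ** (s ** d + d ** t) = 0" by simp
  then have "trace (d ** (s ** d)) + trace (d ** (d ** t)) = 0"
    by (simp add: matrix_add_ldistrib trace_add [symmetric]) (simp add: trace_def)
  moreover have "trace (d ** (d ** t)) = trace (d ** (t ** d))"
    by (metis trace_mul_sym matrix_mul_assoc)
  moreover have tr: "trace (d ** (p ** d)) = (\<Sum>j\<in>UNIV. column j d \<bullet> (p *v column j d))" for p
  proof -
    have "(d ** (p ** d)) $ j $ j = column j d \<bullet> (p *v column j d)" for j
    proof -
      have "d $ j $ k = column j d $ k" for k using sym by (metis (no_types) column_def transpose_def vec_lambda_beta)
      then show ?thesis
        by (simp add: matrix_matrix_mult_def matrix_vector_mult_def inner_vec_def column_def)
    qed
    then show ?thesis by (simp add: trace_def)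
  qed
  moreover have nonneg: "v \<bullet> (p *v v) \<ge> 0" if "pos_def p" for p and v :: "real^'n"
    using that by (cases "v = 0") (auto simp: pos_def_def less_imp_le)
  ultimately have "(\<Sum>j\<in>UNIV. column j d \<bullet> (s *v column j d)) = 0"
    using assms by (metis (mono_tags, lifting) add_nonneg_eq_0_iff sum_nonneg)
  then have "column j d \<bullet> (s *v column j d) = 0" for j
    using nonneg [OF assms(1)] by (simp add: sum_nonneg_eq_0_iff)
  then have "column j d = 0" for j
    using assms(1) by (metis less_irrefl pos_def_def)
  then have "d = 0" by (simp add: vec_eq_iff column_def)
  then show ?thesis by (simp add: d_def)
qed

lemma sqrt_mat:
  assumes "pos_def y"
  shows pos_def_sqrt_mat: "pos_def (sqrt_mat y)" and sqrt_mat_square: "sqrt_mat y ** sqrt_mat y = y"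
proof -
  have "\<exists>!s. pos_def s \<and> s ** s = y"
    using sqrt_mat_exists [OF assms] sqrt_mat_unique by metis
  from theI' [OF this] show "pos_def (sqrt_mat y)" "sqrt_mat y ** sqrt_mat y = y"
    by (simp_all add: sqrt_mat_def)
qed

section \<open>The symplectic action\<close>

lemma sum_UNIV_sum: "(\<Sum>x\<in>(UNIV::('a::finite + 'b::finite) set). f x) = (\<Sum>i\<in>UNIV. f (Inl i)) + (\<Sum>i\<in>UNIV. f (Inr i))"
  by (simp add: UNIV_Plus_UNIV [symmetric] sum.Plus del: UNIV_Plus_UNIV)

section \<open>Block matrices and the symplectic group\<close>

definition mkblock :: "'a^'n^'n \<Rightarrow> 'a^'n^'n \<Rightarrow> 'a^'n^'n \<Rightarrow> 'a^'n^'n \<Rightarrow> 'a^('n::finite+'n)^('n+'n)" where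
  "mkblock a b c d = (\<chi> r s. case (r, s) of (Inl i, Inl j) \<Rightarrow> a $ i $ j | (Inl i, Inr j) \<Rightarrow> b $ i $ j
     | (Inr i, Inl j) \<Rightarrow> c $ i $ j | (Inr i, Inr j) \<Rightarrow> d $ i $ j)"

lemma blocks_mkblock [simp]:
  "blockA (mkblock a b c d) = a" "blockB (mkblock a b c d) = b"
  "blockC (mkblock a b c d) = c" "blockD (mkblock a b c d) = d"
  by (simp_all add: mkblock_def blockA_def blockB_def blockC_def blockD_def)

lemma block_eq_iff:
  "g = h \<longleftrightarrow> blockA g = blockA h \<and> blockB g = blockB h \<and> blockC g = blockC h \<and> blockD g = blockD h"
proof
  assume *: "blockA g = blockA h \<and> blockB g = blockB h \<and> blockC g = blockC h \<and> blockD g = blockD h"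
  have "g $ r $ s = h $ r $ s" for r s
    using * by (cases r; cases s) (auto simp: blockA_def blockB_def blockC_def blockD_def vec_eq_iff)
  then show "g = h" by (simp add: vec_eq_iff)
qed auto

lemma block_mult:
  fixes g :: "'a::semiring_1^('n::finite+'n)^('n+'n)"
  shows "blockA (g ** h) = blockA g ** blockA h + blockB g ** blockC h"
    "blockB (g ** h) = blockA g ** blockB h + blockB g ** blockD h"
    "blockC (g ** h) = blockC g ** blockA h + blockD g ** blockC h"
    "blockD (g ** h) = blockC g ** blockB h + blockD g ** blockD h"
  by (simp_all add: blockA_def blockB_def blockC_def blockD_def vec_eq_iff matrix_matrix_mult_def sum_UNIV_sum)

lemma block_transpose:
  "blockA (transpose g) = transpose (blockA g)" "blockB (transpose g) = transpose (blockC g)"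
  "blockC (transpose g) = transpose (blockB g)" "blockD (transpose g) = transpose (blockD g)"
  by (simp_all add: blockA_def blockB_def blockC_def blockD_def vec_eq_iff transpose_def)

lemma block_mat: "blockA (mat c) = mat c" "blockB (mat c) = 0" "blockC (mat c) = 0" "blockD (mat c) = mat c"
  by (simp_all add: blockA_def blockB_def blockC_def blockD_def vec_eq_iff mat_def)

lemma block_minus: "blockA (- g) = - blockA g" "blockB (- g) = - blockB g"
  "blockC (- g) = - blockC g" "blockD (- g) = - blockD (g::real^_^_)"
  by (simp_all add: blockA_def blockB_def blockC_def blockD_def vec_eq_iff)

lemma block_J: "blockA J_mat = 0" "blockB J_mat = mat 1" "blockC J_mat = - mat 1" "blockD J_mat = 0"
  by (simp_all add: blockA_def blockB_def blockC_def blockD_def vec_eq_iff mat_def J_mat_def)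

text \<open>The blocks of g^T J g = J. Its two off-diagonal blocks are minus transposes of each
  other, so one of them is listed.\<close>

definition symplectic :: "real^('n::finite+'n)^('n+'n) \<Rightarrow> bool" where
  "symplectic g \<longleftrightarrow> transpose (blockA g) ** blockC g = transpose (blockC g) ** blockA g \<and>
     transpose (blockB g) ** blockD g = transpose (blockD g) ** blockB g \<and>
     transpose (blockD g) ** blockA g = mat 1 + transpose (blockB g) ** blockC g"

lemma symplectic_iff: "transpose g ** J_mat ** g = J_mat \<longleftrightarrow> symplectic g"
proof -
  have *: "transpose (blockA g) ** blockD g - transpose (blockC g) ** blockB g = mat 1 \<longleftrightarrow>
    transpose (blockD g) ** blockA g - transpose (blockB g) ** blockC g = mat 1"
    by (subst transpose_iff [symmetric]) (simp add: matrix_transpose_mul transpose_diff transpose_mat)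
  show ?thesis
    unfolding block_eq_iff [of "transpose g ** J_mat ** g"] block_mult block_transpose block_J symplectic_def
    using * by (auto simp: algebra_simps)
qed

text \<open>The form identity gives the left inverse -J g^T J, so membership reduces to the block
  equations.\<close>

lemma carrier_Sp: "carrier Sp = {g. symplectic g}"
proof -
  have "invertible g" if "symplectic g" for g :: "real^('n::finite+'n)^('n+'n)"
  proof -
    have JJ: "(- J_mat) ** J_mat = (mat 1 :: real^('n::finite+'n)^('n+'n))"
      by (simp add: block_eq_iff [of "- (J_mat ** J_mat)"] block_mult block_J block_mat block_minus)
    have "((- J_mat) ** transpose g ** J_mat) ** g = mat 1"
      using that JJ by (simp add: symplectic_iff [symmetric] matrix_mul_assoc [symmetric])
    then show ?thesis using invertible_left_inverse by blast
  qed
  then show ?thesis by (auto simp: Sp_def symplectic_iff)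
qed

lemma Sp_mult [simp]: "x \<otimes>\<^bsub>Sp\<^esub> y = x ** y" and Sp_one [simp]: "\<one>\<^bsub>Sp\<^esub> = mat 1"
  by (simp_all add: Sp_def)

lemma symplectic_mult: "symplectic g \<Longrightarrow> symplectic h \<Longrightarrow> symplectic (g ** h)"
proof -
  assume "symplectic g" "symplectic h"
  then have g: "transpose g ** J_mat ** g = J_mat" and h: "transpose h ** J_mat ** h = J_mat"
    by (simp_all add: symplectic_iff)
  have "transpose (g ** h) ** J_mat ** (g ** h) = transpose h ** (transpose g ** J_mat ** g) ** h"
    by (simp add: matrix_transpose_mul matrix_mul_assoc)
  then show "symplectic (g ** h)" by (simp add: g h symplectic_iff [symmetric])
qed

lemma symplectic_one: "symplectic (mat 1)"
  by (simp add: symplectic_iff [symmetric])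

lemma group_Sp: "group (Sp :: (real^('n::finite+'n)^('n+'n)) monoid)"
proof (rule groupI)
  fix x :: "real^('n::finite+'n)^('n+'n)" assume "x \<in> carrier Sp"
  then have x: "invertible x" "transpose x ** J_mat ** x = J_mat" by (auto simp: Sp_def)
  have "transpose (matrix_inv x) ** (transpose x ** J_mat ** x) ** matrix_inv x = J_mat"
    using x(1) by (simp add: matrix_mul_assoc [symmetric] matrix_inv_cancel)
      (simp add: matrix_mul_assoc matrix_transpose_mul [symmetric] matrix_inv_cancel transpose_mat)
  then have "symplectic (matrix_inv x)" by (simp add: x(2) symplectic_iff [symmetric])
  then show "\<exists>y\<in>carrier Sp. y \<otimes>\<^bsub>Sp\<^esub> x = \<one>\<^bsub>Sp\<^esub>"
    using x by (auto simp: carrier_Sp intro!: bexI [of _ "matrix_inv x"] matrix_inv_left)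
qed (auto simp: carrier_Sp symplectic_mult symplectic_one matrix_mul_assoc)

lemma symplectic_cmat:
  assumes "symplectic g"
  defines "A \<equiv> cmat (blockA g)" and "B \<equiv> cmat (blockB g)" and "C \<equiv> cmat (blockC g)" and "D \<equiv> cmat (blockD g)"
  shows "transpose A ** C = transpose C ** A" "transpose B ** D = transpose D ** B"
    "transpose D ** A = mat 1 + transpose B ** C" "transpose C ** B = transpose A ** D - mat 1"
proof -
  have g: "transpose (blockA g) ** blockC g = transpose (blockC g) ** blockA g"
     "transpose (blockB g) ** blockD g = transpose (blockD g) ** blockB g"
     "transpose (blockD g) ** blockA g = mat 1 + transpose (blockB g) ** blockC g"
    using assms(1) by (auto simp: symplectic_def)
  show "transpose A ** C = transpose C ** A" "transpose B ** D = transpose D ** B"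
    and *: "transpose D ** A = mat 1 + transpose B ** C"
    using g by (simp_all add: A_def B_def C_def D_def cmat_transpose [symmetric] cmat_mult [symmetric] cmat_add del: nth_map_matrix)
  have "transpose (transpose D ** A) = transpose (mat 1 + transpose B ** C)" by (simp add: *)
  then show "transpose C ** B = transpose A ** D - mat 1"
    by (simp add: matrix_transpose_mul transpose_add transpose_mat)
qed

lemma Re_hdot_cmat:
  "Re (hdot (cmat y *v v) v) =
    (\<chi> i. Re (v $ i)) \<bullet> (y *v (\<chi> i. Re (v $ i))) + (\<chi> i. Im (v $ i)) \<bullet> (y *v (\<chi> i. Im (v $ i)))"
  by (simp add: hdot_def matrix_vector_mult_def inner_vec_def sum_distrib_left sum_distrib_right
      algebra_simps sum.distrib)

lemma diff_conj_transpose_sym: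
  "sym_mat z \<Longrightarrow> z - conj_transpose z = mat (2 * \<i>) ** cmat (map_matrix Im z)"
  by (simp add: vec_eq_iff mat_mult_left_nth sym_mat_def transpose_def complex_diff_cnj)

lemma Im_hdot_sym:
  assumes "sym_mat z"
  shows "Im (hdot (z *v v) v) = Re (hdot (cmat (map_matrix Im z) *v v) v)"
proof -
  have "hdot (z *v v) v - cnj (hdot (z *v v) v) = hdot ((z - conj_transpose z) *v v) v"
    by (simp add: hdot_cnj matrix_vector_mult_diff_rdistrib hdot_diff_left hdot_adjoint)
  also have "\<dots> = 2 * \<i> * hdot (cmat (map_matrix Im z) *v v) v"
    by (simp add: diff_conj_transpose_sym [OF assms] matrix_vector_mul_assoc [symmetric] mat_vec hdot_scale_left)
  finally have "2 * \<i> * Im (hdot (z *v v) v) = 2 * \<i> * hdot (cmat (map_matrix Im z) *v v) v"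
    by (simp add: complex_diff_cnj)
  then show ?thesis by (simp add: complex_eq_iff)
qed

lemma pos_def_complex:
  assumes "pos_def y" "v \<noteq> 0"
  shows "Re (hdot (cmat y *v v) v) > 0"
proof -
  have "(\<chi> i. Re (v $ i)) \<noteq> 0 \<or> (\<chi> i. Im (v $ i)) \<noteq> 0"
    using assms(2) by (auto simp: vec_eq_iff complex_eq_iff)
  moreover have "u \<bullet> (y *v u) > 0 \<or> u = 0" for u using assms(1) by (auto simp: pos_def_def)
  ultimately show ?thesis
    unfolding Re_hdot_cmat by (metis add_pos_pos add.left_neutral add.right_neutral inner_zero_left)
qed

text \<open>For symmetric z the imaginary part of the Hermitian form of z is the form of y. Testing
  on complex vectors makes invertibility of z immediate and lets the form be carried along by
  complex matrices.\<close>

lemma siegel_iff: "z \<in> siegel \<longleftrightarrow> sym_mat z \<and> (\<forall>v. v \<noteq> 0 \<longrightarrow> Im (hdot (z *v v) v) > 0)"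
proof
  assume "z \<in> siegel"
  then show "sym_mat z \<and> (\<forall>v. v \<noteq> 0 \<longrightarrow> Im (hdot (z *v v) v) > 0)"
    by (auto simp: siegel_def Im_hdot_sym pos_def_complex)
next
  assume *: "sym_mat z \<and> (\<forall>v. v \<noteq> 0 \<longrightarrow> Im (hdot (z *v v) v) > 0)"
  have "v \<bullet> (map_matrix Im z *v v) > 0" if "v \<noteq> 0" for v
  proof -
    have "(\<chi> i. complex_of_real (v $ i)) \<noteq> 0" using that by (auto simp: vec_eq_iff)
    with * have "Re (hdot (cmat (map_matrix Im z) *v (\<chi> i. of_real (v $ i))) (\<chi> i. of_real (v $ i))) > 0"
      using Im_hdot_sym by metis
    moreover have "(\<chi> i. 0) = (0 :: real^'a)" by (simp add: vec_eq_iff)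
    ultimately show ?thesis by (simp add: Re_hdot_cmat)
  qed
  with * show "z \<in> siegel" by (simp add: siegel_def pos_def_def sym_mat_def transpose_def vec_eq_iff)
qed

lemma siegel_sym: "z \<in> siegel \<Longrightarrow> transpose z = z"
  by (simp add: siegel_def sym_mat_def)

lemma siegel_Im: "z \<in> siegel \<Longrightarrow> pos_def (map_matrix Im z)"
  by (simp add: siegel_def)

lemma siegel_lower_bound:
  assumes "z \<in> siegel"
  shows "\<exists>m>0. \<forall>v. m * (norm v)\<^sup>2 \<le> Im (hdot (z *v v) v)"
proof (rule homogeneous_lower_bound)
  show "continuous_on UNIV (\<lambda>v. Im (hdot (z *v v) v))" by (intro continuous_intros)
  have *: "c *\<^sub>R v = of_real c *s v" for c and v :: "complex^'a" by (simp add: vec_eq_iff) (simp add: scaleR_conv_of_real)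
  show "Im (hdot (z *v (c *\<^sub>R v)) (c *\<^sub>R v)) = c\<^sup>2 * Im (hdot (z *v v) v)" for c v
    by (simp add: * vec.scale hdot_scale_left hdot_scale_right power2_eq_square del: vector_scaleR_component)
qed (use assms in \<open>auto simp: siegel_iff\<close>)

context
  fixes g :: "real^('n::finite+'n)^('n+'n)" and A B C D :: "complex^'n^'n"
  assumes g: "symplectic g"
    and A: "A = cmat (blockA g)" and B: "B = cmat (blockB g)" and C: "C = cmat (blockC g)" and D: "D = cmat (blockD g)"
begin

lemma sp_rules:
  "transpose A ** C = transpose C ** A" "transpose B ** D = transpose D ** B"
  "transpose D ** A = mat 1 + transpose B ** C" "transpose C ** B = transpose A ** D - mat 1"
  using symplectic_cmat [OF g] by (simp_all only: A B C D)

lemma sp_rules_assoc: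
  "transpose A ** (C ** X) = transpose C ** (A ** X)" "transpose B ** (D ** X) = transpose D ** (B ** X)"
  "transpose D ** (A ** X) = X + transpose B ** (C ** X)" "transpose C ** (B ** X) = transpose A ** (D ** X) - X"
  by (simp_all add: matrix_mul_assoc sp_rules matrix_add_rdistrib matrix_diff_rdistrib)

text \<open>The form J, which g preserves, evaluated at the block columns (z0; 1) and (z;
  1).\<close>

lemma act_bilinear:
  assumes "transpose z0 = z0"
  shows "transpose (C ** z0 + D) ** (A ** z + B) - transpose (A ** z0 + B) ** (C ** z + D) = z - z0"
  by (simp add: transpose_add matrix_transpose_mul assms mat_ring sp_rules sp_rules_assoc)

text \<open>The Hermitian version of \<open>act_bilinear\<close>, at (z; 1) twice; it applies
  because g is real.\<close>

lemma autf_hermitian: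
  assumes "transpose z = z"
  shows "conj_transpose (C ** z + D) ** (A ** z + B) - conj_transpose (A ** z + B) ** (C ** z + D) = z - conj_transpose z"
proof -
  have c: "conj_transpose A = transpose A" "conj_transpose B = transpose B"
     "conj_transpose C = transpose C" "conj_transpose D = transpose D"
    by (simp_all add: A B C D conj_transpose_cmat cmat_transpose)
  show ?thesis
    by (simp add: conj_transpose_add conj_transpose_mult c mat_ring sp_rules sp_rules_assoc)
qed

text \<open>By \<open>autf_hermitian\<close> a kernel vector of C z + D would be a zero of the
  definite form y.\<close>

lemma invertible_autf_aux:
  assumes z: "z \<in> siegel"
  shows "invertible (C ** z + D)"
proof (rule invertible_kernel, rule ccontr)
  fix u assume u: "(C ** z + D) *v u = 0" "u \<noteq> 0"
  have "hdot ((z - conj_transpose z) *v u) u = 0"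
    unfolding autf_hermitian [OF siegel_sym [OF z], symmetric]
    by (simp add: matrix_vector_mult_diff_rdistrib matrix_vector_mul_assoc [symmetric] hdot_diff_left hdot_adjoint u)
  then have "hdot (cmat (map_matrix Im z) *v u) u = 0"
    using z by (simp add: siegel_def diff_conj_transpose_sym matrix_vector_mul_assoc [symmetric] mat_vec hdot_scale_left)
  then show False using pos_def_complex [OF siegel_Im [OF z] u(2)] by simp
qed

end

lemma autf_eq: "autf g z = cmat (blockC g) ** z + cmat (blockD g)" by (rule autf_def)

lemma invertible_autf: "symplectic g \<Longrightarrow> z \<in> siegel \<Longrightarrow> invertible (autf g z)"
  unfolding autf_eq by (rule invertible_autf_aux [OF _ refl refl refl refl])

lemma act_autf:
  assumes "symplectic g" "z \<in> siegel"
  shows "act g z ** autf g z = cmat (blockA g) ** z + cmat (blockB g)"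
  using invertible_autf [OF assms] by (simp add: act_def matrix_mul_assoc [symmetric] matrix_inv_cancel)

text \<open>At \<open>z0 = z\<close> this forces \<open>act g z\<close> to be symmetric. For general
  \<open>z0\<close> it is an exact difference formula, from which
  \<open>act_coord_derivative\<close> reads the derivative of the action.\<close>

lemma act_diff:
  assumes g: "symplectic g" and z: "z \<in> siegel" and z0: "z0 \<in> siegel"
  shows "transpose (autf g z0) ** (act g z - transpose (act g z0)) ** autf g z = z - z0"
proof -
  have "transpose (autf g z0) ** (act g z - transpose (act g z0)) ** autf g z =
    transpose (autf g z0) ** (act g z ** autf g z) - transpose (act g z0 ** autf g z0) ** autf g z"
    by (simp add: mat_ring matrix_transpose_mul)
  also have "\<dots> = z - z0"
    unfolding act_autf [OF g z] act_autf [OF g z0] unfolding autf_eq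
    by (rule act_bilinear [OF g refl refl refl refl siegel_sym [OF z0]])
  finally show ?thesis .
qed

lemma act_sym:
  assumes g: "symplectic g" and z: "z \<in> siegel"
  shows "transpose (act g z) = act g z"
proof -
  have inv: "invertible (autf g z)" "invertible (transpose (autf g z))"
    using invertible_autf [OF assms] invertible_transpose by auto
  have "transpose (autf g z) ** ((act g z - transpose (act g z)) ** autf g z) = 0"
    using act_diff [OF g z z] by (simp add: matrix_mul_assoc)
  then have "act g z - transpose (act g z) = 0"
    by (metis inv matrix_inv_cancel_assoc(2) matrix_inv_right matrix_mul_assoc matrix_mul_rid matrix_mult_zero_left matrix_mult_zero_right)
  then show ?thesis by simp
qed

lemma act_diff':
  assumes g: "symplectic g" and z: "z \<in> siegel" and z0: "z0 \<in> siegel"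
  shows "act g z - act g z0 = transpose (matrix_inv (autf g z0)) ** (z - z0) ** matrix_inv (autf g z)"
  unfolding act_diff [OF assms, symmetric] act_sym [OF g z0]
  using invertible_autf [OF g z] invertible_autf [OF g z0] 
  by (simp add: matrix_mul_assoc [symmetric] matrix_inv_cancel matrix_inv_cancel_assoc transpose_inv invertible_transpose)

lemma act_hermitian:
  assumes g: "symplectic g" and z: "z \<in> siegel"
  shows "conj_transpose (autf g z) ** (act g z - conj_transpose (act g z)) ** autf g z = z - conj_transpose z"
proof -
  have "conj_transpose (autf g z) ** (act g z - conj_transpose (act g z)) ** autf g z =
    conj_transpose (autf g z) ** (act g z ** autf g z) - conj_transpose (act g z ** autf g z) ** autf g z"
    by (simp add: mat_ring conj_transpose_mult)
  also have "\<dots> = z - conj_transpose z"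
    unfolding act_autf [OF g z] unfolding autf_eq
    by (rule autf_hermitian [OF g refl refl refl refl siegel_sym [OF z]])
  finally show ?thesis .
qed

lemma Im_act:
  assumes g: "symplectic g" and z: "z \<in> siegel"
  shows "conj_transpose (autf g z) ** cmat (map_matrix Im (act g z)) ** autf g z = cmat (map_matrix Im z)"
proof -
  have "mat (2 * \<i>) ** (conj_transpose (autf g z) ** cmat (map_matrix Im (act g z)) ** autf g z)
     = mat (2 * \<i>) ** cmat (map_matrix Im z)"
    using act_hermitian [OF assms] act_sym [OF assms] siegel_sym [OF z]
    by (simp add: diff_conj_transpose_sym sym_mat_def matrix_mul_assoc mat_commute)
  then show ?thesis by (simp add: vec_eq_iff mat_mult_left_nth)
qed

lemma act_siegel:
  assumes g: "symplectic g" and z: "z \<in> siegel"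
  shows "act g z \<in> siegel"
  unfolding siegel_iff
proof safe
  show s: "sym_mat (act g z)" using act_sym [OF assms] by (simp add: sym_mat_def)
  fix v :: "complex^'a" assume v: "v \<noteq> 0"
  define u where "u = matrix_inv (autf g z) *v v"
  have vu: "v = autf g z *v u" using invertible_autf [OF assms] by (simp add: u_def matrix_inv_cancel_assoc)
  then have u: "u \<noteq> 0" using v by auto
  have "hdot (cmat (map_matrix Im (act g z)) *v v) v = hdot (cmat (map_matrix Im z) *v u) u"
    unfolding Im_act [OF assms, symmetric] vu
    by (simp add: matrix_vector_mul_assoc [symmetric] hdot_adjoint [of "conj_transpose (autf g z)"])
  then show "0 < Im (hdot (act g z *v v) v)"
    using pos_def_complex [OF siegel_Im [OF z] u] by (simp add: Im_hdot_sym [OF s])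
qed

section \<open>The cocycle relation and the composition law\<close>

lemma autf_mult:
  assumes "symplectic h" "z \<in> siegel"
  shows "autf (g ** h) z = autf g (act h z) ** autf h z"
  unfolding autf_eq [of g] matrix_add_rdistrib matrix_mul_assoc [symmetric] act_autf [OF assms]
  by (simp add: autf_eq block_mult cmat_add cmat_mult mat_ring algebra_simps)

lemma act_mult:
  assumes "symplectic g" "symplectic h" "z \<in> siegel"
  shows "act (g ** h) z = act g (act h z)"
proof -
  have i: "invertible (autf h z)" "invertible (autf g (act h z))"
    using assms by (simp_all add: invertible_autf act_siegel)
  have "cmat (blockA (g ** h)) ** z + cmat (blockB (g ** h)) =
     (cmat (blockA g) ** act h z + cmat (blockB g)) ** autf h z"
    unfolding matrix_add_rdistrib matrix_mul_assoc [symmetric] act_autf [OF assms(2,3)]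
    by (simp add: autf_eq block_mult cmat_add cmat_mult mat_ring algebra_simps)
  then show ?thesis
    unfolding act_def [of "g ** h"] act_def [of g]
    by (simp add: autf_mult assms i matrix_inv_mult matrix_mul_assoc [symmetric] matrix_inv_cancel_assoc)
qed

lemma autf_one: "autf (mat 1) z = mat 1"
  by (simp add: autf_eq block_mat)

lemma act_one: "act (mat 1) z = z"
  by (simp add: act_def autf_one block_mat)

section \<open>The Cayley transform\<close>

lemma matrix_op_bound: "\<exists>K>0. \<forall>u. norm ((A::complex^'n^'m) *v u) \<le> K * norm u"
proof -
  have "linear ((*v) A)"
    by (rule linearI) (simp_all add: matrix_vector_right_distrib, simp add: vec_eq_iff matrix_vector_mult_def scaleR_sum_right)
  from linear_bounded_pos [OF this] show ?thesis by auto
qed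

lemma siegel_invertible: "z \<in> siegel \<Longrightarrow> invertible z"
  by (rule invertible_kernel) (auto simp: siegel_iff)

lemma siegel_plus_i: "z \<in> siegel \<Longrightarrow> z + iI \<in> siegel"
  unfolding siegel_iff
  by (auto simp: sym_mat_def transpose_add iI_def transpose_mat matrix_vector_mult_add_rdistrib hdot_add_left
      mat_vec hdot_scale_left hdot_self intro!: add_pos_nonneg)

lemma iI_siegel: "iI \<in> siegel"
  by (auto simp: siegel_iff iI_def sym_mat_def transpose_mat mat_vec hdot_scale_left hdot_self)

lemma invertible_plus_i: "z \<in> siegel \<Longrightarrow> invertible (z + iI)"
  using siegel_plus_i siegel_invertible by blast

text \<open>The matrix inside \<open>f_one\<close>. It is 1 at \<open>iI\<close>, and on the half
  space its inverse is 1 - w in the disc coordinate w (\<open>one_minus_cay\<close>).\<close>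

definition zeta :: "complex^'n^'n \<Rightarrow> complex^'n^'n" where
  "zeta z = mat (1 / (2 * \<i>)) ** (z + iI)"

definition cay :: "complex^'n^'n \<Rightarrow> complex^'n^'n" where
  "cay z = (z - iI) ** matrix_inv (z + iI)"

definition icay :: "complex^'n^'n \<Rightarrow> complex^'n^'n" where
  "icay w = mat \<i> ** ((mat 1 + w) ** matrix_inv (mat 1 - w))"

text \<open>Symmetric matrices of operator norm below 1, that is, with 1 - w^* w positive definite.
  The explicit q leaves room to scale w by numbers slightly larger than 1.\<close>

definition disc :: "(complex^'n^'n) set" where
  "disc = {w. sym_mat w \<and> (\<exists>q. 0 < q \<and> q < 1 \<and> (\<forall>v. norm (w *v v) \<le> q * norm v))}"

lemma invertible_zeta: "z \<in> siegel \<Longrightarrow> invertible (zeta z)"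
  unfolding zeta_def by (intro invertible_mult invertible_plus_i invertible_mat) auto

lemma inv_zeta: "z \<in> siegel \<Longrightarrow> matrix_inv (zeta z) = mat (2 * \<i>) ** matrix_inv (z + iI)"
  unfolding zeta_def
  by (subst matrix_inv_mult) (auto simp: invertible_mat invertible_plus_i matrix_inv_mat mat_commute mult.commute [of "2"])

lemma one_minus_cay:
  assumes "z \<in> siegel"
  shows "mat 1 - cay z = matrix_inv (zeta z)"
proof -
  have "mat 1 - cay z = ((z + iI) - (z - iI)) ** matrix_inv (z + iI)"
    using assms by (simp only: matrix_diff_rdistrib [of "z + iI"] cay_def matrix_inv_right [OF invertible_plus_i])
  also have "(z + iI) - (z - iI) = mat (2 * \<i>)"
    by (simp add: iI_def mat_add [symmetric])
  finally show ?thesis using assms by (simp add: inv_zeta)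
qed

lemma cay_alt:
  assumes "z \<in> siegel"
  shows "cay z = matrix_inv (z + iI) ** (z - iI)"
proof -
  have "(z - iI) ** (z + iI) = (z + iI) ** (z - iI)"
    by (simp add: mat_ring iI_def) (simp add: mat_commute [of z])
  then have "matrix_inv (z + iI) ** ((z - iI) ** (z + iI)) ** matrix_inv (z + iI) =
    matrix_inv (z + iI) ** ((z + iI) ** (z - iI)) ** matrix_inv (z + iI)" by simp
  then show ?thesis
    using invertible_plus_i [OF assms]
    by (simp add: cay_def matrix_mul_assoc [symmetric] matrix_inv_cancel matrix_inv_cancel_assoc)
qed

lemma cay_sym:
  assumes "z \<in> siegel"
  shows "transpose (cay z) = cay z"
proof -
  have "transpose iI = (iI :: complex^'a^'a)" by (simp add: iI_def transpose_mat)
  then have "transpose (cay z) = matrix_inv (z + iI) ** (z - iI)"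
    using assms by (simp add: cay_def matrix_transpose_mul transpose_inv invertible_plus_i transpose_diff transpose_add siegel_sym)
  then show ?thesis by (simp add: cay_alt assms)
qed

text \<open>For p = z + i and q = z - i one has p^* p - q^* q = 4y, and w = q p^{-1}. The factor 4
  is absorbed by the 2i in the inverse of \<open>zeta z\<close>.\<close>

lemma cay_hermitian:
  assumes z: "z \<in> siegel"
  shows "mat 1 - conj_transpose (cay z) ** cay z =
    conj_transpose (matrix_inv (zeta z)) ** cmat (map_matrix Im z) ** matrix_inv (zeta z)"
proof -
  define p where "p = z + iI"
  define q where "q = z - iI"
  have p: "invertible p" using z by (simp add: p_def invertible_plus_i)
  have ct: "conj_transpose iI = - iI" by (simp add: iI_def mat_minus)
  have ii: "iI ** X = mat \<i> ** X" "X ** iI = mat \<i> ** X" for X :: "complex^'a^'a" by (simp_all add: iI_def mat_commute)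
  have "conj_transpose p ** p - conj_transpose q ** q = mat (2 * \<i>) ** (conj_transpose z - z)"
    by (simp add: p_def q_def conj_transpose_add conj_transpose_diff ct mat_ring ii)
      (simp add: vec_eq_iff mat_mult_left_nth algebra_simps)
  also have "\<dots> = mat (2 * \<i>) ** - (z - conj_transpose z)" by simp
  also have "\<dots> = mat 4 ** cmat (map_matrix Im z)"
    using z by (subst diff_conj_transpose_sym) (auto simp: siegel_def matrix_mul_assoc mat_minus [symmetric] vec_eq_iff mat_mult_left_nth)
  finally have e: "conj_transpose p ** p - conj_transpose q ** q = mat 4 ** cmat (map_matrix Im z)" .
  have "mat 1 - conj_transpose (cay z) ** cay z =
    conj_transpose (matrix_inv p) ** (conj_transpose p ** p - conj_transpose q ** q) ** matrix_inv p"
    using p unfolding cay_def p_def [symmetric] q_def [symmetric]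
    by (simp add: conj_transpose_mult conj_transpose_inv mat_ring matrix_inv_cancel invertible_conj_transpose)
  also have "\<dots> = mat 4 ** (conj_transpose (matrix_inv p) ** cmat (map_matrix Im z) ** matrix_inv p)"
    unfolding e by (metis mat_commute matrix_mul_assoc)
  also have "\<dots> = conj_transpose (matrix_inv (zeta z)) ** cmat (map_matrix Im z) ** matrix_inv (zeta z)"
  proof -
    define c y where "c = conj_transpose (matrix_inv p)" and "y = cmat (map_matrix Im z)"
    have "conj_transpose (mat (2 * \<i>) ** matrix_inv p) = c ** mat (- 2 * \<i>)"
      by (simp add: conj_transpose_mult c_def)
    then have "conj_transpose (mat (2 * \<i>) ** matrix_inv p) = mat (- 2 * \<i>) ** c"
      by (simp only: mat_commute)
    moreover have "c ** y ** (mat (2 * \<i>) ** X) = mat (2 * \<i>) ** (c ** y ** X)" for X :: "complex^'a^'a"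
      by (metis mat_commute matrix_mul_assoc)
    ultimately have "conj_transpose (mat (2 * \<i>) ** matrix_inv p) ** y ** (mat (2 * \<i>) ** matrix_inv p)
        = mat (- 2 * \<i>) ** (mat (2 * \<i>) ** (c ** y ** matrix_inv p))"
      by (simp add: matrix_mul_assoc [symmetric])
    then show ?thesis unfolding inv_zeta [OF z] p_def [symmetric] c_def [symmetric] y_def [symmetric]
      by (simp add: matrix_mul_assoc)
  qed
  finally show ?thesis .
qed

lemma siegel_complex_lower_bound:
  assumes "z \<in> siegel"
  shows "\<exists>m>0. \<forall>v. m * (norm v)\<^sup>2 \<le> Re (hdot (cmat (map_matrix Im z) *v v) v)"
  using siegel_lower_bound [OF assms] assms by (simp add: Im_hdot_sym siegel_def)

lemma cay_disc:
  assumes z: "z \<in> siegel"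
  shows "cay z \<in> disc"
proof -
  obtain m where m: "m > 0" "\<And>v. m * (norm v)\<^sup>2 \<le> Re (hdot (cmat (map_matrix Im z) *v v) v)"
    using siegel_complex_lower_bound [OF z] by auto
  obtain K where K: "K > 0" "\<And>u. norm (zeta z *v u) \<le> K * norm u" using matrix_op_bound by blast
  \<comment> \<open>With v = zeta(z) u, the argument needs r K^2 at most m in order to compare r
    |v|^2 with m |u|^2; adding m to the denominator makes r smaller than 1.\<close>
  define r where "r = m / (K\<^sup>2 + m)"
  have r: "0 < r" "r < 1" using m K by (auto simp: r_def field_simps add_pos_pos)
  have "(norm (cay z *v v))\<^sup>2 \<le> (1 - r) * (norm v)\<^sup>2" for v
  proof -
    define u where "u = matrix_inv (zeta z) *v v"
    have v: "v = zeta z *v u" using invertible_zeta [OF z] by (simp add: u_def matrix_inv_cancel_assoc)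
    have "hdot v v - hdot (cay z *v v) (cay z *v v) = hdot ((mat 1 - conj_transpose (cay z) ** cay z) *v v) v"
      by (simp add: matrix_vector_mult_diff_rdistrib matrix_vector_mul_assoc [symmetric] hdot_diff_left
          hdot_adjoint [of "conj_transpose (cay z)"])
    also have "\<dots> = hdot (cmat (map_matrix Im z) *v u) u"
      unfolding cay_hermitian [OF z]
      by (simp add: matrix_vector_mul_assoc [symmetric] u_def hdot_adjoint [of "conj_transpose (matrix_inv (zeta z))"])
    finally have "Re (hdot v v - hdot (cay z *v v) (cay z *v v)) = Re (hdot (cmat (map_matrix Im z) *v u) u)" by simp
    then have e: "(norm v)\<^sup>2 - (norm (cay z *v v))\<^sup>2 = Re (hdot (cmat (map_matrix Im z) *v u) u)"
      by (simp add: hdot_self del: of_real_power)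
    have "(norm v)\<^sup>2 \<le> (K * norm u)\<^sup>2" unfolding v by (intro power_mono K) auto
    then have "r * (norm v)\<^sup>2 \<le> r * (K * norm u)\<^sup>2" using r by (intro mult_left_mono) auto
    also have "\<dots> \<le> m * (norm u)\<^sup>2"
    proof -
      have "r * K\<^sup>2 \<le> m" using m K by (simp add: r_def field_simps add_pos_pos)
      from mult_right_mono [OF this, of "(norm u)\<^sup>2"] show ?thesis by (simp add: power_mult_distrib mult_ac)
    qed
    also have "\<dots> \<le> (norm v)\<^sup>2 - (norm (cay z *v v))\<^sup>2" unfolding e by (rule m)
    finally show ?thesis by (simp add: algebra_simps)
  qed
  then have "norm (cay z *v v) \<le> sqrt (1 - r) * norm v" for v
    using r by (metis abs_norm_cancel real_sqrt_abs real_sqrt_le_iff real_sqrt_mult)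
  moreover have "0 < sqrt (1 - r)" "sqrt (1 - r) < 1" using r by auto
  ultimately show ?thesis using cay_sym [OF z] unfolding disc_def sym_mat_def by blast
qed

lemma disc_invertible:
  assumes "w \<in> disc" "cmod t \<le> 1"
  shows "invertible (mat 1 - mat t ** w)"
proof (rule invertible_kernel)
  fix u assume "(mat 1 - mat t ** w) *v u = 0"
  then have u: "u = t *s (w *v u)"
    by (simp add: matrix_vector_mult_diff_rdistrib matrix_vector_mul_assoc [symmetric] mat_vec)
  obtain q where q: "q < 1" "\<And>v. norm (w *v v) \<le> q * norm v" using assms by (auto simp: disc_def)
  have "norm u = cmod t * norm (w *v u)" by (subst u) (rule norm_smult_vec)
  also have "\<dots> \<le> 1 * norm (w *v u)" using assms by (intro mult_right_mono) auto
  also have "\<dots> \<le> q * norm u" using q by simp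
  finally show "u = 0" using q by (metis linorder_not_le mult.commute mult_less_cancel_left2 norm_eq_zero norm_ge_zero not_less_iff_gr_or_eq)
qed

lemma disc_invertible1: "w \<in> disc \<Longrightarrow> invertible (mat 1 - w)"
  using disc_invertible [of w 1] by simp

text \<open>If w shrinks by q, then t w with |t| < 1/sqrt q shrinks by sqrt q. The unit circle
  therefore lies inside the domain of t -> t w, as \<open>holomorphic_average\<close>
  requires.\<close>

lemma disc_star:
  assumes "w \<in> disc" shows "\<exists>r>1. \<forall>t. cmod t < r \<longrightarrow> mat t ** w \<in> disc"
proof -
  obtain q where q: "0 < q" "q < 1" "\<And>v. norm (w *v v) \<le> q * norm v" and w: "transpose w = w"
    using assms by (auto simp: disc_def sym_mat_def)
  have "mat t ** w \<in> disc" if "cmod t < 1 / sqrt q" for t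
    unfolding disc_def
  proof (safe intro!: exI [of _ "sqrt q"])
    show "sym_mat (mat t ** w)" by (simp add: sym_mat_def matrix_transpose_mul w transpose_mat mat_commute)
    fix v
    have "norm ((mat t ** w) *v v) = cmod t * norm (w *v v)"
      by (simp add: matrix_vector_mul_assoc [symmetric] mat_vec norm_smult_vec)
    also have "\<dots> \<le> (1 / sqrt q) * (q * norm v)" using q that by (intro mult_mono) auto
    also have "\<dots> = sqrt q * norm v" using q by (simp add: real_div_sqrt field_simps)
    finally show "norm ((mat t ** w) *v v) \<le> sqrt q * norm v" .
  qed (use q in auto)
  moreover have "1 / sqrt q > 1" using q by simp
  ultimately show ?thesis by blast
qed

lemma icay_siegel:
  assumes w: "w \<in> disc"
  shows "icay w \<in> siegel"
  unfolding siegel_iff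
proof safe
  have ws: "transpose w = w" using w by (simp add: disc_def sym_mat_def)
  have inv: "invertible (mat 1 - w)" using disc_invertible1 [OF w] .
  have c: "(mat 1 + w) ** (mat 1 - w) = (mat 1 - w) ** (mat 1 + w)" by (simp add: mat_ring)
  have c': "matrix_inv (mat 1 - w) ** (mat 1 + w) = (mat 1 + w) ** matrix_inv (mat 1 - w)"
  proof -
    have "matrix_inv (mat 1 - w) ** ((mat 1 + w) ** (mat 1 - w)) ** matrix_inv (mat 1 - w) =
      matrix_inv (mat 1 - w) ** ((mat 1 - w) ** (mat 1 + w)) ** matrix_inv (mat 1 - w)" by (simp only: c)
    then show ?thesis using inv
      by (simp only: matrix_mul_assoc [symmetric] matrix_inv_cancel matrix_inv_cancel_assoc matrix_mul_rid)
  qed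
  have "transpose (icay w) = matrix_inv (mat 1 - w) ** (mat 1 + w) ** mat \<i>"
    unfolding icay_def matrix_transpose_mul transpose_inv [OF inv] transpose_add transpose_diff transpose_mat ws ..
  then show "sym_mat (icay w)"
    unfolding sym_mat_def icay_def by (simp only: c' mat_commute)
  fix v :: "complex^'a" assume v: "v \<noteq> 0"
  obtain q where q: "q < 1" "\<And>v. norm (w *v v) \<le> q * norm v" using w by (auto simp: disc_def)
  define u where "u = matrix_inv (mat 1 - w) *v v"
  have vu: "v = (mat 1 - w) *v u" using inv by (simp add: u_def matrix_inv_cancel_assoc)
  then have u: "u \<noteq> 0" using v by auto
  have iv: "icay w *v v = \<i> *s ((mat 1 + w) *v u)"
    by (simp add: icay_def u_def matrix_vector_mul_assoc [symmetric] mat_vec)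
  \<comment> \<open>The difference of a number and its conjugate is purely imaginary, so after
    multiplication by i the imaginary part is |u|^2 - |w u|^2.\<close>
  have "hdot (icay w *v v) v = \<i> * (hdot u u - hdot (w *v u) (w *v u) + (hdot (w *v u) u - cnj (hdot (w *v u) u)))"
    unfolding iv unfolding vu
    by (simp add: hdot_scale_left matrix_vector_mult_diff_rdistrib matrix_vector_mult_add_rdistrib
        hdot_add_left hdot_diff_right hdot_cnj algebra_simps)
  then have "Im (hdot (icay w *v v) v) = (norm u)\<^sup>2 - (norm (w *v u))\<^sup>2"
    by (simp add: hdot_self complex_diff_cnj del: of_real_power)
  moreover have "norm (w *v u) < norm u"
    using q(2) [of u] q(1) u by (smt (verit) mult_less_cancel_right2 zero_less_norm_iff)
  ultimately show "0 < Im (hdot (icay w *v v) v)"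
    by (simp add: power_strict_mono)
qed

lemma zeta_icay:
  assumes w: "w \<in> disc"
  shows "zeta (icay w) = matrix_inv (mat 1 - w)"
proof -
  have inv: "invertible (mat 1 - w)" using disc_invertible1 [OF w] .
  have "icay w + iI = mat \<i> ** ((mat 1 + w) ** matrix_inv (mat 1 - w) + (mat 1 - w) ** matrix_inv (mat 1 - w))"
    using inv by (simp add: icay_def iI_def matrix_inv_cancel matrix_add_ldistrib)
  also have "\<dots> = mat \<i> ** (mat 2 ** matrix_inv (mat 1 - w))"
  proof -
    have "mat 1 + w + (mat 1 - w) = mat 2" by (simp add: vec_eq_iff mat_def)
    then show ?thesis by (simp only: matrix_add_rdistrib [symmetric])
  qed
  finally show ?thesis by (simp add: zeta_def matrix_mul_assoc)
qed

lemma icay_cay: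
  assumes z: "z \<in> siegel"
  shows "icay (cay z) = z"
proof -
  have "zeta (icay (cay z)) = zeta z"
    using z by (simp add: zeta_icay cay_disc one_minus_cay matrix_inv_inv invertible_zeta)
  then have "mat (2 * \<i>) ** zeta (icay (cay z)) = mat (2 * \<i>) ** zeta z" by simp
  then show ?thesis by (simp add: zeta_def matrix_mul_assoc)
qed

text \<open>For unitary k = a + ib this is the usual embedding of the unitary group as the
  stabilizer of \<open>iI\<close> in the symplectic group.\<close>

definition rot :: "complex^'n^'n \<Rightarrow> real^('n::finite+'n)^('n+'n)" where
  "rot k = mkblock (map_matrix Re k) (map_matrix Im k) (- map_matrix Im k) (map_matrix Re k)"

lemma symplectic_rot:
  assumes "unitary_matrix k"
  shows "symplectic (rot k)"
proof -
  define a b where "a = map_matrix Re k" and "b = map_matrix Im k"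
  have k: "k $ i $ j = Complex (a $ i $ j) (b $ i $ j)" for i j by (simp add: a_def b_def)
  have "(conj_transpose k ** k) $ i $ j = mat 1 $ i $ j" for i j
    using assms by (simp add: unitary_matrix_def)
  then have "(\<Sum>l\<in>UNIV. cnj (k $ l $ i) * k $ l $ j) = mat 1 $ i $ j" for i j
    by (simp add: matrix_matrix_mult_def)
  then have e: "Re (\<Sum>l\<in>UNIV. cnj (k $ l $ i) * k $ l $ j) = (if i = j then 1 else 0)"
    "Im (\<Sum>l\<in>UNIV. cnj (k $ l $ i) * k $ l $ j) = 0" for i j by (simp_all add: mat_def)
  have *: "(\<Sum>l\<in>UNIV. a $ l $ i * a $ l $ j) + (\<Sum>l\<in>UNIV. b $ l $ i * b $ l $ j) = (if i = j then 1 else 0)"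
      "(\<Sum>l\<in>UNIV. a $ l $ i * b $ l $ j) = (\<Sum>l\<in>UNIV. b $ l $ i * a $ l $ j)" for i j
  proof -
    have "Re (\<Sum>l\<in>UNIV. cnj (k $ l $ i) * k $ l $ j) = (\<Sum>l\<in>UNIV. a $ l $ i * a $ l $ j) + (\<Sum>l\<in>UNIV. b $ l $ i * b $ l $ j)"
      "Im (\<Sum>l\<in>UNIV. cnj (k $ l $ i) * k $ l $ j) = (\<Sum>l\<in>UNIV. a $ l $ i * b $ l $ j) - (\<Sum>l\<in>UNIV. b $ l $ i * a $ l $ j)"
      by (simp_all add: k sum.distrib sum_subtractf)
    then show "(\<Sum>l\<in>UNIV. a $ l $ i * a $ l $ j) + (\<Sum>l\<in>UNIV. b $ l $ i * b $ l $ j) = (if i = j then 1 else 0)"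
      "(\<Sum>l\<in>UNIV. a $ l $ i * b $ l $ j) = (\<Sum>l\<in>UNIV. b $ l $ i * a $ l $ j)"
      using e [of i j] by simp_all
  qed
  have 1: "transpose a ** b = transpose b ** a"
    unfolding vec_eq_iff matrix_matrix_mult_def transpose_def by (simp add: *(2) [symmetric])
  have "(transpose a ** a + transpose b ** b) $ i $ j = mat 1 $ i $ j" for i j
    using *(1) [of i j] by (simp add: matrix_matrix_mult_def transpose_def mat_def)
  then have 2: "transpose a ** a + transpose b ** b = mat 1"
    by (simp add: vec_eq_iff)
  show ?thesis
    using 1 2 by (simp add: symplectic_def rot_def a_def [symmetric] b_def [symmetric] algebra_simps transpose_minus)
qed

lemma unitary_cnj:
  assumes "unitary_matrix k"
  shows "map_matrix cnj k ** transpose k = mat 1"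
proof -
  have "conj_transpose (k ** conj_transpose k) = mat 1" using assms by (simp add: unitary_matrix_def)
  have "map_matrix cnj (k ** conj_transpose k) = mat 1"
    using assms by (simp add: unitary_matrix_def vec_eq_iff mat_def)
  moreover have "map_matrix cnj (k ** conj_transpose k) = map_matrix cnj k ** transpose k"
    by (simp add: vec_eq_iff matrix_matrix_mult_def transpose_def)
  ultimately show ?thesis by simp
qed

text \<open>Multiplied by the automorphy factor, gz - i and gz + i become k (z - i) and k' (z + i),
  where k' is the entrywise conjugate of k; its inverse is the transpose of k.\<close>

lemma cay_rot:
  assumes k: "unitary_matrix k" and z: "z \<in> siegel"
  shows "cay (act (rot k) z) = k ** cay z ** transpose k"
proof -
  define a b where "a = cmat (map_matrix Re k)" and "b = cmat (map_matrix Im k)"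
  define j where "j = autf (rot k) z"
  define k' where "k' = map_matrix cnj k"
  have kk: "k = a + mat \<i> ** b" "k' = a - mat \<i> ** b"
    by (simp_all add: a_def b_def k'_def vec_eq_iff mat_mult_left_nth complex_eq_iff)
  have i: "invertible j" using invertible_autf [OF symplectic_rot [OF k] z] by (simp add: j_def)
  have j: "j = - b ** z + a" by (simp add: j_def autf_eq rot_def a_def b_def cmat_minus)
  have ac: "act (rot k) z ** j = a ** z + b"
    using act_autf [OF symplectic_rot [OF k] z] by (simp add: j_def rot_def a_def b_def)
  have ii: "iI ** X = mat \<i> ** X" "X ** iI = mat \<i> ** X"
    "mat \<i> ** (mat \<i> ** X) = - X" for X :: "complex^'a^'a"
    by (simp_all add: iI_def mat_commute [of X] matrix_mul_assoc mat_minus)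
  have bi: "b ** (mat \<i> ** X) = mat \<i> ** (b ** X)" for X :: "complex^'a^'a"
    by (metis mat_commute matrix_mul_assoc)
  have 1: "(act (rot k) z - iI) ** j = k ** (z - iI)"
    unfolding matrix_diff_rdistrib ac unfolding kk j by (simp add: mat_ring ii bi)
  have 2: "(act (rot k) z + iI) ** j = k' ** (z + iI)"
    unfolding matrix_add_rdistrib ac unfolding kk j by (simp add: mat_ring ii bi)
  have s: "act (rot k) z \<in> siegel" using act_siegel [OF symplectic_rot [OF k] z] .
  have kt: "k' ** transpose k = mat 1" using unitary_cnj [OF k] by (simp add: k'_def)
  then have ki: "invertible k'" "matrix_inv k' = transpose k" by (auto intro: invertibleI matrix_inv_unique)
  have "cay (act (rot k) z) = ((act (rot k) z - iI) ** j) ** matrix_inv ((act (rot k) z + iI) ** j)"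
    using i s by (simp add: cay_def matrix_inv_mult invertible_plus_i matrix_mul_assoc [symmetric] matrix_inv_cancel_assoc)
  also have "\<dots> = k ** cay z ** transpose k"
    unfolding 1 2 using z by (simp add: matrix_inv_mult ki invertible_plus_i cay_def matrix_mul_assoc)
  finally show ?thesis .
qed

lemma unitary_mat: "cmod c = 1 \<Longrightarrow> unitary_matrix (mat c)"
  by (simp add: unitary_matrix_def complex_norm_square [symmetric] mult.commute)

text \<open>The square means that rotating the disc by t takes a square root of t as the scalar;
  this explains the half angles and complex roots below.\<close>

lemma cay_rot_scalar:
  assumes "cmod c = 1" "z \<in> siegel"
  shows "cay (act (rot (mat c)) z) = mat (c\<^sup>2) ** cay z"
  unfolding cay_rot [OF unitary_mat [OF assms(1)] assms(2)]
  by (simp add: transpose_mat mat_commute [of "mat c ** cay z"] matrix_mul_assoc power2_eq_square)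

section \<open>The unitary group and multiplicative functions\<close>

lemma hdot_sum_right: "hdot v (\<Sum>i\<in>S. f i) = (\<Sum>i\<in>S. hdot v (f i))"
  by (induction S rule: infinite_finite_induct) (auto simp: hdot_add_right)

lemma orthogonal_projection_exists:
  assumes "finite S"
  shows "\<exists>c. \<forall>i\<in>S. hdot (x - (\<Sum>i\<in>S. c i *s g i)) (g i) = 0"
  using assms
proof (induction S arbitrary: x)
  case (insert k S)
  obtain d where d: "\<And>i. i \<in> S \<Longrightarrow> hdot (g k - (\<Sum>i\<in>S. d i *s g i)) (g i) = 0"
    using insert.IH [of "g k"] by auto
  obtain c where c: "\<And>i. i \<in> S \<Longrightarrow> hdot (x - (\<Sum>i\<in>S. c i *s g i)) (g i) = 0"
    using insert.IH [of x] by auto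
  define e where "e = g k - (\<Sum>i\<in>S. d i *s g i)"
  define x' where "x' = x - (\<Sum>i\<in>S. c i *s g i)"
  \<comment> \<open>If e = 0, the quotient is 0 by convention, which is right: g k is then in the
    span of the other vectors.\<close>
  define \<alpha> where "\<alpha> = hdot x' e / hdot e e"
  define c' where "c' i = (if i = k then \<alpha> else c i - \<alpha> * d i)" for i
  have "(\<Sum>i\<in>insert k S. c' i *s g i) = \<alpha> *s g k + (\<Sum>i\<in>S. (c i - \<alpha> * d i) *s g i)"
    using insert by (auto simp: c'_def intro!: sum.cong)
  then have x'': "x - (\<Sum>i\<in>insert k S. c' i *s g i) = x' - \<alpha> *s e"
    by (simp add: x'_def e_def vec_eq_iff sum_subtractf sum_distrib_left algebra_simps)
  have oS: "hdot (x' - \<alpha> *s e) (g i) = 0" if "i \<in> S" for i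
    using c [OF that] d [OF that] by (simp add: hdot_diff_left hdot_scale_left x'_def [symmetric] e_def [symmetric])
  have oe: "hdot (x' - \<alpha> *s e) e = 0"
    by (cases "e = 0") (auto simp: hdot_diff_left hdot_scale_left \<alpha>_def)
  have "g k = e + (\<Sum>i\<in>S. d i *s g i)" by (simp add: e_def)
  then have "hdot (x' - \<alpha> *s e) (g k) = 0"
    by (simp only: hdot_add_right hdot_sum_right hdot_scale_right) (simp add: oe oS)
  then show ?case using oS x'' by (intro exI [of _ c']) (simp del: sum.insert)
qed auto

text \<open>The QR decomposition, with the triangular factor on the right so that it meets the Borel
  subgroup of the highest weight vector. The diagonal entry is 1/|e i|, where e i is column i minus
  a projection and hence no longer than the column; this last bound feeds
  \<open>highest_vector_bound\<close>.\<close>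

lemma gram_schmidt:
  fixes g :: "complex^'n::{finite,linorder}^'n::{finite,linorder}"
  assumes g: "invertible g"
  shows "\<exists>b \<beta>. upper_triangular b \<and> unitary_matrix (g ** b) \<and>
    (\<forall>i. b $ i $ i = of_real (\<beta> i) \<and> 0 < \<beta> i \<and> 1 \<le> \<beta> i * norm (column i g))"
proof -
  have "\<forall>j. \<exists>c. \<forall>i\<in>{..<j}. hdot (column j g - (\<Sum>i\<in>{..<j}. c i *s column i g)) (column i g) = 0"
    by (intro allI orthogonal_projection_exists) auto
  then obtain c where c: "\<And>i j. i < j \<Longrightarrow> hdot (column j g - (\<Sum>i\<in>{..<j}. c j i *s column i g)) (column i g) = 0"
    unfolding choice_iff by auto
  define e where "e j = column j g - (\<Sum>i\<in>{..<j}. c j i *s column i g)" for j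
  define a where "a j = (\<chi> i. if i = j then 1 else if i < j then - c j i else 0)" for j
  have ge: "g *v a j = e j" for j
  proof -
    have "g *v a j = (\<Sum>i\<in>UNIV. a j $ i *s column i g)" by (rule matrix_mult_sum)
    also have "\<dots> = (\<Sum>i\<in>insert j {..<j}. a j $ i *s column i g)"
      by (rule sum.mono_neutral_right) (auto simp: a_def)
    also have "\<dots> = column j g + (\<Sum>i\<in>{..<j}. - (c j i *s column i g))"
      by (simp add: a_def, intro sum.cong) (auto simp: vec_eq_iff)
    also have "\<dots> = e j" by (simp add: e_def sum_negf)
    finally show ?thesis .
  qed
  have e0: "e j \<noteq> 0" for j
  proof
    assume "e j = 0"
    then have "matrix_inv g *v (g *v a j) = 0" by (simp add: ge)
    then have "a j = 0" using g by (simp add: matrix_inv_cancel_assoc)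
    then have "a j $ j = 0" by simp
    then show False by (simp add: a_def)
  qed
  have oc: "hdot (e j) (column i g) = 0" if "i < j" for i j using c [OF that] by (simp add: e_def)
  have o: "hdot (e j) (e i) = 0" if "i < j" for i j
  proof -
    have "hdot (e j) (e i) = hdot (e j) (column i g) - (\<Sum>l\<in>{..<i}. cnj (c i l) * hdot (e j) (column l g))"
      unfolding e_def [of i] by (simp add: hdot_diff_right hdot_sum_right hdot_scale_right)
    also have "\<dots> = 0" using that by (simp add: oc)
    finally show ?thesis .
  qed
  have o': "hdot (e i) (e j) = 0" if "i \<noteq> j" for i j
    using o [of i j] o [of j i] hdot_cnj [of "e i" "e j"] that by (cases "i < j") auto
  have le: "norm (e j) \<le> norm (column j g)" for j
  proof -
    have "hdot (e j) (e j) = hdot (e j) (column j g) - (\<Sum>l\<in>{..<j}. cnj (c j l) * hdot (e j) (column l g))"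
      unfolding e_def [of j] by (simp add: hdot_diff_right hdot_sum_right hdot_scale_right)
    also have "\<dots> = hdot (e j) (column j g)" by (simp add: oc)
    finally have "Re (hdot (e j) (e j)) = e j \<bullet> column j g" by (simp add: Re_hdot)
    then have "(norm (e j))\<^sup>2 \<le> norm (e j) * norm (column j g)"
      using norm_cauchy_schwarz [of "e j" "column j g"] by (simp add: hdot_self del: of_real_power)
    then show ?thesis using e0 [of j] by (simp add: power2_eq_square)
  qed
  define \<beta> where "\<beta> j = 1 / norm (e j)" for j
  define b where "b = (\<chi> i j. of_real (\<beta> j) * a j $ i)"
  have col: "column j (g ** b) = of_real (\<beta> j) *s e j" for j
  proof -
    have "column j b = of_real (\<beta> j) *s a j" by (simp add: vec_eq_iff b_def column_def)
    then show ?thesis by (simp add: column_mult vec.scale ge)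
  qed
  have "conj_transpose (g ** b) ** (g ** b) = mat 1"
  proof -
    have "(conj_transpose (g ** b) ** (g ** b)) $ i $ j = hdot (column j (g ** b)) (column i (g ** b))" for i j
      by (simp only: matrix_matrix_mult_def [of "conj_transpose (g ** b)"]) (simp add: hdot_def column_def mult.commute)
    also have "\<dots> i j = mat 1 $ i $ j" for i j
      using e0 [of i] by (cases "i = j") (auto simp: col hdot_scale_left hdot_scale_right o' mat_def \<beta>_def hdot_self power2_eq_square norm_smult_vec norm_divide)
    finally show ?thesis by (simp add: vec_eq_iff)
  qed
  then have "unitary_matrix (g ** b)"
    unfolding unitary_matrix_def using matrix_left_right_inverse by blast
  moreover have "upper_triangular b" by (auto simp: upper_triangular_def b_def a_def)
  moreover have "b $ i $ i = of_real (\<beta> i) \<and> 0 < \<beta> i \<and> 1 \<le> \<beta> i * norm (column i g)" for i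
    using e0 [of i] le [of i] by (simp add: b_def a_def \<beta>_def)
  ultimately show ?thesis by blast
qed

text \<open>The least moved point is the image of a larger one.\<close>

lemma permutes_decrease:
  fixes p :: "'n::{finite,linorder} \<Rightarrow> 'n"
  assumes "p permutes UNIV" "p \<noteq> id"
  shows "\<exists>i. p i < i"
proof -
  define S where "S = {i. p i \<noteq> i}"
  have S: "finite S" "S \<noteq> {}" using assms(2) by (auto simp: S_def)
  define m where "m = Min S"
  have m: "p m \<noteq> m" using Min_in [OF S] by (simp add: S_def m_def)
  obtain j where j: "p j = m" using assms(1) by (metis permutes_def)
  with m have "p j \<noteq> j" by auto
  then have "m \<le> j" using S by (auto simp: m_def S_def)
  with j \<open>p j \<noteq> j\<close> show ?thesis by (metis order_le_less)
qed

lemma det_upper_triangular: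
  fixes b :: "complex^'n::{finite,linorder}^'n::{finite,linorder}"
  assumes "upper_triangular b"
  shows "det b = (\<Prod>i\<in>UNIV. b $ i $ i)"
proof -
  have "det b = (\<Sum>p\<in>{id}. of_int (sign p) * (\<Prod>i\<in>UNIV. b $ i $ p i))"
    unfolding det_def
  proof (rule sum.mono_neutral_right)
    show "\<forall>p\<in>{p. p permutes UNIV} - {id}. of_int (sign p) * (\<Prod>i\<in>UNIV. b $ i $ p i) = 0"
    proof
      fix p :: "'n \<Rightarrow> 'n" assume "p \<in> {p. p permutes UNIV} - {id}"
      then obtain i where "p i < i" using permutes_decrease by blast
      then have "b $ i $ p i = 0" using assms by (simp add: upper_triangular_def)
      then have "(\<Prod>i\<in>UNIV. b $ i $ p i) = 0" by (intro prod_zero) auto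
      then show "of_int (sign p) * (\<Prod>i\<in>UNIV. b $ i $ p i) = 0" by simp
    qed
  qed (auto simp: permutes_id finite_permutations)
  then show ?thesis by (simp add: sign_id)
qed

section \<open>The compact unitary group and multiplicative functions\<close>

lemma unitary_invertible: "unitary_matrix k \<Longrightarrow> invertible k"
  by (auto simp: unitary_matrix_def intro: invertibleI)

lemma unitary_mult: "unitary_matrix k \<Longrightarrow> unitary_matrix l \<Longrightarrow> unitary_matrix (k ** l)"
  unfolding unitary_matrix_def
  by (metis (no_types, lifting) conj_transpose_mult matrix_mul_assoc matrix_mul_rid)

lemma unitary_conj_transpose: "unitary_matrix k \<Longrightarrow> unitary_matrix (conj_transpose k)"
  by (simp add: unitary_matrix_def)

lemma unitary_norm: "unitary_matrix k \<Longrightarrow> (norm (k::complex^'n^'n))\<^sup>2 = CARD('n)"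
proof -
  assume k: "unitary_matrix k"
  have "(norm (k $ i))\<^sup>2 = 1" for i
  proof -
    have "(k ** conj_transpose k) $ i $ i = hdot (k $ i) (k $ i)"
      by (simp add: matrix_matrix_mult_def hdot_def)
    then have "complex_of_real ((norm (k $ i))\<^sup>2) = 1" using k by (simp add: unitary_matrix_def mat_def hdot_self)
    then show ?thesis by (simp only: of_real_eq_1_iff)
  qed
  moreover have "(norm k)\<^sup>2 = (\<Sum>i\<in>UNIV. (norm (k $ i))\<^sup>2)"
    by (simp add: norm_vec_def [of k] L2_set_def sum_nonneg)
  ultimately show ?thesis by simp
qed

lemma compact_unitary: "compact {k :: complex^'n^'n. unitary_matrix k}"
proof -
  have "{k :: complex^'n^'n. unitary_matrix k} = {k. k ** conj_transpose k = mat 1} \<inter> {k. conj_transpose k ** k = mat 1}"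
    by (auto simp: unitary_matrix_def)
  moreover have "closed {k :: complex^'n^'n. k ** conj_transpose k = mat 1}" "closed {k :: complex^'n^'n. conj_transpose k ** k = mat 1}"
    by (intro closed_Collect_eq continuous_intros)+
  moreover have "bounded {k :: complex^'n^'n. unitary_matrix k}"
    by (rule boundedI [of _ "sqrt CARD('n)"]) (metis mem_Collect_eq unitary_norm norm_ge_zero real_sqrt_unique order_refl)
  ultimately show ?thesis by (simp add: compact_eq_bounded_closed closed_Int)
qed

text \<open>A value above 1 would have unbounded powers, against compactness; the value at the
  inverse excludes values below 1.\<close>

lemma multiplicative_on_unitary:
  fixes \<delta> :: "complex^'n^'n \<Rightarrow> real"
  assumes mult: "\<And>A B. invertible A \<Longrightarrow> invertible B \<Longrightarrow> \<delta> (A ** B) = \<delta> A * \<delta> B"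
    and pos: "\<And>A. invertible A \<Longrightarrow> \<delta> A > 0"
    and cont: "continuous_on {A. invertible A} \<delta>"
    and k: "unitary_matrix k"
  shows "\<delta> k = 1"
proof -
  have "continuous_on {k. unitary_matrix k} \<delta>"
    using cont by (rule continuous_on_subset) (auto intro: unitary_invertible)
  then have "bounded (\<delta> ` {k. unitary_matrix k})"
    by (intro compact_imp_bounded compact_continuous_image compact_unitary)
  then obtain C where C: "\<And>k. unitary_matrix k \<Longrightarrow> \<delta> k \<le> C"
    unfolding bounded_iff by (metis abs_le_D1 imageI mem_Collect_eq real_norm_def)
  have one: "\<delta> (mat 1) = 1"
    using mult [of "mat 1" "mat 1"] pos [of "mat 1"] by (simp add: invertible_mat)
  have le: "\<delta> l \<le> 1" if l: "unitary_matrix l" for l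
  proof (rule ccontr)
    assume "\<not> \<delta> l \<le> 1"
    then obtain n where n: "C < \<delta> l ^ n" using real_arch_pow by (meson not_le)
    have "unitary_matrix (((**) l ^^ m) (mat 1)) \<and> \<delta> (((**) l ^^ m) (mat 1)) = \<delta> l ^ m" for m
      by (induction m) (auto simp: one mult unitary_invertible l unitary_mult, auto simp: unitary_matrix_def)
    then show False using C n by (metis not_le)
  qed
  have "\<delta> k * \<delta> (conj_transpose k) = 1"
    using mult [of k "conj_transpose k"] k by (simp add: unitary_invertible unitary_conj_transpose one) (simp add: unitary_matrix_def one)
  moreover have "\<delta> k \<le> 1" "\<delta> (conj_transpose k) \<le> 1" using le k unitary_conj_transpose by blast+
  moreover have "\<delta> k > 0" using pos k unitary_invertible by blast
  ultimately show ?thesis by (smt (verit, ccfv_SIG) mult_left_le)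
qed

text \<open>Conjugation by a diagonal matrix of powers of s does not change \<open>\<delta>\<close>,
  but multiplies the entries above the diagonal by positive powers of s. Letting s tend to 0 leaves
  the diagonal.\<close>

lemma multiplicative_upper_triangular:
  fixes \<delta> :: "complex^'n::{finite,linorder}^'n::{finite,linorder} \<Rightarrow> real"
  assumes mult: "\<And>A B. invertible A \<Longrightarrow> invertible B \<Longrightarrow> \<delta> (A ** B) = \<delta> A * \<delta> B"
    and pos: "\<And>A. invertible A \<Longrightarrow> \<delta> A > 0"
    and cont: "continuous_on {A. invertible A} \<delta>"
    and b: "upper_triangular b" "invertible b"
  shows "\<delta> b = \<delta> (\<chi> i j. if i = j then b $ i $ i else 0)"
proof -
  define rk where "rk i = card {..<i}" for i :: 'n
  have rk: "rk i < rk j" if "i < j" for i j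
    unfolding rk_def using that by (intro psubset_card_mono) auto
  \<comment> \<open>Below the diagonal the natural subtraction gives exponent 0, but there b
    vanishes. As the exponents are natural numbers, B is defined and continuous at s = 0.\<close>
  define B where "B s = (\<chi> i j. of_real (s::real) ^ (rk j - rk i) * b $ i $ j)" for s
  define D where "D s = (\<chi> i j. if i = j then complex_of_real s ^ rk i else 0)" for s :: real
  have ut: "upper_triangular (B s)" for s using b by (simp add: upper_triangular_def B_def)
  have "det (B s) = det b" for s
    by (simp add: det_upper_triangular ut b) (simp add: B_def)
  then have invB: "invertible (B s)" for s using b(2) by (simp add: invertible_det_nz)
  have detD: "det (D s) = (\<Prod>i\<in>UNIV. of_real s ^ rk i)" for s
    by (subst det_diagonal) (auto simp: D_def)
  have eq: "\<delta> (B s) = \<delta> b" if "s \<noteq> 0" for s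
  proof -
    have invD: "invertible (D s)" using that by (simp add: invertible_det_nz detD)
    have "(D s ** B s) $ i $ j = (b ** D s) $ i $ j" for i j
    proof -
      have "(D s ** B s) $ i $ j = (\<Sum>l\<in>{i}. of_real s ^ rk i * B s $ i $ j)"
        unfolding matrix_matrix_mult_def D_def vec_lambda_beta by (rule sum.mono_neutral_cong_right) auto
      moreover have "(b ** D s) $ i $ j = (\<Sum>l\<in>{j}. b $ i $ j * of_real s ^ rk j)"
        unfolding matrix_matrix_mult_def D_def vec_lambda_beta by (rule sum.mono_neutral_cong_right) auto
      moreover have "complex_of_real s ^ rk i * (of_real s ^ (rk j - rk i) * b $ i $ j) = b $ i $ j * of_real s ^ rk j"
      proof (cases "j < i")
        case False
        then have "i < j \<or> i = j" by auto
        then have "rk i \<le> rk j" using rk less_imp_le by blast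
        then show ?thesis by (metis (no_types, lifting) le_add_diff_inverse mult.assoc mult.commute power_add)
      qed (use b in \<open>auto simp: upper_triangular_def\<close>)
      ultimately show ?thesis by (simp add: B_def)
    qed
    then have "D s ** B s = b ** D s" by (simp add: vec_eq_iff)
    then have "\<delta> (D s) * \<delta> (B s) = \<delta> b * \<delta> (D s)" using invD invB b by (metis mult)
    then show ?thesis using pos [OF invD] by simp
  qed
  have "continuous_on UNIV B"
    unfolding continuous_on_matrix B_def by (auto intro!: continuous_intros)
  then have "continuous_on UNIV (\<delta> \<circ> B)"
    by (intro continuous_on_compose continuous_on_subset [OF cont]) (auto simp: invB)
  then have "isCont (\<delta> \<circ> B) 0" by (metis continuous_on_eq_continuous_at open_UNIV UNIV_I)
  then have "((\<lambda>s. \<delta> (B s)) \<longlongrightarrow> \<delta> (B 0)) (at 0)" by (simp add: isCont_def o_def)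
  moreover have "((\<lambda>s. \<delta> (B s)) \<longlongrightarrow> \<delta> b) (at 0)"
    by (rule tendsto_eventually) (auto simp: eventually_at_filter eq)
  ultimately have "\<delta> (B 0) = \<delta> b" by (rule tendsto_unique [rotated]) simp
  moreover have "B 0 = (\<chi> i j. if i = j then b $ i $ i else 0)"
  proof -
    have "B 0 $ i $ j = (if i = j then b $ i $ i else 0)" for i j
      using rk [of i j] b(1) by (cases "i < j") (auto simp: B_def upper_triangular_def)
    then show ?thesis by (simp add: vec_eq_iff)
  qed
  ultimately show ?thesis by simp
qed

text \<open>Gram-Schmidt gives A b unitary with b triangular. As \<open>\<delta>\<close> is 1 at A b
  and sees only the positive diagonal of b, a single computation at positive diagonal matrices
  determines it. It serves to find a Jacobian in \<open>det_congr\<close>.\<close>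

lemma multiplicative_eq_det_power:
  fixes \<delta> :: "complex^'n::{finite,linorder}^'n::{finite,linorder} \<Rightarrow> real"
  assumes mult: "\<And>A B. invertible A \<Longrightarrow> invertible B \<Longrightarrow> \<delta> (A ** B) = \<delta> A * \<delta> B"
    and pos: "\<And>A. invertible A \<Longrightarrow> \<delta> A > 0"
    and cont: "continuous_on {A. invertible A} \<delta>"
    and diag: "\<And>d. (\<And>i. d i > 0) \<Longrightarrow> \<delta> (\<chi> i j. if i = j then of_real (d i) else 0) = (\<Prod>i\<in>UNIV. d i) ^ N"
    and A: "invertible A"
  shows "\<delta> A = cmod (det A) ^ N"
proof -
  obtain b \<beta> where b: "upper_triangular b" "unitary_matrix (A ** b)" "\<And>i. b $ i $ i = of_real (\<beta> i)" "\<And>i. 0 < \<beta> i"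
    using gram_schmidt [OF A] by metis
  have db: "det b = of_real (\<Prod>i\<in>UNIV. \<beta> i)" by (simp add: det_upper_triangular b)
  have P: "(\<Prod>i\<in>UNIV. \<beta> i) > 0" by (intro prod_pos) (simp add: b)
  then have ib: "invertible b" unfolding invertible_det_nz db of_real_eq_0_iff by linarith
  have "(\<chi> i j. if i = j then b $ i $ i else 0) = (\<chi> i j. if i = j then of_real (\<beta> i) else 0)"
    by (simp add: vec_eq_iff b(3))
  then have "\<delta> b = (\<Prod>i\<in>UNIV. \<beta> i) ^ N"
    using multiplicative_upper_triangular [of \<delta>, OF mult pos cont b(1) ib] diag [of \<beta>] b(4) by simp
  moreover have "\<delta> A * \<delta> b = 1"
    using multiplicative_on_unitary [of \<delta>, OF mult pos cont b(2)] mult [OF A ib] by simp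
  moreover have "cmod (det A) * (\<Prod>i\<in>UNIV. \<beta> i) = 1"
  proof -
    have "det ((A ** b) ** conj_transpose (A ** b)) = 1" using b(2) by (simp add: unitary_matrix_def)
    then have "det (A ** b) * cnj (det (A ** b)) = 1" by (simp only: det_mul det_conj_transpose)
    then have "cmod (det (A ** b)) ^ 2 = 1" by (metis complex_norm_square of_real_eq_1_iff)
    then have "cmod (det (A ** b)) = 1" by (metis norm_ge_zero power2_eq_1_iff neg_0_le_iff_le not_one_le_zero)
    moreover have "cmod (det b) = (\<Prod>i\<in>UNIV. \<beta> i)" unfolding db norm_of_real using P by simp
    ultimately show ?thesis by (simp add: det_mul norm_mult)
  qed
  ultimately show ?thesis
    by (metis P mult_right_cancel not_less_iff_gr_or_eq power_mult_distrib power_one zero_less_power)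
qed

section \<open>Coordinates for the invariant measure\<close>

text \<open>Index type for the real coordinates of a symmetric complex matrix, so that they form a
  Cartesian space to which change of variables applies; the boolean selects the imaginary
  part.\<close>

typedef (overloaded) 'n coord = "(upper_index :: ('n::linorder \<times> 'n) set) \<times> (UNIV :: bool set)"
  by (auto simp: upper_index_def)

instance coord :: ("{finite,linorder}") finite
proof
  have "inj (Rep_coord :: 'a coord \<Rightarrow> _)" by (meson Rep_coord_inject injI)
  then show "finite (UNIV :: 'a coord set)" by (rule finite_imageD [rotated]) simp
qed

text \<open>An arbitrary enumeration order; the change of variables theorem asks for a well-ordered index type.\<close>

instantiation coord :: ("{finite,linorder}") wellorder
begin

definition less_eq_coord :: "'a coord \<Rightarrow> 'a coord \<Rightarrow> bool" where
  "less_eq_coord a b \<longleftrightarrow> to_nat a \<le> to_nat b"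

definition less_coord :: "'a coord \<Rightarrow> 'a coord \<Rightarrow> bool" where
  "less_coord a b \<longleftrightarrow> to_nat a < to_nat b"

instance
proof
  fix P :: "'a coord \<Rightarrow> bool" and a :: "'a coord"
  assume *: "\<And>x. (\<And>y. y < x \<Longrightarrow> P y) \<Longrightarrow> P x"
  show "P a"
    by (induction a rule: measure_induct_rule [of to_nat]) (use * in \<open>auto simp: less_coord_def\<close>)
qed (auto simp: less_eq_coord_def less_coord_def)

end

abbreviation pindex :: "'n::linorder coord \<Rightarrow> 'n \<times> 'n" where "pindex c \<equiv> fst (Rep_coord c)"
abbreviation is_im :: "'n::linorder coord \<Rightarrow> bool" where "is_im c \<equiv> snd (Rep_coord c)"

lemma pindex_upper: "pindex c \<in> upper_index"
  using Rep_coord [of c] by auto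

lemma finite_upper_index: "finite (upper_index :: ('n::{finite,linorder} \<times> 'n) set)"
  by (rule finite_subset [of _ UNIV]) auto

lemma minmax_upper: "(min r s, max r s) \<in> upper_index"
  by (auto simp: upper_index_def min_def max_def)

definition toM :: "real^'n::{finite,linorder} coord \<Rightarrow> complex^'n::{finite,linorder}^'n::{finite,linorder}" where
  "toM v = (\<chi> r s. Complex (v $ Abs_coord ((min r s, max r s), False)) (v $ Abs_coord ((min r s, max r s), True)))"

definition fromM :: "complex^'n::{finite,linorder}^'n::{finite,linorder} \<Rightarrow> real^'n::{finite,linorder} coord" where
  "fromM S = (\<chi> c. if is_im c then Im (S $ fst (pindex c) $ snd (pindex c)) else Re (S $ fst (pindex c) $ snd (pindex c)))"

lemma toM_sym: "transpose (toM v) = toM v"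
  by (simp add: vec_eq_iff transpose_def toM_def min.commute max.commute)

lemma toM_fromM: "transpose S = S \<Longrightarrow> toM (fromM S) = S"
proof -
  assume "transpose S = S"
  then have S: "S $ r $ s = S $ s $ r" for r s by (metis (no_types, lifting) transpose_def vec_lambda_beta)
  have "S $ min r s $ max r s = S $ r $ s" for r s by (auto simp: min_def max_def S [of s r])
  then show ?thesis
    by (simp add: vec_eq_iff toM_def fromM_def Abs_coord_inverse minmax_upper)
qed

lemma fromM_toM: "fromM (toM v) = v"
proof -
  have "fromM (toM v) $ c = v $ c" for c
  proof -
    obtain p b where c: "Rep_coord c = (p, b)" by (cases "Rep_coord c")
    then have "p \<in> upper_index" using pindex_upper [of c] by simp
    then have "(min (fst p) (snd p), max (fst p) (snd p)) = p" by (auto simp: upper_index_def)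
    moreover have "Abs_coord (p, b) = c" by (metis c Rep_coord_inverse)
    ultimately show ?thesis by (cases b) (auto simp: fromM_def toM_def c)
  qed
  then show ?thesis by (simp add: vec_eq_iff)
qed

lemma linear_toM: "linear toM"
  by (rule linearI) (simp_all add: vec_eq_iff toM_def complex_eq_iff)

lemma linear_fromM: "linear fromM"
  by (rule linearI) (simp_all add: vec_eq_iff fromM_def)

lemma continuous_on_toM [continuous_intros]: "continuous_on S f \<Longrightarrow> continuous_on S (\<lambda>x. toM (f x))"
  using continuous_on_compose2 [OF linear_continuous_on [OF linear_conv_bounded_linear [THEN iffD1, OF linear_toM], of UNIV], of S f] by auto

lemma continuous_on_fromM [continuous_intros]: "continuous_on S f \<Longrightarrow> continuous_on S (\<lambda>x. fromM (f x))"
  using continuous_on_compose2 [OF linear_continuous_on [OF linear_conv_bounded_linear [THEN iffD1, OF linear_fromM], of UNIV], of S f] by auto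

section \<open>Lebesgue measure in these coordinates\<close>

lemma prod_coord: "(\<Prod>c\<in>UNIV. f (Rep_coord c)) = (\<Prod>p\<in>upper_index. f (p, False) * f (p, True))"
  for f :: "('n::{finite,linorder} \<times> 'n) \<times> bool \<Rightarrow> 'b::comm_monoid_mult"
proof -
  have "bij_betw Rep_coord (UNIV :: 'n coord set) (upper_index \<times> UNIV)"
    using type_definition_coord by (metis bij_betw_def inj_def type_definition.Rep_inject type_definition.Rep_range)
  then have "(\<Prod>c\<in>UNIV. f (Rep_coord c)) = (\<Prod>x\<in>(upper_index \<times> UNIV). f x)"
    by (rule prod.reindex_bij_betw)
  also have "\<dots> = (\<Prod>p\<in>upper_index. \<Prod>b\<in>UNIV. f (p, b))"
    by (simp add: prod.cartesian_product)
  finally show ?thesis by (simp add: UNIV_bool mult.commute)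
qed

lemma prod_Basis_vec:
  fixes f :: "real^'i \<Rightarrow> 'b::comm_monoid_mult"
  shows "(\<Prod>b\<in>Basis. f b) = (\<Prod>i\<in>UNIV. f (axis i 1))"
proof -
  have 1: "(Basis :: (real^'i) set) = (\<lambda>i. axis i 1) ` UNIV" by (auto simp: Basis_vec_def)
  have 2: "inj (\<lambda>i::'i. axis i (1::real))" by (auto simp: inj_def axis_eq_axis)
  show ?thesis unfolding 1 by (subst prod.reindex [OF 2]) simp
qed

abbreviation M0 :: "((('n::{finite,linorder} \<times> 'n) \<Rightarrow> real) \<times> (('n \<times> 'n) \<Rightarrow> real)) measure" where
  "M0 \<equiv> (\<Pi>\<^sub>M p\<in>upper_index. lborel) \<Otimes>\<^sub>M (\<Pi>\<^sub>M p\<in>upper_index. lborel)"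

definition of_xy :: "(('n::{finite,linorder} \<times> 'n) \<Rightarrow> real) \<times> (('n \<times> 'n) \<Rightarrow> real) \<Rightarrow> real^'n::{finite,linorder} coord" where
  "of_xy xy = (\<chi> c. if is_im c then snd xy (pindex c) else fst xy (pindex c))"

lemma measurable_vec_lambda:
  fixes f :: "'x \<Rightarrow> 'i::finite \<Rightarrow> 'b::euclidean_space"
  assumes "\<And>i. (\<lambda>x. f x i) \<in> borel_measurable M"
  shows "(\<lambda>x. \<chi> i. f x i) \<in> borel_measurable M"
  unfolding borel_measurable_euclidean_space [where 'c = "'b^'i"]
  using assms by (auto simp: Basis_vec_def inner_axis)

lemma measurable_of_xy: "of_xy \<in> borel_measurable M0"
  unfolding of_xy_def
proof (intro measurable_vec_lambda)
  fix c :: "'a coord"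
  have [measurable]: "(\<lambda>f. f (pindex c)) \<in> borel_measurable (\<Pi>\<^sub>M p\<in>upper_index. lborel)"
    using measurable_component_singleton [OF pindex_upper [of c], of "\<lambda>_. lborel"] by simp
  show "(\<lambda>xy. if is_im c then snd xy (pindex c) else fst xy (pindex c)) \<in> borel_measurable M0"
    by measurable
qed

lemma sigma_finite_PiM_lborel:
  "finite I \<Longrightarrow> sigma_finite_measure (\<Pi>\<^sub>M p\<in>I. (lborel :: real measure))"
  by (intro product_sigma_finite.sigma_finite) (simp_all add: product_sigma_finite_def lborel.sigma_finite_measure_axioms)

text \<open>Lebesgue measure is determined by its values on open boxes, and the preimage of a box is
  a product of intervals in the x and y variables.\<close>

lemma lborel_coord: "(lborel :: (real^'n::{finite,linorder} coord) measure) = distr M0 borel of_xy"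
proof (rule lborel_eqI)
  fix l u :: "real^'n::{finite,linorder} coord" assume "\<And>b. b \<in> Basis \<Longrightarrow> l \<bullet> b \<le> u \<bullet> b"
  then have "l \<bullet> axis c 1 \<le> u \<bullet> axis c 1" for c by (auto simp: Basis_vec_def)
  then have lu: "l $ c \<le> u $ c" for c by (simp add: inner_axis)
  let ?P = "\<Pi>\<^sub>M p\<in>(upper_index :: ('n \<times> 'n) set). (lborel :: real measure)"
  interpret ps: product_sigma_finite "\<lambda>p::'n \<times> 'n. (lborel :: real measure)"
    by (simp add: product_sigma_finite_def lborel.sigma_finite_measure_axioms)
  interpret sf: sigma_finite_measure ?P by (rule sigma_finite_PiM_lborel [OF finite_upper_index])
  define I where "I b p = {l $ Abs_coord (p, b) <..< u $ Abs_coord (p, b)}" for b p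
  have sets: "(\<Pi>\<^sub>E p\<in>upper_index. I b p) \<in> sets ?P" for b
    by (intro sets_PiM_I_finite finite_upper_index) (auto simp: I_def)
  have "of_xy -` box l u \<inter> space M0 = (\<Pi>\<^sub>E p\<in>upper_index. I False p) \<times> (\<Pi>\<^sub>E p\<in>upper_index. I True p)"
  proof -
    have "of_xy (x, y) \<in> box l u \<longleftrightarrow> (\<forall>p\<in>upper_index. x p \<in> I False p \<and> y p \<in> I True p)" for x y
    proof
      assume *: "of_xy (x, y) \<in> box l u"
      show "\<forall>p\<in>upper_index. x p \<in> I False p \<and> y p \<in> I True p"
      proof
        fix p :: "'n \<times> 'n" assume p: "p \<in> upper_index"
        have "l $ Abs_coord (p, b) < of_xy (x, y) $ Abs_coord (p, b) \<and> of_xy (x, y) $ Abs_coord (p, b) < u $ Abs_coord (p, b)" for b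
          using * by (auto simp: interval_cart)
        from this [of False] this [of True] show "x p \<in> I False p \<and> y p \<in> I True p"
          using p by (auto simp: I_def of_xy_def Abs_coord_inverse)
      qed
    next
      assume *: "\<forall>p\<in>upper_index. x p \<in> I False p \<and> y p \<in> I True p"
      have "l $ c < of_xy (x, y) $ c \<and> of_xy (x, y) $ c < u $ c" for c
        using bspec [OF * pindex_upper [of c]]
        by (cases "Rep_coord c"; cases "is_im c") (auto simp: of_xy_def I_def Rep_coord_inverse dest!: arg_cong [of "Rep_coord c" _ Abs_coord])
      then show "of_xy (x, y) \<in> box l u" by (auto simp: interval_cart)
    qed
    then show ?thesis by (auto simp: space_pair_measure space_PiM PiE_iff)
  qed
  then have "emeasure (distr M0 borel of_xy) (box l u) =
      emeasure M0 ((\<Pi>\<^sub>E p\<in>upper_index. I False p) \<times> (\<Pi>\<^sub>E p\<in>upper_index. I True p))"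
    by (simp add: emeasure_distr measurable_of_xy)
  also have "\<dots> = (\<Prod>p\<in>upper_index. emeasure lborel (I False p)) * (\<Prod>p\<in>upper_index. emeasure lborel (I True p))"
    by (subst sf.emeasure_pair_measure_Times [OF sets sets]) (simp add: ps.emeasure_PiM [OF finite_upper_index] I_def)
  also have "\<dots> = (\<Prod>p\<in>upper_index. ennreal (u $ Abs_coord (p, False) - l $ Abs_coord (p, False)) * ennreal (u $ Abs_coord (p, True) - l $ Abs_coord (p, True)))"
    by (simp add: I_def lu prod.distrib)
  also have "\<dots> = (\<Prod>c\<in>UNIV. ennreal ((\<lambda>x. u $ Abs_coord x - l $ Abs_coord x) (Rep_coord c)))"
    by (subst prod_coord [of "\<lambda>x. ennreal (u $ Abs_coord x - l $ Abs_coord x)"]) simp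
  also have "\<dots> = (\<Prod>c\<in>UNIV. ennreal (u $ c - l $ c))" by (simp add: Rep_coord_inverse)
  also have "\<dots> = ennreal (\<Prod>b\<in>Basis. (u - l) \<bullet> b)"
    unfolding prod_Basis_vec by (subst prod_ennreal) (auto simp: lu inner_axis)
  finally show "emeasure (distr M0 borel of_xy) (box l u) = ennreal (\<Prod>b\<in>Basis. (u - l) \<bullet> b)" .
qed simp

lemma toM_of_xy: "toM (of_xy (x, y)) = cmat (sym_of x) + mscale \<i> (cmat (sym_of y))"
  by (simp add: vec_eq_iff toM_def of_xy_def sym_of_def Abs_coord_inverse minmax_upper complex_eq_iff)

lemma borel_toM: "toM \<in> borel_measurable borel"
  by (intro borel_measurable_continuous_onI continuous_intros)

lemma M0_toM: "distr M0 borel (\<lambda>(x, y). cmat (sym_of x) + mscale \<i> (cmat (sym_of y))) =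
    distr lborel borel (toM :: real^'n::{finite,linorder} coord \<Rightarrow> _)"
proof -
  have "distr lborel borel (toM :: real^'n::{finite,linorder} coord \<Rightarrow> _) = distr M0 borel (toM \<circ> of_xy)"
    unfolding lborel_coord by (subst distr_distr) (auto simp: borel_toM measurable_of_xy)
  also have "toM \<circ> of_xy = (\<lambda>(x, y). cmat (sym_of x) + mscale \<i> (cmat (sym_of y)))"
    by (auto simp: toM_of_xy)
  finally show ?thesis by simp
qed

lemma closed_pos: "closed {y :: real^'n^'n. \<forall>v. m * (norm v)\<^sup>2 \<le> v \<bullet> (y *v v)}"
proof -
  have "{y :: real^'n^'n. \<forall>v. m * (norm v)\<^sup>2 \<le> v \<bullet> (y *v v)} = (\<Inter>v. {y. m * (norm v)\<^sup>2 \<le> v \<bullet> (y *v v)})" by auto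
  moreover have "closed {y :: real^'n^'n. m * (norm v)\<^sup>2 \<le> v \<bullet> (y *v v)}" for v
    by (intro closed_Collect_le continuous_intros)
  ultimately show ?thesis by auto
qed

text \<open>Positive definiteness is a countable union of closed conditions, one for each lower
  bound 1/(1 + k) of the form.\<close>

lemma borel_siegel: "siegel \<in> sets borel"
proof -
  have pd: "pos_def y \<longleftrightarrow> sym_mat y \<and> (\<exists>k::nat. \<forall>v. (1 / (1 + real k)) * (norm v)\<^sup>2 \<le> v \<bullet> (y *v v))" for y :: "real^'n^'n"
  proof
    assume y: "pos_def y"
    then obtain m where m: "m > 0" "\<And>v. m * (norm v)\<^sup>2 \<le> v \<bullet> (y *v v)" using pos_def_lower_bound by blast
    obtain k :: nat where "1 / m < k" using reals_Archimedean2 by blast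
    then have "1 / (1 + real k) \<le> m" using m by (simp add: field_simps)
    then have "(1 / (1 + real k)) * (norm v)\<^sup>2 \<le> m * (norm v)\<^sup>2" for v by (intro mult_right_mono) auto
    with m y show "sym_mat y \<and> (\<exists>k::nat. \<forall>v. (1 / (1 + real k)) * (norm v)\<^sup>2 \<le> v \<bullet> (y *v v))"
      unfolding pos_def_def by (meson order_trans)
  next
    assume "sym_mat y \<and> (\<exists>k::nat. \<forall>v. (1 / (1 + real k)) * (norm v)\<^sup>2 \<le> v \<bullet> (y *v v))"
    then obtain k :: nat where k: "sym_mat y" "\<And>v. (1 / (1 + real k)) * (norm v)\<^sup>2 \<le> v \<bullet> (y *v v)" by blast
    have "0 < (1 / (1 + real k)) * (norm v)\<^sup>2" if "v \<noteq> 0" for v :: "real^'n" using that by simp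
    then show "pos_def y" unfolding pos_def_def using k by (meson less_le_trans)
  qed
  have "siegel = {z :: complex^'n^'n. transpose z = z} \<inter> (\<Union>k::nat. (map_matrix Im) -` {y. \<forall>v. (1 / (1 + real k)) * (norm v)\<^sup>2 \<le> v \<bullet> (y *v v)})"
    unfolding siegel_def pd by (auto simp: sym_mat_def vec_eq_iff transpose_def)
  moreover have "closed {z :: complex^'n^'n. transpose z = z}"
    by (intro closed_Collect_eq continuous_intros)
  moreover have "closed ((map_matrix Im) -` {y :: real^'n^'n. \<forall>v. (1 / (1 + real k)) * (norm v)\<^sup>2 \<le> v \<bullet> (y *v v)})" for k :: nat
  proof (rule closed_vimage [OF closed_pos])
    show "continuous_on UNIV (map_matrix Im :: complex^'n^'n \<Rightarrow> _)" by (intro continuous_intros)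
  qed
  ultimately show ?thesis by (metis (no_types, lifting) borel_closed sets.Int sets.countable_UN image_subset_iff rangeI)
qed

section \<open>The invariant density\<close>

definition dens :: "complex^'n^'n \<Rightarrow> real" where
  "dens z = 1 / det (map_matrix Im z) ^ (CARD('n) + 1)"

lemma dens_pos: "z \<in> siegel \<Longrightarrow> dens z > 0"
  by (simp add: dens_def siegel_Im pos_def_det_pos)

lemma borel_dens: "dens \<in> borel_measurable borel"
  unfolding dens_def by (intro borel_measurable_divide borel_measurable_power borel_measurable_continuous_onI) (auto intro!: continuous_intros)

lemma siegel_measure_alt:
  "siegel_measure = density (distr lborel borel toM) (\<lambda>z. indicator siegel z * ennreal (dens z))"
  unfolding siegel_measure_def M0_toM dens_def ..

lemma sets_siegel_measure [simp, measurable_cong]: "sets siegel_measure = sets borel"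
  and space_siegel_measure [simp]: "space siegel_measure = UNIV"
  by (simp_all add: siegel_measure_alt)

lemma emeasure_siegel:
  assumes "A \<in> sets borel"
  shows "emeasure siegel_measure A = (\<integral>\<^sup>+ v. ennreal (dens (toM v)) * indicator (toM -` (A \<inter> siegel)) v \<partial>lborel)"
proof -
  have m: "(\<lambda>z. indicator siegel z * ennreal (dens z)) \<in> borel_measurable borel"
    using borel_dens borel_siegel by measurable
  then have m2: "(\<lambda>z. indicator siegel z * ennreal (dens z) * indicator A z) \<in> borel_measurable borel"
    using assms by measurable
  have "emeasure siegel_measure A = (\<integral>\<^sup>+ z. indicator siegel z * ennreal (dens z) * indicator A z \<partial>distr lborel borel toM)"
    unfolding siegel_measure_alt using assms m by (subst emeasure_density) auto
  also have "\<dots> = (\<integral>\<^sup>+ v. indicator siegel (toM v) * ennreal (dens (toM v)) * indicator A (toM v) \<partial>lborel)"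
    by (subst nn_integral_distr) (use borel_toM m2 in auto)
  also have "\<dots> = (\<integral>\<^sup>+ v. ennreal (dens (toM v)) * indicator (toM -` (A \<inter> siegel)) v \<partial>lborel)"
    by (intro nn_integral_cong) (auto simp: indicator_def)
  finally show ?thesis .
qed

section \<open>Invariance of the measure\<close>

text \<open>An exact factorisation of the increment with a continuous second factor yields the
  derivative at once. Both the symplectic action and the resolvent have this shape, so inversion of
  matrices need not be differentiated.\<close>

lemma has_derivative_bilinear_continuous:
  fixes h :: "'a::euclidean_space \<Rightarrow> 'b::euclidean_space \<Rightarrow> 'c::euclidean_space"
  assumes h: "bounded_bilinear h"
    and f: "\<And>y. y \<in> S \<Longrightarrow> f y - f x = h (y - x) (k y)"
    and k: "continuous (at x within S) k"
  shows "(f has_derivative (\<lambda>u. h u (k x))) (at x within S)"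
proof -
  interpret bounded_bilinear h by (rule h)
  obtain K where K: "\<And>a b. norm (h a b) \<le> norm a * norm b * K" "K > 0" using pos_bounded by blast
  show ?thesis
  proof (rule has_derivativeI_sandwich [of 1])
    show "bounded_linear (\<lambda>u. h u (k x))" by (rule bounded_linear_left)
    fix y assume y: "y \<in> S" "y \<noteq> x"
    have "norm (f y - f x - h (y - x) (k x)) = norm (h (y - x) (k y - k x))"
      by (simp add: f [OF y(1)] diff_right)
    also have "\<dots> \<le> norm (y - x) * norm (k y - k x) * K" by (rule K)
    finally show "norm (f y - f x - h (y - x) (k x)) / norm (y - x) \<le> norm (k y - k x) * K"
      using y by (simp add: divide_le_eq mult_ac)
  next
    have "((\<lambda>y. k y - k x) \<longlongrightarrow> 0) (at x within S)"
      using k by (simp add: continuous_within LIM_zero)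
    then have "((\<lambda>y. norm (k y - k x) * K) \<longlongrightarrow> 0 * K) (at x within S)"
      by (intro tendsto_mult tendsto_norm_zero tendsto_const)
    then show "((\<lambda>y. norm (k y - k x) * K) \<longlongrightarrow> 0) (at x within S)" by simp
  qed simp
qed

text \<open>The congruence h -> T^T h T in real coordinates; with T the inverse of C z + D it is the
  derivative of the action.\<close>

definition congr :: "complex^'n::{finite,linorder}^'n::{finite,linorder} \<Rightarrow> real^'n::{finite,linorder} coord \<Rightarrow> real^'n::{finite,linorder} coord" where
  "congr T h = fromM (transpose T ** toM h ** T)"

lemma mmult_scaleR: "(c *\<^sub>R A) ** B = c *\<^sub>R (A ** (B::complex^'n^'n))" "A ** (c *\<^sub>R B) = c *\<^sub>R (A ** (B::complex^'n^'n))"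
  by (simp_all add: vec_eq_iff matrix_matrix_mult_def scaleR_sum_right)

lemma bilinear_congr:
  fixes T :: "complex^'n::{finite,linorder}^'n::{finite,linorder}"
  shows "bounded_bilinear (\<lambda>h m. fromM (transpose T ** toM h ** m))"
proof -
  have "linear (\<lambda>m. fromM (transpose T ** toM h ** m))" for h
    by (rule linearI) (simp_all only: matrix_add_ldistrib mmult_scaleR linear_add [OF linear_fromM] linear_scale [OF linear_fromM])
  moreover have "linear (\<lambda>h. fromM (transpose T ** toM h ** m))" for m
    by (rule linearI) (simp_all add: matrix_add_ldistrib matrix_add_rdistrib mmult_scaleR linear_add [OF linear_fromM] linear_scale [OF linear_fromM]
        linear_add [OF linear_toM] linear_scale [OF linear_toM])
  ultimately show ?thesis
    unfolding bilinear_conv_bounded_bilinear [symmetric] bilinear_def by blast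
qed

lemma linear_congr: "linear (congr T)"
  unfolding congr_def using bounded_bilinear.bounded_linear_left [OF bilinear_congr] bounded_linear.linear by blast

lemma congr_mult: "congr (A ** B) = congr B \<circ> congr A"
  by (simp add: fun_eq_iff congr_def matrix_transpose_mul toM_fromM toM_sym matrix_mul_assoc)

lemma congr_one: "congr (mat 1) = id"
  by (simp add: fun_eq_iff congr_def transpose_mat fromM_toM)

lemma congr_inverse: "invertible T \<Longrightarrow> congr T \<circ> congr (matrix_inv T) = id"
  by (simp add: congr_mult [symmetric] matrix_inv_left congr_one)

lemma prod_Sigma_fst:
  fixes d :: "'n::finite \<Rightarrow> real" and B :: "'n \<Rightarrow> 'n set"
  shows "(\<Prod>p\<in>Sigma UNIV B. d (fst p)) = (\<Prod>i\<in>UNIV. d i ^ card (B i))"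
proof -
  have "(\<Prod>p\<in>Sigma UNIV B. d (fst p)) = (\<Prod>(i,j)\<in>Sigma UNIV B. d i)" by (simp add: case_prod_unfold)
  also have "\<dots> = (\<Prod>i\<in>UNIV. \<Prod>j\<in>B i. d i)" by (rule prod.Sigma [symmetric]) auto
  finally show ?thesis by simp
qed

text \<open>The index i occurs n + 1 times in the pairs r <= s, counting (i, i) twice: once for each
  s >= i as first entry and once for each r <= i as second.\<close>

lemma prod_upper_index:
  fixes d :: "'n::{finite,linorder} \<Rightarrow> real"
  shows "(\<Prod>p\<in>upper_index. d (fst p) * d (snd p)) = (\<Prod>i\<in>UNIV. d i) ^ (CARD('n) + 1)"
proof -
  have A: "(upper_index :: ('n \<times> 'n) set) = Sigma UNIV (\<lambda>i. {i..})" by (auto simp: upper_index_def)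
  have "(\<Prod>p\<in>upper_index. d (fst p)) = (\<Prod>i\<in>UNIV. d i ^ card {i..})"
    unfolding A by (rule prod_Sigma_fst)
  moreover have "(\<Prod>p\<in>upper_index. d (snd p)) = (\<Prod>i\<in>UNIV. d i ^ card {..i})"
  proof -
    have "(\<Prod>p\<in>upper_index. d (snd p)) = (\<Prod>p\<in>Sigma UNIV (\<lambda>i. {..i}). d (fst p))"
      by (rule prod.reindex_bij_witness [of _ "\<lambda>(a,b). (b,a)" "\<lambda>(a,b). (b,a)"]) (auto simp: upper_index_def)
    then show ?thesis by (simp only: prod_Sigma_fst)
  qed
  ultimately have "(\<Prod>p\<in>upper_index. d (fst p) * d (snd p)) = (\<Prod>i\<in>UNIV. d i ^ (card {i..} + card {..i}))"
    by (simp add: prod.distrib power_add)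
  moreover have "card {i..} + card {..i} = CARD('n) + 1" for i :: 'n
  proof -
    have "card {i..} + card {..i} = card ({i..} \<union> {..i}) + card ({i..} \<inter> {..i})"
      by (rule card_Un_Int) auto
    moreover have "{i..} \<union> {..i} = UNIV" "{i..} \<inter> {..i} = {i}" by auto
    ultimately show ?thesis by simp
  qed
  ultimately show ?thesis by (simp only: prod_power_distrib)
qed

lemma mult_diag:
  fixes S :: "complex^'n^'n"
  shows "((\<chi> i j. if i = j then d i else 0) ** S ** (\<chi> i j. if i = j then d i else 0)) $ r $ s = d r * S $ r $ s * d s"
proof -
  have 1: "((\<chi> i j. if i = j then d i else 0) ** S) $ r $ l = d r * S $ r $ l" for l
  proof -
    have "(\<Sum>k\<in>UNIV. (if r = k then d r else 0) * S $ k $ l) = (\<Sum>k\<in>{r}. d r * S $ r $ l)"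
      by (rule sum.mono_neutral_cong_right) auto
    then show ?thesis by (simp add: matrix_matrix_mult_def)
  qed
  have "(\<Sum>l\<in>UNIV. (d r * S $ r $ l) * (if l = s then d l else 0)) = (\<Sum>l\<in>{s}. d r * S $ r $ s * d s)"
    by (rule sum.mono_neutral_cong_right) auto
  then show ?thesis unfolding matrix_matrix_mult_def [of "_ ** S"] by (simp add: 1)
qed

text \<open>The map is diagonal with eigenvalue d_r d_s, once on the real and once on the imaginary
  part of entry (r, s); hence the doubled exponent.\<close>

lemma det_congr_diag:
  fixes d :: "'n::{finite,linorder} \<Rightarrow> real"
  assumes "\<And>i. d i > 0"
  shows "\<bar>det (matrix (congr (\<chi> i j. if i = j then of_real (d i) else 0)))\<bar> = (\<Prod>i\<in>UNIV. d i) ^ (2 * (CARD('n) + 1))"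
proof -
  let ?D = "\<chi> i j. if i = j then complex_of_real (d i) else 0"
  have tD: "transpose ?D = ?D" by (auto simp: vec_eq_iff transpose_def)
  have c: "congr ?D h $ c = d (fst (pindex c)) * d (snd (pindex c)) * h $ c" for h c
  proof -
    have "congr ?D h $ c = d (fst (pindex c)) * d (snd (pindex c)) * fromM (toM h) $ c"
      by (simp add: congr_def tD fromM_def mult_diag)
    then show ?thesis by (simp add: fromM_toM)
  qed
  have "matrix (congr ?D) $ a $ b = (if a = b then d (fst (pindex a)) * d (snd (pindex a)) else 0)" for a b
    by (simp add: matrix_def c axis_def)
  then have "det (matrix (congr ?D)) = (\<Prod>c\<in>UNIV. d (fst (pindex c)) * d (snd (pindex c)))"
    by (subst det_diagonal) auto
  also have "\<dots> = (\<Prod>p\<in>upper_index. (d (fst p) * d (snd p)) * (d (fst p) * d (snd p)))"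
    using prod_coord [of "\<lambda>x. d (fst (fst x)) * d (snd (fst x))"] by simp
  also have "\<dots> = ((\<Prod>i\<in>UNIV. d i) ^ (CARD('n) + 1))\<^sup>2"
    unfolding prod.distrib [of "\<lambda>p. d (fst p) * d (snd p)" "\<lambda>p. d (fst p) * d (snd p)"] prod_upper_index by (simp add: power2_eq_square)
  also have "\<dots> = (\<Prod>i\<in>UNIV. d i) ^ (2 * (CARD('n) + 1))" by (simp only: power_mult [symmetric] mult.commute)
  finally show ?thesis using prod_pos [of UNIV d] assms by simp
qed

lemma det_congr:
  assumes "invertible T"
  shows "\<bar>det (matrix (congr T))\<bar> = cmod (det (T::complex^'n::{finite,linorder}^'n::{finite,linorder})) ^ (2 * (CARD('n) + 1))"
proof (rule multiplicative_eq_det_power [where \<delta> = "\<lambda>T. \<bar>det (matrix (congr T))\<bar>"])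
  fix A B :: "complex^'n::{finite,linorder}^'n::{finite,linorder}"
  show "\<bar>det (matrix (congr (A ** B)))\<bar> = \<bar>det (matrix (congr A))\<bar> * \<bar>det (matrix (congr B))\<bar>"
    by (simp add: congr_mult matrix_compose linear_congr det_mul abs_mult mult.commute)
  assume A: "invertible A"
  have "matrix (congr A) ** matrix (congr (matrix_inv A)) = mat 1"
    by (simp add: matrix_compose [symmetric] linear_congr congr_inverse A matrix_id_mat_1)
  then have "det (matrix (congr A)) * det (matrix (congr (matrix_inv A))) = 1" by (metis det_mul det_I)
  then show "0 < \<bar>det (matrix (congr A))\<bar>" by (metis mult_zero_left zero_less_abs_iff zero_neq_one)
next
  have "continuous_on {A. invertible A} (\<lambda>T. matrix (congr (T::complex^'n::{finite,linorder}^'n::{finite,linorder})))"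
    unfolding continuous_on_matrix
  proof safe
    fix i j :: "'n coord"
    have "continuous_on {A. invertible A} (\<lambda>T. congr (T::complex^'n::{finite,linorder}^'n::{finite,linorder}) (axis j 1) $ i)"
      unfolding congr_def by (intro continuous_intros)
    then show "continuous_on {A. invertible A} (\<lambda>T. matrix (congr (T::complex^'n::{finite,linorder}^'n::{finite,linorder})) $ i $ j)"
      by (simp add: matrix_def)
  qed
  then show "continuous_on {A. invertible A} (\<lambda>T. \<bar>det (matrix (congr (T::complex^'n::{finite,linorder}^'n::{finite,linorder})))\<bar>)"
    by (intro continuous_intros)
qed (use det_congr_diag assms in auto)

lemma continuous_on_autf [continuous_intros]:
  "continuous_on S f \<Longrightarrow> continuous_on S (\<lambda>x. autf g (f x))"
  unfolding autf_def by (intro continuous_intros)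

lemma continuous_on_act:
  assumes "symplectic g"
  shows "continuous_on siegel (act g)"
  unfolding act_def using invertible_autf [OF assms] by (intro continuous_intros) auto

lemma act_coord_derivative:
  fixes g :: "real^('n::{finite,linorder}+'n)^('n+'n)"
  assumes g: "symplectic g" and v: "toM v \<in> siegel"
  shows "((\<lambda>v. fromM (act g (toM v))) has_derivative congr (matrix_inv (autf g (toM v)))) (at v within toM -` siegel)"
proof -
  define T where "T = matrix_inv (autf g (toM v))"
  have "((\<lambda>v. fromM (act g (toM v))) has_derivative
      (\<lambda>h. (\<lambda>h m. fromM (transpose T ** toM h ** m)) h (matrix_inv (autf g (toM v))))) (at v within toM -` siegel)"
  proof (rule has_derivative_bilinear_continuous [OF bilinear_congr])
    fix w :: "real^'n::{finite,linorder} coord" assume "w \<in> toM -` siegel"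
    then have "act g (toM w) - act g (toM v) = transpose T ** (toM w - toM v) ** matrix_inv (autf g (toM w))"
      using act_diff' [OF g _ v] by (simp add: T_def)
    then show "fromM (act g (toM w)) - fromM (act g (toM v)) = fromM (transpose T ** toM (w - v) ** matrix_inv (autf g (toM w)))"
      by (simp only: linear_diff [OF linear_toM] linear_diff [OF linear_fromM, symmetric])
  next
    have "continuous_on (toM -` siegel) (\<lambda>w. matrix_inv (autf g (toM w)))"
      using invertible_autf [OF g] by (intro continuous_intros) auto
    then show "continuous (at v within toM -` siegel) (\<lambda>w. matrix_inv (autf g (toM w)))"
      using v by (simp add: continuous_on_eq_continuous_within)
  qed
  then show ?thesis by (simp add: congr_def [abs_def] T_def)
qed

lemma symplectic_inverse:
  assumes "symplectic g"
  shows "\<exists>h. symplectic h \<and> h ** g = mat 1 \<and> g ** h = mat 1"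
proof -
  have "g \<in> carrier Sp" using assms by (simp add: carrier_Sp)
  then show ?thesis using group.l_inv [OF group_Sp] group.r_inv [OF group_Sp] group.inv_closed [OF group_Sp]
    by (auto simp: carrier_Sp)
qed

lemma act_inverse:
  assumes "symplectic g" "symplectic h" "h ** g = mat 1" "z \<in> siegel"
  shows "act h (act g z) = z"
  using assms act_mult [of h g z] by (simp add: act_one)

text \<open>Taking determinants in \<open>Im_act\<close> gives det Im(gz) |det j|^2 = det Im z; the
  power n + 1 in the density then matches the Jacobian exponent 2(n + 1).\<close>

lemma dens_act:
  fixes z :: "complex^'n^'n"
  assumes g: "symplectic g" and z: "z \<in> siegel"
  shows "dens (act g z) * cmod (det (matrix_inv (autf g z))) ^ (2 * (CARD('n) + 1)) = dens z"
proof -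
  define j where "j = autf g z"
  have j: "invertible j" using invertible_autf [OF assms] by (simp add: j_def)
  then have dj: "det j \<noteq> 0" by (simp add: invertible_det_nz)
  have "det j * det (matrix_inv j) = 1" using j by (simp add: det_mul [symmetric] matrix_inv_right)
  then have dinv: "cmod (det (matrix_inv j)) = 1 / cmod (det j)"
    using dj by (metis nonzero_eq_divide_eq norm_divide norm_one mult.commute)
  have "det (conj_transpose j ** cmat (map_matrix Im (act g z)) ** j) = det (cmat (map_matrix Im z))"
    unfolding j_def by (simp only: Im_act [OF assms])
  then have "cnj (det j) * of_real (det (map_matrix Im (act g z))) * det j = of_real (det (map_matrix Im z))"
    by (simp only: det_mul det_conj_transpose det_cmat)
  then have "of_real (det (map_matrix Im (act g z)) * (cmod (det j))\<^sup>2) = complex_of_real (det (map_matrix Im z))"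
    by (simp add: complex_norm_square mult_ac del: of_real_power)
  then have "det (map_matrix Im (act g z)) * (cmod (det j))\<^sup>2 = det (map_matrix Im z)"
    by (simp only: of_real_eq_iff)
  moreover have "det (map_matrix Im (act g z)) > 0" using act_siegel [OF assms] siegel_Im pos_def_det_pos by blast
  ultimately show ?thesis
    using dj unfolding dens_def j_def [symmetric] dinv power_mult
    by (simp only: power_divide power_mult_distrib [symmetric] power_one times_divide_times_eq mult_1)
qed

text \<open>The change of variables theorem speaks of the gauge integral, the measure of
  \<open>nn_integral\<close>; this passes between them for nonnegative Borel functions.\<close>

lemma has_integral_iff_nn_integral_borel:
  fixes f :: "'a::euclidean_space \<Rightarrow> real"
  assumes f: "f \<in> borel_measurable borel" and S: "S \<in> sets borel" and pos: "\<And>x. x \<in> S \<Longrightarrow> 0 \<le> f x"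
  shows "(f has_integral b) S \<longleftrightarrow> 0 \<le> b \<and> (\<integral>\<^sup>+ x. ennreal (f x) * indicator S x \<partial>lborel) = ennreal b"
proof
  assume *: "(f has_integral b) S"
  then show "0 \<le> b \<and> (\<integral>\<^sup>+ x. ennreal (f x) * indicator S x \<partial>lborel) = ennreal b"
    using nn_integral_has_integral_lebesgue' [OF pos *] has_integral_nonneg [OF * pos] by auto
next
  assume *: "0 \<le> b \<and> (\<integral>\<^sup>+ x. ennreal (f x) * indicator S x \<partial>lborel) = ennreal b"
  have "((\<lambda>x. f x * indicator S x) has_integral b) UNIV"
  proof (rule nn_integral_has_integral)
    show "(\<lambda>x. f x * indicator S x) \<in> borel_measurable borel" using f S by measurable
    show "0 \<le> f x * indicator S x" for x using pos by (simp add: indicator_def)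
    have "(\<integral>\<^sup>+ x. ennreal (f x * indicator S x) \<partial>lborel) = (\<integral>\<^sup>+ x. ennreal (f x) * indicator S x \<partial>lborel)"
      by (intro nn_integral_cong) (auto simp: indicator_def)
    then show "(\<integral>\<^sup>+ x. ennreal (f x * indicator S x) \<partial>lborel) = ennreal b" using * by simp
  qed (use * in auto)
  moreover have "(\<lambda>x. f x * indicator S x) = (\<lambda>x. if x \<in> S then f x else 0)" by (auto simp: indicator_def)
  ultimately show "(f has_integral b) S" by (simp add: has_integral_restrict_UNIV)
qed

text \<open>Outside the open set of invertible matrices the choice operator is applied to the empty
  predicate, so \<open>matrix_inv\<close> is constant there.\<close>

lemma borel_matrix_inv: "(matrix_inv :: complex^'n^'n \<Rightarrow> _) \<in> borel_measurable borel"
proof -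
  define D where "D = {A :: complex^'n^'n. invertible A}"
  have "open D" unfolding D_def invertible_det_nz by (intro open_Collect_neq continuous_intros)
  then have D: "D \<in> sets borel" by simp
  have "continuous_on D matrix_inv" unfolding D_def by (intro continuous_intros) auto
  then have 1: "(\<lambda>A. indicator D A *\<^sub>R matrix_inv A) \<in> borel_measurable borel"
    by (rule borel_measurable_continuous_on_indicator [OF D])
  have 2: "matrix_inv A = (SOME B::complex^'n^'n. False)" if "A \<notin> D" for A :: "complex^'n^'n"
  proof -
    have "(\<lambda>B. A ** B = mat 1 \<and> B ** A = mat 1) = (\<lambda>B. False)"
      using that by (auto simp: D_def invertible_def fun_eq_iff)
    then show ?thesis by (simp only: matrix_inv_def)
  qed
  have e: "matrix_inv = (\<lambda>A. if A \<in> D then indicator D A *\<^sub>R matrix_inv A else (SOME B::complex^'n^'n. False))"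
    using 2 by (auto simp: fun_eq_iff)
  have "(\<lambda>A. if A \<in> D then indicator D A *\<^sub>R matrix_inv A else (SOME B::complex^'n^'n. False)) \<in> borel_measurable borel"
    by (rule measurable_If_set) (use 1 D in auto)
  then show ?thesis by (subst e)
qed

lemma borel_act: "act g \<in> borel_measurable borel"
proof -
  have 1: "(\<lambda>p::(complex^'a^'a) \<times> (complex^'a^'a). fst p ** snd p) \<in> borel_measurable borel"
    by (intro borel_measurable_continuous_onI continuous_intros)
  have 2: "(\<lambda>z. cmat (blockA g) ** z + cmat (blockB g)) \<in> borel_measurable borel"
    by (intro borel_measurable_continuous_onI continuous_intros)
  have "(\<lambda>z. autf g z) \<in> borel_measurable borel"
    by (intro borel_measurable_continuous_onI continuous_intros)
  then have 3: "(\<lambda>z. matrix_inv (autf g z)) \<in> borel_measurable borel"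
    by (rule measurable_compose [OF _ borel_matrix_inv])
  show ?thesis
    using measurable_compose [OF borel_measurable_Pair [OF 2 3] 1] by (simp add: act_def [abs_def])
qed

text \<open>Change of variables for the density itself, between the coordinates of B and of its
  preimage; by \<open>dens_act\<close> the Jacobian times the transported density is the density
  again.\<close>

theorem siegel_measure_invariant:
  fixes g :: "real^('n::{finite,linorder}+'n)^('n+'n)"
  assumes g: "symplectic g"
  shows "distr siegel_measure borel (act g) = siegel_measure"
proof (rule measure_eqI)
  fix B assume "B \<in> sets (distr siegel_measure borel (act g))"
  then have B: "B \<in> sets borel" by simp
  obtain h where h: "symplectic h" "h ** g = mat 1" "g ** h = mat 1" using symplectic_inverse [OF g] by blast
  define S where "S = toM -` ((act g -` B) \<inter> siegel)"
  define T where "T = toM -` (B \<inter> siegel)"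
  define f where "f v = dens (toM v)" for v :: "real^'n::{finite,linorder} coord"
  have B': "act g -` B \<in> sets borel" using measurable_sets [OF borel_act B] by simp
  have S: "S \<in> sets borel" unfolding S_def using measurable_sets [OF borel_toM, of "act g -` B \<inter> siegel"] B' borel_siegel by auto
  have T: "T \<in> sets borel" unfolding T_def using measurable_sets [OF borel_toM, of "B \<inter> siegel"] B borel_siegel by auto
  have f: "f \<in> borel_measurable borel" unfolding f_def by (rule measurable_compose [OF borel_toM borel_dens])
  define G where "G v = fromM (act g (toM v))" for v
  define H where "H v = fromM (act h (toM v))" for v
  have cov: "((\<lambda>v. \<bar>det (matrix (congr (matrix_inv (autf g (toM v)))))\<bar> * f (G v)) has_integral b) S \<longleftrightarrow> (f has_integral b) T" for b
  proof (rule cov_invertible_nonneg_eq [where h = H and h' = "\<lambda>v. congr (matrix_inv (autf h (toM v)))"])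
    fix v assume v: "v \<in> S"
    then have v': "toM v \<in> siegel" "act g (toM v) \<in> B" by (auto simp: S_def)
    show "(G has_derivative congr (matrix_inv (autf g (toM v)))) (at v within S)"
      unfolding G_def using act_coord_derivative [OF g v'(1)] by (rule has_derivative_subset) (auto simp: S_def)
    have "toM (G v) = act g (toM v)" unfolding G_def by (rule toM_fromM [OF act_sym [OF g v'(1)]])
    then show "G v \<in> T \<and> H (G v) = v"
      using v' act_siegel [OF g v'(1)] by (simp add: T_def H_def act_inverse [OF g h(1,2)] fromM_toM)
  next
    fix v assume v: "v \<in> T"
    then have v': "toM v \<in> siegel" "toM v \<in> B" by (auto simp: T_def)
    show "(H has_derivative congr (matrix_inv (autf h (toM v)))) (at v within T)"
      unfolding H_def using act_coord_derivative [OF h(1) v'(1)] by (rule has_derivative_subset) (auto simp: T_def)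
    show "0 \<le> f v" using dens_pos [OF v'(1)] by (simp add: f_def)
    have HH: "toM (H v) = act h (toM v)" unfolding H_def by (rule toM_fromM [OF act_sym [OF h(1) v'(1)]])
    then show "H v \<in> S \<and> G (H v) = v"
      using v' act_siegel [OF h(1) v'(1)] by (simp add: S_def G_def act_inverse [OF h(1) g h(3)] fromM_toM)
    have "autf g (act h (toM v)) ** autf h (toM v) = mat 1"
      using autf_mult [OF h(1) v'(1), of g] by (simp add: h autf_one)
    then have "matrix_inv (autf g (toM (H v))) = autf h (toM v)"
      unfolding HH by (rule matrix_inv_unique)
    then show "congr (matrix_inv (autf h (toM v))) \<circ> congr (matrix_inv (autf g (toM (H v)))) = id"
      by (simp add: congr_mult [symmetric] matrix_inv_right invertible_autf [OF h(1) v'(1)] congr_one)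
  qed
  have eqf: "\<bar>det (matrix (congr (matrix_inv (autf g (toM v)))))\<bar> * f (G v) = f v" if "v \<in> S" for v
  proof -
    have v: "toM v \<in> siegel" using that by (simp add: S_def)
    have "toM (G v) = act g (toM v)" unfolding G_def by (rule toM_fromM [OF act_sym [OF g v]])
    then show ?thesis using dens_act [OF g v]
      by (simp add: f_def det_congr invertible_matrix_inv invertible_autf [OF g v] mult.commute)
  qed
  have cov': "(f has_integral b) S \<longleftrightarrow> (f has_integral b) T" for b
    unfolding cov [symmetric] by (rule has_integral_cong) (simp add: eqf)
  have fpos: "0 \<le> f x" if "x \<in> S \<union> T" for x
    using that by (auto simp: f_def S_def T_def intro: less_imp_le dens_pos)
  have nn: "(\<integral>\<^sup>+ x. ennreal (f x) * indicator S x \<partial>lborel) = ennreal b \<longleftrightarrow> (\<integral>\<^sup>+ x. ennreal (f x) * indicator T x \<partial>lborel) = ennreal b"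
    if "b \<ge> 0" for b
    using cov' [of b] has_integral_iff_nn_integral_borel [OF f S, of b] has_integral_iff_nn_integral_borel [OF f T, of b] fpos that by auto
  have "(\<integral>\<^sup>+ x. ennreal (f x) * indicator S x \<partial>lborel) = (\<integral>\<^sup>+ x. ennreal (f x) * indicator T x \<partial>lborel)"
    (is "?s = ?t")
  \<comment> \<open>\<open>nn\<close> compares finite values. If the left integral is infinite, it
    excludes every finite value on the right.\<close>
  proof (cases ?s)
    case (real r)
    then show ?thesis using nn [of r] by simp
  next
    case top
    then show ?thesis using nn by (cases ?t) auto
  qed
  moreover have "emeasure (distr siegel_measure borel (act g)) B = emeasure siegel_measure (act g -` B)"
    using B borel_act by (subst emeasure_distr) (auto simp: measurable_cong_sets [OF sets_siegel_measure refl])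
  ultimately show "emeasure (distr siegel_measure borel (act g)) B = emeasure siegel_measure B"
    using B B' by (simp only: emeasure_siegel f_def S_def T_def)
qed simp

section \<open>Zariski density of the unitary group\<close>

definition polyfun :: "(complex \<Rightarrow> complex) \<Rightarrow> bool" where
  "polyfun h \<longleftrightarrow> (\<exists>a. \<forall>t. h t = poly a t)"

lemma polyfun_const [intro]: "polyfun (\<lambda>t. c)"
  unfolding polyfun_def by (rule exI [of _ "[:c:]"]) simp

lemma polyfun_id [intro]: "polyfun (\<lambda>t. t)"
  unfolding polyfun_def by (rule exI [of _ "[:0, 1:]"]) simp

lemma polyfun_add [intro]: "polyfun f \<Longrightarrow> polyfun g \<Longrightarrow> polyfun (\<lambda>t. f t + g t)"
  unfolding polyfun_def by (metis poly_add)

lemma polyfun_mult [intro]: "polyfun f \<Longrightarrow> polyfun g \<Longrightarrow> polyfun (\<lambda>t. f t * g t)"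
  unfolding polyfun_def by (metis poly_mult)

lemma polyfun_sum [intro]: "(\<And>i. i \<in> I \<Longrightarrow> polyfun (f i)) \<Longrightarrow> polyfun (\<lambda>t. \<Sum>i\<in>I. f i t)"
  by (induction I rule: infinite_finite_induct) auto

lemma polyfun_prod [intro]: "(\<And>i. i \<in> I \<Longrightarrow> polyfun (f i)) \<Longrightarrow> polyfun (\<lambda>t. \<Prod>i\<in>I. f i t)"
  by (induction I rule: infinite_finite_induct) auto

lemma polyfun_power [intro]: "polyfun f \<Longrightarrow> polyfun (\<lambda>t. f t ^ n)"
  by (induction n) auto

lemma polyfun_det: "(\<And>i j. polyfun (\<lambda>t. M t $ i $ j)) \<Longrightarrow> polyfun (\<lambda>t. det (M t))"
  unfolding det_def by (intro polyfun_sum polyfun_mult polyfun_const polyfun_prod) auto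

lemma polyfun_eq_0:
  assumes "polyfun f" "infinite {t. f t = 0}"
  shows "f t = 0"
  using assms poly_roots_finite unfolding polyfun_def by (metis (no_types, lifting) Collect_cong poly_0)

lemma polyfun_mat_affine: "polyfun (\<lambda>t. (A + mat t ** B) $ i $ j)"
  unfolding vector_add_component mat_mult_left_nth
  by (intro polyfun_add polyfun_mult polyfun_const polyfun_id)

text \<open>Clearing denominators: a polynomial at a matrix of fractions with common denominator d
  is a polynomial over a power of d.\<close>

lemma complex_polynomial_rational:
  assumes "complex_polynomial_fun p" "polyfun d" "\<And>i j. polyfun (\<lambda>t. M t $ i $ j)"
  shows "\<exists>k q. polyfun q \<and> (\<forall>t. d t \<noteq> 0 \<longrightarrow> p (\<chi> i j. M t $ i $ j / d t) = q t / d t ^ k)"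
  using assms(1)
proof induction
  case (entry i j)
  show ?case by (rule exI [of _ 1], rule exI [of _ "\<lambda>t. M t $ i $ j"]) (use assms in auto)
next
  case (const c)
  show ?case by (rule exI [of _ 0], rule exI [of _ "\<lambda>t. c"]) auto
next
  case (add p r)
  then obtain k q k' q' where *: "polyfun q" "polyfun q'"
    "\<And>t. d t \<noteq> 0 \<Longrightarrow> p (\<chi> i j. M t $ i $ j / d t) = q t / d t ^ k"
    "\<And>t. d t \<noteq> 0 \<Longrightarrow> r (\<chi> i j. M t $ i $ j / d t) = q' t / d t ^ k'" by metis
  have "polyfun (\<lambda>t. q t * d t ^ k' + q' t * d t ^ k)"
    using * assms(2) by (intro polyfun_add polyfun_mult polyfun_power)
  moreover have "q t / d t ^ k + q' t / d t ^ k' = (q t * d t ^ k' + q' t * d t ^ k) / d t ^ (k + k')" if "d t \<noteq> 0" for t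
    using that by (simp add: power_add field_simps)
  ultimately show ?case
    by (intro exI [of _ "k + k'"] exI [of _ "\<lambda>t. q t * d t ^ k' + q' t * d t ^ k"]) (simp add: *(3,4))
next
  case (mult p r)
  then obtain k q k' q' where "polyfun q" "polyfun q'"
    "\<And>t. d t \<noteq> 0 \<Longrightarrow> p (\<chi> i j. M t $ i $ j / d t) = q t / d t ^ k"
    "\<And>t. d t \<noteq> 0 \<Longrightarrow> r (\<chi> i j. M t $ i $ j / d t) = q' t / d t ^ k'" by metis
  then show ?case
    by (intro exI [of _ "k + k'"] exI [of _ "\<lambda>t. q t * q' t"]) (auto simp: power_add)
qed

lemma complex_polynomial_polyfun:
  assumes "complex_polynomial_fun p" "\<And>i j. polyfun (\<lambda>t. M t $ i $ j)"
  shows "polyfun (\<lambda>t. p (M t))"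
  using assms(1) by induction (use assms(2) in auto)

text \<open>The form of a skew-Hermitian X is purely imaginary, so the real part of the form of 1 +
  X or 1 - X at u is |u|^2.\<close>

lemma skew_invertible:
  assumes "conj_transpose X = - X"
  shows "invertible (mat 1 + X)" "invertible (mat 1 - X)"
proof -
  have X: "Re (hdot (X *v u) u) = 0" for u
  proof -
    have "hdot (X *v u) u = hdot u ((- X) *v u)" by (simp add: hdot_adjoint assms)
    also have "(- X) *v u = - (X *v u)" by (metis diff_0 matrix_vector_mult_0 matrix_vector_mult_diff_rdistrib)
    also have "hdot u (- (X *v u)) = - cnj (hdot (X *v u) u)"
      using hdot_diff_right [of u 0 "X *v u"] by (simp add: hdot_cnj)
    finally have "hdot (X *v u) u = - cnj (hdot (X *v u) u)" .
    from arg_cong [OF this, of Re] show ?thesis by simp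
  qed
  show "invertible (mat 1 + X)"
  proof (rule invertible_kernel)
    fix u assume "(mat 1 + X) *v u = 0"
    then have "u + X *v u = 0" by (simp add: matrix_vector_mult_add_rdistrib)
    then have "hdot u u + hdot (X *v u) u = 0" by (metis hdot_add_left hdot_zero(1))
    from arg_cong [OF this, of Re] have "(norm u)\<^sup>2 = 0" using X [of u] by (simp add: hdot_self del: of_real_power)
    then show "u = 0" by simp
  qed
  show "invertible (mat 1 - X)"
  proof (rule invertible_kernel)
    fix u assume "(mat 1 - X) *v u = 0"
    then have "u - X *v u = 0" by (simp add: matrix_vector_mult_diff_rdistrib)
    then have "hdot u u - hdot (X *v u) u = 0" by (metis hdot_diff_left hdot_zero(1))
    from arg_cong [OF this, of Re] have "(norm u)\<^sup>2 = 0" using X [of u] by (simp add: hdot_self del: of_real_power)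
    then show "u = 0" by simp
  qed
qed

lemma skew_cayley_unitary:
  assumes X: "conj_transpose X = - X"
  shows "unitary_matrix ((mat 1 - X) ** matrix_inv (mat 1 + X))"
proof -
  note i = skew_invertible [OF X]
  define k where "k = (mat 1 - X) ** matrix_inv (mat 1 + X)"
  have c: "(mat 1 + X) ** (mat 1 - X) = (mat 1 - X) ** (mat 1 + X)" by (simp add: mat_ring)
  have "conj_transpose k = matrix_inv (mat 1 - X) ** (mat 1 + X)"
    using i by (simp add: k_def conj_transpose_mult conj_transpose_inv conj_transpose_add conj_transpose_diff X)
  then have "conj_transpose k ** k = matrix_inv (mat 1 - X) ** (((mat 1 + X) ** (mat 1 - X)) ** matrix_inv (mat 1 + X))"
    by (simp add: k_def matrix_mul_assoc)
  also have "\<dots> = mat 1"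
    unfolding c using i by (simp only: matrix_mul_assoc [symmetric] matrix_inv_cancel matrix_inv_cancel_assoc matrix_mul_rid)
  finally show ?thesis unfolding unitary_matrix_def k_def [symmetric]
    using matrix_left_right_inverse by blast
qed

text \<open>The Cayley transform turns skew-Hermitian matrices, a real form of all matrices,
  into unitary ones.\<close>

lemma unitary_zariski_dense_aux:
  fixes g :: "complex^'n^'n"
  assumes p: "complex_polynomial_fun p" and 0: "\<And>k. unitary_matrix k \<Longrightarrow> p k = 0"
    and g: "invertible (mat 1 + g)"
  shows "p g = 0"
proof -
  define S where "S = (mat 1 - g) ** matrix_inv (mat 1 + g)"
  \<comment> \<open>S = S1 + i S2 with both parts skew-Hermitian. Thus X t is skew-Hermitian for
    real t and X i = S; the numerator q of p along this line vanishes on the real axis, hence also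
    at i.\<close>
  define S1 where "S1 = mat (1/2) ** (S - conj_transpose S)"
  define S2 where "S2 = mat (1/(2*\<i>)) ** (S + conj_transpose S)"
  define X where "X t = S1 + mat t ** S2" for t
  define d where "d t = det (mat 1 + X t)" for t
  define M where "M t = (\<chi> k l. det (\<chi> i j. if j = k then (if i = l then 1 else 0) else (mat 1 + X t) $ i $ j))" for t :: complex
  have Xi: "X \<i> = S"
    by (simp add: X_def S1_def S2_def vec_eq_iff mat_mult_left_nth algebra_simps)
  have Xreal: "conj_transpose (X (of_real t)) = - X (of_real t)" for t
    by (simp add: X_def S1_def S2_def vec_eq_iff mat_mult_left_nth algebra_simps)
  have inv: "matrix_inv (mat 1 + X t) = (\<chi> k l. M t $ k $ l / d t)" if "d t \<noteq> 0" for t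
    using that by (simp add: vec_eq_iff M_def d_def matrix_inv_nth)
  have pX: "polyfun (\<lambda>t. (mat 1 + X t) $ i $ j)" for i j
    unfolding X_def vector_add_component mat_mult_left_nth
    by (intro polyfun_add polyfun_mult polyfun_const polyfun_id)
  have pd: "polyfun d" unfolding d_def by (rule polyfun_det [OF pX])
  have pM: "polyfun (\<lambda>t. M t $ k $ l)" for k l
    unfolding M_def vec_lambda_beta
  proof (rule polyfun_det)
    fix i j
    show "polyfun (\<lambda>t. (\<chi> i j. if j = k then (if i = l then 1 else 0) else (mat 1 + X t) $ i $ j) $ i $ j)"
      using pX [of i j] by (cases "j = k") auto
  qed
  have pN: "polyfun (\<lambda>t. ((mat 1 - X t) ** M t) $ i $ j)" for i j
    unfolding matrix_matrix_mult_def vec_lambda_beta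
  proof (intro polyfun_sum polyfun_mult pM)
    fix k
    have "(mat 1 - X t) $ i $ k = 2 * mat 1 $ i $ k + (- 1) * (mat 1 + X t) $ i $ k" for t by simp
    moreover have "polyfun (\<lambda>t. 2 * mat 1 $ i $ k + (- 1) * (mat 1 + X t) $ i $ k)"
      using pX [of i k] by (intro polyfun_add polyfun_mult polyfun_const)
    ultimately show "polyfun (\<lambda>t. (mat 1 - X t) $ i $ k)" by simp
  qed
  obtain k q where q: "polyfun q" "\<And>t. d t \<noteq> 0 \<Longrightarrow> p (\<chi> i j. ((mat 1 - X t) ** M t) $ i $ j / d t) = q t / d t ^ k"
    using complex_polynomial_rational [OF p pd pN] by blast
  have pq: "p ((mat 1 - X t) ** matrix_inv (mat 1 + X t)) = q t / d t ^ k" if "d t \<noteq> 0" for t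
  proof -
    have "(mat 1 - X t) ** matrix_inv (mat 1 + X t) = (\<chi> i j. ((mat 1 - X t) ** M t) $ i $ j / d t)"
      unfolding inv [OF that] by (simp add: vec_eq_iff matrix_matrix_mult_def sum_divide_distrib)
    then show ?thesis using q(2) [OF that] by simp
  qed
  have "q (of_real t) = 0" for t
  proof -
    have "d (of_real t) \<noteq> 0" using skew_invertible(1) [OF Xreal] by (simp add: d_def invertible_det_nz)
    then show ?thesis using pq [of "of_real t"] 0 [OF skew_cayley_unitary [OF Xreal], of t] by simp
  qed
  then have "range complex_of_real \<subseteq> {t. q t = 0}" by auto
  moreover have "infinite (range complex_of_real)"
    using infinite_UNIV_char_0 [where 'a = real] by (metis finite_imageD inj_of_real)
  ultimately have "q \<i> = 0" using polyfun_eq_0 [OF q(1)] finite_subset by blast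
  have e1: "mat 1 + S = mat 2 ** matrix_inv (mat 1 + g)"
  proof -
    have "mat 1 + S = ((mat 1 + g) + (mat 1 - g)) ** matrix_inv (mat 1 + g)"
      unfolding matrix_add_rdistrib [of "mat 1 + g"] S_def using g by (simp add: matrix_inv_cancel)
    also have "(mat 1 + g) + (mat 1 - g) = mat 2" by (simp add: vec_eq_iff mat_def)
    finally show ?thesis .
  qed
  have e2: "mat 1 - S = mat 2 ** (g ** matrix_inv (mat 1 + g))"
  proof -
    have "mat 1 - S = ((mat 1 + g) - (mat 1 - g)) ** matrix_inv (mat 1 + g)"
      unfolding matrix_diff_rdistrib [of "mat 1 + g"] S_def using g by (simp add: matrix_inv_cancel)
    also have "(mat 1 + g) - (mat 1 - g) = mat 2 ** g" by (simp add: vec_eq_iff mat_mult_left_nth)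
    finally show ?thesis by (simp add: matrix_mul_assoc)
  qed
  have i1: "invertible (mat 1 + S)" unfolding e1 using g by (intro invertible_mult invertible_mat invertible_matrix_inv) auto
  then have "d \<i> \<noteq> 0" by (simp add: d_def Xi invertible_det_nz)
  moreover have "(mat 1 - S) ** matrix_inv (mat 1 + S) = g"
  proof -
    have "mat 1 - S = g ** (mat 1 + S)" unfolding e1 e2 by (metis mat_commute matrix_mul_assoc)
    then show ?thesis using i1 by (simp add: matrix_mul_assoc [symmetric] matrix_inv_cancel)
  qed
  ultimately show ?thesis using pq [of \<i>] \<open>q \<i> = 0\<close> by (simp add: Xi)
qed

text \<open>The condition on 1 + g is removed by scaling: p(s g) is a polynomial in s that vanishes
  for all but finitely many s.\<close>

lemma unitary_zariski_dense:
  fixes g :: "complex^'n^'n"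
  assumes p: "complex_polynomial_fun p" and 0: "\<And>k. unitary_matrix k \<Longrightarrow> p k = 0"
  shows "p g = 0"
proof -
  have pd: "polyfun (\<lambda>s. det (mat 1 + mat s ** g))" by (intro polyfun_det polyfun_mat_affine)
  have pp: "polyfun (\<lambda>s. p (mat s ** g))"
    by (intro complex_polynomial_polyfun [OF p]) (auto simp: mat_mult_left_nth)
  have "finite {s. det (mat 1 + mat s ** g) = 0}"
    using polyfun_eq_0 [OF pd, of 0] by (auto simp del: infinite_imp_nonempty)
  then have "infinite (- {s. det (mat 1 + mat s ** g) = 0})"
    using infinite_UNIV_char_0 [where 'a = complex] by (metis Compl_eq_Diff_UNIV finite_Diff2)
  moreover have "- {s. det (mat 1 + mat s ** g) = 0} \<subseteq> {s. p (mat s ** g) = 0}"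
    using unitary_zariski_dense_aux [OF p 0] by (auto simp: invertible_det_nz)
  ultimately have "infinite {s. p (mat s ** g) = 0}" using finite_subset by blast
  from polyfun_eq_0 [OF pp this, of 1] show ?thesis by simp
qed

lemma complex_polynomial_sum:
  "(\<And>i. i \<in> I \<Longrightarrow> complex_polynomial_fun (f i)) \<Longrightarrow> complex_polynomial_fun (\<lambda>g. \<Sum>i\<in>I. f i g)"
  by (induction I rule: infinite_finite_induct) (auto intro: complex_polynomial_fun.intros)

lemma complex_polynomial_diff:
  assumes "complex_polynomial_fun p" "complex_polynomial_fun q"
  shows "complex_polynomial_fun (\<lambda>g. p g - q g)"
proof -
  have "complex_polynomial_fun (\<lambda>g. p g + (- 1) * q g)"
    using assms by (intro complex_polynomial_fun.intros)
  then show ?thesis by simp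
qed

text \<open>The two conjugations cancel. This makes an identity between an operator and its adjoint
  polynomial in g, so that the density argument covers it.\<close>

lemma complex_polynomial_conj:
  "complex_polynomial_fun p \<Longrightarrow> complex_polynomial_fun (\<lambda>g. cnj (p (conj_transpose g)))"
  by (induction rule: complex_polynomial_fun.induct) (auto intro: complex_polynomial_fun.intros)

lemma complex_polynomial_continuous:
  "complex_polynomial_fun p \<Longrightarrow> continuous_on S p"
  by (induction rule: complex_polynomial_fun.induct) (auto intro!: continuous_intros)

text \<open>Without eigenvalues det(A - l) has no zero and is constant in l. Then det(1 - s A) =
  (-s)^d det A for nonzero s, which tends to 0 at s = 0, whereas det 1 = 1.\<close>

lemma complex_eigenvector_exists:
  fixes A :: "complex^'d^'d"
  shows "\<exists>l u. u \<noteq> 0 \<and> A *v u = l *s u"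
proof (rule ccontr)
  assume *: "\<not> (\<exists>l u. u \<noteq> 0 \<and> A *v u = l *s u)"
  have inv: "invertible (A - mat l)" for l
    by (rule invertible_kernel) (use * in \<open>auto simp: matrix_vector_mult_diff_rdistrib mat_vec\<close>)
  have "polyfun (\<lambda>l. det (A + mat l ** (- mat 1)))" by (intro polyfun_det polyfun_mat_affine)
  moreover have "A + mat l ** (- mat 1) = A - mat l" for l by (simp add: vec_eq_iff mat_mult_left_nth)
  ultimately obtain a where a: "\<And>l. det (A - mat l) = poly a l"
    unfolding polyfun_def by metis
  have nz: "poly a l \<noteq> 0" for l using inv [of l] by (simp only: invertible_det_nz a not_False_eq_True)
  have "constant (poly a)"
  proof (rule ccontr)
    assume "\<not> constant (poly a)"
    then obtain z where "poly a z = 0" using Fundamental_Theorem_Algebra.fundamental_theorem_of_algebra [of a] by auto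
    then show False using nz by simp
  qed
  then have "poly a l = poly a 0" for l by (metis constant_degree degree_eq_zeroE poly_const_conv)
  then have "det (A - mat l) = det (A - mat 0)" for l by (simp only: a)
  then have c: "det (A - mat l) = det A" for l by simp
  have e: "det (mat 1 - mat s ** A) = (- s) ^ CARD('d) * det A" if "s \<noteq> 0" for s
  proof -
    have "mat 1 - mat s ** A = mat (- s) ** (A - mat (1 / s))"
      using that by (simp add: mat_ring mat_minus)
    then show ?thesis by (simp add: det_mul det_mat c)
  qed
  have "continuous_on UNIV (\<lambda>s. det (mat 1 - mat s ** A))"
    unfolding det_def vector_minus_component mat_mult_left_nth by (intro continuous_intros)
  then have "((\<lambda>s. det (mat 1 - mat s ** A)) \<longlongrightarrow> det (mat 1 - mat 0 ** A)) (at 0)"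
    unfolding continuous_on_def by (rule bspec) simp
  moreover have "((\<lambda>s. (- s) ^ CARD('d) * det A) \<longlongrightarrow> (- 0) ^ CARD('d) * det A) (at 0)"
    by (intro tendsto_intros)
  then have "((\<lambda>s. det (mat 1 - mat s ** A)) \<longlongrightarrow> (- 0) ^ CARD('d) * det A) (at 0)"
    by (rule Lim_transform_eventually) (auto simp: eventually_at_filter e)
  ultimately have "det (mat 1 - mat 0 ** A) = (- 0) ^ CARD('d) * det A"
    by (rule tendsto_unique [rotated]) simp
  then show False by (simp add: zero_power)
qed

section \<open>Representations of the general linear group\<close>

lemma hermitian_inner_simps:
  assumes "hermitian_inner ip"
  shows "ip (u + v) w = ip u w + ip v w" "ip (c *s u) w = c * ip u w" "ip w (u + v) = ip w u + ip w v"
    "ip w (c *s u) = cnj c * ip w u" "ip 0 w = 0" "ip w 0 = 0"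
proof -
  have h: "\<And>u v w. ip (u + v) w = ip u w + ip v w" "\<And>c u w. ip (c *s u) w = c * ip u w" "\<And>u v. ip v u = cnj (ip u v)"
    using assms unfolding hermitian_inner_def by blast+
  show "ip (u + v) w = ip u w + ip v w" "ip (c *s u) w = c * ip u w" by (fact h)+
  show "ip w (u + v) = ip w u + ip w v" by (metis h(1,3) complex_cnj_add)
  show "ip w (c *s u) = cnj c * ip w u" by (metis h(2,3) complex_cnj_mult)
  show z: "ip 0 w = 0" using h(2) [of 0 0 w] by simp
  show "ip w 0 = 0" using h(3) [of w 0] z by simp
qed

lemma hermitian_inner_cnj: "hermitian_inner ip \<Longrightarrow> cnj (ip u v) = ip v u"
  unfolding hermitian_inner_def by metis

lemma hermitian_inner_pos: "hermitian_inner ip \<Longrightarrow> u \<noteq> 0 \<Longrightarrow> Re (ip u u) > 0"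
  unfolding hermitian_inner_def by blast

lemma hermitian_inner_sum_left: "hermitian_inner ip \<Longrightarrow> ip (\<Sum>i\<in>I. f i) w = (\<Sum>i\<in>I. ip (f i) w)"
  by (induction I rule: infinite_finite_induct) (auto simp: hermitian_inner_simps)

lemma hermitian_inner_expand:
  assumes "hermitian_inner ip"
  shows "ip u v = (\<Sum>i\<in>UNIV. u $ i * ip (axis i 1) v)"
proof -
  have "u = (\<Sum>i\<in>UNIV. u $ i *s axis i 1)" by (simp add: basis_expansion)
  then have "ip u v = ip (\<Sum>i\<in>UNIV. u $ i *s axis i 1) v" by simp
  then show ?thesis by (simp add: hermitian_inner_sum_left hermitian_inner_simps assms)
qed

lemma hermitian_inner_expand2:
  assumes "hermitian_inner ip"
  shows "ip u v = (\<Sum>i\<in>UNIV. \<Sum>j\<in>UNIV. u $ i * cnj (v $ j) * ip (axis i 1) (axis j 1))"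
proof -
  have "ip (axis i 1) v = (\<Sum>j\<in>UNIV. cnj (v $ j) * ip (axis i 1) (axis j 1))" for i
    unfolding hermitian_inner_cnj [OF assms, of v, symmetric] hermitian_inner_expand [OF assms, of v]
    by (simp add: hermitian_inner_cnj [OF assms])
  then show ?thesis unfolding hermitian_inner_expand [OF assms, of u v] by (simp add: sum_distrib_left mult.assoc)
qed

lemma continuous_on_ip:
  assumes "hermitian_inner ip" "continuous_on S f" "continuous_on S g"
  shows "continuous_on S (\<lambda>x. ip (f x) (g x))"
  by (subst hermitian_inner_expand2 [OF assms(1)]) (intro continuous_intros assms)

lemma ip_bound:
  assumes "hermitian_inner ip"
  shows "\<exists>C>0. \<forall>u v. cmod (ip u v) \<le> C * norm u * norm v"
proof -
  define C where "C = 1 + (\<Sum>i\<in>UNIV. \<Sum>j\<in>UNIV. cmod (ip (axis i 1) (axis j 1)))"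
  have "cmod (ip u v) \<le> C * norm u * norm v" for u v
  proof -
    have "cmod (ip u v) \<le> (\<Sum>i\<in>UNIV. \<Sum>j\<in>UNIV. cmod (u $ i * cnj (v $ j) * ip (axis i 1) (axis j 1)))"
      unfolding hermitian_inner_expand2 [OF assms, of u v]
      by (rule order_trans [OF norm_sum sum_mono [OF norm_sum]])
    also have "\<dots> \<le> (\<Sum>i\<in>UNIV. \<Sum>j\<in>UNIV. norm u * norm v * cmod (ip (axis i 1) (axis j 1)))"
      by (intro sum_mono) (auto simp: norm_mult intro!: mult_right_mono mult_mono Finite_Cartesian_Product.norm_nth_le)
    also have "\<dots> = (\<Sum>i\<in>UNIV. \<Sum>j\<in>UNIV. cmod (ip (axis i 1) (axis j 1))) * (norm u * norm v)"
      by (simp add: sum_distrib_left sum_distrib_right mult_ac)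
    also have "\<dots> \<le> C * (norm u * norm v)" by (intro mult_right_mono) (auto simp: C_def)
    finally show ?thesis by (simp add: mult.assoc)
  qed
  moreover have "C > 0" by (auto simp: C_def intro!: add_pos_nonneg sum_nonneg)
  ultimately show ?thesis by blast
qed

text \<open>Expanding \<open>u + c w\<close> with \<open>c = - \<langle>u, w\<rangle> / \<langle>w, w\<rangle>\<close>.\<close>

lemma ip_cauchy_schwarz:
  assumes "hermitian_inner ip"
  shows "cmod (ip u w) \<le> ip_norm ip u * ip_norm ip w"
proof (cases "w = 0")
  case True
  then show ?thesis by (simp add: hermitian_inner_simps [OF assms] ip_norm_def)
next
  case False
  note s = hermitian_inner_simps [OF assms]
  have real: "Im (ip x x) = 0" for x using hermitian_inner_cnj [OF assms, of x x] by (metis Reals_cnj_iff complex_is_Real_iff)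
  have nn: "Re (ip x x) \<ge> 0" for x using hermitian_inner_pos [OF assms, of x] by (cases "x = 0") (auto simp: s less_imp_le)
  define a b c where "a = Re (ip u u)" and "b = Re (ip w w)" and "c = ip u w"
  have ww: "ip w w = of_real b" and uu: "ip u u = of_real a" using real by (auto simp: a_def b_def complex_eq_iff)
  have b: "b > 0" using hermitian_inner_pos [OF assms False] by (simp add: b_def)
  define t where "t = - c / of_real b"
  have "ip (u + t *s w) (u + t *s w) = of_real a + t * cnj c + cnj t * c + t * cnj t * of_real b"
    using hermitian_inner_cnj [OF assms, of u w] by (simp add: s ww uu c_def algebra_simps)
  also have "\<dots> = of_real a - c * cnj c / of_real b"
    using b by (simp add: t_def field_simps)
  also have "\<dots> = of_real (a - (cmod c)\<^sup>2 / b)" by (simp add: complex_norm_square [symmetric])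
  finally have "0 \<le> a - (cmod c)\<^sup>2 / b" using nn [of "u + t *s w"] by simp
  then have "(cmod c)\<^sup>2 \<le> a * b" using b by (simp add: field_simps)
  then have "cmod c \<le> sqrt (a * b)" by (simp add: real_le_rsqrt)
  then show ?thesis by (simp add: ip_norm_def a_def b_def c_def real_sqrt_mult)
qed

context
  fixes \<rho> :: "complex^'n^'n \<Rightarrow> complex^'d^'d"
  assumes rep: "polynomial_rep \<rho>"
begin

lemma rep_one: "\<rho> (mat 1) = mat 1"
  using rep by (simp add: polynomial_rep_def)

lemma rep_mult: "invertible g \<Longrightarrow> invertible h \<Longrightarrow> \<rho> (g ** h) = \<rho> g ** \<rho> h"
  using rep by (simp add: polynomial_rep_def)

lemma rep_mult_inv: "invertible g \<Longrightarrow> \<rho> g ** \<rho> (matrix_inv g) = mat 1"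
  by (metis invertible_matrix_inv matrix_inv_right rep_mult rep_one)

lemma rep_inv: "invertible g \<Longrightarrow> \<rho> (matrix_inv g) = matrix_inv (\<rho> g)"
  by (rule matrix_inv_unique [symmetric]) (rule rep_mult_inv)

lemma rep_invertible: "invertible g \<Longrightarrow> invertible (\<rho> g)"
  by (rule invertibleI) (rule rep_mult_inv)

lemma rep_polynomial:
  obtains P where "\<And>i j. complex_polynomial_fun (P i j)" "\<And>g i j. invertible g \<Longrightarrow> \<rho> g $ i $ j = P i j g"
  using rep unfolding polynomial_rep_def by metis

lemma rep_continuous: "continuous_on {g. invertible g} \<rho>"
  unfolding continuous_on_matrix
proof safe
  fix i j
  obtain P where P: "\<And>i j. complex_polynomial_fun (P i j)" "\<And>g i j. invertible g \<Longrightarrow> \<rho> g $ i $ j = P i j g"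
    using rep_polynomial by blast
  show "continuous_on {g. invertible g} (\<lambda>g. \<rho> g $ i $ j)"
    by (subst continuous_on_cong [OF refl, of _ _ "P i j"]) (auto simp: P complex_polynomial_continuous)
qed

lemma continuous_on_rep:
  "continuous_on S f \<Longrightarrow> (\<And>x. x \<in> S \<Longrightarrow> invertible (f x)) \<Longrightarrow> continuous_on S (\<lambda>x. \<rho> (f x))"
  by (rule continuous_on_compose2 [OF rep_continuous]) auto

text \<open>For unitary k the conjugate transpose is the inverse, so this is the invariance of the
  inner product. Both sides are polynomial in g, and density extends the identity.\<close>

lemma rep_adjoint:
  assumes ip: "hermitian_inner ip" and un: "unitary_on_U \<rho> ip" and g: "invertible g"
  shows "ip (\<rho> g *v u) v = ip u (\<rho> (conj_transpose g) *v v)"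
proof -
  obtain P where P: "\<And>i j. complex_polynomial_fun (P i j)" "\<And>g i j. invertible g \<Longrightarrow> \<rho> g $ i $ j = P i j g"
    using rep_polynomial by blast
  define Q where "Q u v g = (\<Sum>i\<in>UNIV. (\<Sum>j\<in>UNIV. P i j g * u $ j) * ip (axis i 1) v)" for u v g
  have pQ: "complex_polynomial_fun (Q u v)" for u v
    unfolding Q_def by (intro complex_polynomial_sum complex_polynomial_fun.mult P complex_polynomial_fun.const)
  have Q: "ip (\<rho> g *v u) v = Q u v g" if "invertible g" for g u v
    unfolding hermitian_inner_expand [OF ip, of "\<rho> g *v u"] Q_def
    by (simp add: matrix_vector_mult_def P that)
  have "complex_polynomial_fun (\<lambda>g. Q u v g - cnj (Q v u (conj_transpose g)))"
    by (intro complex_polynomial_diff complex_polynomial_conj pQ)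
  moreover have "Q u v k - cnj (Q v u (conj_transpose k)) = 0" if k: "unitary_matrix k" for k
  proof -
    have i: "invertible k" "invertible (conj_transpose k)" using k unitary_invertible unitary_conj_transpose by blast+
    have "ip u (\<rho> (conj_transpose k) *v v) = ip (\<rho> k *v u) (\<rho> k *v (\<rho> (conj_transpose k) *v v))"
      using un k by (simp add: unitary_on_U_def)
    also have "\<rho> k *v (\<rho> (conj_transpose k) *v v) = v"
      using k by (simp add: matrix_vector_mul_assoc rep_mult [OF i, symmetric] unitary_matrix_def rep_one)
    finally have "ip (\<rho> k *v u) v = ip u (\<rho> (conj_transpose k) *v v)" by simp
    then show ?thesis using i by (simp add: Q [symmetric] hermitian_inner_cnj [OF ip])
  qed
  ultimately have "Q u v g - cnj (Q v u (conj_transpose g)) = 0"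
    by (rule unitary_zariski_dense)
  then show ?thesis using g by (simp add: Q [symmetric] invertible_conj_transpose hermitian_inner_cnj [OF ip])
qed

text \<open>Commutation is polynomial in the group element, hence extends from unitary k to every
  invertible g. An eigenspace of A is then invariant and nonzero.\<close>

lemma schur_unitary:
  assumes irr: "irreducible_rep \<rho>" and comm: "\<And>k. unitary_matrix k \<Longrightarrow> A ** \<rho> k = \<rho> k ** A"
  shows "\<exists>l. A = mat l"
proof -
  obtain P where P: "\<And>i j. complex_polynomial_fun (P i j)" "\<And>g i j. invertible g \<Longrightarrow> \<rho> g $ i $ j = P i j g"
    using rep_polynomial by blast
  have c: "A ** \<rho> g = \<rho> g ** A" if g: "invertible g" for g
  proof -
    have "(A ** \<rho> g) $ i $ j = (\<rho> g ** A) $ i $ j" for i j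
    proof -
      define Q where "Q g = (\<Sum>k\<in>UNIV. A $ i $ k * P k j g) - (\<Sum>k\<in>UNIV. P i k g * A $ k $ j)" for g
      have e: "Q g = (A ** \<rho> g) $ i $ j - (\<rho> g ** A) $ i $ j" if "invertible g" for g
        by (simp add: Q_def matrix_matrix_mult_def P that)
      have "complex_polynomial_fun Q"
        unfolding Q_def by (intro complex_polynomial_diff complex_polynomial_sum complex_polynomial_fun.mult P complex_polynomial_fun.const)
      moreover have "Q k = 0" if "unitary_matrix k" for k
        using comm [OF that] by (simp add: e unitary_invertible that)
      ultimately have "Q g = 0" by (rule unitary_zariski_dense)
      then show ?thesis using e [OF g] by simp
    qed
    then show ?thesis by (simp add: vec_eq_iff)
  qed
  obtain l u where u: "u \<noteq> 0" "A *v u = l *s u" using complex_eigenvector_exists by blast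
  define W where "W = {w. A *v w = l *s w}"
  have "vec.subspace W"
    by (simp add: vec.subspace_def W_def matrix_vector_right_distrib vec.scale vec.scale_right_distrib mult.commute)
  moreover have "\<rho> g *v w \<in> W" if "invertible g" "w \<in> W" for g w
    using that c [OF that(1)] by (simp add: W_def matrix_vector_mul_assoc) (metis matrix_vector_mul_assoc vec.scale)
  ultimately have "W = {0} \<or> W = UNIV" using irr unfolding irreducible_rep_def by blast
  moreover have "u \<in> W" using u by (simp add: W_def)
  ultimately have "W = UNIV" using u by blast
  then have "A *v w = mat l *v w" for w by (auto simp: W_def mat_vec)
  then have "A = mat l" by (simp add: matrix_eq)
  then show ?thesis ..
qed

end

lemma norm_column_le: "norm (column j (A::complex^'n^'m)) \<le> norm A"
  unfolding norm_vec_def [of "column j A"] norm_vec_def [of A]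
  by (rule L2_set_mono) (auto simp: column_def Finite_Cartesian_Product.norm_nth_le)

lemma norm_mmult_bound: "\<exists>K>0. \<forall>(A::complex^'n^'n) (B::complex^'n^'n). norm (A ** B) \<le> norm A * norm B * K"
proof -
  have "bilinear (\<lambda>(A::complex^'n^'n) (B::complex^'n^'n). A ** B)"
    unfolding bilinear_def
    by (auto intro!: linearI simp: matrix_add_ldistrib matrix_add_rdistrib mmult_scaleR)
  then have "bounded_bilinear (\<lambda>(A::complex^'n^'n) (B::complex^'n^'n). A ** B)"
    by (simp add: bilinear_conv_bounded_bilinear)
  from bounded_bilinear.pos_bounded [OF this] show ?thesis by auto
qed

text \<open>Write g = (g b) b^{-1} with g b unitary. On u the factor b^{-1} acts by the product of
  beta_i^{-omega_i}, and the unitary factor stays bounded. The product of the 1/beta_i is |det g|;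
  the surplus exponents m i are harmless because 1/beta_i is at most the length of column i of
  g.\<close>

lemma highest_vector_bound:
  fixes \<rho> :: "complex^'n::{finite,linorder}^'n::{finite,linorder} \<Rightarrow> complex^'d^'d"
  assumes rep: "polynomial_rep \<rho>"
    and u: "\<And>b. invertible b \<Longrightarrow> upper_triangular b \<Longrightarrow> \<rho> b *v u = (\<Prod>i\<in>UNIV. (b $ i $ i) powi \<omega> i) *s u"
    and k: "\<And>i. int k \<le> \<omega> i"
  shows "\<exists>C\<ge>0. \<forall>g. invertible g \<longrightarrow> norm g \<le> R \<longrightarrow> norm (\<rho> g *v u) \<le> C * cmod (det g) ^ k"
proof -
  define R1 where "R1 = max R 1"
  have "continuous_on {q. unitary_matrix q} (\<lambda>q. \<rho> q *v u)"
    using unitary_invertible by (intro continuous_intros continuous_on_rep [OF rep]) auto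
  then have "bounded ((\<lambda>q. \<rho> q *v u) ` {q. unitary_matrix q})"
    by (intro compact_imp_bounded compact_continuous_image compact_unitary)
  then obtain C0 where C0: "\<And>q. unitary_matrix q \<Longrightarrow> norm (\<rho> q *v u) \<le> C0"
    unfolding bounded_iff by auto
  define m where "m i = nat (\<omega> i) - k" for i
  have \<omega>: "\<omega> i = int (k + m i)" for i using k [of i] by (simp add: m_def)
  define C where "C = max C0 0 * (\<Prod>i\<in>UNIV. R1 ^ m i)"
  have "norm (\<rho> g *v u) \<le> C * cmod (det g) ^ k" if g: "invertible g" "norm g \<le> R" for g
  proof -
    obtain b \<beta> where b: "upper_triangular b" "unitary_matrix (g ** b)"
      and \<beta>: "\<And>i. b $ i $ i = of_real (\<beta> i)" "\<And>i. 0 < \<beta> i" "\<And>i. 1 \<le> \<beta> i * norm (column i g)"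
      using gram_schmidt [OF g(1)] by metis
    have db: "det b = of_real (\<Prod>i\<in>UNIV. \<beta> i)" by (simp add: det_upper_triangular b \<beta>)
    have Pb: "(\<Prod>i\<in>UNIV. \<beta> i) > 0" by (intro prod_pos) (simp add: \<beta>)
    then have ib: "invertible b" unfolding invertible_det_nz db of_real_eq_0_iff by linarith
    define B where "B = (\<Prod>i\<in>UNIV. \<beta> i ^ (k + m i))"
    have B: "B > 0" unfolding B_def by (intro prod_pos) (simp add: \<beta>)
    have "\<rho> (g ** b) *v u = \<rho> g *v (\<rho> b *v u)" by (simp add: rep_mult [OF rep] g ib matrix_vector_mul_assoc)
    also have "\<dots> = of_real B *s (\<rho> g *v u)"
      by (simp add: u [OF ib b(1)] \<omega> power_int_of_nat \<beta> B_def vec.scale del: of_nat_add)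
    finally have "norm (\<rho> (g ** b) *v u) = B * norm (\<rho> g *v u)" using B by (simp add: norm_smult_vec)
    then have 1: "norm (\<rho> g *v u) = norm (\<rho> (g ** b) *v u) * (1 / B)" using B by simp
    have dg: "cmod (det g) * (\<Prod>i\<in>UNIV. \<beta> i) = 1"
    proof -
      have "det ((g ** b) ** conj_transpose (g ** b)) = 1" using b(2) by (simp add: unitary_matrix_def)
      then have "det (g ** b) * cnj (det (g ** b)) = 1" by (simp only: det_mul det_conj_transpose)
      then have "cmod (det (g ** b)) ^ 2 = 1" by (metis complex_norm_square of_real_eq_1_iff)
      then have "cmod (det (g ** b)) = 1" by (metis norm_ge_zero power2_eq_1_iff neg_0_le_iff_le not_one_le_zero)
      moreover have "cmod (det b) = (\<Prod>i\<in>UNIV. \<beta> i)" unfolding db norm_of_real using Pb by simp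
      ultimately show ?thesis by (simp add: det_mul norm_mult)
    qed
    have ib: "1 / \<beta> i \<le> R1" for i
    proof -
      have "1 \<le> \<beta> i * norm (column i g)" by (rule \<beta>)
      also have "\<dots> \<le> \<beta> i * R1" using \<beta>(2) [of i] norm_column_le [of i g] g(2) by (intro mult_left_mono) (auto simp: R1_def)
      finally show ?thesis using \<beta>(2) [of i] by (simp add: field_simps)
    qed
    have "1 / B = (\<Prod>i\<in>UNIV. (1 / \<beta> i) ^ k * (1 / \<beta> i) ^ m i)"
      by (simp add: B_def prod_dividef power_add power_one_over prod.distrib)
    also have "\<dots> \<le> (\<Prod>i\<in>UNIV. (1 / \<beta> i) ^ k * R1 ^ m i)"
      using ib \<beta>(2) by (intro prod_mono conjI mult_left_mono power_mono mult_nonneg_nonneg) (auto simp: less_imp_le)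
    also have "\<dots> = (\<Prod>i\<in>UNIV. 1 / \<beta> i) ^ k * (\<Prod>i\<in>UNIV. R1 ^ m i)"
      by (simp only: prod.distrib prod_power_distrib)
    also have "(\<Prod>i\<in>UNIV. 1 / \<beta> i) = cmod (det g)"
      using eq_divide_imp [OF _ dg] Pb by (simp only: prod_dividef prod.neutral_const less_irrefl)
    finally have 2: "1 / B \<le> cmod (det g) ^ k * (\<Prod>i\<in>UNIV. R1 ^ m i)" .
    have "norm (\<rho> g *v u) \<le> max C0 0 * (cmod (det g) ^ k * (\<Prod>i\<in>UNIV. R1 ^ m i))"
      unfolding 1 using C0 [OF b(2)] B by (intro mult_mono 2) auto
    then show ?thesis by (simp add: C_def mult_ac)
  qed
  moreover have "C \<ge> 0" unfolding C_def by (intro mult_nonneg_nonneg prod_nonneg) (auto simp: R1_def)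
  ultimately show ?thesis by blast
qed

text \<open>The translates \<open>\<rho>(x) u\<close> of the highest weight vector span \<open>V\<close>, so the bound for \<open>u\<close>
  carries over to all of \<open>\<rho>(g)\<close>.\<close>

lemma rep_det_bound:
  fixes \<rho> :: "complex^'n::{finite,linorder}^'n::{finite,linorder} \<Rightarrow> complex^'d^'d"
  assumes rep: "polynomial_rep \<rho>" and irr: "irreducible_rep \<rho>" and hw: "highest_weight \<rho> \<omega>"
    and k: "\<And>i. int k \<le> \<omega> i"
  shows "\<exists>C\<ge>0. \<forall>g. invertible g \<longrightarrow> norm g \<le> R \<longrightarrow> (\<forall>w. norm (\<rho> g *v w) \<le> C * cmod (det g) ^ k * norm w)"
proof -
  obtain u where u0: "u \<noteq> 0" and
    u: "\<And>b. invertible b \<Longrightarrow> upper_triangular b \<Longrightarrow> \<rho> b *v u = (\<Prod>i\<in>UNIV. (b $ i $ i) powi \<omega> i) *s u"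
    using hw by (auto simp: highest_weight_def)
  define Good where "Good w \<longleftrightarrow> (\<exists>C\<ge>0. \<forall>g. invertible g \<longrightarrow> norm g \<le> R \<longrightarrow> norm (\<rho> g *v w) \<le> C * cmod (det g) ^ k)" for w
  obtain K where K: "K > 0" "\<And>(A::complex^'n::{finite,linorder}^'n::{finite,linorder}) (B::complex^'n::{finite,linorder}^'n::{finite,linorder}). norm (A ** B) \<le> norm A * norm B * K"
    using norm_mmult_bound by blast
  define X where "X = (\<lambda>x. \<rho> x *v u) ` {x. invertible x}"
  have GX: "Good w" if "w \<in> X" for w
  proof -
    obtain x where x: "invertible x" "w = \<rho> x *v u" using \<open>w \<in> X\<close> by (auto simp: X_def)
    \<comment> \<open>The bound for u is needed at g x, which ranges over this larger ball.\<close>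
    obtain C where C: "C \<ge> 0" "\<And>g. invertible g \<Longrightarrow> norm g \<le> R * norm x * K \<Longrightarrow> norm (\<rho> g *v u) \<le> C * cmod (det g) ^ k"
      using highest_vector_bound [where R = "R * norm x * K", OF rep u k] by metis
    have "norm (\<rho> g *v w) \<le> (C * cmod (det x) ^ k) * cmod (det g) ^ k" if g: "invertible g" "norm g \<le> R" for g
    proof -
      have "norm (g ** x) \<le> norm g * norm x * K" by (rule K)
      also have "\<dots> \<le> R * norm x * K" using g K by (intro mult_right_mono) auto
      finally have "norm (\<rho> (g ** x) *v u) \<le> C * cmod (det (g ** x)) ^ k" using g x by (intro C) (auto simp: invertible_mult)
      then show ?thesis
        by (simp add: x(2) matrix_vector_mul_assoc rep_mult [OF rep g(1) x(1)] det_mul norm_mult power_mult_distrib mult_ac)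
    qed
    then show ?thesis unfolding Good_def using C by (intro exI [of _ "C * cmod (det x) ^ k"]) auto
  qed
  have sub: "vec.subspace {w. Good w}"
  proof (rule vec.subspaceI)
    show "0 \<in> {w. Good w}" unfolding Good_def by (auto intro!: exI [of _ 0])
  next
    fix a b assume "a \<in> {w. Good w}" "b \<in> {w. Good w}"
    then obtain C D where "C \<ge> 0" "D \<ge> 0"
      "\<And>g. invertible g \<Longrightarrow> norm g \<le> R \<Longrightarrow> norm (\<rho> g *v a) \<le> C * cmod (det g) ^ k"
      "\<And>g. invertible g \<Longrightarrow> norm g \<le> R \<Longrightarrow> norm (\<rho> g *v b) \<le> D * cmod (det g) ^ k"
      unfolding Good_def by auto
    then have "norm (\<rho> g *v (a + b)) \<le> (C + D) * cmod (det g) ^ k" if "invertible g" "norm g \<le> R" for g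
      using that norm_triangle_ineq [of "\<rho> g *v a" "\<rho> g *v b"]
      by (simp add: matrix_vector_right_distrib distrib_right) (meson add_mono order_trans)
    with \<open>C \<ge> 0\<close> \<open>D \<ge> 0\<close> show "a + b \<in> {w. Good w}" unfolding Good_def by (auto intro!: exI [of _ "C + D"])
  next
    fix c a assume "a \<in> {w. Good w}"
    then obtain C where C: "C \<ge> 0" "\<And>g. invertible g \<Longrightarrow> norm g \<le> R \<Longrightarrow> norm (\<rho> g *v a) \<le> C * cmod (det g) ^ k"
      unfolding Good_def by auto
    then have "norm (\<rho> g *v (c *s a)) \<le> (cmod c * C) * cmod (det g) ^ k" if "invertible g" "norm g \<le> R" for g
      using C(2) [OF that] by (simp add: vec.scale norm_smult_vec mult.assoc mult_left_mono)
    with C show "c *s a \<in> {w. Good w}" unfolding Good_def by (auto intro!: exI [of _ "cmod c * C"])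
  qed
  have inv: "\<rho> g *v w \<in> vec.span X" if g: "invertible g" and w: "w \<in> vec.span X" for g w
  proof -
    have "\<rho> g *v w \<in> vec.span ((*v) (\<rho> g) ` X)"
      using w matrix_vector_mul_linear_gen vec.linear_span_image by blast
    moreover have "(*v) (\<rho> g) ` X \<subseteq> X"
    proof safe
      fix x assume "x \<in> X"
      then obtain h where h: "invertible h" "x = \<rho> h *v u" by (auto simp: X_def)
      then have "\<rho> g *v x = \<rho> (g ** h) *v u" using g by (simp add: rep_mult [OF rep] matrix_vector_mul_assoc)
      then show "\<rho> g *v x \<in> X" using g h unfolding X_def by (auto simp: invertible_mult)
    qed
    ultimately show ?thesis using vec.span_mono by blast
  qed
  have "u \<in> X" unfolding X_def by (rule image_eqI [of _ _ "mat 1"]) (auto simp: rep_one [OF rep] invertible_mat)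
  then have "u \<in> vec.span X" by (rule vec.span_base)
  then have "vec.span X = UNIV"
    using irr inv u0 unfolding irreducible_rep_def by (metis singletonD vec.subspace_span)
  moreover have "vec.span X \<subseteq> {w. Good w}" using sub GX by (intro vec.span_minimal) auto
  ultimately have G: "Good w" for w by auto
  then have "\<forall>j. \<exists>C\<ge>0. \<forall>g. invertible g \<longrightarrow> norm g \<le> R \<longrightarrow> norm (\<rho> g *v axis j 1) \<le> C * cmod (det g) ^ k"
    unfolding Good_def by blast
  then obtain C where C: "\<And>j. C j \<ge> 0" "\<And>j g. invertible g \<Longrightarrow> norm g \<le> R \<Longrightarrow> norm (\<rho> g *v axis j 1) \<le> C j * cmod (det g) ^ k"
    by metis
  have "norm (\<rho> g *v w) \<le> (\<Sum>j\<in>UNIV. C j) * cmod (det g) ^ k * norm w" if g: "invertible g" "norm g \<le> R" for g w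
  proof -
    have "\<rho> g *v w = \<rho> g *v (\<Sum>j\<in>UNIV. w $ j *s axis j 1)" by (simp add: basis_expansion)
    also have "\<dots> = (\<Sum>j\<in>UNIV. w $ j *s (\<rho> g *v axis j 1))" by (simp add: vec.sum vec.scale)
    finally have "norm (\<rho> g *v w) \<le> (\<Sum>j\<in>UNIV. norm (w $ j *s (\<rho> g *v axis j 1)))" by (simp add: norm_sum)
    also have "\<dots> \<le> (\<Sum>j\<in>UNIV. norm w * (C j * cmod (det g) ^ k))"
      by (intro sum_mono) (auto simp: norm_smult_vec intro!: mult_mono Finite_Cartesian_Product.norm_nth_le C g)
    finally show ?thesis by (simp add: sum_distrib_left sum_distrib_right mult_ac)
  qed
  moreover have "(\<Sum>j\<in>UNIV. C j) \<ge> 0" by (intro sum_nonneg C)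
  ultimately show ?thesis by blast
qed

section \<open>Integrability of the kernel\<close>

lemma AE_siegel: "AE z in siegel_measure. z \<in> siegel"
proof (rule AE_I)
  show "emeasure siegel_measure (- siegel) = 0"
    using borel_siegel by (subst emeasure_siegel) (auto intro: borel_comp)
qed (use borel_siegel borel_comp in auto)

lemma nn_integral_act:
  fixes g :: "real^('n::{finite,linorder}+'n)^('n+'n)"
  assumes "symplectic g" "h \<in> borel_measurable borel"
  shows "(\<integral>\<^sup>+ z. h (act g z) \<partial>siegel_measure) = (\<integral>\<^sup>+ z. h z \<partial>siegel_measure)"
proof -
  have "(\<integral>\<^sup>+ z. h z \<partial>distr siegel_measure borel (act g)) = (\<integral>\<^sup>+ z. h (act g z) \<partial>siegel_measure)"
    using assms borel_act by (intro nn_integral_distr) (auto simp: measurable_cong_sets [OF sets_siegel_measure refl])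
  then show ?thesis by (simp add: siegel_measure_invariant [OF assms(1)])
qed

text \<open>Permutations that move k contribute 0, so the entries of column k outside row k do not
  matter.\<close>

lemma det_unit_row:
  fixes A B :: "'a::comm_ring_1^'n^'n"
  assumes "\<And>j. A $ k $ j = (if j = k then 1 else 0)" "\<And>j. B $ k $ j = (if j = k then 1 else 0)"
    and "\<And>i j. i \<noteq> k \<Longrightarrow> j \<noteq> k \<Longrightarrow> A $ i $ j = B $ i $ j"
  shows "det A = det B"
  unfolding det_def
proof (rule sum.cong [OF refl])
  fix p :: "'n \<Rightarrow> 'n" assume "p \<in> {p. p permutes UNIV}"
  then have p: "p permutes UNIV" by simp
  have "(\<Prod>i\<in>UNIV. A $ i $ p i) = (\<Prod>i\<in>UNIV. B $ i $ p i)"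
  proof (cases "p k = k")
    case True
    have "A $ i $ p i = B $ i $ p i" for i
    proof (cases "i = k")
      case False
      then have "p i \<noteq> k" using True permutes_inj [OF p] by (metis injD)
      then show ?thesis using False assms(3) by blast
    qed (simp add: True assms)
    then show ?thesis by simp
  next
    case False
    then have "A $ k $ p k = 0" "B $ k $ p k = 0" using assms by auto
    then have "(\<Prod>i\<in>UNIV. A $ i $ p i) = 0" "(\<Prod>i\<in>UNIV. B $ i $ p i) = 0"
      by (intro prod_zero; auto)+
    then show ?thesis by simp
  qed
  then show "of_int (sign p) * (\<Prod>i\<in>UNIV. A $ i $ p i) = of_int (sign p) * (\<Prod>i\<in>UNIV. B $ i $ p i)" by simp
qed

text \<open>Its determinant is the principal minor of y on I; padding by the identity keeps one
  matrix type for all I, as induction on I requires.\<close>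

definition minor_mat :: "'n set \<Rightarrow> real^'n^'n \<Rightarrow> real^'n^'n" where
  "minor_mat I y = (\<chi> i j. if i \<in> I \<and> j \<in> I then y $ i $ j else if i = j then 1 else 0)"

lemma minor_mat_pos_def:
  assumes "pos_def y"
  shows "pos_def (minor_mat I y)"
  unfolding pos_def_def
proof safe
  have "y $ i $ j = y $ j $ i" for i j
    using assms unfolding pos_def_def sym_mat_def by (metis (no_types, lifting) transpose_def vec_lambda_beta)
  then show "sym_mat (minor_mat I y)" by (auto simp: sym_mat_def minor_mat_def vec_eq_iff transpose_def)
  fix v :: "real^'a" assume v: "v \<noteq> 0"
  define u where "u = (\<chi> i. if i \<in> I then v $ i else 0)"
  have "v \<bullet> (minor_mat I y *v v) = (\<Sum>i\<in>UNIV. \<Sum>j\<in>UNIV. u $ i * y $ i $ j * u $ j + (if i = j then (if i \<in> I then 0 else (v $ i)\<^sup>2) else 0))"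
    unfolding inner_vec_def matrix_vector_mult_def minor_mat_def
    by (simp add: sum_distrib_left u_def) (intro sum.cong refl, auto simp: power2_eq_square)
  also have "\<dots> = u \<bullet> (y *v u) + (\<Sum>i\<in>UNIV. if i \<in> I then 0 else (v $ i)\<^sup>2)"
    by (simp add: sum.distrib inner_vec_def matrix_vector_mult_def sum_distrib_left mult_ac)
  also have "\<dots> > 0"
  proof (cases "u = 0")
    case False
    then have "u \<bullet> (y *v u) > 0" using assms by (simp add: pos_def_def)
    then show ?thesis by (intro add_pos_nonneg sum_nonneg) auto
  next
    case True
    obtain i where i: "v $ i \<noteq> 0" using v by (auto simp: vec_eq_iff)
    moreover have "u $ i = 0" using True by simp
    ultimately have "i \<notin> I" by (auto simp: u_def)
    then have "0 < (\<Sum>i\<in>UNIV. if i \<in> I then 0 else (v $ i)\<^sup>2)" using i by (intro sum_pos2 [of _ i]) auto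
    then show ?thesis using True by simp
  qed
  finally show "v \<bullet> (minor_mat I y *v v) > 0" .
qed

lemma minor_mat_UNIV: "minor_mat UNIV y = y"
  by (simp add: minor_mat_def vec_eq_iff)

text \<open>Row k is linear in t, and the coefficient of t is the determinant with row k replaced by
  a unit row, that is, the smaller minor.\<close>

lemma det_minor_insert:
  fixes y :: "real^'n^'n"
  assumes "k \<notin> I"
  shows "\<exists>c. \<forall>t. det (minor_mat (insert k I) (\<chi> i j. if i = k \<and> j = k then t else y $ i $ j)) = t * det (minor_mat I y) + c"
proof -
  define M where "M = minor_mat (insert k I) y"
  define a where "a = (\<chi> j. if j = k then 0 else M $ k $ j)"
  have "det (minor_mat (insert k I) (\<chi> i j. if i = k \<and> j = k then t else y $ i $ j)) =
     t * det (minor_mat I y) + det (\<chi> i. if i = k then a else M $ i)" for t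
  proof -
    have "minor_mat (insert k I) (\<chi> i j. if i = k \<and> j = k then t else y $ i $ j) = (\<chi> i. if i = k then t *s axis k 1 + a else M $ i)"
      by (auto simp: vec_eq_iff M_def a_def minor_mat_def axis_def)
    then have "det (minor_mat (insert k I) (\<chi> i j. if i = k \<and> j = k then t else y $ i $ j)) =
       det (\<chi> i. if i = k then t *s axis k 1 else M $ i) + det (\<chi> i. if i = k then a else M $ i)"
      by (simp add: det_row_add)
    also have "det (\<chi> i. if i = k then t *s axis k 1 else M $ i) = t * det (\<chi> i. if i = k then axis k 1 else M $ i)"
      by (rule det_row_mul)
    also have "det (\<chi> i. if i = k then axis k 1 else M $ i) = det (minor_mat I y)"
      by (rule det_unit_row [of _ k]) (use assms in \<open>auto simp: axis_def M_def minor_mat_def\<close>)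
    finally show ?thesis .
  qed
  then show ?thesis by blast
qed

lemma inverse_sqrt_integral:
  fixes b R :: real
  assumes "b \<le> R"
  shows "(\<integral>\<^sup>+ t. ennreal (1 / sqrt (t - b)) * indicator {b..R} t \<partial>lborel) = ennreal (2 * sqrt (R - b))"
proof -
  have "((\<lambda>t. 1 / sqrt (t - b)) has_integral (2 * sqrt (R - b) - 2 * sqrt (b - b))) {b..R}"
  proof (rule fundamental_theorem_of_calculus_interior [OF assms])
    show "continuous_on {b..R} (\<lambda>t. 2 * sqrt (t - b))" by (intro continuous_intros)
    fix t assume "t \<in> {b<..<R}"
    then show "((\<lambda>t. 2 * sqrt (t - b)) has_vector_derivative 1 / sqrt (t - b)) (at t)"
      unfolding has_real_derivative_iff_has_vector_derivative [symmetric]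
      by (auto intro!: derivative_eq_intros simp: field_simps)
  qed
  then show ?thesis by (intro nn_integral_has_integral_lebesgue') auto
qed

text \<open>The point is the factor 1/sqrt d on the right: integrating one diagonal variable
  reproduces an inverse root, now of the slope d.\<close>

lemma inverse_sqrt_affine_integral:
  fixes c d R :: real
  assumes d: "d > 0" and R: "R > 0"
  shows "(\<integral>\<^sup>+ t. (if \<bar>t\<bar> < R \<and> t * d + c > 0 then ennreal (1 / sqrt (t * d + c)) else 0) \<partial>lborel) \<le> ennreal (2 * sqrt (2 * R)) * ennreal (1 / sqrt d)"
proof -
  \<comment> \<open>The left end of the domain: the zero -c/d of the affine function or the cut at
    -R. Then t d + c is at least d (t - b), and R - b is at most 2R.\<close>
  define b where "b = max (- c / d) (- R)"
  have "(\<integral>\<^sup>+ t. (if \<bar>t\<bar> < R \<and> t * d + c > 0 then ennreal (1 / sqrt (t * d + c)) else 0) \<partial>lborel)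
      \<le> (\<integral>\<^sup>+ t. ennreal (1 / sqrt d) * (ennreal (1 / sqrt (t - b)) * indicator {b..R} t) \<partial>lborel)"
  proof (intro nn_integral_mono)
    fix t
    show "(if \<bar>t\<bar> < R \<and> t * d + c > 0 then ennreal (1 / sqrt (t * d + c)) else 0)
      \<le> ennreal (1 / sqrt d) * (ennreal (1 / sqrt (t - b)) * indicator {b..R} t)"
    proof (cases "\<bar>t\<bar> < R \<and> t * d + c > 0")
      case True
      then have "- c / d < t" using d by (simp add: field_simps)
      then have t: "b < t" "t < R" using True by (auto simp: b_def)
      have "d * (t - b) \<le> t * d + c"
      proof -
        have "d * (- c / d) \<le> d * b" using d by (intro mult_left_mono) (auto simp: b_def)
        then show ?thesis using d by (simp add: algebra_simps)
      qed
      moreover have "0 < d * (t - b)" using t d by simp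
      ultimately have "1 / sqrt (t * d + c) \<le> 1 / sqrt (d * (t - b))"
        by (intro divide_left_mono mult_pos_pos) auto
      then have "ennreal (1 / sqrt (t * d + c)) \<le> ennreal (1 / sqrt d * (1 / sqrt (t - b)))"
        by (intro ennreal_leI) (simp add: real_sqrt_mult)
      also have "\<dots> = ennreal (1 / sqrt d) * ennreal (1 / sqrt (t - b))"
        using d t by (intro ennreal_mult) auto
      finally show ?thesis using True t by simp
    qed auto
  qed
  also have "\<dots> = ennreal (1 / sqrt d) * (\<integral>\<^sup>+ t. ennreal (1 / sqrt (t - b)) * indicator {b..R} t \<partial>lborel)"
    by (intro nn_integral_cmult) auto
  also have "\<dots> \<le> ennreal (1 / sqrt d) * ennreal (2 * sqrt (2 * R))"
  proof (cases "b \<le> R")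
    case True
    show ?thesis unfolding inverse_sqrt_integral [OF True]
      by (intro mult_left_mono ennreal_leI) (auto simp: b_def)
  qed simp
  finally show ?thesis by (simp add: mult.commute)
qed

text \<open>All off-diagonal variables are present from the start; only the diagonal ones, which get
  integrated out, grow with I.\<close>

definition diag_vars :: "'n::linorder set \<Rightarrow> ('n \<times> 'n) set" where
  "diag_vars I = {(r, s). r < s} \<union> (\<lambda>i. (i, i)) ` I"

text \<open>Positivity is asked of all minors on subsets of I, so that the constraint passes to I
  when an index is removed.\<close>

definition minor_fun :: "real \<Rightarrow> 'n::{finite,linorder} set \<Rightarrow> ('n \<times> 'n \<Rightarrow> real) \<Rightarrow> ennreal" where
  "minor_fun R I y = (if (\<forall>p\<in>diag_vars I. \<bar>y p\<bar> < R) \<and> (\<forall>J\<in>Pow I. det (minor_mat J (sym_of y)) > 0)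
     then ennreal (1 / sqrt (det (minor_mat I (sym_of y)))) else 0)"

lemma diag_vars_UNIV: "diag_vars UNIV = upper_index"
  by (auto simp: diag_vars_def upper_index_def)

lemma diag_vars_insert: "diag_vars (insert k I) = insert (k, k) (diag_vars I)"
  by (auto simp: diag_vars_def)

lemma minmax_diag_vars: "i \<in> I \<Longrightarrow> j \<in> I \<Longrightarrow> (min i j, max i j) \<in> diag_vars I"
  by (cases i j rule: linorder_cases) (auto simp: diag_vars_def min_def max_def)

lemma borel_minor:
  fixes I J :: "'n::{finite,linorder} set"
  assumes "J \<subseteq> I"
  shows "(\<lambda>y. det (minor_mat J (sym_of y))) \<in> borel_measurable (\<Pi>\<^sub>M p\<in>diag_vars I. (lborel :: real measure))"
proof -
  have "(\<lambda>y. minor_mat J (sym_of y) $ i $ j) \<in> borel_measurable (\<Pi>\<^sub>M p\<in>diag_vars I. (lborel :: real measure))" for i j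
  proof (cases "i \<in> J \<and> j \<in> J")
    case True
    then have "(min i j, max i j) \<in> diag_vars I" using assms minmax_diag_vars by blast
    from measurable_component_singleton [OF this, of "\<lambda>_. lborel"] show ?thesis
      using True by (simp add: minor_mat_def sym_of_def)
  next
    case False
    then have "(\<lambda>y. minor_mat J (sym_of y) $ i $ j) = (\<lambda>y. if i = j then 1 else 0)" by (auto simp: minor_mat_def fun_eq_iff)
    then show ?thesis by simp
  qed
  then show ?thesis unfolding det_def by (intro borel_measurable_sum borel_measurable_times borel_measurable_prod borel_measurable_const)
qed

lemma borel_minor_fun:
  fixes I :: "'n::{finite,linorder} set"
  shows "minor_fun R I \<in> borel_measurable (\<Pi>\<^sub>M p\<in>diag_vars I. (lborel :: real measure))"
proof -
  have m1: "Measurable.pred (\<Pi>\<^sub>M p\<in>diag_vars I. (lborel :: real measure)) (\<lambda>y. \<forall>p\<in>diag_vars I. \<bar>y p\<bar> < R)"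
  proof (intro pred_intros_finite)
    fix p assume p: "p \<in> diag_vars I"
    have [measurable]: "(\<lambda>y. y p) \<in> borel_measurable (\<Pi>\<^sub>M p\<in>diag_vars I. (lborel :: real measure))"
      using measurable_component_singleton [OF p, of "\<lambda>_. lborel"] by simp
    show "Measurable.pred (\<Pi>\<^sub>M p\<in>diag_vars I. (lborel :: real measure)) (\<lambda>y. \<bar>y p\<bar> < R)" by measurable
  qed simp
  have m2: "Measurable.pred (\<Pi>\<^sub>M p\<in>diag_vars I. (lborel :: real measure)) (\<lambda>y. \<forall>J\<in>Pow I. det (minor_mat J (sym_of y)) > 0)"
  proof (intro pred_intros_finite)
    fix J assume "J \<in> Pow I"
    then have [measurable]: "(\<lambda>y. det (minor_mat J (sym_of y))) \<in> borel_measurable (\<Pi>\<^sub>M p\<in>diag_vars I. (lborel :: real measure))"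
      using borel_minor by blast
    show "Measurable.pred (\<Pi>\<^sub>M p\<in>diag_vars I. (lborel :: real measure)) (\<lambda>y. det (minor_mat J (sym_of y)) > 0)" by measurable
  qed simp
  have [measurable]: "(\<lambda>y. det (minor_mat I (sym_of y))) \<in> borel_measurable (\<Pi>\<^sub>M p\<in>diag_vars I. (lborel :: real measure))"
    by (rule borel_minor) simp
  show ?thesis unfolding minor_fun_def using m1 m2 by measurable
qed

text \<open>Inserting k integrates over the entry (k, k): the new minor is affine in it with slope
  the minor on I, so its inverse root integrates to at most a constant times the inverse root of the
  old minor. With no diagonal variables left, a bounded function on a box remains.\<close>

lemma minor_fun_integral:
  fixes I :: "'n::{finite,linorder} set"
  assumes R: "R > 0"
  shows "(\<integral>\<^sup>+ y. minor_fun R I y \<partial>(\<Pi>\<^sub>M p\<in>diag_vars I. (lborel :: real measure))) < \<infinity>"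
  using finite [of I]
proof induction
  case empty
  interpret ps: product_sigma_finite "\<lambda>p::'n \<times> 'n. (lborel :: real measure)"
    by (simp add: product_sigma_finite_def lborel.sigma_finite_measure_axioms)
  have "minor_fun R {} y \<le> indicator (\<Pi>\<^sub>E p\<in>diag_vars {}. {- R .. R}) y"
    if "y \<in> space (\<Pi>\<^sub>M p\<in>diag_vars ({} :: 'n set). (lborel :: real measure))" for y
  proof -
    have "minor_mat {} (sym_of y) = mat 1" by (simp add: minor_mat_def vec_eq_iff mat_def)
    show ?thesis
    proof (cases "\<forall>p\<in>diag_vars {}. \<bar>y p\<bar> < R")
      case True
      then have "y p \<in> {- R .. R}" if "p \<in> diag_vars {}" for p using that by force
      then have "y \<in> (\<Pi>\<^sub>E p\<in>diag_vars {}. {- R .. R})" using that by (simp only: space_PiM PiE_iff space_lborel) simp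
      then show ?thesis using \<open>minor_mat {} (sym_of y) = mat 1\<close> by (simp add: minor_fun_def)
    next
      case False
      then show ?thesis unfolding minor_fun_def by auto
    qed
  qed
  then have "(\<integral>\<^sup>+ y. minor_fun R {} y \<partial>(\<Pi>\<^sub>M p\<in>diag_vars ({} :: 'n set). (lborel :: real measure))) \<le>
    (\<integral>\<^sup>+ y. indicator (\<Pi>\<^sub>E p\<in>diag_vars {}. {- R .. R}) y \<partial>(\<Pi>\<^sub>M p\<in>diag_vars ({} :: 'n set). (lborel :: real measure)))"
    by (intro nn_integral_mono) auto
  also have "\<dots> = emeasure (\<Pi>\<^sub>M p\<in>diag_vars ({} :: 'n set). (lborel :: real measure)) (\<Pi>\<^sub>E p\<in>diag_vars {}. {- R .. R})"
    by (intro nn_integral_indicator sets_PiM_I_finite) auto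
  also have "\<dots> = (\<Prod>p\<in>diag_vars ({} :: 'n set). emeasure lborel {- R .. R})"
    by (rule ps.emeasure_PiM) auto
  also have "\<dots> < \<infinity>" using R by (simp add: ennreal_power ennreal_less_top)
  finally show ?case .
next
  case (insert k I)
  interpret ps: product_sigma_finite "\<lambda>p::'n \<times> 'n. (lborel :: real measure)"
    by (simp add: product_sigma_finite_def lborel.sigma_finite_measure_axioms)
  let ?P = "\<Pi>\<^sub>M p\<in>diag_vars I. (lborel :: real measure)"
  have kk: "(k, k) \<notin> diag_vars I" using insert by (auto simp: diag_vars_def)
  have "(\<integral>\<^sup>+ y. minor_fun R (insert k I) y \<partial>(\<Pi>\<^sub>M p\<in>diag_vars (insert k I). (lborel :: real measure))) =
    (\<integral>\<^sup>+ x. (\<integral>\<^sup>+ t. minor_fun R (insert k I) (x((k, k) := t)) \<partial>lborel) \<partial>?P)"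
    unfolding diag_vars_insert using borel_minor_fun [of R "insert k I"]
    by (intro ps.product_nn_integral_insert kk) (auto simp: diag_vars_insert)
  also have "\<dots> \<le> (\<integral>\<^sup>+ x. ennreal (2 * sqrt (2 * R)) * minor_fun R I x \<partial>?P)"
  proof (intro nn_integral_mono)
    fix x :: "'n \<times> 'n \<Rightarrow> real"
    have sym: "sym_of (x((k, k) := t)) = (\<chi> i j. if i = k \<and> j = k then t else sym_of x $ i $ j)" for t
      by (auto simp: vec_eq_iff sym_of_def min_def max_def)
    have minor: "minor_mat J (sym_of (x((k, k) := t))) = minor_mat J (sym_of x)" if "J \<subseteq> I" for J t
      using that insert(2) by (auto simp: sym minor_mat_def vec_eq_iff)
    obtain c where c: "\<And>t. det (minor_mat (insert k I) (sym_of (x((k, k) := t)))) = t * det (minor_mat I (sym_of x)) + c"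
      unfolding sym using det_minor_insert [OF insert(2)] by blast
    show "(\<integral>\<^sup>+ t. minor_fun R (insert k I) (x((k, k) := t)) \<partial>lborel) \<le> ennreal (2 * sqrt (2 * R)) * minor_fun R I x"
    proof (cases "(\<forall>p\<in>diag_vars I. \<bar>x p\<bar> < R) \<and> (\<forall>J\<in>Pow I. det (minor_mat J (sym_of x)) > 0)")
      case False
      have "minor_fun R (insert k I) (x((k, k) := t)) = 0" for t
      proof (rule ccontr)
        assume "\<not> ?thesis"
        then have *: "\<forall>p\<in>diag_vars (insert k I). \<bar>(x((k, k) := t)) p\<bar> < R"
          "\<forall>J\<in>Pow (insert k I). det (minor_mat J (sym_of (x((k, k) := t)))) > 0"
          unfolding minor_fun_def by (auto split: if_splits)
        have "\<bar>x p\<bar> < R" if "p \<in> diag_vars I" for p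
          using *(1) that kk by (metis diag_vars_insert fun_upd_other insertCI)
        moreover have "det (minor_mat J (sym_of x)) > 0" if "J \<in> Pow I" for J
          using bspec [OF *(2), of J] minor [of J t] that by auto
        ultimately show False using False by blast
      qed
      then show ?thesis by simp
    next
      case True
      then have d: "det (minor_mat I (sym_of x)) > 0" by blast
      have "minor_fun R (insert k I) (x((k, k) := t)) \<le>
         (if \<bar>t\<bar> < R \<and> t * det (minor_mat I (sym_of x)) + c > 0 then ennreal (1 / sqrt (t * det (minor_mat I (sym_of x)) + c)) else 0)" for t
      proof (cases "t * det (minor_mat I (sym_of x)) + c > 0")
        case False
        then have "\<not> (\<forall>J\<in>Pow (insert k I). det (minor_mat J (sym_of (x((k, k) := t)))) > 0)" using c [of t] by (metis Pow_top)
        then have "minor_fun R (insert k I) (x((k, k) := t)) = 0" unfolding minor_fun_def by (simp only: simp_thms if_False)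
        then show ?thesis by simp
      qed (auto simp: minor_fun_def c diag_vars_insert)
      then have "(\<integral>\<^sup>+ t. minor_fun R (insert k I) (x((k, k) := t)) \<partial>lborel) \<le>
         (\<integral>\<^sup>+ t. (if \<bar>t\<bar> < R \<and> t * det (minor_mat I (sym_of x)) + c > 0 then ennreal (1 / sqrt (t * det (minor_mat I (sym_of x)) + c)) else 0) \<partial>lborel)"
        by (intro nn_integral_mono)
      also have "\<dots> \<le> ennreal (2 * sqrt (2 * R)) * ennreal (1 / sqrt (det (minor_mat I (sym_of x))))"
        by (rule inverse_sqrt_affine_integral [OF d R])
      finally show ?thesis using True by (simp add: minor_fun_def)
    qed
  qed
  also have "\<dots> = ennreal (2 * sqrt (2 * R)) * (\<integral>\<^sup>+ x. minor_fun R I x \<partial>?P)"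
    by (intro nn_integral_cmult borel_minor_fun)
  also have "\<dots> < \<infinity>" using insert by (simp add: ennreal_mult_less_top)
  finally show ?case .
qed

lemma inverse_sqrt_det_integral:
  assumes R: "R > 0"
  shows "(\<integral>\<^sup>+ y. (if (\<forall>p\<in>upper_index. \<bar>y p\<bar> < R) \<and> pos_def (sym_of y) then ennreal (1 / sqrt (det (sym_of y))) else 0)
    \<partial>(\<Pi>\<^sub>M p\<in>(upper_index :: ('n::{finite,linorder} \<times> 'n) set). (lborel :: real measure))) < \<infinity>"
proof -
  have "(if (\<forall>p\<in>upper_index. \<bar>y p\<bar> < R) \<and> pos_def (sym_of y) then ennreal (1 / sqrt (det (sym_of y))) else 0) \<le> minor_fun R UNIV y"
    for y :: "'n \<times> 'n \<Rightarrow> real"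
  proof (cases "(\<forall>p\<in>upper_index. \<bar>y p\<bar> < R) \<and> pos_def (sym_of y)")
    case True
    then have "\<forall>J\<in>Pow UNIV. det (minor_mat J (sym_of y)) > 0"
      by (intro ballI pos_def_det_pos minor_mat_pos_def) auto
    then show ?thesis using True by (simp add: minor_fun_def diag_vars_UNIV minor_mat_UNIV)
  next
    case False
    then show ?thesis by (simp only: if_False zero_le)
  qed
  then show ?thesis
    by (intro le_less_trans [OF nn_integral_mono minor_fun_integral [OF R, of UNIV, unfolded diag_vars_UNIV]])
qed

section \<open>The dominating function and its integral over the half space\<close>

lemma borel_cay: "cay \<in> borel_measurable borel"
proof -
  have 1: "(\<lambda>p::(complex^'a^'a) \<times> (complex^'a^'a). fst p ** snd p) \<in> borel_measurable borel"
    by (intro borel_measurable_continuous_onI continuous_intros)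
  have 2: "(\<lambda>z::complex^'a^'a. z - iI) \<in> borel_measurable borel"
    by (intro borel_measurable_continuous_onI continuous_intros)
  have "(\<lambda>z::complex^'a^'a. z + iI) \<in> borel_measurable borel"
    by (intro borel_measurable_continuous_onI continuous_intros)
  then have 3: "(\<lambda>z::complex^'a^'a. matrix_inv (z + iI)) \<in> borel_measurable borel"
    by (rule measurable_compose [OF _ borel_matrix_inv])
  show ?thesis
    using measurable_compose [OF borel_measurable_Pair [OF 2 3] 1] by (simp add: cay_def [abs_def])
qed

definition herm :: "complex^'n^'n \<Rightarrow> complex^'n^'n" where
  "herm w = mat 1 - conj_transpose w ** w"

text \<open>The square root of the bound for the kernel; 2n + 1 is the least weight allowed by the
  hypothesis.\<close>

definition kappa :: "complex^'n^'n \<Rightarrow> real" where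
  "kappa z = sqrt (cmod (det (herm (cay z))) ^ (2 * CARD('n) + 1))"

lemma borel_kappa: "kappa \<in> borel_measurable borel"
proof -
  have "(\<lambda>w::complex^'n^'n. sqrt (cmod (det (herm w)) ^ (2 * CARD('n) + 1))) \<in> borel_measurable borel"
    unfolding herm_def by (intro borel_measurable_continuous_onI continuous_intros)
  from measurable_compose [OF borel_cay this] show ?thesis by (simp add: kappa_def [abs_def])
qed

lemma norm_matrix_le: "norm (A::complex^'n^'m) \<le> (\<Sum>i\<in>UNIV. \<Sum>j\<in>UNIV. cmod (A $ i $ j))"
proof -
  have "norm A \<le> (\<Sum>i\<in>UNIV. norm (A $ i))" unfolding norm_vec_def [of A] by (rule L2_set_le_sum) auto
  also have "\<dots> \<le> (\<Sum>i\<in>UNIV. \<Sum>j\<in>UNIV. cmod (A $ i $ j))"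
    by (intro sum_mono) (unfold norm_vec_def, rule L2_set_le_sum, auto)
  finally show ?thesis .
qed

lemma norm_axis_complex: "norm (axis j (1::complex) :: complex^'n) = 1"
  by (simp add: norm_vec_def L2_set_def axis_def if_distrib [of norm] if_distrib [of "\<lambda>x. x\<^sup>2"] cong: if_cong)

lemma disc_norm: "w \<in> disc \<Longrightarrow> norm (w::complex^'n^'n) \<le> real (CARD('n) * CARD('n))"
proof -
  assume "w \<in> disc"
  then obtain q where q: "q < 1" "\<And>v. norm (w *v v) \<le> q * norm v" by (auto simp: disc_def)
  have "cmod (w $ i $ j) \<le> 1" for i j
  proof -
    have "(w *v axis j 1) $ i = w $ i $ j"
      by (simp add: matrix_vector_mult_def axis_def if_distrib [of "(*) _"] cong: if_cong)
    then have "cmod (w $ i $ j) \<le> norm (w *v axis j 1)" by (metis Finite_Cartesian_Product.norm_nth_le)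
    also have "\<dots> \<le> q * norm (axis j (1::complex))" by (rule q)
    also have "\<dots> \<le> 1" using q by (simp add: norm_axis_complex)
    finally show ?thesis .
  qed
  then have "(\<Sum>i\<in>UNIV. \<Sum>j\<in>UNIV. cmod (w $ i $ j)) \<le> (\<Sum>i\<in>(UNIV::'n set). \<Sum>j\<in>(UNIV::'n set). 1)"
    by (intro sum_mono)
  then show ?thesis using norm_matrix_le [of w] by simp
qed

lemma compact_closure_disc: "compact (closure (disc :: (complex^'n^'n) set))"
  unfolding compact_closure using disc_norm by (intro boundedI) auto

lemma continuous_disc_bound:
  fixes f :: "complex^'n^'n \<Rightarrow> real"
  assumes "continuous_on UNIV f"
  shows "\<exists>C>0. \<forall>w\<in>disc. f w \<le> C"
proof -
  have "continuous_on (closure disc) f" using assms continuous_on_subset by blast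
  then have "bounded (f ` closure disc)" by (intro compact_imp_bounded compact_continuous_image compact_closure_disc)
  then obtain C where "\<And>w. w \<in> closure disc \<Longrightarrow> \<bar>f w\<bar> \<le> C" by (auto simp: bounded_iff)
  then have "\<forall>w\<in>disc. f w \<le> max C 1" using closure_subset by fastforce
  then show ?thesis by (intro exI [of _ "max C 1"]) auto
qed

lemma det_herm_cay:
  assumes z: "z \<in> siegel"
  shows "cmod (det (herm (cay z))) = det (map_matrix Im z) * (cmod (det (mat 1 - cay z)))\<^sup>2"
proof -
  have "det (herm (cay z)) = cnj (det (mat 1 - cay z)) * of_real (det (map_matrix Im z)) * det (mat 1 - cay z)"
    unfolding herm_def cay_hermitian [OF z] one_minus_cay [OF z] by (simp add: det_mul det_conj_transpose det_cmat)
  then show ?thesis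
    using pos_def_det_pos [OF siegel_Im [OF z]] by (simp add: norm_mult power2_eq_square mult_ac)
qed

text \<open>By \<open>det_herm_cay\<close>, \<open>kappa\<close> contains det y to the power (2n +
  1)/2 and the density takes away n + 1, which leaves -1/2.\<close>

lemma kappa_dens:
  fixes z :: "complex^'n^'n"
  assumes z: "z \<in> siegel"
  shows "kappa z * dens z = cmod (det (mat 1 - cay z)) ^ (2 * CARD('n) + 1) * (1 / sqrt (det (map_matrix Im z)))"
proof -
  define n where "n = CARD('n)"
  define D where "D = det (map_matrix Im z)"
  define a where "a = cmod (det (mat 1 - cay z))"
  have D: "D > 0" and a: "a \<ge> 0" using pos_def_det_pos [OF siegel_Im [OF z]] by (auto simp: D_def a_def)
  have "sqrt ((D * a\<^sup>2) ^ (2 * n + 1)) = sqrt (D * a\<^sup>2) ^ (2 * n + 1)" by (rule real_sqrt_power)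
  also have "sqrt (D * a\<^sup>2) = sqrt D * a" using a by (simp add: real_sqrt_mult)
  also have "(sqrt D * a) ^ (2 * n + 1) = a ^ (2 * n + 1) * (sqrt D ^ (2 * n) * sqrt D)"
    by (simp add: power_mult_distrib)
  also have "sqrt D ^ (2 * n) = D ^ n" using D by (simp add: power_mult)
  finally have "sqrt ((D * a\<^sup>2) ^ (2 * n + 1)) = a ^ (2 * n + 1) * (D ^ n * sqrt D)" .
  moreover have "(D ^ n * sqrt D) * (1 / D ^ (n + 1)) = 1 / sqrt D"
    using D by (simp add: field_simps)
  ultimately show ?thesis
    unfolding kappa_def dens_def det_herm_cay [OF z] n_def [symmetric] D_def [symmetric] a_def [symmetric]
    by (metis (no_types, lifting) mult.assoc)
qed

text \<open>On a bounded set the x variables contribute a finite factor and |det(1 - w)| is bounded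
  over the disc; what remains is \<open>inverse_sqrt_det_integral\<close>.\<close>

lemma kappa_local_integral:
  "(\<integral>\<^sup>+ z. ennreal (kappa z) * indicator (siegel \<inter> {z :: complex^'n::{finite,linorder}^'n::{finite,linorder}. norm z < R}) z \<partial>siegel_measure) < \<infinity>"
  (is "?lhs < _")
proof (cases "R > 0")
  case False
  then have "siegel \<inter> {z::complex^'n::{finite,linorder}^'n::{finite,linorder}. norm z < R} = {}" by (auto simp: not_less) (meson le_less_trans norm_ge_zero not_le)
  then show ?thesis by simp
next
  case R: True
  let ?P = "\<Pi>\<^sub>M p\<in>(upper_index :: ('n \<times> 'n) set). (lborel :: real measure)"
  interpret ps: product_sigma_finite "\<lambda>p::'n \<times> 'n. (lborel :: real measure)"
    by (simp add: product_sigma_finite_def lborel.sigma_finite_measure_axioms)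
  interpret sf: sigma_finite_measure ?P by (rule sigma_finite_PiM_lborel [OF finite_upper_index])
  obtain C where C: "C > 0" "\<And>w::complex^'n::{finite,linorder}^'n::{finite,linorder}. w \<in> disc \<Longrightarrow> cmod (det (mat 1 - w)) ^ (2 * CARD('n) + 1) \<le> C"
  proof -
    have "continuous_on UNIV (\<lambda>w::complex^'n::{finite,linorder}^'n::{finite,linorder}. cmod (det (mat 1 - w)) ^ (2 * CARD('n) + 1))" by (intro continuous_intros)
    from continuous_disc_bound [OF this] that show ?thesis by blast
  qed
  define S where "S = siegel \<inter> {z::complex^'n::{finite,linorder}^'n::{finite,linorder}. norm z < R}"
  have S: "S \<in> sets borel" 
  proof -
    have "open {z :: complex^'n::{finite,linorder}^'n::{finite,linorder}. norm z < R}"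
      by (intro open_Collect_less continuous_intros)
    then show ?thesis unfolding S_def by (rule sets.Int [OF borel_siegel borel_open])
  qed
  define F where "F z = (if z \<in> S then ennreal (1 / sqrt (det (map_matrix Im z))) else 0)" for z
  have bF: "F \<in> borel_measurable borel"
  proof -
    have "(\<lambda>z::complex^'n::{finite,linorder}^'n::{finite,linorder}. 1 / sqrt (det (map_matrix Im z))) \<in> borel_measurable borel"
      by (intro borel_measurable_divide borel_measurable_continuous_onI) (auto intro!: continuous_intros)
    then show ?thesis unfolding F_def using S by measurable
  qed
  have "?lhs = (\<integral>\<^sup>+ z. (indicator siegel z * ennreal (dens z)) * (ennreal (kappa z) * indicator S z) \<partial>distr lborel borel toM)"
    unfolding S_def [symmetric] siegel_measure_alt
  proof (subst nn_integral_density)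
    show "(\<lambda>z. indicator siegel z * ennreal (dens z)) \<in> borel_measurable (distr lborel borel toM)"
      using borel_dens borel_siegel by measurable
    show "(\<lambda>z. ennreal (kappa z) * indicator S z) \<in> borel_measurable (distr lborel borel toM)"
      using borel_kappa S by measurable
  qed simp
  also have "\<dots> \<le> (\<integral>\<^sup>+ z. ennreal C * F z \<partial>distr lborel borel toM)"
  proof (intro nn_integral_mono)
    fix z :: "complex^'n::{finite,linorder}^'n::{finite,linorder}"
    show "indicator siegel z * ennreal (dens z) * (ennreal (kappa z) * indicator S z) \<le> ennreal C * F z"
    proof (cases "z \<in> S")
      case True
      then have z: "z \<in> siegel" by (simp add: S_def)
      have "kappa z * dens z \<le> C * (1 / sqrt (det (map_matrix Im z)))"
        unfolding kappa_dens [OF z] using pos_def_det_pos [OF siegel_Im [OF z]]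
        by (intro mult_right_mono C cay_disc z) auto
      moreover have "0 \<le> kappa z" "0 \<le> dens z" using dens_pos [OF z] by (auto simp: kappa_def)
      ultimately show ?thesis
        using True z C(1) by (simp add: F_def ennreal_mult' [symmetric] mult.commute ennreal_leI)
    qed simp
  qed
  also have "\<dots> = ennreal C * (\<integral>\<^sup>+ z. F z \<partial>distr lborel borel toM)"
    using bF by (intro nn_integral_cmult) auto
  also have "(\<integral>\<^sup>+ z. F z \<partial>distr lborel borel toM) = (\<integral>\<^sup>+ xy. F (toM (of_xy xy)) \<partial>M0)"
  proof -
    have "(\<integral>\<^sup>+ z. F z \<partial>distr lborel borel toM) = (\<integral>\<^sup>+ v. F (toM v) \<partial>lborel)"
      using borel_toM bF by (intro nn_integral_distr) auto
    also have "\<dots> = (\<integral>\<^sup>+ v. F (toM v) \<partial>distr M0 borel of_xy)" by (simp only: lborel_coord)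
    also have "\<dots> = (\<integral>\<^sup>+ xy. F (toM (of_xy xy)) \<partial>M0)"
      using measurable_of_xy measurable_compose [OF borel_toM bF] by (intro nn_integral_distr) auto
    finally show ?thesis .
  qed
  also have "\<dots> = (\<integral>\<^sup>+ x. \<integral>\<^sup>+ y. F (toM (of_xy (x, y))) \<partial>?P \<partial>?P)"
    using measurable_compose [OF measurable_of_xy measurable_compose [OF borel_toM bF]]
    by (subst sf.nn_integral_fst [symmetric]) auto
  also have "\<dots> \<le> (\<integral>\<^sup>+ x. (\<integral>\<^sup>+ y. (if (\<forall>p\<in>upper_index. \<bar>y p\<bar> < R) \<and> pos_def (sym_of y) then ennreal (1 / sqrt (det (sym_of y))) else 0) \<partial>?P)
      * indicator (\<Pi>\<^sub>E p\<in>upper_index. {- R .. R}) x \<partial>?P)"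
    (is "_ \<le> (\<integral>\<^sup>+ x. ?H * _ \<partial>?P)")
  proof (intro nn_integral_mono)
    fix x assume x: "x \<in> space ?P"
    have key: "F (toM (of_xy (x, y))) \<le> (if (\<forall>p\<in>upper_index. \<bar>y p\<bar> < R) \<and> pos_def (sym_of y) then ennreal (1 / sqrt (det (sym_of y))) else 0)
        * indicator (\<Pi>\<^sub>E p\<in>upper_index. {- R .. R}) x" for y
    proof (cases "toM (of_xy (x, y)) \<in> S")
      case True
      define z where "z = toM (of_xy (x, y))"
      have zz: "z $ r $ s = Complex (x (min r s, max r s)) (y (min r s, max r s))" for r s
        unfolding z_def toM_of_xy by (simp add: sym_of_def complex_eq_iff)
      have z: "z \<in> siegel" "norm z < R" using True by (auto simp: S_def z_def)
      have Im: "map_matrix Im z = sym_of y" by (simp add: vec_eq_iff zz sym_of_def)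
      have e: "cmod (z $ r $ s) < R" for r s
        using z(2) Finite_Cartesian_Product.norm_nth_le [of z r] Finite_Cartesian_Product.norm_nth_le [of "z $ r" s] by linarith
      have "\<bar>x p\<bar> < R \<and> \<bar>y p\<bar> < R" if pU: "p \<in> upper_index" for p
      proof -
        obtain r s where p: "p = (r, s)" "r \<le> s" using pU by (auto simp: upper_index_def)
        have "z $ r $ s = Complex (x p) (y p)" using p by (simp add: zz min_def max_def)
        then show ?thesis using e [of r s] abs_Re_le_cmod [of "z $ r $ s"] abs_Im_le_cmod [of "z $ r $ s"] by simp
      qed
      moreover from this have "x \<in> (\<Pi>\<^sub>E p\<in>upper_index. {- R .. R})"
        using x by (force simp: space_PiM PiE_iff)
      moreover have "pos_def (sym_of y)" using siegel_Im [OF z(1)] by (simp add: Im)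
      ultimately show ?thesis using True by (simp add: F_def z_def [symmetric] Im)
    qed (simp add: F_def)
    show "(\<integral>\<^sup>+ y. F (toM (of_xy (x, y))) \<partial>?P) \<le> ?H * indicator (\<Pi>\<^sub>E p\<in>upper_index. {- R .. R}) x"
    proof (cases "x \<in> (\<Pi>\<^sub>E p\<in>upper_index. {- R .. R})")
      case True
      then show ?thesis using key by (simp add: nn_integral_mono)
    next
      case False
      then have "F (toM (of_xy (x, y))) = 0" for y using key [of y] by simp
      then show ?thesis by simp
    qed
  qed
  also have "\<dots> = ?H * emeasure ?P (\<Pi>\<^sub>E p\<in>upper_index. {- R .. R})"
    using finite_upper_index by (intro nn_integral_cmult_indicator sets_PiM_I_finite) auto
  also have "emeasure ?P (\<Pi>\<^sub>E p\<in>upper_index. {- R .. R}) = (\<Prod>p\<in>(upper_index :: ('n \<times> 'n) set). emeasure lborel {- R .. R})"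
    by (rule ps.emeasure_PiM [OF finite_upper_index]) auto
  finally have "?lhs \<le> ennreal C * (?H * (\<Prod>p\<in>(upper_index :: ('n \<times> 'n) set). emeasure lborel {- R .. R}))"
    by (simp add: mult_left_mono)
  also have "\<dots> < \<infinity>"
    using inverse_sqrt_det_integral [OF R, where 'n = 'n] R by (simp add: ennreal_mult_less_top ennreal_power)
  finally show ?thesis .
qed

lemma kappa_rot:
  assumes "cmod c = 1" "z \<in> siegel"
  shows "kappa (act (rot (mat c)) z) = kappa z"
proof -
  have "conj_transpose (mat (c\<^sup>2) ** cay z) ** (mat (c\<^sup>2) ** cay z) = mat (cnj (c\<^sup>2) * c\<^sup>2) ** (conj_transpose (cay z) ** cay z)"
    unfolding conj_transpose_mult conj_transpose_mat mat_commute [of "conj_transpose (cay z)"]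
    by (simp only: matrix_mul_assoc [symmetric])
       (simp only: matrix_mul_assoc mat_commute [of "conj_transpose (cay z)"] mat_mat)
  also have "cnj (c\<^sup>2) * c\<^sup>2 = 1"
    using assms(1) complex_norm_square [of "c\<^sup>2"] by (simp add: norm_power mult.commute)
  finally show ?thesis by (simp add: kappa_def herm_def cay_rot_scalar assms)
qed

lemma infinite_unit_circle: "infinite {t::complex. cmod t = 1}"
proof -
  have "inj_on cis {0..1}"
  proof (rule inj_onI)
    fix x y :: real assume xy: "x \<in> {0..1}" "y \<in> {0..1}" "cis x = cis y"
    then have "cos x = cos y" by (metis cis.sel(1))
    then show "x = y" using xy cos_inj_pi [of x y] pi_gt3 by auto
  qed
  moreover have "infinite {0..1::real}" by (simp add: infinite_Icc)
  ultimately have "infinite (cis ` {0..1})" using finite_imageD by blast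
  moreover have "cis ` {0..1} \<subseteq> {t. cmod t = 1}" by (auto simp: norm_cis)
  ultimately show ?thesis using finite_subset by blast
qed

text \<open>A region where |det(1 - w)| is bounded below is a bounded region of the half space.
  Every w in the closed disc satisfies such a condition after some rotation, finitely many
  conditions cover by compactness, and rotations preserve both \<open>kappa\<close> and the
  measure.\<close>

theorem kappa_integral:
  "(\<integral>\<^sup>+ z. ennreal (kappa (z :: complex^'n::{finite,linorder}^'n::{finite,linorder})) \<partial>siegel_measure) < \<infinity>"
proof -
  let ?K = "closure disc :: (complex^'n::{finite,linorder}^'n::{finite,linorder}) set"
  define U where "U = (\<lambda>(t, \<delta>). {w::complex^'n::{finite,linorder}^'n::{finite,linorder}. \<delta> < cmod (det (mat 1 - mat t ** w))})"
  define P where "P = {(t, \<delta>). cmod t = 1 \<and> (\<delta>::real) > 0}"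
  have cont: "continuous_on UNIV (\<lambda>w::complex^'n::{finite,linorder}^'n::{finite,linorder}. cmod (det (mat 1 - mat t ** w)))" for t
    by (intro continuous_intros)
  have op: "open (U p)" for p
    unfolding U_def by (cases p) (auto intro!: open_Collect_less cont continuous_intros)
  have cover: "?K \<subseteq> (\<Union>p\<in>P. U p)"
  proof
    fix w :: "complex^'n::{finite,linorder}^'n::{finite,linorder}"
    have pd: "polyfun (\<lambda>t. det (mat 1 + mat t ** (- w)))" by (intro polyfun_det polyfun_mat_affine)
    have "\<exists>t. cmod t = 1 \<and> det (mat 1 + mat t ** (- w)) \<noteq> 0"
    proof (rule ccontr)
      assume "\<not> ?thesis"
      then have "{t. cmod t = 1} \<subseteq> {t. det (mat 1 + mat t ** (- w)) = 0}" by auto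
      then have "infinite {t. det (mat 1 + mat t ** (- w)) = 0}" using infinite_unit_circle finite_subset by blast
      \<comment> \<open>At t = 0 the polynomial det(1 - t w) is 1, so it cannot vanish on the whole
        circle.\<close>
      from polyfun_eq_0 [OF pd this, of 0] show False by simp
    qed
    then obtain t where t: "cmod t = 1" "det (mat 1 - mat t ** w) \<noteq> 0" by auto
    then have "(t, cmod (det (mat 1 - mat t ** w)) / 2) \<in> P" "w \<in> U (t, cmod (det (mat 1 - mat t ** w)) / 2)"
      by (auto simp: P_def U_def)
    then show "w \<in> (\<Union>p\<in>P. U p)" by blast
  qed
  obtain T where T: "T \<subseteq> P" "finite T" "?K \<subseteq> (\<Union>p\<in>T. U p)"
    using compactE_image [OF compact_closure_disc op cover] by metis
  have fin: "(\<integral>\<^sup>+ z. ennreal (kappa z) * indicator (siegel \<inter> cay -` U p) z \<partial>siegel_measure) < \<infinity>" if pT: "p \<in> T" for p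
  proof -
    obtain t \<delta> where p: "p = (t, \<delta>)" "cmod t = 1" "\<delta> > 0" using subsetD [OF T(1) pT] by (cases p) (auto simp: P_def)
    \<comment> \<open>The scalar c rotates the disc by c^2.\<close>
    define c where "c = csqrt t"
    have c: "c\<^sup>2 = t" "cmod c = 1" using p(2) by (auto simp: c_def)
    define L where "L = ?K \<inter> {w. \<delta> \<le> cmod (det (mat 1 - w))}"
    have "compact L" unfolding L_def using cont [of 1]
      by (intro compact_Int_closed compact_closure_disc closed_Collect_le continuous_intros)
    moreover have "continuous_on L icay"
      unfolding icay_def using p(3) by (intro continuous_intros) (auto simp: L_def invertible_det_nz)
    ultimately have "bounded (icay ` L)" by (intro compact_imp_bounded compact_continuous_image)
    then obtain R where R: "\<And>w. w \<in> L \<Longrightarrow> norm (icay w) \<le> R" by (auto simp: bounded_iff)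
    \<comment> \<open>R + 1 because R is attained while the set in
      \<open>kappa_local_integral\<close> is given by a strict inequality.\<close>
    define h where "h z = ennreal (kappa z) * indicator (siegel \<inter> {z. norm z < R + 1}) z" for z :: "complex^'n::{finite,linorder}^'n::{finite,linorder}"
    have "open {z :: complex^'n::{finite,linorder}^'n::{finite,linorder}. norm z < R + 1}"
      by (intro open_Collect_less continuous_intros)
    then have "siegel \<inter> {z :: complex^'n::{finite,linorder}^'n::{finite,linorder}. norm z < R + 1} \<in> sets borel"
      by (rule sets.Int [OF borel_siegel borel_open])
    then have bh: "h \<in> borel_measurable borel" unfolding h_def using borel_kappa by measurable
    have "ennreal (kappa z) * indicator (siegel \<inter> cay -` U p) z \<le> h (act (rot (mat c)) z)" for z
    proof (cases "z \<in> siegel \<and> cay z \<in> U p")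
      case True
      then have z: "z \<in> siegel" "\<delta> < cmod (det (mat 1 - mat t ** cay z))" by (auto simp: U_def p)
      define z' where "z' = act (rot (mat c)) z"
      have z': "z' \<in> siegel" unfolding z'_def by (intro act_siegel symplectic_rot unitary_mat c z)
      have cz': "cay z' = mat t ** cay z" unfolding z'_def using cay_rot_scalar [OF c(2) z(1)] c(1) by simp
      have "cay z' \<in> L" using z(2) cay_disc [OF z'] closure_subset [of disc] by (auto simp: L_def cz')
      then have "norm z' < R + 1" using R [of "cay z'"] icay_cay [OF z'] by simp
      then show ?thesis using z' kappa_rot [OF c(2) z(1)] by (simp add: h_def z'_def indicator_def)
    qed auto
    then have "(\<integral>\<^sup>+ z. ennreal (kappa z) * indicator (siegel \<inter> cay -` U p) z \<partial>siegel_measure) \<le>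
      (\<integral>\<^sup>+ z. h (act (rot (mat c)) z) \<partial>siegel_measure)" by (intro nn_integral_mono)
    also have "\<dots> = (\<integral>\<^sup>+ z. h z \<partial>siegel_measure)"
      by (intro nn_integral_act symplectic_rot unitary_mat c bh)
    also have "\<dots> < \<infinity>" unfolding h_def by (rule kappa_local_integral)
    finally show ?thesis .
  qed
  have bU: "siegel \<inter> cay -` U p \<in> sets borel" for p
    using measurable_sets [OF borel_cay, of "U p"] op [of p] borel_siegel by auto
  have "(\<integral>\<^sup>+ z. ennreal (kappa (z :: complex^'n::{finite,linorder}^'n::{finite,linorder})) \<partial>siegel_measure) \<le> (\<integral>\<^sup>+ z. (\<Sum>p\<in>T. ennreal (kappa z) * indicator (siegel \<inter> cay -` U p) z) \<partial>siegel_measure)"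
  proof (rule nn_integral_mono_AE, rule AE_mp [OF AE_siegel], rule AE_I2, rule impI)
    fix z :: "complex^'n::{finite,linorder}^'n::{finite,linorder}" assume z: "z \<in> siegel"
    then have "cay z \<in> ?K" using cay_disc closure_subset by blast
    then obtain p where p: "p \<in> T" "cay z \<in> U p" using T(3) by blast
    then have "ennreal (kappa z) = ennreal (kappa z) * indicator (siegel \<inter> cay -` U p) z" using z by simp
    also have "\<dots> \<le> (\<Sum>p\<in>T. ennreal (kappa z) * indicator (siegel \<inter> cay -` U p) z)"
      by (rule member_le_sum [OF p(1)]) (auto simp: T(2))
    finally show "ennreal (kappa z) \<le> (\<Sum>p\<in>T. ennreal (kappa z) * indicator (siegel \<inter> cay -` U p) z)" .
  qed
  also have "\<dots> = (\<Sum>p\<in>T. \<integral>\<^sup>+ z. ennreal (kappa z) * indicator (siegel \<inter> cay -` U p) z \<partial>siegel_measure)"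
    using bU
    by (intro nn_integral_sum borel_measurable_times_ennreal borel_measurable_indicator)
      (auto simp: measurable_cong_sets [OF sets_siegel_measure refl] intro: measurable_compose [OF borel_kappa measurable_ennreal])
  also have "\<dots> < \<infinity>" using fin T(2) by simp
  finally show ?thesis .
qed

section \<open>Discreteness of the group\<close>

lemma real_matrix_norm_le: "norm (A::real^'n^'m) \<le> (\<Sum>i\<in>UNIV. \<Sum>j\<in>UNIV. \<bar>A $ i $ j\<bar>)"
proof -
  have "norm A \<le> (\<Sum>i\<in>UNIV. norm (A $ i))" unfolding norm_vec_def [of A] by (rule L2_set_le_sum) auto
  also have "\<dots> \<le> (\<Sum>i\<in>UNIV. \<Sum>j\<in>UNIV. \<bar>A $ i $ j\<bar>)"
    by (intro sum_mono) (unfold norm_vec_def, rule order_trans [OF L2_set_le_sum], auto)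
  finally show ?thesis .
qed

lemma matrix_entry_le_norm: "\<bar>A $ i $ j\<bar> \<le> norm (A::real^'n^'m)"
  using Finite_Cartesian_Product.norm_nth_le [of A i] Finite_Cartesian_Product.norm_nth_le [of "A $ i" j] by simp

definition int_matrices :: "(real^'n^'m) set" where
  "int_matrices = {A. \<forall>i j. A $ i $ j \<in> \<int>}"

lemma finite_int_matrices_entries: "finite {A :: real^'n^'m. A \<in> int_matrices \<and> (\<forall>i j. \<bar>A $ i $ j\<bar> \<le> R)}"
proof (rule finite_subset)
  define S where "S = real_of_int ` {- \<lceil>\<bar>R\<bar>\<rceil> .. \<lceil>\<bar>R\<bar>\<rceil>}"
  show "{A :: real^'n^'m. A \<in> int_matrices \<and> (\<forall>i j. \<bar>A $ i $ j\<bar> \<le> R)} \<subseteq>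
    (\<lambda>f. \<chi> i j. f (i, j)) ` (PiE UNIV (\<lambda>_. S))"
  proof
    fix A :: "real^'n^'m" assume "A \<in> {A. A \<in> int_matrices \<and> (\<forall>i j. \<bar>A $ i $ j\<bar> \<le> R)}"
    then have A: "A $ i $ j \<in> \<int>" "\<bar>A $ i $ j\<bar> \<le> R" for i j by (auto simp: int_matrices_def)
    have "A $ i $ j \<in> S" for i j
    proof -
      obtain k where k: "A $ i $ j = real_of_int k" using A(1) Ints_cases by blast
      then have "\<bar>real_of_int k\<bar> \<le> \<bar>R\<bar>" using A(2) [of i j] by simp
      then have "k \<in> {- \<lceil>\<bar>R\<bar>\<rceil> .. \<lceil>\<bar>R\<bar>\<rceil>}" by (simp add: abs_le_iff) linarith
      then show ?thesis by (simp add: S_def k)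
    qed
    then show "A \<in> (\<lambda>f. \<chi> i j. f (i, j)) ` (PiE UNIV (\<lambda>_. S))"
      by (intro image_eqI [of _ _ "\<lambda>(i, j). A $ i $ j"]) (auto simp: vec_eq_iff)
  qed
  show "finite ((\<lambda>f. (\<chi> i j. f (i, j)) :: real^'n^'m) ` (PiE UNIV (\<lambda>_. S)))"
    by (intro finite_imageI finite_PiE) (auto simp: S_def)
qed

lemma finite_int_matrices: "finite {A :: real^'n^'m. A \<in> int_matrices \<and> norm A \<le> R}"
proof (rule finite_subset [OF _ finite_int_matrices_entries [of R]])
  show "{A :: real^'n^'m. A \<in> int_matrices \<and> norm A \<le> R} \<subseteq> {A. A \<in> int_matrices \<and> (\<forall>i j. \<bar>A $ i $ j\<bar> \<le> R)}"
    using matrix_entry_le_norm order_trans by blast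
qed

lemma norm_mmult_bound_real: "\<exists>K>0. \<forall>(A::real^'n^'n) (B::real^'n^'n). norm (A ** B) \<le> norm A * norm B * K"
proof -
  have "bilinear (\<lambda>(A::real^'n^'n) (B::real^'n^'n). A ** B)"
    unfolding bilinear_def
    by (auto intro!: linearI simp: matrix_add_ldistrib matrix_add_rdistrib scalar_matrix_assoc [symmetric] matrix_scalar_ac)
  then have "bounded_bilinear (\<lambda>(A::real^'n^'n) (B::real^'n^'n). A ** B)"
    by (simp add: bilinear_conv_bounded_bilinear)
  from bounded_bilinear.pos_bounded [OF this] show ?thesis by auto
qed

locale discrete_group =
  fixes \<Gamma> :: "(real^('n::{finite,linorder}+'n)^('n+'n)) set"
  assumes subgroup: "subgroup \<Gamma> Sp" and comm: "commensurable Sp \<Gamma> Sp_Z"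
begin

lemma symplectic: "g \<in> \<Gamma> \<Longrightarrow> symplectic g"
  using subgroup.subset [OF subgroup] by (auto simp: carrier_Sp)

lemma mult_closed: "g \<in> \<Gamma> \<Longrightarrow> h \<in> \<Gamma> \<Longrightarrow> g ** h \<in> \<Gamma>"
  using subgroup.m_closed [OF subgroup] by simp

lemma one_closed: "mat 1 \<in> \<Gamma>"
  using subgroup.one_closed [OF subgroup] by simp

lemma inverse_closed: "g \<in> \<Gamma> \<Longrightarrow> \<exists>h\<in>\<Gamma>. h ** g = mat 1 \<and> g ** h = mat 1"
proof -
  assume g: "g \<in> \<Gamma>"
  then have "g \<in> carrier Sp" using subgroup.subset [OF subgroup] by blast
  then have "inv\<^bsub>Sp\<^esub> g ** g = mat 1" "g ** inv\<^bsub>Sp\<^esub> g = mat 1"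
    using group.l_inv [OF group_Sp, of g] group.r_inv [OF group_Sp, of g] by simp_all
  then show ?thesis using subgroup.m_inv_closed [OF subgroup g] by blast
qed

text \<open>The half of commensurability that concerns the index in \<open>\<Gamma>\<close>, with
  chosen coset representatives.\<close>

lemma finite_cosets:
  "\<exists>T. finite T \<and> T \<subseteq> \<Gamma> \<and> (\<forall>g\<in>\<Gamma>. \<exists>t\<in>T. \<exists>d\<in>\<Gamma> \<inter> Sp_Z. g = d ** t)"
proof -
  let ?C = "rcosets\<^bsub>Sp\<lparr>carrier := \<Gamma>\<rparr>\<^esub> (\<Gamma> \<inter> Sp_Z)"
  have fin: "finite ?C" using comm by (simp add: commensurable_def finite_index_def)
  have C: "?C = (\<lambda>a. (\<lambda>d. d ** a) ` (\<Gamma> \<inter> Sp_Z)) ` \<Gamma>"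
    by (auto simp: RCOSETS_def r_coset_def Sp_def)
  define r where "r S = (SOME a. a \<in> \<Gamma> \<and> S = (\<lambda>d. d ** a) ` (\<Gamma> \<inter> Sp_Z))" for S
  have r: "r S \<in> \<Gamma> \<and> S = (\<lambda>d. d ** r S) ` (\<Gamma> \<inter> Sp_Z)" if "S \<in> ?C" for S
    unfolding r_def by (rule someI_ex) (use that C in auto)
  have Z1: "mat 1 \<in> Sp_Z" by (simp add: Sp_Z_def carrier_Sp symplectic_one) (simp add: mat_def)
  have "\<exists>t\<in>r ` ?C. \<exists>d\<in>\<Gamma> \<inter> Sp_Z. g = d ** t" if "g \<in> \<Gamma>" for g
  proof -
    define S where "S = (\<lambda>d. d ** g) ` (\<Gamma> \<inter> Sp_Z)"
    have S: "S \<in> ?C" unfolding C S_def using that by blast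
    have "mat 1 ** g \<in> S" unfolding S_def by (rule imageI) (simp add: one_closed Z1)
    then have "g \<in> (\<lambda>d. d ** r S) ` (\<Gamma> \<inter> Sp_Z)" using r [OF S] by simp
    then show ?thesis using S by blast
  qed
  moreover have "r ` ?C \<subseteq> \<Gamma>" using r by blast
  ultimately show ?thesis using fin by (intro exI [of _ "r ` ?C"]) simp
qed

text \<open>After removing one of finitely many representatives t on the right, g becomes an
  integral matrix of bounded norm.\<close>

lemma finite_bounded: "finite {g \<in> \<Gamma>. norm g \<le> R}"
proof -
  obtain T where T: "finite T" "T \<subseteq> \<Gamma>" "\<And>g. g \<in> \<Gamma> \<Longrightarrow> \<exists>t\<in>T. \<exists>d\<in>\<Gamma> \<inter> Sp_Z. g = d ** t"
    using finite_cosets by blast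
  obtain K where K: "K > 0" "\<And>(A::real^('n+'n)^('n+'n)) (B::real^('n+'n)^('n+'n)). norm (A ** B) \<le> norm A * norm B * K"
    using norm_mmult_bound_real by blast
  define N where "N t = R * norm (matrix_inv t) * K" for t :: "real^('n+'n)^('n+'n)"
  have "{g \<in> \<Gamma>. norm g \<le> R} \<subseteq> (\<Union>t\<in>T. (\<lambda>d. d ** t) ` {A. A \<in> int_matrices \<and> norm A \<le> N t})"
  proof
    fix g assume g: "g \<in> {g \<in> \<Gamma>. norm g \<le> R}"
    then obtain t d where td: "t \<in> T" "d \<in> \<Gamma> \<inter> Sp_Z" "g = d ** t" using T(3) by blast
    have "invertible t" using T(2) td(1) subgroup.subset [OF subgroup] by (auto simp: Sp_def)
    then have d: "d = g ** matrix_inv t" by (simp add: td(3) matrix_mul_assoc [symmetric] matrix_inv_right)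
    have "norm d \<le> norm g * norm (matrix_inv t) * K" unfolding d by (rule K)
    also have "\<dots> \<le> N t" unfolding N_def using g K(1) by (intro mult_right_mono) auto
    finally have "norm d \<le> N t" .
    moreover have "d \<in> int_matrices" using td(2) by (auto simp: Sp_Z_def int_matrices_def)
    ultimately show "g \<in> (\<Union>t\<in>T. (\<lambda>d. d ** t) ` {A. A \<in> int_matrices \<and> norm A \<le> N t})"
      using td by blast
  qed
  moreover have "finite (\<Union>t\<in>T. (\<lambda>d. d ** t) ` {A :: real^('n+'n)^('n+'n). A \<in> int_matrices \<and> norm A \<le> N t})"
    by (intro finite_UN_I T(1) finite_imageI finite_int_matrices)
  ultimately show ?thesis by (rule finite_subset)
qed

lemma countable_group: "countable \<Gamma>"
proof -
  have "\<Gamma> = (\<Union>k::nat. {g \<in> \<Gamma>. norm g \<le> real k})" using real_arch_simple by blast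
  moreover have "countable (\<Union>k::nat. {g \<in> \<Gamma>. norm g \<le> real k})"
    by (rule countable_UN [OF countableI_type]) (rule countable_finite [OF finite_bounded])
  ultimately show ?thesis by (rule ssubst)
qed

end

text \<open>A proper function on the half space: a bound keeps z bounded and y away from singular
  matrices.\<close>

definition height :: "complex^'n^'n \<Rightarrow> real" where
  "height z = norm z + norm (matrix_inv (cmat (map_matrix Im z)))"

text \<open>The inverse of \<open>Im_act\<close>. It has the automorphy factor on the outside, so a
  bound on the inverse of Im(gz) bounds that factor.\<close>

lemma autf_Im_inverse:
  assumes g: "symplectic g" and z: "z \<in> siegel"
  shows "autf g z ** matrix_inv (cmat (map_matrix Im z)) ** conj_transpose (autf g z) = matrix_inv (cmat (map_matrix Im (act g z)))"
proof -
  define j where "j = autf g z"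
  define y where "y = cmat (map_matrix Im z)"
  define y' where "y' = cmat (map_matrix Im (act g z))"
  have j: "invertible j" "invertible (conj_transpose j)"
    using invertible_autf [OF assms] by (simp_all add: j_def invertible_conj_transpose)
  have y: "invertible y" unfolding y_def using pos_def_invertible [OF siegel_Im [OF z]] by (simp only: invertible_cmat)
  have e: "conj_transpose j ** (y' ** j) = y" using Im_act [OF assms] by (simp add: j_def y_def y'_def matrix_mul_assoc)
  have "matrix_inv y' = j ** matrix_inv y ** conj_transpose j"
  proof (rule matrix_inv_unique')
    have "conj_transpose j ** (y' ** j) ** matrix_inv j = y ** matrix_inv j" by (simp only: e)
    then have "conj_transpose j ** y' = y ** matrix_inv j"
      using j by (simp add: matrix_mul_assoc [symmetric] matrix_inv_cancel)
    then have "(j ** matrix_inv y ** conj_transpose j) ** y' = j ** (matrix_inv y ** (y ** matrix_inv j))"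
      by (simp add: matrix_mul_assoc [symmetric])
    also have "\<dots> = mat 1" using y j by (simp add: matrix_inv_cancel_assoc matrix_inv_cancel)
    finally show "(j ** matrix_inv y ** conj_transpose j) ** y' = mat 1" .
  qed
  then show ?thesis by (simp add: j_def y_def y'_def)
qed

lemma norm_conj_transpose: "norm (conj_transpose A) = norm (A::complex^'n^'n)"
proof -
  have "(\<Sum>i\<in>UNIV. \<Sum>j\<in>UNIV. (cmod (A $ j $ i))\<^sup>2) = (\<Sum>j\<in>UNIV. \<Sum>i\<in>UNIV. (cmod (A $ j $ i))\<^sup>2)" by (rule sum.swap)
  then show ?thesis by (simp add: norm_vec_def L2_set_def sum_nonneg)
qed

lemma matrix_norm_from_columns: "norm (A::complex^'n^'n) \<le> (\<Sum>j\<in>UNIV. norm (A *v axis j 1))"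
proof -
  have "A *v axis j 1 = column j A" for j
    by (simp add: vec_eq_iff column_def matrix_vector_mult_def axis_def if_distrib [of "(*) _"] cong: if_cong)
  moreover have "norm A \<le> (\<Sum>j\<in>UNIV. norm (column j A))"
  proof -
    have "norm A = norm (conj_transpose A)" by (simp add: norm_conj_transpose)
    also have "\<dots> \<le> (\<Sum>j\<in>UNIV. norm (conj_transpose A $ j))"
      unfolding norm_vec_def [of "conj_transpose A"] by (rule L2_set_le_sum) auto
    also have "\<dots> = (\<Sum>j\<in>UNIV. norm (column j A))"
      by (intro sum.cong refl) (simp add: norm_vec_def column_def)
    finally show ?thesis .
  qed
  ultimately show ?thesis by simp
qed

text \<open>The inverse of y is positive definite, so by \<open>autf_Im_inverse\<close> the diagonal
  entries of the inverse of Im(gz) dominate the squared norms of j^* applied to the unit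
  vectors.\<close>

lemma autf_bounded:
  fixes z :: "complex^'n^'n"
  assumes z: "z \<in> siegel"
  shows "\<exists>B. \<forall>g. symplectic g \<longrightarrow> height (act g z) \<le> c \<longrightarrow> norm (autf g z) \<le> B"
proof -
  define y where "y = cmat (map_matrix Im z)"
  have pd: "pos_def (map_matrix Im z)" by (rule siegel_Im [OF z])
  have "\<exists>m>0. \<forall>v. m * (norm v)\<^sup>2 \<le> Re (hdot (matrix_inv y *v v) v)"
  proof (rule homogeneous_lower_bound)
    show "continuous_on UNIV (\<lambda>v. Re (hdot (matrix_inv y *v v) v))" by (intro continuous_intros)
    have *: "c *\<^sub>R v = of_real c *s v" for c and v :: "complex^'n" by (simp add: vec_eq_iff) (simp add: scaleR_conv_of_real)
    show "Re (hdot (matrix_inv y *v (c *\<^sub>R v)) (c *\<^sub>R v)) = c\<^sup>2 * Re (hdot (matrix_inv y *v v) v)" for c v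
      by (simp add: * vec.scale hdot_scale_left hdot_scale_right power2_eq_square del: vector_scaleR_component)
    fix v :: "complex^'n" assume v: "v \<noteq> 0"
    define u where "u = matrix_inv y *v v"
    have iy: "invertible y" unfolding y_def using pos_def_invertible [OF pd] by (simp only: invertible_cmat)
    then have vu: "v = y *v u" by (simp add: u_def matrix_inv_cancel_assoc)
    then have "u \<noteq> 0" using v by auto
    then have "Re (hdot (y *v u) u) > 0" unfolding y_def by (rule pos_def_complex [OF pd])
    then have "Re (hdot u (y *v u)) > 0" by (metis hdot_cnj cnj.sel(1))
    then show "0 < Re (hdot (matrix_inv y *v v) v)" by (simp add: u_def [symmetric] vu [symmetric])
  qed
  then obtain m where m: "m > 0" "\<And>v. m * (norm v)\<^sup>2 \<le> Re (hdot (matrix_inv y *v v) v)" by blast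
  obtain K where K: "K > 0" "\<And>(A::complex^'n^'n) (v::complex^'n). norm (A *v v) \<le> norm A * norm v * K"
  proof -
    have "bilinear (\<lambda>(A::complex^'n^'n) (v::complex^'n). A *v v)"
      unfolding bilinear_def
      by (auto intro!: linearI simp: matrix_vector_right_distrib matrix_vector_mult_add_rdistrib)
        (auto simp: vec_eq_iff matrix_vector_mult_def scaleR_sum_right)
    then have "bounded_bilinear (\<lambda>(A::complex^'n^'n) (v::complex^'n). A *v v)"
      by (simp add: bilinear_conv_bounded_bilinear)
    from bounded_bilinear.pos_bounded [OF this] that show ?thesis by blast
  qed
  define b where "b = sqrt (\<bar>c\<bar> * K / m)"
  have "norm (autf g z) \<le> CARD('n) * b" if g: "symplectic g" and h: "height (act g z) \<le> c" for g
  proof -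
    define j where "j = autf g z"
    have "norm (conj_transpose j *v axis i 1) \<le> b" for i
    proof -
      define v where "v = (axis i 1 :: complex^'n)"
      have nv: "norm v = 1" by (simp add: v_def norm_axis_complex)
      have "m * (norm (conj_transpose j *v v))\<^sup>2 \<le> Re (hdot (matrix_inv y *v (conj_transpose j *v v)) (conj_transpose j *v v))" by (rule m)
      also have "\<dots> = Re (hdot (matrix_inv (cmat (map_matrix Im (act g z))) *v v) v)"
        unfolding autf_Im_inverse [OF g z, symmetric] j_def y_def
        by (simp add: matrix_vector_mul_assoc [symmetric] hdot_adjoint [of "autf g z"])
      also have "\<dots> \<le> norm (matrix_inv (cmat (map_matrix Im (act g z))) *v v) * norm v"
        unfolding Re_hdot by (rule norm_cauchy_schwarz)
      also have "\<dots> \<le> norm (matrix_inv (cmat (map_matrix Im (act g z)))) * K"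
        using K(2) [of "matrix_inv (cmat (map_matrix Im (act g z)))" v] by (simp add: nv)
      also have "\<dots> \<le> \<bar>c\<bar> * K" using h K(1) unfolding height_def
        by (intro mult_right_mono) (auto intro: order_trans [of _ "norm (act g z) + norm (matrix_inv (cmat (map_matrix Im (act g z))))"])
      finally have "(norm (conj_transpose j *v v))\<^sup>2 \<le> \<bar>c\<bar> * K / m" using m(1) by (simp add: field_simps)
      then show ?thesis unfolding b_def v_def by (rule real_le_rsqrt)
    qed
    then have "(\<Sum>i\<in>UNIV. norm (conj_transpose j *v axis i 1)) \<le> (\<Sum>i\<in>(UNIV::'n set). b)" by (intro sum_mono)
    then have "norm (conj_transpose j) \<le> CARD('n) * b" using matrix_norm_from_columns [of "conj_transpose j"] by simp
    then show ?thesis by (simp add: norm_conj_transpose j_def)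
  qed
  then show ?thesis by blast
qed

lemma norm_block_le:
  fixes g :: "real^('n::finite+'n)^('n+'n)"
  shows "norm g \<le> (\<Sum>i\<in>UNIV. \<Sum>j\<in>UNIV. \<bar>blockA g $ i $ j\<bar> + \<bar>blockB g $ i $ j\<bar> + \<bar>blockC g $ i $ j\<bar> + \<bar>blockD g $ i $ j\<bar>)"
  using real_matrix_norm_le [of g]
  by (simp add: sum_UNIV_sum blockA_def blockB_def blockC_def blockD_def sum.distrib algebra_simps)

text \<open>With W = A z + B real and imaginary parts separate: A = Im(W) y^{-1} and B = Re(W) - A
  x.\<close>

lemma real_imag_split:
  fixes z :: "complex^'n^'n"
  assumes "pos_def (map_matrix Im z)"
  shows "\<exists>K. \<forall>(A::real^'n^'n) (B::real^'n^'n) M. norm (cmat A ** z + cmat B) \<le> M \<longrightarrow> (\<forall>i j. \<bar>A $ i $ j\<bar> \<le> K * M \<and> \<bar>B $ i $ j\<bar> \<le> K * M)"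
proof -
  define x y where "x = map_matrix Re z" and "y = map_matrix Im z"
  have y: "invertible y" using pos_def_invertible [OF assms] by (simp add: y_def)
  obtain k where k: "k > 0" "\<And>(A::real^'n^'n) (B::real^'n^'n). norm (A ** B) \<le> norm A * norm B * k"
    using norm_mmult_bound_real by blast
  define n where "n = real (CARD('n) * CARD('n))"
  define K1 where "K1 = n * norm (matrix_inv y) * k"
  define K where "K = K1 + (n + K1 * norm x * k)"
  have nn: "n \<ge> 0" "K1 \<ge> 0" using k by (auto simp: n_def K1_def)
  have "\<bar>A $ i $ j\<bar> \<le> K * M \<and> \<bar>B $ i $ j\<bar> \<le> K * M" if M: "norm (cmat A ** z + cmat B) \<le> M" for A B :: "real^'n^'n" and M i j
  proof -
    define W where "W = cmat A ** z + cmat B"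
    have e: "cmod (W $ r $ s) \<le> M" for r s
      using M Finite_Cartesian_Product.norm_nth_le [of W r] Finite_Cartesian_Product.norm_nth_le [of "W $ r" s] by (simp add: W_def)
    then have M0: "M \<ge> 0" using norm_ge_zero order_trans by blast
    have WI: "map_matrix Im W = A ** y" and WR: "map_matrix Re W = A ** x + B"
      by (simp_all add: W_def x_def y_def vec_eq_iff matrix_matrix_mult_def)
    have "norm (map_matrix Im W) \<le> (\<Sum>i\<in>(UNIV::'n set). \<Sum>j\<in>(UNIV::'n set). M)"
      by (rule order_trans [OF real_matrix_norm_le]) (intro sum_mono, simp, rule order_trans [OF abs_Im_le_cmod e])
    then have nI: "norm (A ** y) \<le> n * M" by (simp add: n_def WI)
    have "norm (map_matrix Re W) \<le> (\<Sum>i\<in>(UNIV::'n set). \<Sum>j\<in>(UNIV::'n set). M)"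
      by (rule order_trans [OF real_matrix_norm_le]) (intro sum_mono, simp, rule order_trans [OF abs_Re_le_cmod e])
    then have nR: "norm (A ** x + B) \<le> n * M" by (simp add: n_def WR)
    have "A = (A ** y) ** matrix_inv y" using y by (simp add: matrix_mul_assoc [symmetric] matrix_inv_right)
    then have "norm A \<le> norm (A ** y) * norm (matrix_inv y) * k" by (metis k(2))
    also have "\<dots> \<le> (n * M) * norm (matrix_inv y) * k" using nI k(1) by (intro mult_right_mono) auto
    also have "\<dots> = K1 * M" by (simp add: K1_def)
    finally have nA: "norm A \<le> K1 * M" .
    have "norm B = norm ((A ** x + B) - A ** x)" by simp
    also have "\<dots> \<le> norm (A ** x + B) + norm (A ** x)" by (rule norm_triangle_ineq4)
    also have "\<dots> \<le> n * M + norm A * norm x * k" by (intro add_mono nR k)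
    also have "\<dots> \<le> n * M + (K1 * M) * norm x * k" using nA k(1) by (intro add_left_mono mult_right_mono) auto
    finally have nB: "norm B \<le> (n + K1 * norm x * k) * M" by (simp add: algebra_simps)
    have "K1 * M \<le> K * M" "(n + K1 * norm x * k) * M \<le> K * M"
      using nn k M0 by (auto simp: K_def intro!: mult_right_mono)
    then show ?thesis using nA nB matrix_entry_le_norm [of A i j] matrix_entry_le_norm [of B i j] by linarith
  qed
  then show ?thesis by blast
qed

text \<open>\<open>real_imag_split\<close> recovers C and D from j = C z + D, and A and B from (gz)
  j = A z + B; both matrices are bounded in terms of the height.\<close>

lemma group_elements_bounded:
  fixes z :: "complex^'n^'n"
  assumes z: "z \<in> siegel"
  shows "\<exists>R. \<forall>g. symplectic g \<longrightarrow> height (act g z) \<le> c \<longrightarrow> norm g \<le> R"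
proof -
  obtain B where B: "\<And>g. symplectic g \<Longrightarrow> height (act g z) \<le> c \<Longrightarrow> norm (autf g z) \<le> B" using autf_bounded [OF z] by blast
  obtain k where k: "k > 0" "\<And>(A::complex^'n^'n) (B::complex^'n^'n). norm (A ** B) \<le> norm A * norm B * k"
    using norm_mmult_bound by blast
  obtain K where K: "\<And>(A::real^'n^'n) (B::real^'n^'n) M i j. norm (cmat A ** z + cmat B) \<le> M \<Longrightarrow> \<bar>A $ i $ j\<bar> \<le> K * M \<and> \<bar>B $ i $ j\<bar> \<le> K * M"
    using real_imag_split [OF siegel_Im [OF z]] by blast
  define M where "M = \<bar>c\<bar> * \<bar>B\<bar> * k"
  have "norm g \<le> (\<Sum>i\<in>(UNIV::'n set). \<Sum>j\<in>(UNIV::'n set). K * M + K * M + K * B + K * B)"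
    if g: "symplectic g" and h: "height (act g z) \<le> c" for g
  proof -
    have nj: "norm (autf g z) \<le> B" by (rule B [OF g h])
    have na: "norm (act g z) \<le> c" using h unfolding height_def by (smt (verit) norm_ge_zero)
    have "norm (cmat (blockA g) ** z + cmat (blockB g)) \<le> norm (act g z) * norm (autf g z) * k"
      unfolding act_autf [OF g z, symmetric] by (rule k)
    also have "\<dots> \<le> M" unfolding M_def using na nj k(1) by (intro mult_right_mono mult_mono) auto
    finally have 1: "norm (cmat (blockA g) ** z + cmat (blockB g)) \<le> M" .
    have 2: "norm (cmat (blockC g) ** z + cmat (blockD g)) \<le> B" using nj by (simp add: autf_def)
    show ?thesis
      by (rule order_trans [OF norm_block_le]) (intro sum_mono add_mono; use K [OF 1] K [OF 2] in blast)
  qed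
  then show ?thesis by blast
qed

section \<open>Fundamental sets and fixed points\<close>

text \<open>Lists compare lexicographically, so the comparison unfolds into finitely many
  comparisons of real functions.\<close>

lemma borel_lex_le:
  fixes fs :: "('a::topological_space \<Rightarrow> real) list"
  assumes "\<forall>f\<in>set fs. f \<in> borel_measurable borel" "T \<in> borel_measurable borel"
  shows "{z. map (\<lambda>f. f z) fs \<le> map (\<lambda>f. f (T z)) fs} \<in> sets borel"
  using assms(1)
proof (induction fs)
  case (Cons f fs)
  have f: "f \<in> borel_measurable borel" using Cons by simp
  have fT: "(\<lambda>z. f (T z)) \<in> borel_measurable borel" using measurable_compose [OF assms(2) f] .
  have "{z. map (\<lambda>f. f z) (f # fs) \<le> map (\<lambda>f. f (T z)) (f # fs)} =
    {z. f z < f (T z)} \<union> ({z. f z = f (T z)} \<inter> {z. map (\<lambda>f. f z) fs \<le> map (\<lambda>f. f (T z)) fs})"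
    by auto
  moreover have "{z \<in> space borel. f z < f (T z)} \<in> sets borel" "{z \<in> space borel. f z = f (T z)} \<in> sets borel"
    using f fT by measurable
  ultimately show ?case using Cons by auto
qed simp

lemma borel_height: "(height :: complex^'n^'n \<Rightarrow> real) \<in> borel_measurable borel"
proof -
  have "(\<lambda>z::complex^'n^'n. cmat (map_matrix Im z)) \<in> borel_measurable borel"
    by (intro borel_measurable_continuous_onI continuous_intros)
  from measurable_compose [OF this borel_matrix_inv]
  show ?thesis unfolding height_def by (intro borel_measurable_add borel_measurable_norm) auto
qed

text \<open>The first coordinate is the height, whose sublevel sets meet each orbit in a finite set; the
  remaining coordinates only break ties.\<close>

definition enc_funs :: "(complex^'n^'n \<Rightarrow> real) list" where
  "enc_funs = height # map (\<lambda>p z. Re (z $ fst p $ snd p)) (SOME l. set l = UNIV) @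
     map (\<lambda>p z. Im (z $ fst p $ snd p)) (SOME l. set l = UNIV)"

definition enc :: "complex^'n^'n \<Rightarrow> real list" where
  "enc z = map (\<lambda>f. f z) enc_funs"

lemma some_enum: "set (SOME l :: ('n::finite \<times> 'n) list. set l = UNIV) = UNIV"
  by (rule someI_ex) (simp add: finite_list)

lemma enc_inj: "enc z = enc w \<Longrightarrow> z = w"
  unfolding enc_def enc_funs_def using some_enum [where 'n = 'a]
  by (auto simp: vec_eq_iff complex_eq_iff)

lemma enc_height: "height z < height w \<Longrightarrow> enc z \<le> enc w"
  by (simp add: enc_def enc_funs_def)

lemma borel_enc:
  fixes T :: "complex^'n^'n \<Rightarrow> complex^'n^'n"
  assumes "T \<in> borel_measurable borel"
  shows "{z. enc z \<le> enc (T z)} \<in> sets borel"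
  unfolding enc_def
proof (rule borel_lex_le [OF _ assms], safe)
  fix f :: "complex^'n^'n \<Rightarrow> real" assume f: "f \<in> set enc_funs"
  have "(\<lambda>z::complex^'n^'n. Re (z $ i $ j)) \<in> borel_measurable borel" "(\<lambda>z::complex^'n^'n. Im (z $ i $ j)) \<in> borel_measurable borel" for i j
    by (intro borel_measurable_continuous_onI continuous_intros)+
  then show "f \<in> borel_measurable borel" using f borel_height by (auto simp: enc_funs_def)
qed

context discrete_group
begin

lemma finite_low_orbit:
  assumes z: "z \<in> siegel"
  shows "finite {g \<in> \<Gamma>. height (act g z) \<le> c}"
proof -
  obtain R where "\<And>g. symplectic g \<Longrightarrow> height (act g z) \<le> c \<Longrightarrow> norm g \<le> R"
    using group_elements_bounded [OF z] by blast
  then have "{g \<in> \<Gamma>. height (act g z) \<le> c} \<subseteq> {g \<in> \<Gamma>. norm g \<le> R}" using symplectic by blast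
  then show ?thesis using finite_bounded finite_subset by blast
qed

text \<open>Each orbit is represented by its point of least encoding. The minimum exists because
  finitely many group elements keep the height below that of z, it is unique because the encoding is
  injective, and the set is Borel because the group is countable.\<close>

lemma orbit_reps_exists: "\<exists>F. orbit_reps \<Gamma> F"
proof -
  define F where "F = {z \<in> siegel. \<forall>g\<in>\<Gamma>. enc z \<le> enc (act g z)}"
  have "F = siegel - (\<Union>g\<in>\<Gamma>. - {z. enc z \<le> enc (act g z)})" by (auto simp: F_def)
  moreover have "(\<Union>g\<in>\<Gamma>. - {z. enc z \<le> enc (act g z)}) \<in> sets borel"
    by (intro sets.countable_UN' countable_group) (auto intro!: borel_comp borel_enc borel_act)
  ultimately have bF: "F \<in> sets borel" using borel_siegel by auto
  have "\<exists>!w. w \<in> F \<and> (\<exists>g\<in>\<Gamma>. w = act g z)" if z: "z \<in> siegel" for z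
  proof (rule ex_ex1I)
    define S where "S = (\<lambda>g. act g z) ` {g \<in> \<Gamma>. height (act g z) \<le> height z}"
    have S: "finite S" unfolding S_def using finite_low_orbit [OF z] by simp
    have "z \<in> S" unfolding S_def using one_closed by (intro image_eqI [of _ _ "mat 1"]) (auto simp: act_one)
    then have "enc ` S \<noteq> {}" by blast
    then have "Min (enc ` S) \<in> enc ` S" using S by (intro Min_in) auto
    then obtain w where w: "w \<in> S" "enc w = Min (enc ` S)" by auto
    have wmin: "enc w \<le> enc v" if "v \<in> S" for v unfolding w(2) using S that by (intro Min_le) auto
    obtain g0 where g0: "g0 \<in> \<Gamma>" "w = act g0 z" "height w \<le> height z" using w(1) by (auto simp: S_def)
    have "w \<in> siegel" unfolding g0 using z g0 symplectic by (intro act_siegel) auto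
    moreover have "enc w \<le> enc (act g w)" if g: "g \<in> \<Gamma>" for g
    proof -
      have e: "act g w = act (g ** g0) z" unfolding g0(2) using symplectic g g0 z by (simp add: act_mult)
      show ?thesis
      proof (cases "height (act g w) \<le> height z")
        case True
        then have "act g w \<in> S" unfolding e S_def using mult_closed [OF g g0(1)] by blast
        then show ?thesis by (rule wmin)
      next
        case False
        then show ?thesis using g0(3) by (intro enc_height) auto
      qed
    qed
    ultimately show "\<exists>w. w \<in> F \<and> (\<exists>g\<in>\<Gamma>. w = act g z)" using g0 by (auto simp: F_def)
  next
    fix w v assume w: "w \<in> F \<and> (\<exists>g\<in>\<Gamma>. w = act g z)" and v: "v \<in> F \<and> (\<exists>g\<in>\<Gamma>. v = act g z)"
    have le: "enc w \<le> enc v" if wv: "w \<in> F" "g \<in> \<Gamma>" "w = act g z" "h \<in> \<Gamma>" "v = act h z" for w v g h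
    proof -
      obtain g' where g': "g' \<in> \<Gamma>" "g' ** g = mat 1" using inverse_closed [OF wv(2)] by blast
      have "act (h ** g') w = act ((h ** g') ** g) z"
        unfolding wv(3) using symplectic mult_closed wv(2,4) g' z by (intro act_mult [symmetric]) auto
      also have "(h ** g') ** g = h" by (simp add: matrix_mul_assoc [symmetric] g')
      finally have "v = act (h ** g') w" by (simp add: wv(5))
      then show ?thesis using wv(1) mult_closed [OF wv(4) g'(1)] by (auto simp: F_def)
    qed
    obtain gw gv where "gw \<in> \<Gamma>" "w = act gw z" "gv \<in> \<Gamma>" "v = act gv z" using w v by blast
    then have "enc w = enc v" using le [of w gw gv v] le [of v gv gw w] w v by (intro order_antisym) auto
    then show "w = v" by (rule enc_inj)
  qed
  then have "orbit_reps \<Gamma> F" unfolding orbit_reps_def using bF by (auto simp: F_def)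
  then show ?thesis ..
qed

end

section \<open>Zero sets of polynomials and fixed points of group elements\<close>

inductive mpoly :: "'i set \<Rightarrow> (('i \<Rightarrow> real) \<Rightarrow> complex) \<Rightarrow> bool" for I where
  var: "p \<in> I \<Longrightarrow> mpoly I (\<lambda>x. of_real (x p))"
| const: "mpoly I (\<lambda>x. c)"
| add: "mpoly I f \<Longrightarrow> mpoly I g \<Longrightarrow> mpoly I (\<lambda>x. f x + g x)"
| mult: "mpoly I f \<Longrightarrow> mpoly I g \<Longrightarrow> mpoly I (\<lambda>x. f x * g x)"

lemma mpoly_sum: "(\<And>a. a \<in> A \<Longrightarrow> mpoly I (f a)) \<Longrightarrow> mpoly I (\<lambda>x. \<Sum>a\<in>A. f a x)"
  by (induction A rule: infinite_finite_induct) (auto intro: mpoly.intros)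

lemma mpoly_diff: "mpoly I f \<Longrightarrow> mpoly I g \<Longrightarrow> mpoly I (\<lambda>x. f x - g x)"
  using mpoly.add [of I f "\<lambda>x. (- 1) * g x"] mpoly.mult [of I "\<lambda>x. - 1" g] mpoly.const by auto

lemma mpoly_restrict: "mpoly (insert k I) f \<Longrightarrow> mpoly I (\<lambda>x. f (x(k := c)))"
proof (induction rule: mpoly.induct)
  case (var p)
  then show ?case by (cases "p = k") (auto intro: mpoly.intros)
qed (auto intro: mpoly.intros)

lemma mpoly_slice: "mpoly I f \<Longrightarrow> \<exists>q. polyfun q \<and> (\<forall>t. f (x(k := t)) = q (of_real t))"
proof (induction rule: mpoly.induct)
  case (var p)
  show ?case
  proof (cases "p = k")
    case True
    then show ?thesis by (intro exI [of _ "\<lambda>t. t"]) auto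
  next
    case False
    then show ?thesis by (intro exI [of _ "\<lambda>t. of_real (x p)"]) auto
  qed
next
  case (const c)
  then show ?case by (intro exI [of _ "\<lambda>t. c"]) auto
next
  case (add f g)
  then obtain q r where "polyfun q" "polyfun r" "\<And>t. f (x(k := t)) = q (of_real t)" "\<And>t. g (x(k := t)) = r (of_real t)" by blast
  then show ?case by (intro exI [of _ "\<lambda>t. q t + r t"] conjI polyfun_add) (simp_all del: fun_upd_apply)
next
  case (mult f g)
  then obtain q r where "polyfun q" "polyfun r" "\<And>t. f (x(k := t)) = q (of_real t)" "\<And>t. g (x(k := t)) = r (of_real t)" by blast
  then show ?case by (intro exI [of _ "\<lambda>t. q t * r t"] conjI polyfun_mult) (simp_all del: fun_upd_apply)
qed

lemma mpoly_measurable: "mpoly I f \<Longrightarrow> f \<in> borel_measurable (\<Pi>\<^sub>M p\<in>I. (lborel :: real measure))"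
proof (induction rule: mpoly.induct)
  case (var p)
  have [measurable]: "(\<lambda>x. x p) \<in> borel_measurable (\<Pi>\<^sub>M p\<in>I. (lborel :: real measure))"
    using measurable_component_singleton [OF var, of "\<lambda>_. lborel"] by simp
  show ?case by measurable
qed auto

lemma polyfun_AE_nonzero:
  assumes "polyfun q" "q s \<noteq> 0"
  shows "AE t in lborel. q (of_real t) \<noteq> 0"
proof -
  have "finite {t. q t = 0}" using polyfun_eq_0 assms by blast
  then have "finite (complex_of_real -` {t. q t = 0})" by (intro finite_vimageI inj_of_real)
  then have "emeasure lborel (complex_of_real -` {t. q t = 0}) = 0" by (intro emeasure_lborel_countable countable_finite)
  moreover have "complex_of_real -` {t. q t = 0} \<in> sets lborel"
    using \<open>finite (complex_of_real -` {t. q t = 0})\<close> by (simp add: finite_imp_closed borel_closed)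
  ultimately show ?thesis by (intro AE_I [of _ _ "complex_of_real -` {t. q t = 0}"]) auto
qed

text \<open>For almost every choice of the other variables the slice in variable k is a nonzero
  polynomial, which has finitely many roots; Fubini does the rest.\<close>

lemma mpoly_AE_nonzero:
  assumes "finite I" "mpoly I f" "f x0 \<noteq> 0"
  shows "AE x in (\<Pi>\<^sub>M p\<in>I. (lborel :: real measure)). f x \<noteq> 0"
  using assms
proof (induction I arbitrary: f)
  case empty
  from empty(1) have "f x = f y" for x y by (induction rule: mpoly.induct) auto
  then show ?case using empty(2) by (metis (mono_tags, lifting) AE_I2)
next
  case (insert k I)
  interpret ps: product_sigma_finite "\<lambda>p::'a. (lborel :: real measure)"
    by (simp add: product_sigma_finite_def lborel.sigma_finite_measure_axioms)
  let ?P = "\<Pi>\<^sub>M p\<in>I. (lborel :: real measure)" and ?Q = "\<Pi>\<^sub>M p\<in>insert k I. (lborel :: real measure)"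
  have fm [measurable]: "f \<in> borel_measurable ?Q" by (rule mpoly_measurable [OF insert(4)])
  define N where "N = {x \<in> space ?Q. f x = 0}"
  have N: "N \<in> sets ?Q" unfolding N_def by measurable
  \<comment> \<open>Freezing variable k at its value in x0 keeps the polynomial nonzero at x0, as
    the induction hypothesis demands.\<close>
  have "AE x in ?P. f (x(k := x0 k)) \<noteq> 0"
    by (rule insert.IH [OF mpoly_restrict [OF insert(4)]]) (use insert in simp)
  then have "AE x in ?P. (\<integral>\<^sup>+ t. indicator N (x(k := t)) \<partial>lborel) = 0"
  proof eventually_elim
    case (elim x)
    obtain q where q: "polyfun q" "\<And>t. f (x(k := t)) = q (of_real t)" using mpoly_slice [OF insert(4)] by blast
    have "AE t in lborel. q (of_real t) \<noteq> 0"
      using polyfun_AE_nonzero [OF q(1), of "of_real (x0 k)"] elim by (simp add: q(2) [symmetric])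
    then have "AE t in lborel. (indicator N (x(k := t)) :: ennreal) = 0"
      by eventually_elim (simp add: N_def q(2))
    then show ?case by (simp cong: nn_integral_cong_AE)
  qed
  then have "(\<integral>\<^sup>+ x. (\<integral>\<^sup>+ t. indicator N (x(k := t)) \<partial>lborel) \<partial>?P) = 0"
    by (simp cong: nn_integral_cong_AE)
  moreover have "emeasure ?Q N = (\<integral>\<^sup>+ x. (\<integral>\<^sup>+ t. indicator N (x(k := t)) \<partial>lborel) \<partial>?P)"
    using N by (subst ps.product_nn_integral_insert [symmetric]) (use insert in auto)
  ultimately have "emeasure ?Q N = 0" by simp
  then show ?case using N by (intro AE_I [of _ _ N]) (auto simp: N_def)
qed

text \<open>Testing with E_ii kills the off-diagonal entries of D; testing with E_ij + E_ji equates
  its diagonal entries.\<close>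

lemma scalar_from_sym_commuting:
  fixes D :: "real^'n^'n"
  assumes "\<And>Y. transpose Y = Y \<Longrightarrow> Y ** D = D ** Y"
  shows "\<exists>l. D = mat l"
proof -
  define E where "E a b = (\<chi> i j. if i = a \<and> j = b then 1 else (0::real))" for a b :: 'n
  have ED: "(E a b ** D) $ i $ j = (if i = a then D $ b $ j else 0)" for a b i j
  proof -
    have "(\<Sum>k\<in>UNIV. (if i = a \<and> k = b then 1 else 0) * D $ k $ j) = (\<Sum>k\<in>{b}. if i = a then D $ b $ j else 0)"
      by (rule sum.mono_neutral_cong_right) auto
    then show ?thesis by (simp add: matrix_matrix_mult_def E_def)
  qed
  have DE: "(D ** E a b) $ i $ j = (if j = b then D $ i $ a else 0)" for a b i j
  proof -
    have "(\<Sum>k\<in>UNIV. D $ i $ k * (if k = a \<and> j = b then 1 else 0)) = (\<Sum>k\<in>{a}. if j = b then D $ i $ a else 0)"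
      by (rule sum.mono_neutral_cong_right) auto
    then show ?thesis by (simp add: matrix_matrix_mult_def E_def)
  qed
  have c: "(E a b + E b a) ** D = D ** (E a b + E b a)" for a b
    by (rule assms) (simp add: vec_eq_iff transpose_def E_def conj_commute add.commute)
  have off: "D $ i $ j = 0" if "i \<noteq> j" for i j
  proof -
    have "((E i i + E i i) ** D) $ i $ j = (D ** (E i i + E i i)) $ i $ j" by (simp only: c)
    then show ?thesis using that unfolding matrix_add_ldistrib matrix_add_rdistrib vector_add_component ED DE by simp
  qed
  have eq: "D $ i $ i = D $ j $ j" for i j
  proof (cases "i = j")
    case False
    have "((E i j + E j i) ** D) $ i $ j = (D ** (E i j + E j i)) $ i $ j" by (simp only: c)
    then show ?thesis using False by (simp add: matrix_add_ldistrib matrix_add_rdistrib ED DE)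
  qed simp
  define l where "l = D $ (SOME i. True) $ (SOME i. True)"
  have "D $ i $ i = l" for i unfolding l_def by (rule eq)
  then have "D = mat l" using off by (auto simp: vec_eq_iff mat_def)
  then show ?thesis ..
qed

text \<open>The fixed point equation with denominators cleared: a polynomial in the entries of z, to
  which \<open>mpoly_AE_nonzero\<close> applies.\<close>

definition fix_eq :: "real^('n::finite+'n)^('n+'n) \<Rightarrow> complex^'n^'n \<Rightarrow> complex^'n^'n" where
  "fix_eq g z = z ** (cmat (blockC g) ** z + cmat (blockD g)) - (cmat (blockA g) ** z + cmat (blockB g))"

text \<open>With x fixed, separate real and imaginary parts. The real part at y = 0 and at y = 1
  differs by C, so C = 0. The imaginary part becomes y D = A y for all symmetric y, which makes D =
  A scalar; then B = 0, and the symplectic relation gives the square 1.\<close>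

lemma fix_eq_trivial:
  fixes x :: "real^'n^'n"
  assumes g: "symplectic g" and x: "transpose x = x"
    and 0: "\<And>y. transpose y = y \<Longrightarrow> fix_eq g (cmat x + mat \<i> ** cmat y) = 0"
  shows "g = mat 1 \<or> g = - mat 1"
proof -
  define A B C D where "A = blockA g" and "B = blockB g" and "C = blockC g" and "D = blockD g"
  have split: "x ** C ** x - y ** C ** y + x ** D - A ** x - B = 0 \<and> x ** C ** y + y ** C ** x + y ** D - A ** y = 0"
    if "transpose y = y" for y
  proof -
    have e: "fix_eq g (cmat x + mat \<i> ** cmat y) =
      cmat (x ** C ** x - y ** C ** y + x ** D - A ** x - B) + mat \<i> ** cmat (x ** C ** y + y ** C ** x + y ** D - A ** y)"
    proof -
      have ii: "X ** (mat \<i> ** Y) = mat \<i> ** (X ** Y)" if "X \<in> {cmat x, cmat y, cmat A, cmat C}" for X Y :: "complex^'n^'n"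
        by (simp only: matrix_mul_assoc mat_commute [of X])
      have jj: "mat \<i> ** (mat \<i> ** Y) = - Y" for Y :: "complex^'n^'n"
        by (simp add: matrix_mul_assoc mat_minus)
      show ?thesis
        unfolding fix_eq_def A_def [symmetric] B_def [symmetric] C_def [symmetric] D_def [symmetric]
        by (simp add: mat_ring cmat_add cmat_diff cmat_mult ii jj algebra_simps)
    qed
    have "cmat P + mat \<i> ** cmat Q = 0 \<Longrightarrow> P = 0 \<and> Q = 0" for P Q :: "real^'n^'n"
      by (simp add: vec_eq_iff mat_mult_left_nth complex_eq_iff)
    then show ?thesis using 0 [OF that] unfolding e by blast
  qed
  have s0: "x ** C ** x + x ** D - A ** x - B = 0" using split [of 0] by (simp add: transpose_def vec_eq_iff)
  have s1: "x ** C ** x - C + x ** D - A ** x - B = 0" using split [of "mat 1"] by (simp add: transpose_mat)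
  have "C = (x ** C ** x + x ** D - A ** x - B) - (x ** C ** x - C + x ** D - A ** x - B)" by simp
  then have C0: "C = 0" unfolding s0 s1 by simp
  have DA: "y ** D = A ** y" if "transpose y = y" for y using split [OF that] by (simp add: C0)
  have AD: "D = A" using DA [of "mat 1"] by (simp add: transpose_mat)
  obtain l where l: "D = mat l" using scalar_from_sym_commuting [of D] DA AD by metis
  have B0: "B = 0" using s0 DA [OF x] by (simp add: C0)
  have "transpose D ** A = mat 1" using g by (simp add: symplectic_def A_def [symmetric] B_def [symmetric] C_def [symmetric] D_def [symmetric] C0)
  then have "mat (l * l) = (mat 1 :: real^'n^'n)" by (simp add: AD [symmetric] l transpose_mat)
  then have "(mat (l * l) :: real^'n^'n) $ i $ i = mat 1 $ i $ i" for i by simp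
  then have "l * l = 1" by (simp add: mat_def)
  then have "l = 1 \<or> l = - 1" by (metis square_eq_1_iff)
  then show ?thesis
    using A_def B_def C_def D_def l AD B0 C0
    by (auto simp: block_eq_iff [of g] block_mat block_minus mat_minus)
qed

text \<open>For every x some y violates the equation, by \<open>fix_eq_trivial\<close>; hence for
  every x almost every y does.\<close>

lemma fixed_points_null:
  fixes g :: "real^('n::{finite,linorder}+'n)^('n+'n)"
  assumes g: "symplectic g" and ne: "g \<noteq> mat 1" "g \<noteq> - mat 1"
  shows "AE z in siegel_measure. act g z \<noteq> z"
proof -
  let ?P = "\<Pi>\<^sub>M p\<in>(upper_index :: ('n \<times> 'n) set). (lborel :: real measure)"
  interpret sf: sigma_finite_measure ?P by (rule sigma_finite_PiM_lborel [OF finite_upper_index])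
  have cont: "continuous_on UNIV (fix_eq g)" unfolding fix_eq_def by (intro continuous_intros)
  define Z where "Z = {z. fix_eq g z \<noteq> 0}"
  have "open Z" unfolding Z_def by (intro open_Collect_neq cont continuous_intros)
  then have Z: "Z \<in> sets borel" by simp
  have m: "(\<lambda>xy. toM (of_xy xy)) \<in> borel_measurable M0" by (rule measurable_compose [OF measurable_of_xy borel_toM])
  have "AE y in ?P. toM (of_xy (x, y)) \<in> Z" for x :: "'n \<times> 'n \<Rightarrow> real"
  proof -
    have sx: "transpose (sym_of x) = sym_of x" by (simp add: vec_eq_iff transpose_def sym_of_def min.commute max.commute)
    obtain y where y: "transpose y = y" "fix_eq g (cmat (sym_of x) + mat \<i> ** cmat y) \<noteq> 0"
      using fix_eq_trivial [OF g sx] ne by blast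
    then obtain i j where ij: "fix_eq g (cmat (sym_of x) + mat \<i> ** cmat y) $ i $ j \<noteq> 0" by (auto simp: vec_eq_iff)
    define y0 where "y0 p = y $ fst p $ snd p" for p
    have "sym_of y0 = y"
    proof -
      have "y $ r $ s = y $ s $ r" for r s using y(1) by (metis (no_types, lifting) transpose_def vec_lambda_beta)
      then show ?thesis by (auto simp: vec_eq_iff sym_of_def y0_def min_def max_def)
    qed
    then have y0: "fix_eq g (toM (of_xy (x, y0))) $ i $ j \<noteq> 0" using ij by (simp add: toM_of_xy mscale_eq)
    have me: "mpoly upper_index (\<lambda>y. toM (of_xy (x, y)) $ r $ s)" for r s
    proof -
      have "(\<lambda>y. toM (of_xy (x, y)) $ r $ s) = (\<lambda>y. of_real (x (min r s, max r s)) + \<i> * of_real (y (min r s, max r s)))"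
        by (simp add: toM_of_xy sym_of_def)
      then show ?thesis
        by (simp only:) (rule mpoly.add [OF mpoly.const mpoly.mult [OF mpoly.const mpoly.var [OF minmax_upper]]])
    qed
    have "mpoly upper_index (\<lambda>y. fix_eq g (toM (of_xy (x, y))) $ i $ j)"
      unfolding fix_eq_def vector_minus_component vector_add_component matrix_matrix_mult_def vec_lambda_beta
      by (intro mpoly_diff mpoly.add mpoly_sum mpoly.mult me mpoly.const)
    from mpoly_AE_nonzero [OF finite_upper_index this y0]
    show ?thesis by eventually_elim (auto simp: Z_def vec_eq_iff)
  qed
  then have "AE x in ?P. AE y in ?P. toM (of_xy (x, y)) \<in> Z" by simp
  moreover have "{xy \<in> space M0. toM (of_xy xy) \<in> Z} \<in> sets M0"
    using measurable_sets [OF m Z] by (simp add: vimage_def Int_def conj_commute)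
  ultimately have "AE xy in M0. toM (of_xy xy) \<in> Z"
    by (intro pair_sigma_finite.AE_pair_measure) (auto simp: pair_sigma_finite_def sf.sigma_finite_measure_axioms)
  then have "AE v in lborel. toM v \<in> Z"
    unfolding lborel_coord
    by (subst AE_distr_iff) (use measurable_of_xy measurable_sets [OF borel_toM Z] in \<open>auto simp: vimage_def\<close>)
  then have "AE z in distr lborel borel toM. z \<in> Z"
    by (subst AE_distr_iff) (use borel_toM Z in auto)
  moreover have "(\<lambda>z :: complex^'n::{finite,linorder}^'n::{finite,linorder}. indicator siegel z * ennreal (dens z)) \<in> borel_measurable borel"
    using borel_dens borel_siegel by measurable
  ultimately have "AE z in siegel_measure. z \<in> Z"
    unfolding siegel_measure_alt by (subst AE_density) auto
  then show ?thesis
    using AE_siegel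
  proof eventually_elim
    case (elim z)
    show ?case
    proof
      assume "act g z = z"
      then have "fix_eq g z = 0" using act_autf [OF g elim(2)] by (simp add: fix_eq_def autf_def)
      then show False using elim(1) by (simp add: Z_def)
    qed
  qed
qed

section \<open>Holomorphic averages in the disc model\<close>

lemma root_of_unity_average:
  fixes n m :: nat
  assumes "m > 0"
  shows "(\<Sum>j<m. (cis (2 * pi * real j / real m)) ^ n) / of_nat m = (if m dvd n then 1 else 0)"
proof -
  define c where "c = cis (2 * pi * real n / real m)"
  have e: "(cis (2 * pi * real j / real m)) ^ n = c ^ j" for j
    by (simp add: c_def Complex.DeMoivre mult_ac)
  have cm: "c ^ m = 1"
  proof -
    have "c ^ m = cis (2 * pi * real n)" using assms by (simp add: c_def Complex.DeMoivre)
    also have "\<dots> = 1" by (rule cis_multiple_2pi) simp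
    finally show ?thesis .
  qed
  show ?thesis
  proof (cases "m dvd n")
    case True
    then obtain k where "n = m * k" by auto
    then have "2 * pi * real n / real m = 2 * pi * real k" using assms by simp
    then have "c = cis (2 * pi * real k)" by (simp only: c_def)
    moreover have "cis (2 * pi * real k) = 1" by (rule cis_multiple_2pi) simp
    ultimately have "c = 1" by (simp only:)
    then show ?thesis using True assms by (simp add: e)
  next
    case False
    have "c \<noteq> 1"
    proof
      assume "c = 1"
      then have "cos (2 * pi * real n / real m) = 1" by (metis c_def cis.sel(1) one_complex.sel(1))
      then obtain x where "2 * pi * real n / real m = real_of_int x * 2 * pi"
        using cos_one_2pi_int [THEN iffD1] by fastforce
      then have "2 * pi * real n = 2 * pi * (of_int x * real m)" using assms by (simp add: field_simps)
      then have "real n = of_int x * real m" by (simp only: mult_cancel_left) simp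
      then have "real_of_int (int n) = real_of_int (x * int m)" by simp
      then have "int n = x * int m" by (simp only: of_int_eq_iff)
      then have "int m dvd int n" by simp
      then show False using False by simp
    qed
    then have "(\<Sum>j<m. c ^ j) = 0" by (simp add: geometric_sum cm)
    then show ?thesis using False by (simp add: e)
  qed
qed

text \<open>Averaging over the m-th roots of unity retains the Taylor coefficients of index
  divisible by m, so the error is bounded by the tail of an absolutely convergent series.\<close>

lemma holomorphic_average:
  assumes f: "f holomorphic_on ball 0 r" and r: "r > 1"
  shows "(\<lambda>m. (\<Sum>j<Suc m. f (cis (2 * pi * real j / real (Suc m)))) / of_nat (Suc m)) \<longlonglongrightarrow> f 0"
proof -
  define a where "a n = (deriv ^^ n) f 0 / fact n" for n
  have s: "(\<lambda>n. a n * w ^ n) sums f w" if "cmod w < r" for w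
    using holomorphic_power_series [OF f, of w] that by (simp add: a_def)
  \<comment> \<open>A point of convergence strictly between 1 and r, from which absolute convergence
    at 1 follows.\<close>
  have "summable (\<lambda>n. a n * (of_real ((1 + r) / 2)) ^ n)"
  proof (rule sums_summable [OF s])
    have "cmod (of_real ((1 + r) / 2)) = (1 + r) / 2" using r by (subst norm_of_real) simp
    then show "cmod (of_real ((1 + r) / 2)) < r" using r by simp
  qed
  then have "summable (\<lambda>n. norm (a n * 1 ^ n))"
  proof (rule powser_insidea)
    have "cmod (of_real ((1 + r) / 2)) = (1 + r) / 2" using r by (subst norm_of_real) simp
    then show "cmod 1 < cmod (of_real ((1 + r) / 2))" using r by simp
  qed
  then have sa: "summable (\<lambda>n. norm (a n))" by simp
  define c where "c m n = (if Suc m dvd n then 1 else 0 :: complex)" for m n :: nat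
  have avg: "(\<Sum>j<Suc m. f (cis (2 * pi * real j / real (Suc m)))) / of_nat (Suc m) = (\<Sum>n. a n * c m n)" for m
  proof -
    have "(\<lambda>n. (\<Sum>j<Suc m. a n * cis (2 * pi * real j / real (Suc m)) ^ n) / of_nat (Suc m)) sums
      ((\<Sum>j<Suc m. f (cis (2 * pi * real j / real (Suc m)))) / of_nat (Suc m))"
      by (intro sums_divide sums_sum s) (use r in \<open>simp add: norm_cis\<close>)
    moreover have "(\<Sum>j<Suc m. a n * cis (2 * pi * real j / real (Suc m)) ^ n) / of_nat (Suc m) = a n * c m n" for n
    proof -
      have "(\<Sum>j<Suc m. a n * cis (2 * pi * real j / real (Suc m)) ^ n) / of_nat (Suc m) =
        a n * ((\<Sum>j<Suc m. cis (2 * pi * real j / real (Suc m)) ^ n) / of_nat (Suc m))"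
        unfolding sum_distrib_left [symmetric] by (rule times_divide_eq_right [symmetric])
      then show ?thesis by (simp only: c_def root_of_unity_average [OF zero_less_Suc])
    qed
    ultimately have "(\<lambda>n. a n * c m n) sums ((\<Sum>j<Suc m. f (cis (2 * pi * real j / real (Suc m)))) / of_nat (Suc m))"
      by (simp only:)
    then show ?thesis by (simp add: sums_iff)
  qed
  have le: "cmod ((\<Sum>n. a n * c m n) - a 0) \<le> (\<Sum>n. norm (a (n + Suc m)))" for m
  proof -
    have sc: "summable (\<lambda>n. norm (a n * c m n))"
      by (rule summable_comparison_test' [OF sa, of 0]) (auto simp: c_def)
    have "(\<Sum>n. a n * c m n) = (\<Sum>n. a (n + Suc m) * c m (n + Suc m)) + (\<Sum>n<Suc m. a n * c m n)"
      by (rule suminf_split_initial_segment [OF summable_norm_cancel [OF sc]])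
    also have "(\<Sum>n<Suc m. a n * c m n) = (\<Sum>n\<in>{0}. a n * c m n)"
      by (rule sum.mono_neutral_right) (auto simp: c_def dest: dvd_imp_le)
    also have "\<dots> = a 0" by (simp add: c_def)
    finally have "cmod ((\<Sum>n. a n * c m n) - a 0) = cmod (\<Sum>n. a (n + Suc m) * c m (n + Suc m))" by simp
    also have "\<dots> \<le> (\<Sum>n. norm (a (n + Suc m) * c m (n + Suc m)))"
      by (rule summable_norm) (rule summable_ignore_initial_segment [OF sc])
    also have "\<dots> \<le> (\<Sum>n. norm (a (n + Suc m)))"
      by (rule suminf_le [OF _ summable_ignore_initial_segment [OF sc] summable_ignore_initial_segment [OF sa]])
        (simp add: c_def)
    finally show ?thesis .
  qed
  have "(\<lambda>m. \<Sum>n. norm (a (n + Suc m))) \<longlonglongrightarrow> 0"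
    using LIMSEQ_Suc [OF suminf_exist_split2 [OF sa]] by simp
  then have "(\<lambda>m. (\<Sum>n. a n * c m n) - a 0) \<longlonglongrightarrow> 0"
    by (rule Lim_null_comparison [rotated]) (rule always_eventually [OF allI [OF le]])
  moreover have "a 0 = f 0" by (simp add: a_def)
  ultimately show ?thesis unfolding avg by (simp add: LIM_zero_iff)
qed

lemma bounded_bilinear_mat_mult: "bounded_bilinear (\<lambda>u (M::complex^'n^'n). mat u ** M)"
proof -
  have "bilinear (\<lambda>u (M::complex^'n^'n). mat u ** M)"
    unfolding bilinear_def
    by (auto intro!: linearI simp: vec_eq_iff mat_mult_left_nth algebra_simps)
  then show ?thesis by (simp add: bilinear_conv_bounded_bilinear)
qed

text \<open>The resolvent identity N(t) - N(s) = (t - s) N(s) w N(t) is the factorisation required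
  by \<open>has_derivative_bilinear_continuous\<close>.\<close>

lemma resolvent_derivative:
  fixes w :: "complex^'n^'n"
  assumes inv: "\<And>t. t \<in> S \<Longrightarrow> invertible (mat 1 - mat t ** w)" and s: "s \<in> S"
  shows "((\<lambda>t. matrix_inv (mat 1 - mat t ** w)) has_derivative
    (\<lambda>u. mat u ** (matrix_inv (mat 1 - mat s ** w) ** w ** matrix_inv (mat 1 - mat s ** w)))) (at s within S)"
proof -
  define N where "N t = matrix_inv (mat 1 - mat t ** w)" for t
  have "(N has_derivative (\<lambda>u. mat u ** (N s ** w ** N s))) (at s within S)"
  proof (rule has_derivative_bilinear_continuous [OF bounded_bilinear_mat_mult, where k = "\<lambda>t. N s ** w ** N t"])
    fix t assume t: "t \<in> S"
    have "(mat 1 - mat s ** w) - (mat 1 - mat t ** w) = mat (t - s) ** w"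
      by (simp add: vec_eq_iff mat_mult_left_nth algebra_simps)
    then have "N s ** ((mat 1 - mat s ** w) - (mat 1 - mat t ** w)) ** N t = N s ** (mat (t - s) ** w) ** N t" by simp
    moreover have "N s ** ((mat 1 - mat s ** w) - (mat 1 - mat t ** w)) ** N t = N t - N s"
    proof -
      have "N s ** ((mat 1 - mat s ** w) - (mat 1 - mat t ** w)) ** N t =
        (N s ** (mat 1 - mat s ** w)) ** N t - N s ** ((mat 1 - mat t ** w) ** N t)"
        by (simp only: matrix_diff_ldistrib matrix_diff_rdistrib matrix_mul_assoc)
      then show ?thesis using inv [OF s] inv [OF t] by (simp only: N_def matrix_inv_cancel matrix_mul_lid matrix_mul_rid)
    qed
    moreover have "N s ** (mat (t - s) ** w) ** N t = mat (t - s) ** (N s ** w ** N t)"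
      by (simp only: matrix_mul_assoc mat_commute [of "N s"])
    ultimately show "N t - N s = mat (t - s) ** (N s ** w ** N t)" by simp
  next
    have "continuous_on S (\<lambda>t. mat 1 - mat t ** w)"
      unfolding continuous_on_matrix vector_minus_component mat_mult_left_nth by (intro allI continuous_intros)
    then have "continuous_on S N"
      unfolding N_def by (rule continuous_on_minv) (use inv in auto)
    then have "continuous_on S (\<lambda>t. N s ** w ** N t)"
      by (rule continuous_on_mmult [OF continuous_on_const])
    then show "continuous (at s within S) (\<lambda>t. N s ** w ** N t)"
      using s by (simp add: continuous_on_eq_continuous_within)
  qed
  then show ?thesis unfolding N_def [abs_def] .
qed

lemma complex_polynomial_field_differentiable:
  assumes "complex_polynomial_fun p" "\<And>i j. (\<lambda>t. M t $ i $ j) field_differentiable (at s within S)"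
  shows "(\<lambda>t. p (M t)) field_differentiable (at s within S)"
  using assms(1)
  by induction (auto intro!: derivative_intros assms(2) field_differentiable_add field_differentiable_mult field_differentiable_const)

definition transfer_form where
  "transfer_form \<rho> f w = \<rho> (matrix_inv (mat 1 - w)) *v f (icay w)"

text \<open>Here w occurs only inside the resolvent, so the derivative along t -> t w comes from
  \<open>resolvent_derivative\<close> alone.\<close>

lemma icay_alt:
  assumes "w \<in> disc"
  shows "icay w = mat \<i> ** (mat 2 ** matrix_inv (mat 1 - w) - mat 1)"
proof -
  have e: "mat 1 + w = mat 2 - (mat 1 - w)" by (simp add: vec_eq_iff mat_def)
  have "(mat 1 + w) ** matrix_inv (mat 1 - w) = mat 2 ** matrix_inv (mat 1 - w) - (mat 1 - w) ** matrix_inv (mat 1 - w)"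
    unfolding e by (rule matrix_diff_rdistrib)
  then have "(mat 1 + w) ** matrix_inv (mat 1 - w) = mat 2 ** matrix_inv (mat 1 - w) - mat 1"
    using disc_invertible1 [OF assms] by (simp only: matrix_inv_cancel)
  then show ?thesis by (simp only: icay_def)
qed

text \<open>Restricting to the line t -> t w reduces holomorphy to one variable: along it both the
  argument of \<open>\<rho>\<close> and the point of the half space are functions of the resolvent.
  The line stays in the half space, which suits a derivative of f taken within it.\<close>

lemma transfer_form_holomorphic:
  fixes f :: "complex^'n^'n \<Rightarrow> complex^'d"
  assumes rep: "polynomial_rep \<rho>" and f: "holomorphic_siegel f" and w: "w \<in> disc"
  shows "\<exists>r>1. (\<forall>t. cmod t < r \<longrightarrow> mat t ** w \<in> disc) \<and>
    (\<forall>i. (\<lambda>t. transfer_form \<rho> f (mat t ** w) $ i) holomorphic_on ball 0 r)"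
proof -
  obtain r where r: "r > 1" "\<And>t. cmod t < r \<Longrightarrow> mat t ** w \<in> disc" using disc_star [OF w] by blast
  define S where "S = ball (0::complex) r"
  have S: "mat t ** w \<in> disc" if "t \<in> S" for t using that r(2) by (simp add: S_def)
  define N where "N t = matrix_inv (mat 1 - mat t ** w)" for t
  have inv: "invertible (mat 1 - mat t ** w)" if "t \<in> S" for t using S [OF that] disc_invertible1 by blast
  have dN: "(N has_derivative (\<lambda>u. mat u ** (N s ** w ** N s))) (at s within S)" if "s \<in> S" for s
    unfolding N_def by (rule resolvent_derivative [OF inv that])
  have fN: "(\<lambda>t. N t $ i $ j) field_differentiable (at s within S)" if s: "s \<in> S" for s i j
  proof -
    have "((\<lambda>t. N t $ i $ j) has_derivative (\<lambda>u. (mat u ** (N s ** w ** N s)) $ i $ j)) (at s within S)"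
      by (intro bounded_linear.has_derivative [OF bounded_linear_vec_nth] dN s)
    moreover have "(\<lambda>u. (mat u ** (N s ** w ** N s)) $ i $ j) = (*) ((N s ** w ** N s) $ i $ j)"
      by (simp add: mat_mult_left_nth fun_eq_iff mult.commute)
    ultimately show ?thesis unfolding field_differentiable_def has_field_derivative_def by auto
  qed
  have ff: "(\<lambda>t. f (icay (mat t ** w)) $ i) field_differentiable (at s within S)" if s: "s \<in> S" for s i
  proof -
    define X where "X = N s ** w ** N s"
    have "((\<lambda>t. mat \<i> ** (mat 2 ** N t - mat 1)) has_derivative (\<lambda>u. mat \<i> ** (mat 2 ** (mat u ** X)))) (at s within S)"
    proof -
      have bl: "bounded_linear (\<lambda>M::complex^'n^'n. mat \<i> ** (mat 2 ** M))"
      proof -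
        have "bounded_linear (\<lambda>M::complex^'n^'n. mat (2 * \<i>) ** M)"
          using bounded_bilinear.bounded_linear_right [OF bounded_bilinear_mat_mult] .
        then show ?thesis by (simp add: matrix_mul_assoc mult.commute)
      qed
      have "((\<lambda>t. mat \<i> ** (mat 2 ** N t) - mat \<i>) has_derivative (\<lambda>u. mat \<i> ** (mat 2 ** (mat u ** X)) - 0)) (at s within S)"
        unfolding X_def by (intro has_derivative_diff bounded_linear.has_derivative [OF bl] dN s has_derivative_const)
      then show ?thesis by (simp add: matrix_diff_ldistrib)
    qed
    then have di: "((\<lambda>t. icay (mat t ** w)) has_derivative (\<lambda>u. mat \<i> ** (mat 2 ** (mat u ** X)))) (at s within S)"
      by (rule has_derivative_transform [OF s, rotated]) (simp add: icay_alt S N_def)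
    define z where "z = icay (mat s ** w)"
    have "z \<in> siegel" unfolding z_def by (intro icay_siegel S s)
    then obtain L where L: "(f has_derivative L) (at z within siegel)" "\<And>c w. L (mscale c w) = c *s L w"
      using f unfolding holomorphic_siegel_def by blast
    have "((\<lambda>t. f (icay (mat t ** w))) has_derivative (\<lambda>u. L (mat \<i> ** (mat 2 ** (mat u ** X))))) (at s within S)"
    proof (rule has_derivative_in_compose [OF di])
      show "(f has_derivative L) (at (icay (mat s ** w)) within (\<lambda>t. icay (mat t ** w)) ` S)"
        using L(1) unfolding z_def by (rule has_derivative_subset) (use icay_siegel S in auto)
    qed
    then have "((\<lambda>t. f (icay (mat t ** w)) $ i) has_derivative (\<lambda>u. L (mat \<i> ** (mat 2 ** (mat u ** X))) $ i)) (at s within S)"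
      by (rule bounded_linear.has_derivative [OF bounded_linear_vec_nth])
    moreover have "(\<lambda>u. L (mat \<i> ** (mat 2 ** (mat u ** X))) $ i) = (*) ((2 * \<i>) * L X $ i)"
    proof
      fix u
      have "mat \<i> ** (mat 2 ** (mat u ** X)) = mscale (2 * \<i> * u) X" by (simp add: mscale_eq matrix_mul_assoc mult_ac)
      then show "L (mat \<i> ** (mat 2 ** (mat u ** X))) $ i = (2 * \<i>) * L X $ i * u" by (simp only: L(2)) simp
    qed
    ultimately show ?thesis unfolding field_differentiable_def has_field_derivative_def by auto
  qed
  obtain P where P: "\<And>i j. complex_polynomial_fun (P i j)" "\<And>g i j. invertible g \<Longrightarrow> \<rho> g $ i $ j = P i j g"
    using rep_polynomial [OF rep] by blast
  have "(\<lambda>t. transfer_form \<rho> f (mat t ** w) $ i) holomorphic_on S" for i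
  proof -
    have "(\<lambda>t. \<Sum>j\<in>UNIV. P i j (N t) * f (icay (mat t ** w)) $ j) holomorphic_on S"
      unfolding holomorphic_on_def
    proof
      fix s assume s: "s \<in> S"
      have "(\<lambda>t. P i j (N t) * f (icay (mat t ** w)) $ j) field_differentiable (at s within S)" for j
        by (rule field_differentiable_mult [OF complex_polynomial_field_differentiable [OF P(1) fN [OF s]] ff [OF s]])
      then show "(\<lambda>t. \<Sum>j\<in>UNIV. P i j (N t) * f (icay (mat t ** w)) $ j) field_differentiable (at s within S)"
        by (rule field_differentiable_sum)
    qed
    moreover have "(\<Sum>j\<in>UNIV. P i j (N t) * f (icay (mat t ** w)) $ j) = transfer_form \<rho> f (mat t ** w) $ i" if "t \<in> S" for t
      using inv [OF that] by (simp add: transfer_form_def matrix_vector_mult_def N_def P invertible_matrix_inv)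
    ultimately show ?thesis by (rule holomorphic_transform)
  qed
  then show ?thesis using r unfolding S_def by blast
qed

section \<open>The matrix 1 - w^* w under unitary transformations\<close>

lemma zeta_mscale: "mscale (1 / (2 * \<i>)) (z + iI) = zeta z"
  by (simp add: zeta_def mscale_eq)

lemma invertible_herm_cay: "z \<in> siegel \<Longrightarrow> invertible (herm (cay z))"
  unfolding herm_def cay_hermitian
  by (intro invertible_mult invertible_conj_transpose invertible_matrix_inv invertible_zeta)
    (auto simp only: invertible_cmat intro: pos_def_invertible siegel_Im)

text \<open>A rotation w -> k w k^T conjugates w^* w by the entrywise conjugate of k; taking k to be
  the conjugate of u makes this conjugation by u itself.\<close>

lemma herm_unitary:
  assumes u: "unitary_matrix u"
  shows "herm (map_matrix cnj u ** w ** transpose (map_matrix cnj u)) = u ** herm w ** conj_transpose u"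
proof -
  have k: "conj_transpose (map_matrix cnj u) = transpose u" "transpose (map_matrix cnj u) = conj_transpose u"
    "conj_transpose (conj_transpose u) = u"
    by (simp_all add: vec_eq_iff transpose_def)
  have 1: "transpose u ** map_matrix cnj u = mat 1"
  proof -
    have "map_matrix cnj (conj_transpose u ** u) = mat 1"
      using u by (simp add: unitary_matrix_def vec_eq_iff mat_def)
    moreover have "map_matrix cnj (conj_transpose u ** u) = transpose u ** map_matrix cnj u"
      by (simp add: vec_eq_iff matrix_matrix_mult_def transpose_def)
    ultimately show ?thesis by simp
  qed
  have "conj_transpose (map_matrix cnj u ** w ** conj_transpose u) ** (map_matrix cnj u ** w ** conj_transpose u) =
    u ** (conj_transpose w ** ((transpose u ** map_matrix cnj u) ** (w ** conj_transpose u)))"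
    by (simp add: conj_transpose_mult k matrix_mul_assoc)
  also have "\<dots> = u ** (conj_transpose w ** w) ** conj_transpose u" unfolding 1 by (simp add: matrix_mul_assoc)
  finally show ?thesis
    using u unfolding herm_def k by (simp add: matrix_diff_ldistrib matrix_diff_rdistrib unitary_matrix_def)
qed

lemma unitary_cnj_matrix: "unitary_matrix u \<Longrightarrow> unitary_matrix (map_matrix cnj u)"
proof -
  assume u: "unitary_matrix u"
  have "map_matrix cnj (u ** conj_transpose u) = mat 1" "map_matrix cnj (conj_transpose u ** u) = mat 1"
    using u by (simp_all add: unitary_matrix_def vec_eq_iff mat_def)
  moreover have "map_matrix cnj (u ** conj_transpose u) = map_matrix cnj u ** conj_transpose (map_matrix cnj u)"
    "map_matrix cnj (conj_transpose u ** u) = conj_transpose (map_matrix cnj u) ** map_matrix cnj u"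
    by (simp_all add: vec_eq_iff matrix_matrix_mult_def)
  ultimately show ?thesis by (simp add: unitary_matrix_def)
qed

lemma herm_rot_scalar:
  assumes "cmod c = 1"
  shows "herm (mat c ** w) = herm w"
proof -
  have "conj_transpose (mat c ** w) ** (mat c ** w) = mat (cnj c * c) ** (conj_transpose w ** w)"
    unfolding conj_transpose_mult conj_transpose_mat mat_commute [of "conj_transpose w"]
    by (simp only: matrix_mul_assoc [symmetric])
       (simp only: matrix_mul_assoc mat_commute [of "conj_transpose w"] mat_mat)
  also have "cnj c * c = 1"
    using assms complex_norm_square [of c] by (simp add: mult.commute)
  finally show ?thesis by (simp add: herm_def)
qed

section \<open>The averaged kernel operator\<close>

text \<open>Each of the n^2 entries of y - 1 changes the form by less than |v|^2 / n^2. This places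
  an open set of coordinates inside the half space.\<close>

lemma pos_def_near_one:
  fixes y :: "real^'n^'n"
  assumes sym: "transpose y = y"
    and y: "\<And>i j. \<bar>y $ i $ j - mat 1 $ i $ j\<bar> < 1 / real (CARD('n) * CARD('n))"
  shows "pos_def y"
  unfolding pos_def_def sym_mat_def
proof (intro conjI allI impI sym)
  fix v :: "real^'n" assume v: "v \<noteq> 0"
  define e where "e = y - mat 1"
  have b: "\<bar>v $ i * (e $ i $ j * v $ j)\<bar> < (norm v)\<^sup>2 * (1 / real (CARD('n) * CARD('n)))" for i j
  proof -
    have "\<bar>v $ i * (e $ i $ j * v $ j)\<bar> = (\<bar>v $ i\<bar> * \<bar>v $ j\<bar>) * \<bar>e $ i $ j\<bar>" by (simp add: abs_mult mult_ac)
    also have "\<dots> \<le> (norm v)\<^sup>2 * \<bar>e $ i $ j\<bar>"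
      unfolding power2_eq_square by (intro mult_right_mono mult_mono component_le_norm_cart) auto
    also have "\<dots> < (norm v)\<^sup>2 * (1 / real (CARD('n) * CARD('n)))"
      using v y [of i j] by (intro mult_strict_left_mono) (auto simp: e_def)
    finally show ?thesis .
  qed
  have "\<bar>v \<bullet> (e *v v)\<bar> = \<bar>\<Sum>i\<in>UNIV. \<Sum>j\<in>UNIV. v $ i * (e $ i $ j * v $ j)\<bar>"
    by (simp add: inner_vec_def matrix_vector_mult_def sum_distrib_left)
  also have "\<dots> \<le> (\<Sum>i\<in>UNIV. \<Sum>j\<in>UNIV. \<bar>v $ i * (e $ i $ j * v $ j)\<bar>)"
    by (rule order_trans [OF sum_abs sum_mono]) (rule sum_abs)
  also have "\<dots> < (\<Sum>i\<in>(UNIV::'n set). \<Sum>j\<in>(UNIV::'n set). (norm v)\<^sup>2 * (1 / real (CARD('n) * CARD('n))))"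
    by (intro sum_strict_mono b) auto
  also have "\<dots> = (norm v)\<^sup>2" by simp
  finally have "\<bar>v \<bullet> (e *v v)\<bar> < v \<bullet> v" by (simp add: power2_norm_eq_inner)
  moreover have "v \<bullet> (y *v v) = v \<bullet> v + v \<bullet> (e *v v)"
    by (simp add: e_def matrix_vector_mult_diff_rdistrib inner_diff_right)
  ultimately show "v \<bullet> (y *v v) > 0" by linarith
qed

lemma borel_measurable_siegel_measure [simp]:
  "f \<in> siegel_measure \<rightarrow>\<^sub>M N \<longleftrightarrow> f \<in> borel \<rightarrow>\<^sub>M N"
  using measurable_cong_sets [OF sets_siegel_measure refl] by blast

text \<open>The coordinates whose imaginary part is close to the identity form a nonempty open set
  of half space points, and the density is positive there. It is used to show that the scalar is
  nonzero.\<close>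

lemma siegel_measure_nonzero:
  "emeasure siegel_measure (siegel :: (complex^'n::{finite,linorder}^'n::{finite,linorder}) set) \<noteq> 0"
proof
  let ?S = "siegel :: (complex^'n::{finite,linorder}^'n::{finite,linorder}) set"
  let ?toM = "toM :: real^'n::{finite,linorder} coord \<Rightarrow> complex^'n::{finite,linorder}^'n::{finite,linorder}"
  assume "emeasure siegel_measure ?S = 0"
  then have 0: "(\<integral>\<^sup>+ v. ennreal (dens (?toM v)) * indicator (?toM -` ?S) v \<partial>lborel) = 0"
    using emeasure_siegel [OF borel_siegel, where 'a='n] by simp
  have m: "?toM \<in> borel \<rightarrow>\<^sub>M borel" by (rule borel_toM)
  have [measurable]: "?toM -` ?S \<in> sets borel" using measurable_sets [OF m borel_siegel] by simp
  have [measurable]: "(\<lambda>v. dens (?toM v)) \<in> borel_measurable borel"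
    by (rule measurable_compose [OF m borel_dens])
  have "AE v in lborel. ennreal (dens (?toM v)) * indicator (?toM -` ?S) v = 0"
    using 0 by (subst (asm) nn_integral_0_iff_AE) auto
  then have ae: "AE v in lborel. v \<notin> ?toM -` ?S"
  proof eventually_elim
    case (elim v)
    show ?case
    proof
      assume v: "v \<in> ?toM -` ?S"
      then have "ennreal (dens (?toM v)) = 0" using elim by (simp only: indicator_simps mult_1_right)
      moreover have "dens (?toM v) > 0" using v by (intro dens_pos) simp
      ultimately show False by (simp add: ennreal_eq_0_iff)
    qed
  qed
  define U where "U = (\<Inter>i. \<Inter>j. {v. \<bar>Im (?toM v $ i $ j) - mat 1 $ i $ j\<bar> < 1 / real (CARD('n) * CARD('n))})"
  have "open {v. \<bar>Im (?toM v $ i $ j) - mat 1 $ i $ j\<bar> < 1 / real (CARD('n) * CARD('n))}" for i j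
    by (intro open_Collect_less continuous_intros)
  then have "open U" unfolding U_def by (intro open_INT) auto
  have "U \<subseteq> ?toM -` ?S"
  proof
    fix v assume v: "v \<in> U"
    have t: "transpose (?toM v) = ?toM v" by (rule toM_sym)
    then have "transpose (map_matrix Im (?toM v)) = map_matrix Im (?toM v)"
      unfolding vec_eq_iff transpose_def by simp
    then have "pos_def (map_matrix Im (?toM v))"
      by (rule pos_def_near_one) (use v in \<open>simp add: U_def\<close>)
    then show "v \<in> ?toM -` ?S" using t by (simp add: siegel_def sym_mat_def)
  qed
  then have "AE v in lborel. v \<notin> U" using ae by (rule_tac AE_mp [OF ae]) auto
  then have "U \<in> null_sets lborel" using \<open>open U\<close> AE_iff_null_sets [of U lborel] by simp
  then have "negligible U" by (simp add: negligible_iff_null_sets null_sets_completionI)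
  moreover have "fromM iI \<in> U"
  proof -
    have "?toM (fromM iI) = iI" by (rule toM_fromM) (simp add: iI_def transpose_mat)
    then show ?thesis by (simp add: U_def iI_def mat_def)
  qed
  ultimately show False using open_not_negligible [OF \<open>open U\<close>] by blast
qed

lemma kappa_nonneg: "kappa z \<ge> 0"
  by (simp add: kappa_def)

lemma kappa_square: "(kappa (z :: complex^'n^'n))\<^sup>2 = cmod (det (herm (cay z))) ^ (2 * CARD('n) + 1)"
  by (simp add: kappa_def)

lemma kappa_pos:
  assumes "z \<in> siegel"
  shows "kappa z > 0"
proof -
  have "det (herm (cay z)) \<noteq> 0" using invertible_herm_cay [OF assms] by (simp add: invertible_det_nz)
  then show ?thesis by (simp add: kappa_def)
qed

lemma continuous_herm: "continuous_on UNIV herm"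
  unfolding herm_def [abs_def] by (intro continuous_intros)

lemma kappa_bounded: "\<exists>B>0. \<forall>z\<in>siegel. kappa (z::complex^'n^'n) \<le> B"
proof -
  have "continuous_on UNIV (\<lambda>w::complex^'n^'n. sqrt (cmod (det (herm w)) ^ (2 * CARD('n) + 1)))"
    unfolding herm_def by (intro continuous_intros)
  from continuous_disc_bound [OF this] show ?thesis unfolding kappa_def by (metis cay_disc)
qed

lemma kappa_integrable: "integrable siegel_measure (kappa :: complex^'n::{finite,linorder}^'n::{finite,linorder} \<Rightarrow> real)"
proof (rule integrableI_nonneg)
  show "(kappa :: complex^'n::{finite,linorder}^'n::{finite,linorder} \<Rightarrow> real) \<in> borel_measurable siegel_measure"
    using borel_kappa by simp
qed (use kappa_integral in \<open>auto simp: kappa_nonneg\<close>)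

lemma continuous_on_cay: "continuous_on siegel cay"
  unfolding cay_def [abs_def] by (intro continuous_intros invertible_plus_i)

lemma continuous_on_zeta: "continuous_on siegel zeta"
  unfolding zeta_def [abs_def] by (intro continuous_intros)

lemma continuous_on_herm_cay: "continuous_on siegel (\<lambda>z. herm (cay z))"
  unfolding herm_def by (intro continuous_intros continuous_on_cay)

lemma integral_act:
  fixes g :: "real^('n::{finite,linorder}+'n)^('n+'n)"
    and h :: "complex^'n::{finite,linorder}^'n::{finite,linorder} \<Rightarrow> 'b::{banach,second_countable_topology}"
  assumes g: "symplectic g" and h: "h \<in> borel_measurable borel"
  shows "(LINT z|siegel_measure. h (act g z)) = (LINT z|siegel_measure. h z)"
proof -
  have "act g \<in> siegel_measure \<rightarrow>\<^sub>M borel" using borel_act [of g] by simp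
  then have "(LINT z|distr siegel_measure borel (act g). h z) = (LINT z|siegel_measure. h (act g z))"
    using h by (rule integral_distr)
  then show ?thesis by (simp only: siegel_measure_invariant [OF g])
qed

lemma holomorphic_siegel_continuous: "holomorphic_siegel f \<Longrightarrow> continuous_on siegel f"
  unfolding holomorphic_siegel_def continuous_on_eq_continuous_within
  using has_derivative_continuous by blast

locale siegel_weight =
  fixes \<rho> :: "complex^'n::{finite,linorder}^'n::{finite,linorder} \<Rightarrow> complex^'d^'d"
    and \<omega> :: "'n \<Rightarrow> int"
  assumes rep: "polynomial_rep \<rho>" and irr: "irreducible_rep \<rho>" and hw: "highest_weight \<rho> \<omega>"
    and anti: "antimono \<omega>" and large: "\<omega> (Max UNIV) > 2 * int CARD('n)"
begin

text \<open>The cutoff by the indicator makes the kernel Borel on all matrices, while continuity is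
  available only on the half space.\<close>

definition kernel_op :: "complex^'n::{finite,linorder}^'n::{finite,linorder} \<Rightarrow> complex^'d^'d" where
  "kernel_op z = indicator siegel z *\<^sub>R \<rho> (herm (cay z))"

lemma kernel_op_siegel: "z \<in> siegel \<Longrightarrow> kernel_op z = \<rho> (herm (cay z))"
  by (simp add: kernel_op_def)

lemma borel_kernel_op: "kernel_op \<in> borel_measurable borel"
  unfolding kernel_op_def [abs_def]
  by (intro borel_measurable_continuous_on_indicator borel_siegel continuous_on_rep [OF rep]
      continuous_on_herm_cay invertible_herm_cay)

lemma rep_herm_bound: "\<exists>C\<ge>0. \<forall>z\<in>siegel. \<forall>v. norm (\<rho> (herm (cay z)) *v v) \<le> C * (kappa z)\<^sup>2 * norm v"
proof -
  \<comment> \<open>The last index carries the least weight, and an integer above 2n is at least 2n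
    + 1.\<close>
  have k: "int (2 * CARD('n) + 1) \<le> \<omega> i" for i
  proof -
    have "\<omega> (Max UNIV) \<le> \<omega> i" by (rule antimonoD [OF anti]) simp
    then show ?thesis using large by simp
  qed
  have "continuous_on UNIV (\<lambda>w::complex^'n::{finite,linorder}^'n::{finite,linorder}. norm (herm w))"
    by (intro continuous_intros continuous_herm)
  from continuous_disc_bound [OF this] obtain R where R: "\<And>w. w \<in> disc \<Longrightarrow> norm (herm w :: complex^'n::{finite,linorder}^'n::{finite,linorder}) \<le> R" by blast
  obtain C where C: "C \<ge> 0" "\<And>g w. invertible g \<Longrightarrow> norm g \<le> R \<Longrightarrow>
      norm (\<rho> g *v w) \<le> C * cmod (det g) ^ (2 * CARD('n) + 1) * norm w"
    using rep_det_bound [OF rep irr hw k] by blast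
  show ?thesis
    using C(1) by (intro exI [of _ C]) (auto simp only: kappa_square intro!: C(2) invertible_herm_cay R cay_disc)
qed

lemma kernel_op_bound: "\<exists>C\<ge>0. \<forall>z. norm (kernel_op z) \<le> C * kappa z"
proof -
  obtain C where C: "C \<ge> 0" "\<And>z v. z \<in> siegel \<Longrightarrow> norm (\<rho> (herm (cay z)) *v v) \<le> C * (kappa z)\<^sup>2 * norm v"
    using rep_herm_bound by blast
  obtain B where B: "B > 0" "\<And>z::complex^'n::{finite,linorder}^'n::{finite,linorder}. z \<in> siegel \<Longrightarrow> kappa z \<le> B" using kappa_bounded by blast
  define N where "N = real (CARD('d) * CARD('d)) * C * B"
  have "norm (kernel_op z) \<le> N * kappa z" for z
  proof (cases "z \<in> siegel")
    case True
    have "cmod (kernel_op z $ i $ j) \<le> C * (kappa z)\<^sup>2" for i j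
    proof -
      have "cmod (kernel_op z $ i $ j) = cmod ((kernel_op z *v axis j 1) $ i)"
        by (simp add: matrix_vector_mult_def axis_def if_distrib [of "(*) _"] cong: if_cong)
      also have "\<dots> \<le> norm (kernel_op z *v axis j 1)" by (rule Finite_Cartesian_Product.norm_nth_le)
      also have "\<dots> \<le> C * (kappa z)\<^sup>2" using C(2) [OF True, of "axis j 1"] True by (simp add: kernel_op_siegel norm_axis_complex)
      finally show ?thesis .
    qed
    then have "(\<Sum>i\<in>UNIV. \<Sum>j\<in>UNIV. cmod (kernel_op z $ i $ j)) \<le> (\<Sum>i\<in>(UNIV::'d set). \<Sum>j\<in>(UNIV::'d set). C * (kappa z)\<^sup>2)"
      by (intro sum_mono)
    with norm_matrix_le [of "kernel_op z"] have "norm (kernel_op z) \<le> real (CARD('d) * CARD('d)) * C * (kappa z * kappa z)"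
      by (simp add: power2_eq_square mult_ac)
    also have "\<dots> \<le> real (CARD('d) * CARD('d)) * C * (B * kappa z)"
      using C(1) B(2) [OF True] by (intro mult_left_mono mult_right_mono) (auto simp: kappa_nonneg)
    finally show ?thesis by (simp add: N_def mult_ac)
  next
    case False
    have "N \<ge> 0" using B(1) C(1) by (simp add: N_def)
    with False show ?thesis by (simp add: kernel_op_def kappa_nonneg)
  qed
  then show ?thesis using B(1) C(1) by (intro exI [of _ N]) (auto simp: N_def)
qed

lemma kernel_op_integrable: "integrable siegel_measure kernel_op"
proof -
  obtain C where C: "C \<ge> 0" "\<And>z. norm (kernel_op z) \<le> C * kappa z" using kernel_op_bound by blast
  show ?thesis
  proof (rule Bochner_Integration.integrable_bound [where f = "\<lambda>z. C * kappa z"])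
    show "integrable siegel_measure (\<lambda>z::complex^'n::{finite,linorder}^'n::{finite,linorder}. C * kappa z)" by (intro integrable_mult_right kappa_integrable)
    show "kernel_op \<in> borel_measurable siegel_measure" using borel_kernel_op by simp
    show "AE z in siegel_measure. norm (kernel_op z) \<le> norm (C * kappa z)"
      using C by (auto simp: kappa_nonneg)
  qed
qed

definition average_op :: "complex^'d^'d" where
  "average_op = (LINT z|siegel_measure. kernel_op z)"

lemma bounded_linear_mmult: "bounded_linear (\<lambda>M. (A::complex^'m^'m) ** M ** (B::complex^'m^'m))"
  by (rule linear_conv_bounded_linear [THEN iffD1], rule linearI)
    (simp_all add: matrix_add_ldistrib matrix_add_rdistrib mmult_scaleR)

text \<open>Substituting the rotation by the conjugate of u in the integral turns the kernel into
  rho(u) kernel rho(u)^{-1}, by \<open>cay_rot\<close> and \<open>herm_unitary\<close>.\<close>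

lemma average_op_commute:
  assumes u: "unitary_matrix u"
  shows "average_op ** \<rho> u = \<rho> u ** average_op"
proof -
  define g where "g = rot (map_matrix cnj u)"
  have k: "unitary_matrix (map_matrix cnj u)" by (rule unitary_cnj_matrix [OF u])
  have g: "symplectic g" unfolding g_def by (rule symplectic_rot [OF k])
  have iu: "invertible u" "invertible (conj_transpose u)"
    using u unfolding unitary_matrix_def by (metis invertible_def)+
  have "average_op = (LINT z|siegel_measure. kernel_op (act g z))"
    unfolding average_op_def by (rule integral_act [OF g borel_kernel_op, symmetric])
  also have "\<dots> = (LINT z|siegel_measure. \<rho> u ** kernel_op z ** \<rho> (conj_transpose u))"
  proof (rule integral_cong_AE)
    show "(\<lambda>z. kernel_op (act g z)) \<in> borel_measurable siegel_measure"
      using measurable_compose [OF borel_act [of g] borel_kernel_op] by simp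
    have "(\<lambda>z. \<rho> u ** kernel_op z ** \<rho> (conj_transpose u)) \<in> borel_measurable borel"
      by (intro borel_measurable_continuous_onI [THEN measurable_compose [OF borel_kernel_op]] continuous_intros)
    then show "(\<lambda>z. \<rho> u ** kernel_op z ** \<rho> (conj_transpose u)) \<in> borel_measurable siegel_measure" by simp
    show "AE z in siegel_measure. kernel_op (act g z) = \<rho> u ** kernel_op z ** \<rho> (conj_transpose u)"
      using AE_siegel
    proof eventually_elim
      case (elim z)
      have "herm (cay (act g z)) = u ** herm (cay z) ** conj_transpose u"
        unfolding g_def cay_rot [OF k elim] by (rule herm_unitary [OF u])
      then show ?case
        using iu invertible_herm_cay [OF elim] elim act_siegel [OF g elim]
        by (simp add: kernel_op_siegel rep_mult [OF rep] invertible_mult)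
    qed
  qed
  also have "\<dots> = \<rho> u ** average_op ** \<rho> (conj_transpose u)"
    unfolding average_op_def by (rule integral_bounded_linear [OF bounded_linear_mmult kernel_op_integrable])
  finally have "average_op ** \<rho> u = \<rho> u ** average_op ** (\<rho> (conj_transpose u) ** \<rho> u)"
    by (simp add: matrix_mul_assoc)
  also have "\<rho> (conj_transpose u) ** \<rho> u = mat 1"
    using u iu by (simp add: rep_mult [OF rep, symmetric] unitary_matrix_def rep_one [OF rep])
  finally show ?thesis by simp
qed

definition average_scalar :: complex where
  "average_scalar = (SOME l. average_op = mat l)"

lemma average_op_eq: "average_op = mat average_scalar"
  unfolding average_scalar_def by (rule someI_ex, rule schur_unitary [OF rep irr average_op_commute])

end

section \<open>Integration against the kernel\<close>

lemma ip_norm_square: "hermitian_inner ip \<Longrightarrow> (ip_norm ip u)\<^sup>2 = Re (ip u u)"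
  unfolding ip_norm_def by (cases "u = 0") (auto simp: hermitian_inner_simps(5) dest: hermitian_inner_pos less_imp_le)

lemma ip_norm_nonneg: "hermitian_inner ip \<Longrightarrow> ip_norm ip u \<ge> 0"
  unfolding ip_norm_def by (cases "u = 0") (auto simp: hermitian_inner_simps(5) dest: hermitian_inner_pos less_imp_le)

lemma bounded_linear_ip_mult:
  assumes "hermitian_inner ip"
  shows "bounded_linear (\<lambda>A. ip (A *v u) v)"
proof (rule linear_conv_bounded_linear [THEN iffD1], rule linearI)
  fix A B :: "complex^'b^'a"
  show "ip ((A + B) *v u) v = ip (A *v u) v + ip (B *v u) v"
    by (simp add: matrix_vector_mult_add_rdistrib hermitian_inner_simps [OF assms])
next
  fix r :: real and A :: "complex^'b^'a"
  have "(r *\<^sub>R A) *v u = complex_of_real r *s (A *v u)"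
    by (simp add: vec_eq_iff matrix_vector_mult_def sum_distrib_left scaleR_conv_of_real [where 'a = complex] mult.assoc)
  then show "ip ((r *\<^sub>R A) *v u) v = r *\<^sub>R ip (A *v u) v"
    by (simp add: hermitian_inner_simps [OF assms] scaleR_conv_of_real)
qed

lemma f_one_alt: "f_one \<rho> v z = matrix_inv (\<rho> (zeta z)) *v v"
  by (simp only: f_one_def zeta_mscale)

locale siegel_weight_inner = siegel_weight \<rho> \<omega>
  for \<rho> :: "complex^'n::{finite,linorder}^'n::{finite,linorder} \<Rightarrow> complex^'d^'d" and \<omega> +
  fixes ip :: "complex^'d \<Rightarrow> complex^'d \<Rightarrow> complex"
  assumes ip: "hermitian_inner ip" and unitary: "unitary_on_U \<rho> ip"
begin

lemmas adjoint = rep_adjoint [OF rep ip unitary]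

text \<open>The root of y is Hermitian, so its second occurrence moves to the left factor and the
  square root disappears; measurability and transformation laws can be checked on rho(y).\<close>

lemma weighted_inner:
  assumes z: "z \<in> siegel"
  shows "ip (weighted \<rho> f z) (weighted \<rho> g z) = ip (\<rho> (cmat (map_matrix Im z)) *v f z) (g z)"
proof -
  define s where "s = cmat (sqrt_mat (map_matrix Im z))"
  have pd: "pos_def (sqrt_mat (map_matrix Im z))" by (rule pos_def_sqrt_mat [OF siegel_Im [OF z]])
  have i: "invertible s" unfolding s_def invertible_cmat by (rule pos_def_invertible [OF pd])
  have c: "conj_transpose s = s"
    using pd by (simp add: s_def conj_transpose_cmat pos_def_def sym_mat_def)
  have "s ** s = cmat (map_matrix Im z)"
    by (simp add: s_def cmat_mult [symmetric] sqrt_mat_square [OF siegel_Im [OF z]])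
  then have "\<rho> (cmat (map_matrix Im z)) *v f z = \<rho> s *v (\<rho> s *v f z)"
    using rep_mult [OF rep i i] by (simp add: matrix_vector_mul_assoc)
  then show ?thesis
    using adjoint [OF i, of "\<rho> s *v f z" "g z"] unfolding c by (simp only: weighted_def s_def)
qed

lemma transfer_form_cay:
  assumes z: "z \<in> siegel"
  shows "transfer_form \<rho> f (cay z) = \<rho> (zeta z) *v f z"
  by (simp add: transfer_form_def one_minus_cay [OF z] matrix_inv_inv [OF invertible_zeta [OF z]] icay_cay [OF z])

definition pairing :: "(complex^'n::{finite,linorder}^'n::{finite,linorder} \<Rightarrow> complex^'d) \<Rightarrow> complex^'d \<Rightarrow> complex^'n::{finite,linorder}^'n::{finite,linorder} \<Rightarrow> complex" where
  "pairing f v z = indicator siegel z *\<^sub>R ip (\<rho> (herm (cay z)) *v (\<rho> (zeta z) *v f z)) v"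

text \<open>With h the inverse of \<open>zeta z\<close>, one has 1 - w^* w = h^* y h, so multiplying
  by \<open>zeta z\<close> on the right leaves h^* y; moving h^* to the other side as h turns v into
  \<open>f_one\<close>.\<close>

lemma weighted_inner_f_one:
  assumes z: "z \<in> siegel"
  shows "ip (weighted \<rho> f z) (weighted \<rho> (f_one \<rho> v) z) = pairing f v z"
proof -
  define h where "h = matrix_inv (zeta z)"
  define Y where "Y = cmat (map_matrix Im z)"
  have iz: "invertible (zeta z)" by (rule invertible_zeta [OF z])
  then have ih: "invertible h" unfolding h_def by (rule invertible_matrix_inv)
  then have ic: "invertible (conj_transpose h)" by (rule invertible_conj_transpose)
  have iY: "invertible Y" unfolding Y_def invertible_cmat by (rule pos_def_invertible [OF siegel_Im [OF z]])
  have e: "herm (cay z) = conj_transpose h ** Y ** h"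
    by (simp add: herm_def cay_hermitian [OF z] h_def Y_def)
  have "\<rho> h ** \<rho> (zeta z) = mat 1"
    using rep_mult [OF rep ih iz] iz by (simp add: h_def matrix_inv_left rep_one [OF rep])
  then have "\<rho> (herm (cay z)) ** \<rho> (zeta z) = \<rho> (conj_transpose h) ** \<rho> Y"
    by (simp add: e rep_mult [OF rep] ih ic iY invertible_mult matrix_mul_assoc [symmetric])
  then have "\<rho> (herm (cay z)) *v (\<rho> (zeta z) *v f z) = \<rho> (conj_transpose h) *v (\<rho> Y *v f z)"
    by (simp add: matrix_vector_mul_assoc)
  moreover have "f_one \<rho> v z = \<rho> h *v v"
    by (simp add: f_one_alt h_def rep_inv [OF rep iz])
  ultimately show ?thesis
    using adjoint [OF ic, of "\<rho> Y *v f z" v] z by (simp add: weighted_inner pairing_def Y_def)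
qed

text \<open>Pairing \<open>f_one\<close> with itself gives the value of the form rho(1 - w^* w) at
  v, which is O(kappa^2); the norm is its square root.\<close>

lemma weighted_f_one_bound: "\<exists>C\<ge>0. \<forall>z\<in>siegel. ip_norm ip (weighted \<rho> (f_one \<rho> v) z) \<le> C * kappa z"
proof -
  obtain B where B: "B > 0" "\<And>u v. cmod (ip u v) \<le> B * norm u * norm v" using ip_bound [OF ip] by blast
  obtain C where C: "C \<ge> 0" "\<And>z v. z \<in> siegel \<Longrightarrow> norm (\<rho> (herm (cay z)) *v v) \<le> C * (kappa z)\<^sup>2 * norm v"
    using rep_herm_bound by blast
  have "ip_norm ip (weighted \<rho> (f_one \<rho> v) z) \<le> (sqrt (B * C) * norm v) * kappa z" if z: "z \<in> siegel" for z
  proof (rule power2_le_imp_le)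
    have iz: "invertible (zeta z)" by (rule invertible_zeta [OF z])
    have "\<rho> (zeta z) *v f_one \<rho> v z = v"
      using matrix_inv_right [OF rep_invertible [OF rep iz]]
      by (simp add: f_one_alt matrix_vector_mul_assoc)
    then have "(ip_norm ip (weighted \<rho> (f_one \<rho> v) z))\<^sup>2 = Re (ip (\<rho> (herm (cay z)) *v v) v)"
      using z by (simp add: ip_norm_square [OF ip] weighted_inner_f_one pairing_def)
    also have "\<dots> \<le> cmod (ip (\<rho> (herm (cay z)) *v v) v)" by (rule complex_Re_le_cmod)
    also have "\<dots> \<le> B * norm (\<rho> (herm (cay z)) *v v) * norm v" by (rule B)
    also have "\<dots> \<le> B * (C * (kappa z)\<^sup>2 * norm v) * norm v"
      using B(1) C(2) [OF z] by (intro mult_right_mono mult_left_mono) auto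
    also have "\<dots> = ((sqrt (B * C) * norm v) * kappa z)\<^sup>2"
      using B(1) C(1) by (simp add: power_mult_distrib power2_eq_square [of "norm v"])
    finally show "(ip_norm ip (weighted \<rho> (f_one \<rho> v) z))\<^sup>2 \<le> ((sqrt (B * C) * norm v) * kappa z)\<^sup>2" .
    show "0 \<le> (sqrt (B * C) * norm v) * kappa z" using B(1) C(1) by (simp add: kappa_nonneg)
  qed
  then show ?thesis using B(1) C(1) by (intro exI [of _ "sqrt (B * C) * norm v"]) auto
qed

text \<open>By \<open>weighted_inner_f_one\<close> this is the squared norm of the weighted
  \<open>f_one\<close>, a nonzero vector.\<close>

lemma Re_ip_herm_pos:
  assumes z: "z \<in> siegel" and v: "v \<noteq> 0"
  shows "Re (ip (\<rho> (herm (cay z)) *v v) v) > 0"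
proof -
  have iz: "invertible (zeta z)" by (rule invertible_zeta [OF z])
  have e: "\<rho> (zeta z) *v f_one \<rho> v z = v"
    using matrix_inv_right [OF rep_invertible [OF rep iz]]
    by (simp add: f_one_alt matrix_vector_mul_assoc)
  define s where "s = cmat (sqrt_mat (map_matrix Im z))"
  have "invertible s" unfolding s_def invertible_cmat
    by (rule pos_def_invertible [OF pos_def_sqrt_mat [OF siegel_Im [OF z]]])
  then have "invertible (\<rho> s)" by (rule rep_invertible [OF rep])
  moreover have "f_one \<rho> v z \<noteq> 0" using e v by auto
  ultimately have "weighted \<rho> (f_one \<rho> v) z \<noteq> 0"
    unfolding weighted_def s_def [symmetric] by (metis matrix_vector_mul_assoc matrix_inv_left matrix_vector_mul_lid matrix_vector_mult_0_right)
  then have "Re (ip (weighted \<rho> (f_one \<rho> v) z) (weighted \<rho> (f_one \<rho> v) z)) > 0"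
    by (rule hermitian_inner_pos [OF ip])
  then show ?thesis using z by (simp add: weighted_inner_f_one pairing_def e)
qed

lemma average_op_ip:
  "integrable siegel_measure (\<lambda>z. ip (kernel_op z *v u) v)"
  "(LINT z|siegel_measure. ip (kernel_op z *v u) v) = average_scalar * ip u v"
proof -
  show "integrable siegel_measure (\<lambda>z. ip (kernel_op z *v u) v)"
    by (rule integrable_bounded_linear [OF bounded_linear_ip_mult [OF ip] kernel_op_integrable])
  have "(LINT z|siegel_measure. ip (kernel_op z *v u) v) = ip (average_op *v u) v"
    unfolding average_op_def by (rule integral_bounded_linear [OF bounded_linear_ip_mult [OF ip] kernel_op_integrable])
  also have "average_op *v u = average_scalar *s u" by (simp add: average_op_eq mat_vec)
  finally show "(LINT z|siegel_measure. ip (kernel_op z *v u) v) = average_scalar * ip u v"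
    by (simp add: hermitian_inner_simps [OF ip])
qed

text \<open>Otherwise a strictly positive function would have integral 0 over the half space, which
  has nonzero measure.\<close>

lemma average_scalar_nonzero: "average_scalar \<noteq> 0"
proof
  assume 0: "average_scalar = 0"
  define v :: "complex^'d" where "v = axis undefined 1"
  have v: "v \<noteq> 0" by (simp add: v_def axis_eq_0_iff)
  have pos: "Re (ip (kernel_op z *v v) v) > 0" if "z \<in> siegel" for z
    using Re_ip_herm_pos [OF that v] that by (simp add: kernel_op_siegel)
  have "AE z in siegel_measure. Re (ip (kernel_op z *v v) v) = 0"
  proof (rule integral_nonneg_eq_0_iff_AE [THEN iffD1])
    show "integrable siegel_measure (\<lambda>z. Re (ip (kernel_op z *v v) v))"
      by (rule integrable_Re [OF average_op_ip(1)])
    show "AE z in siegel_measure. 0 \<le> Re (ip (kernel_op z *v v) v)"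
      using AE_siegel by eventually_elim (use pos in \<open>auto intro: less_imp_le\<close>)
    show "(LINT z|siegel_measure. Re (ip (kernel_op z *v v) v)) = 0"
      using average_op_ip(2) [of v v] 0 by (simp add: integral_Re [OF average_op_ip(1)])
  qed
  with AE_siegel have "AE z in (siegel_measure :: (complex^'n::{finite,linorder}^'n::{finite,linorder}) measure). z \<notin> siegel"
    by eventually_elim (use pos in force)
  then have "emeasure siegel_measure (siegel :: (complex^'n::{finite,linorder}^'n::{finite,linorder}) set) = 0"
    using borel_siegel by (subst (asm) AE_iff_measurable [where N = siegel]) auto
  then show False using siegel_measure_nonzero by blast
qed

lemma borel_pairing: "holomorphic_siegel f \<Longrightarrow> pairing f v \<in> borel_measurable borel"
  unfolding pairing_def [abs_def]
  by (intro borel_measurable_continuous_on_indicator borel_siegel continuous_on_ip [OF ip] continuous_on_mvmult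
      continuous_on_rep [OF rep] continuous_on_herm_cay invertible_herm_cay continuous_on_const
      continuous_on_zeta invertible_zeta holomorphic_siegel_continuous)

lemma pairing_bound:
  assumes b: "\<And>z. z \<in> siegel \<Longrightarrow> ip_norm ip (weighted \<rho> f z) \<le> M"
  shows "\<exists>C\<ge>0. \<forall>z. cmod (pairing f v z) \<le> C * kappa z"
proof -
  obtain C where C: "C \<ge> 0" "\<And>z. z \<in> siegel \<Longrightarrow> ip_norm ip (weighted \<rho> (f_one \<rho> v) z) \<le> C * kappa z"
    using weighted_f_one_bound [of v] by blast
  have M: "M \<ge> 0" using b [OF iI_siegel] ip_norm_nonneg [OF ip] order_trans by blast
  have "cmod (pairing f v z) \<le> (M * C) * kappa z" for z
  proof (cases "z \<in> siegel")
    case True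
    have "cmod (pairing f v z) \<le> ip_norm ip (weighted \<rho> f z) * ip_norm ip (weighted \<rho> (f_one \<rho> v) z)"
      unfolding weighted_inner_f_one [OF True, symmetric] by (rule ip_cauchy_schwarz [OF ip])
    also have "\<dots> \<le> M * (C * kappa z)"
      by (intro mult_mono b C True M ip_norm_nonneg [OF ip])
    finally show ?thesis by (simp add: mult.assoc)
  next
    case False
    then show ?thesis using M C(1) by (simp add: pairing_def kappa_nonneg)
  qed
  then show ?thesis using M C(1) by (intro exI [of _ "M * C"]) auto
qed

text \<open>The finite averages s m over rotations have the same integral as the pairing and
  converge pointwise to the kernel applied to f(iI). They are dominated by a multiple of
  \<open>kappa\<close> because \<open>kappa\<close> is rotation invariant.\<close>

lemma pairing_integral:
  assumes f: "holomorphic_siegel f" and b: "\<And>z. z \<in> siegel \<Longrightarrow> ip_norm ip (weighted \<rho> f z) \<le> M"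
  shows "integrable siegel_measure (pairing f v)"
    and "(LINT z|siegel_measure. pairing f v z) = average_scalar * ip (f iI) v"
proof -
  obtain C where C: "C \<ge> 0" "\<And>z. cmod (pairing f v z) \<le> C * kappa z" using pairing_bound [OF b] by blast
  have ik: "integrable siegel_measure (\<lambda>z::complex^'n::{finite,linorder}^'n::{finite,linorder}. C * kappa z)"
    by (intro integrable_mult_right kappa_integrable)
  show int: "integrable siegel_measure (pairing f v)"
    by (rule Bochner_Integration.integrable_bound [OF ik])
      (use C borel_pairing [OF f] in \<open>auto simp: kappa_nonneg\<close>)
  \<comment> \<open>Half the angle of a root of unity, since the scalar c acts on the disc as
    c^2.\<close>
  define c where "c m j = cis (pi * real j / real (Suc m))" for m j
  have c1: "cmod (c m j) = 1" for m j by (simp add: c_def)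
  have c2: "(c m j)\<^sup>2 = cis (2 * pi * real j / real (Suc m))" for m j
    unfolding c_def Complex.DeMoivre by (rule arg_cong [where f = cis]) simp
  define g where "g m j = rot (mat (c m j) :: complex^'n::{finite,linorder}^'n::{finite,linorder})" for m j
  have g: "symplectic (g m j)" for m j unfolding g_def by (rule symplectic_rot [OF unitary_mat [OF c1]])
  define s where "s m z = (\<Sum>j<Suc m. pairing f v (act (g m j) z)) / of_nat (Suc m)" for m z
  have bs: "(\<lambda>z. pairing f v (act (g m j) z)) \<in> borel_measurable borel" for m j
    using measurable_compose [OF borel_act borel_pairing [OF f]] .
  have ia: "integrable siegel_measure (\<lambda>z. pairing f v (act (g m j) z))" for m j
    using integrable_distr [of "act (g m j)" siegel_measure borel "pairing f v"] borel_act [of "g m j"] int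
    by (simp add: siegel_measure_invariant [OF g])
  have si: "(LINT z|siegel_measure. s m z) = (LINT z|siegel_measure. pairing f v z)" for m
  proof -
    have "(LINT z|siegel_measure. s m z) = (\<Sum>j<Suc m. LINT z|siegel_measure. pairing f v (act (g m j) z)) / of_nat (Suc m)"
      unfolding s_def by (subst integral_divide_zero, subst Bochner_Integration.integral_sum) (rule ia refl)+
    also have "\<dots> = (\<Sum>j<Suc m. LINT z|siegel_measure. pairing f v z) / of_nat (Suc m)"
      by (simp only: integral_act [OF g borel_pairing [OF f]])
    also have "\<dots> = (LINT z|siegel_measure. pairing f v z)" by (simp del: of_nat_Suc)
    finally show ?thesis .
  qed
  have lim: "(\<lambda>m. s m z) \<longlonglongrightarrow> ip (kernel_op z *v f iI) v" if z: "z \<in> siegel" for z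
  proof -
    define w where "w = cay z"
    have w: "w \<in> disc" unfolding w_def by (rule cay_disc [OF z])
    define G where "G t = ip (\<rho> (herm w) *v transfer_form \<rho> f (mat t ** w)) v" for t
    obtain r where r: "r > 1" "\<And>i. (\<lambda>t. transfer_form \<rho> f (mat t ** w) $ i) holomorphic_on ball 0 r"
      using transfer_form_holomorphic [OF rep f w] by blast
    have "G = (\<lambda>t. \<Sum>i\<in>UNIV. (\<Sum>j\<in>UNIV. \<rho> (herm w) $ i $ j * transfer_form \<rho> f (mat t ** w) $ j) * ip (axis i 1) v)"
      unfolding G_def by (subst hermitian_inner_expand [OF ip]) (simp add: matrix_vector_mult_def)
    then have "G holomorphic_on ball 0 r" by (simp only:) (intro holomorphic_intros r(2))
    then have "(\<lambda>m. (\<Sum>j<Suc m. G (cis (2 * pi * real j / real (Suc m)))) / of_nat (Suc m)) \<longlonglongrightarrow> G 0"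
      by (rule holomorphic_average [OF _ r(1)])
    moreover have "G (cis (2 * pi * real j / real (Suc m))) = pairing f v (act (g m j) z)" for m j
    proof -
      have z': "act (g m j) z \<in> siegel" by (rule act_siegel [OF g z])
      have e: "cay (act (g m j) z) = mat ((c m j)\<^sup>2) ** w" unfolding g_def w_def by (rule cay_rot_scalar [OF c1 z])
      have "cmod ((c m j)\<^sup>2) = 1" by (simp add: norm_power c1)
      then have "herm (mat ((c m j)\<^sup>2) ** w) = herm w" by (rule herm_rot_scalar)
      then show ?thesis
        using z' by (simp only: pairing_def transfer_form_cay [symmetric] e G_def c2) simp
    qed
    moreover have "G 0 = ip (kernel_op z *v f iI) v"
    proof -
      have "icay 0 = (iI :: complex^'n::{finite,linorder}^'n::{finite,linorder})"
        by (simp add: icay_def iI_def matrix_inv_mat)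
      then have "transfer_form \<rho> f (mat 0 ** w) = f iI"
        by (simp add: transfer_form_def matrix_inv_mat rep_one [OF rep])
      then show ?thesis by (simp add: G_def kernel_op_siegel z w_def)
    qed
    ultimately show ?thesis by (simp add: s_def)
  qed
  have "(\<lambda>m. LINT z|siegel_measure. s m z) \<longlonglongrightarrow> (LINT z|siegel_measure. ip (kernel_op z *v f iI) v)"
  proof (rule integral_dominated_convergence [OF _ _ ik])
    show "(\<lambda>z. ip (kernel_op z *v f iI) v) \<in> borel_measurable siegel_measure"
      by (rule borel_measurable_integrable [OF average_op_ip(1)])
    show "s m \<in> borel_measurable siegel_measure" for m
      unfolding s_def [abs_def] using bs by simp
    show "AE z in siegel_measure. (\<lambda>m. s m z) \<longlonglongrightarrow> ip (kernel_op z *v f iI) v"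
      using AE_siegel by eventually_elim (rule lim)
    show "AE z in siegel_measure. cmod (s m z) \<le> C * kappa z" for m
      using AE_siegel
    proof eventually_elim
      case (elim z)
      have "cmod (\<Sum>j<Suc m. pairing f v (act (g m j) z)) \<le> (\<Sum>j<Suc m. C * kappa z)"
      proof (rule sum_norm_le)
        fix j
        show "cmod (pairing f v (act (g m j) z)) \<le> C * kappa z"
          using C(2) [of "act (g m j) z"] by (simp add: g_def kappa_rot [OF c1 elim])
      qed
      also have "\<dots> = real (Suc m) * (C * kappa z)" by simp
      finally show ?case by (simp add: s_def norm_divide divide_le_eq mult.commute del: of_nat_Suc sum.lessThan_Suc)
    qed
  qed
  then show "(LINT z|siegel_measure. pairing f v z) = average_scalar * ip (f iI) v"
    unfolding si average_op_ip(2) by (rule LIMSEQ_const_iff [THEN iffD1])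
qed

end

section \<open>Measurability and stabilizers\<close>

text \<open>The sets where \<open>kappa\<close> is at least 1/m have finite measure by Markov's
  inequality and exhaust the half space, as \<open>kappa\<close> is positive there.\<close>

lemma sigma_finite_siegel_measure:
  "sigma_finite_measure (siegel_measure :: (complex^'n::{finite,linorder}^'n::{finite,linorder}) measure)"
proof
  let ?M = "siegel_measure :: (complex^'n::{finite,linorder}^'n::{finite,linorder}) measure"
  define K where "K m = {z :: complex^'n::{finite,linorder}^'n::{finite,linorder}. 1 \<le> ennreal (real m) * ennreal (kappa z)}" for m :: nat
  have [measurable]: "(kappa :: complex^'n::{finite,linorder}^'n::{finite,linorder} \<Rightarrow> real) \<in> borel_measurable borel" by (rule borel_kappa)
  have K: "K m \<in> sets borel" for m unfolding K_def by measurable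
  show "\<exists>A. countable A \<and> A \<subseteq> sets ?M \<and> \<Union>A = space ?M \<and> (\<forall>a\<in>A. emeasure ?M a \<noteq> \<infinity>)"
  proof (intro exI [of _ "insert (- siegel) (range K)"] conjI ballI)
    show "countable (insert (- siegel) (range K))" by simp
    show "insert (- siegel) (range K) \<subseteq> sets ?M" using K borel_siegel by (auto intro: borel_comp)
    have "z \<in> \<Union> (range K)" if zs: "z \<in> siegel" for z :: "complex^'n::{finite,linorder}^'n::{finite,linorder}"
    proof -
      obtain m where "1 < real m * kappa z" using reals_Archimedean3 [OF kappa_pos [OF zs]] by blast
      then have "z \<in> K m" unfolding K_def
        by (simp add: ennreal_mult [symmetric] kappa_nonneg ennreal_1 [symmetric] ennreal_le_iff del: ennreal_1)
      then show ?thesis by blast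
    qed
    then show "\<Union> (insert (- siegel) (range K)) = space ?M" by auto
    fix a assume "a \<in> insert (- siegel) (range K)"
    then consider "a = - siegel" | m where "a = K m" by blast
    then show "emeasure ?M a \<noteq> \<infinity>"
    proof cases
      case 1
      have "emeasure ?M (- siegel) = 0"
        using AE_siegel borel_siegel by (subst (asm) AE_iff_measurable [where N = "- siegel"]) (auto intro: borel_comp)
      then show ?thesis using 1 by simp
    next
      case 2
      have "emeasure ?M ({z \<in> UNIV. 1 \<le> ennreal (real m) * ennreal (kappa z)}) \<le>
        ennreal (real m) * (\<integral>\<^sup>+ z. ennreal (kappa z) * indicator UNIV z \<partial>?M)"
        by (rule nn_integral_Markov_inequality) (auto simp: borel_kappa)
      also have "\<dots> < \<infinity>" by (simp add: ennreal_mult_less_top kappa_integral [unfolded infinity_ennreal_def])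
      finally show ?thesis by (simp add: 2 K_def)
    qed
  qed
qed

text \<open>Both sides take the default value 0 when the series is not summable, so the identity
  covers that case as well.\<close>

lemma infsum_complex_integral: "infsum f A = (LINT x|count_space A. f x :: complex)"
proof (cases "f summable_on A")
  case True
  then have "Infinite_Set_Sum.abs_summable_on f A"
    by (simp add: summable_on_iff_abs_summable_on_complex abs_summable_equivalent)
  from infsetsum_infsum [OF this] show ?thesis by (simp add: infsetsum_def)
next
  case False
  then have "\<not> integrable (count_space A) f"
    by (simp add: summable_on_iff_abs_summable_on_complex abs_summable_equivalent abs_summable_on_def)
  with False show ?thesis by (simp add: infsum_not_exists not_integrable_integral_eq)
qed

lemma summable_on_vec_iff: "f summable_on A \<longleftrightarrow> (\<forall>i. (\<lambda>x. f x $ i) summable_on A)"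
  for f :: "'x \<Rightarrow> complex^'d"
proof
  assume "\<forall>i. (\<lambda>x. f x $ i) summable_on A"
  then obtain l where "\<And>i. ((\<lambda>x. f x $ i) has_sum l i) A" unfolding summable_on_def by metis
  then have "(f has_sum (\<chi> i. l i)) A" unfolding has_sum_def by (intro vec_tendstoI) simp
  then show "f summable_on A" by (auto simp: summable_on_def)
qed (auto intro: summable_on_bounded_linear [OF bounded_linear_vec_nth])

lemma infsum_vec: "infsum f A $ i = (if f summable_on A then (\<Sum>\<^sub>\<infinity>x\<in>A. f x $ i) else 0)"
  for f :: "'x \<Rightarrow> complex^'d"
  using infsumI [OF has_sum_bounded_linear [OF bounded_linear_vec_nth has_sum_infsum], of f A i]
  by (simp add: infsum_not_exists)

text \<open>Each component is an integral over counting measure, measurable in the parameter. The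
  conditional over all components reproduces the value 0 that a vector sum takes as soon as one
  component is not summable.\<close>

lemma borel_measurable_infsum:
  fixes f :: "'x \<Rightarrow> 'z \<Rightarrow> complex^'d"
  assumes A: "countable A" and f: "\<And>x. x \<in> A \<Longrightarrow> f x \<in> borel_measurable M"
  shows "(\<lambda>z. \<Sum>\<^sub>\<infinity>x\<in>A. f x z) \<in> borel_measurable M"
proof -
  interpret sigma_finite_measure "count_space A" by (rule sigma_finite_measure_count_space_countable [OF A])
  have fi: "(\<lambda>(z, x). f x z $ i) \<in> borel_measurable (M \<Otimes>\<^sub>M count_space A)" for i
  proof -
    have "(\<lambda>(x, z). f x z $ i) \<in> borel_measurable (count_space A \<Otimes>\<^sub>M M)"
    proof (rule measurable_pair_measure_countable1 [OF A])
      fix x assume "x \<in> A"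
      then show "(\<lambda>y. case (x, y) of (x, z) \<Rightarrow> f x z $ i) \<in> borel_measurable M"
        using measurable_compose [OF f borel_measurable_continuous_onI [OF continuous_on_component [OF continuous_on_id]]]
        by simp
    qed
    from measurable_pair_swap [OF this] show ?thesis by (simp add: case_prod_unfold)
  qed
  have s: "Measurable.pred M (\<lambda>z. integrable (count_space A) (\<lambda>x. f x z $ i))" for i
    by (rule borel_measurable_lebesgue_integrable [OF fi])
  have "(\<lambda>z. \<chi> i. if \<forall>i. integrable (count_space A) (\<lambda>x. f x z $ i) then (LINT x|count_space A. f x z $ i) else 0)
    \<in> borel_measurable M"
    by (intro measurable_vec_lambda measurable_If measurable_const borel_measurable_lebesgue_integral fi)
      (use s in measurable)
  moreover have "(\<Sum>\<^sub>\<infinity>x\<in>A. f x z) =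
    (\<chi> i. if \<forall>i. integrable (count_space A) (\<lambda>x. f x z $ i) then (LINT x|count_space A. f x z $ i) else 0)" for z
    by (auto simp: vec_eq_iff infsum_vec summable_on_vec_iff summable_on_iff_abs_summable_on_complex
        abs_summable_equivalent abs_summable_on_def infsum_complex_integral)
  ultimately show ?thesis by simp
qed

lemma act_neg_one: "act (- mat 1) z = z" for z :: "complex^'n^'n"
proof -
  have b: "blockA (- mat 1 :: real^('n::finite+'n)^('n+'n)) = - mat 1" "blockB (- mat 1 :: real^('n::finite+'n)^('n+'n)) = 0"
     "blockC (- mat 1 :: real^('n::finite+'n)^('n+'n)) = 0" "blockD (- mat 1 :: real^('n::finite+'n)^('n+'n)) = - mat 1"
    by (simp_all add: vec_eq_iff mat_def blockA_def blockB_def blockC_def blockD_def)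
  have c: "cmat (- mat 1 :: real^'n^'n) = - mat 1" "cmat (0 :: real^'n^'n) = 0"
    by (simp_all add: vec_eq_iff mat_def)
  have i: "matrix_inv (- mat 1 :: complex^'n^'n) = - mat 1" by (rule matrix_inv_unique) simp
  show ?thesis by (simp add: act_def autf_def b c i)
qed

context discrete_group
begin

definition center_order :: nat where
  "center_order = card (\<Gamma> \<inter> {mat 1, - mat 1})"

lemma center_order_pos: "center_order > 0"
  using one_closed by (auto simp: center_order_def card_gt_0_iff)

lemma matrix_inv_closed:
  assumes "g \<in> \<Gamma>"
  shows "matrix_inv g \<in> \<Gamma>" "matrix_inv g ** g = mat 1" "g ** matrix_inv g = mat 1"
proof -
  obtain h where h: "h \<in> \<Gamma>" "h ** g = mat 1" "g ** h = mat 1" using inverse_closed [OF assms] by blast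
  then have "matrix_inv g = h" by (intro matrix_inv_unique)
  then show "matrix_inv g \<in> \<Gamma>" "matrix_inv g ** g = mat 1" "g ** matrix_inv g = mat 1" using h by auto
qed

lemma AE_trivial_stabilizer:
  "AE z in siegel_measure. \<forall>g\<in>\<Gamma>. act g z = z \<longrightarrow> g \<in> {mat 1, - mat 1}"
proof (rule AE_ball_countable [THEN iffD2, OF countable_group], rule ballI)
  fix g assume g: "g \<in> \<Gamma>"
  show "AE z in siegel_measure. act g z = z \<longrightarrow> g \<in> {mat 1, - mat 1}"
  proof (cases "g \<in> {mat 1, - mat 1}")
    case False
    then have "AE z in siegel_measure. act g z \<noteq> z" by (intro fixed_points_null symplectic g) auto
    then show ?thesis by eventually_elim simp
  qed simp
qed

text \<open>If h carries z into F, then so does the inverse of g exactly when g h fixes z, that is,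
  when g h is central. The set is thus a translate of the central part of the group.\<close>

lemma orbit_count:
  assumes F: "orbit_reps \<Gamma> F" and z: "z \<in> siegel"
    and st: "\<forall>g\<in>\<Gamma>. act g z = z \<longrightarrow> g \<in> {mat 1, - mat 1}"
  shows "finite {g \<in> \<Gamma>. act (matrix_inv g) z \<in> F}" "card {g \<in> \<Gamma>. act (matrix_inv g) z \<in> F} = center_order"
proof -
  let ?Z = "\<Gamma> \<inter> {mat 1, - mat 1}"
  have "\<exists>!w. w \<in> F \<and> (\<exists>\<gamma>\<in>\<Gamma>. w = act \<gamma> z)" using F z by (auto simp: orbit_reps_def)
  then obtain h where h: "h \<in> \<Gamma>" "act h z \<in> F"
    and u: "\<And>g. g \<in> \<Gamma> \<Longrightarrow> act g z \<in> F \<Longrightarrow> act g z = act h z" by metis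
  note hi = matrix_inv_closed [OF h(1)]
  have s: "act (matrix_inv g) (act g z) = z" if g: "g \<in> \<Gamma>" for g
    by (rule act_inverse [OF symplectic [OF g] symplectic [OF matrix_inv_closed(1) [OF g]] matrix_inv_closed(2) [OF g] z])
  have "{g \<in> \<Gamma>. act (matrix_inv g) z \<in> F} = (\<lambda>e. e ** matrix_inv h) ` ?Z"
  proof (intro subset_antisym subsetI)
    fix g assume "g \<in> {g \<in> \<Gamma>. act (matrix_inv g) z \<in> F}"
    then have g: "g \<in> \<Gamma>" "act (matrix_inv g) z \<in> F" by auto
    note gi = matrix_inv_closed [OF g(1)]
    have "act (matrix_inv g) z = act h z" by (rule u [OF gi(1) g(2)])
    then have "act g (act h z) = z"
      using act_inverse [OF symplectic [OF gi(1)] symplectic [OF g(1)] gi(3) z] by simp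
    then have "act (g ** h) z = z" by (simp add: act_mult [OF symplectic [OF g(1)] symplectic [OF h(1)] z])
    then have "g ** h \<in> ?Z" using st mult_closed [OF g(1) h(1)] by blast
    moreover have "g = (g ** h) ** matrix_inv h" using hi by (simp add: matrix_mul_assoc [symmetric])
    ultimately show "g \<in> (\<lambda>e. e ** matrix_inv h) ` ?Z" by blast
  next
    fix x assume "x \<in> (\<lambda>e. e ** matrix_inv h) ` ?Z"
    then obtain e where e: "e \<in> \<Gamma>" "e = mat 1 \<or> e = - mat 1" and x: "x = e ** matrix_inv h" by blast
    have m: "e ** matrix_inv h \<in> \<Gamma>" by (rule mult_closed [OF e(1) hi(1)])
    have ee: "e ** e = mat 1" using e(2) by auto
    have "(h ** e) ** (e ** matrix_inv h) = h ** (e ** e) ** matrix_inv h" by (simp only: matrix_mul_assoc)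
    then have "matrix_inv (e ** matrix_inv h) = h ** e"
      by (intro matrix_inv_unique') (simp add: ee hi)
    moreover have "act e z = z" using e(2) by (auto simp: act_one act_neg_one)
    ultimately have "act (matrix_inv (e ** matrix_inv h)) z \<in> F"
      using h by (simp add: act_mult [OF symplectic [OF h(1)] symplectic [OF e(1)] z])
    then show "x \<in> {g \<in> \<Gamma>. act (matrix_inv g) z \<in> F}" using m by (simp add: x)
  qed
  moreover have "inj_on (\<lambda>e. e ** matrix_inv h) ?Z"
  proof (rule inj_onI)
    fix x y assume "x ** matrix_inv h = y ** matrix_inv h"
    then have "x ** matrix_inv h ** h = y ** matrix_inv h ** h" by simp
    then show "x = y" by (simp add: matrix_mul_assoc [symmetric] hi)
  qed
  ultimately show "finite {g \<in> \<Gamma>. act (matrix_inv g) z \<in> F}" "card {g \<in> \<Gamma>. act (matrix_inv g) z \<in> F} = center_order"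
    by (simp_all add: card_image center_order_def)
qed

end

section \<open>Unfolding\<close>

context discrete_group
begin

lemma pair_sigma_finite_group: "pair_sigma_finite (count_space \<Gamma>) siegel_measure"
  by (intro pair_sigma_finite.intro sigma_finite_siegel_measure sigma_finite_measure_count_space_countable countable_group)

lemma borel_group_pair:
  assumes "\<And>g. g \<in> \<Gamma> \<Longrightarrow> h g \<in> borel_measurable borel"
  shows "case_prod h \<in> borel_measurable (count_space \<Gamma> \<Otimes>\<^sub>M siegel_measure)"
  by (rule measurable_pair_measure_countable1 [OF countable_group]) (use assms in simp)

lemma AE_count_orbit:
  assumes F: "orbit_reps \<Gamma> F"
  shows "AE z in siegel_measure. finite {g \<in> \<Gamma>. act (matrix_inv g) z \<in> F} \<and>
    card {g \<in> \<Gamma>. act (matrix_inv g) z \<in> F} = center_order"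
  using AE_siegel AE_trivial_stabilizer
proof eventually_elim
  case (elim z)
  show ?case using orbit_count [OF F elim] by blast
qed

lemma act_matrix_inv:
  assumes "g \<in> \<Gamma>" "z \<in> siegel"
  shows "act g (act (matrix_inv g) z) = z"
  by (rule act_inverse [OF symplectic symplectic _ assms(2)]) (use assms matrix_inv_closed in auto)

lemma borel_orbit_indicator:
  assumes "orbit_reps \<Gamma> F" "h \<in> borel_measurable borel"
  shows "(\<lambda>z. indicator F z * h (act g z) :: ennreal) \<in> borel_measurable borel"
    and "(\<lambda>z. indicator F (act k z) * h z :: ennreal) \<in> borel_measurable borel"
proof -
  have [measurable]: "F \<in> sets borel" using assms(1) by (simp add: orbit_reps_def)
  have [measurable]: "h \<in> borel_measurable borel" by (rule assms)
  have a: "act k \<in> borel \<rightarrow>\<^sub>M borel" for k by (rule borel_act)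
  have [measurable]: "(\<lambda>z. h (act g z)) \<in> borel_measurable borel" by (rule measurable_compose [OF a assms(2)])
  have "(indicator F :: _ \<Rightarrow> ennreal) \<in> borel_measurable borel" by measurable
  from measurable_compose [OF a this] have [measurable]: "(\<lambda>z. indicator F (act k z) :: ennreal) \<in> borel_measurable borel" .
  show "(\<lambda>z. indicator F z * h (act g z) :: ennreal) \<in> borel_measurable borel"
    and "(\<lambda>z. indicator F (act k z) * h z :: ennreal) \<in> borel_measurable borel" by measurable
qed

lemma nn_integral_shift:
  assumes F: "orbit_reps \<Gamma> F" and h: "h \<in> borel_measurable borel" and g: "g \<in> \<Gamma>"
  shows "(\<integral>\<^sup>+ z. indicator F z * h (act g z) \<partial>siegel_measure) =
    (\<integral>\<^sup>+ z. indicator F (act (matrix_inv g) z) * h z \<partial>siegel_measure)"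
proof -
  have "(\<integral>\<^sup>+ z. indicator F z * h (act g z) \<partial>siegel_measure) =
    (\<integral>\<^sup>+ z. indicator F (act (matrix_inv g) z) * h (act g (act (matrix_inv g) z)) \<partial>siegel_measure)"
    by (rule nn_integral_act [symmetric, OF symplectic [OF matrix_inv_closed(1) [OF g]] borel_orbit_indicator(1) [OF F h]])
  also have "\<dots> = (\<integral>\<^sup>+ z. indicator F (act (matrix_inv g) z) * h z \<partial>siegel_measure)"
    by (rule nn_integral_cong_AE) (use AE_siegel in eventually_elim, simp add: act_matrix_inv [OF g])
  finally show ?thesis .
qed

lemma nn_integral_count_orbit:
  assumes F: "orbit_reps \<Gamma> F" and h: "h \<in> borel_measurable borel"
  shows "(\<integral>\<^sup>+ g. \<integral>\<^sup>+ z. indicator F (act (matrix_inv g) z) * h z \<partial>siegel_measure \<partial>count_space \<Gamma>) =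
    of_nat center_order * (\<integral>\<^sup>+ z. h z \<partial>siegel_measure)"
proof -
  interpret pair_sigma_finite "count_space \<Gamma>" "siegel_measure" by (rule pair_sigma_finite_group)
  have "(\<integral>\<^sup>+ g. \<integral>\<^sup>+ z. indicator F (act (matrix_inv g) z) * h z \<partial>siegel_measure \<partial>count_space \<Gamma>) =
     (\<integral>\<^sup>+ z. \<integral>\<^sup>+ g. indicator F (act (matrix_inv g) z) * h z \<partial>count_space \<Gamma> \<partial>siegel_measure)"
    by (rule Fubini' [symmetric]) (intro borel_group_pair borel_orbit_indicator(2) F h)
  also have "\<dots> = (\<integral>\<^sup>+ z. of_nat center_order * h z \<partial>siegel_measure)"
  proof (rule nn_integral_cong_AE, use AE_count_orbit [OF F] in eventually_elim)
    case (elim z)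
    have "(\<integral>\<^sup>+ g. indicator F (act (matrix_inv g) z) * h z \<partial>count_space \<Gamma>) =
      (\<integral>\<^sup>+ g. indicator {g \<in> \<Gamma>. act (matrix_inv g) z \<in> F} g \<partial>count_space \<Gamma>) * h z"
      by (subst nn_integral_multc [symmetric]) (auto intro!: nn_integral_cong simp: indicator_def)
    also have "(\<integral>\<^sup>+ g. indicator {g \<in> \<Gamma>. act (matrix_inv g) z \<in> F} g \<partial>count_space \<Gamma>) = of_nat center_order"
      using elim by (subst nn_integral_indicator) (auto simp: emeasure_count_space)
    finally show ?case .
  qed
  also have "\<dots> = of_nat center_order * (\<integral>\<^sup>+ z. h z \<partial>siegel_measure)"
    by (rule nn_integral_cmult) (use h in simp)
  finally show ?thesis .
qed

text \<open>Substituting g^{-1} z for z in each summand moves g from h to the indicator of F, and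
  the sum over g then counts the elements carrying z into F. The argument runs first with norms, for
  integrability on the product, then with h. The type class covers both \<open>kappa\<close> and the
  complex pairing.\<close>

lemma unfold_integral:
  fixes h :: "complex^'n::{finite,linorder}^'n::{finite,linorder} \<Rightarrow> 'b::{banach,second_countable_topology,real_normed_algebra_1}"
  assumes F: "orbit_reps \<Gamma> F" and h: "h \<in> borel_measurable borel" and int: "integrable siegel_measure h"
  shows "integrable (count_space \<Gamma> \<Otimes>\<^sub>M siegel_measure) (\<lambda>(g, z). indicator F z *\<^sub>R h (act g z))"
    and "(LINT z|siegel_measure. LINT g|count_space \<Gamma>. indicator F z *\<^sub>R h (act g z)) =
      of_nat center_order * (LINT z|siegel_measure. h z)"
proof -
  interpret pair_sigma_finite "count_space \<Gamma>" siegel_measure by (rule pair_sigma_finite_group)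
  have Fb: "(indicator F :: _ \<Rightarrow> real) \<in> borel_measurable borel"
    using F unfolding orbit_reps_def by (intro borel_measurable_indicator) blast
  have a: "act k \<in> borel \<rightarrow>\<^sub>M borel" for k by (rule borel_act)
  have b1: "(\<lambda>z. indicator F z *\<^sub>R h (act g z)) \<in> borel_measurable borel" for g
    by (intro borel_measurable_scaleR Fb measurable_compose [OF a h])
  have b2: "(\<lambda>z. indicator F (act k z) *\<^sub>R h z) \<in> borel_measurable borel" for k
    by (intro borel_measurable_scaleR h measurable_compose [OF a Fb])
  define u where "u z = ennreal (norm (h z))" for z
  have u: "u \<in> borel_measurable borel" unfolding u_def using h by measurable
  have n1: "ennreal (norm (indicator F z *\<^sub>R h (act g z))) = indicator F z * u (act g z)"
    and n2: "ennreal (norm (indicator F (act k z) *\<^sub>R h z)) = indicator F (act k z) * u z" for g k z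
    by (auto simp: u_def indicator_def)
  have fin: "of_nat center_order * (\<integral>\<^sup>+ z. u z \<partial>siegel_measure) < \<infinity>"
    using int unfolding u_def by (simp add: integrable_iff_bounded ennreal_mult_less_top of_nat_less_top)
  show i1: "integrable (count_space \<Gamma> \<Otimes>\<^sub>M siegel_measure) (\<lambda>(g, z). indicator F z *\<^sub>R h (act g z))"
  proof (rule integrableI_bounded)
    show m: "(\<lambda>(g, z). indicator F z *\<^sub>R h (act g z)) \<in> borel_measurable (count_space \<Gamma> \<Otimes>\<^sub>M siegel_measure)"
      by (rule borel_group_pair [OF b1])
    have "(\<integral>\<^sup>+ p. ennreal (norm (case p of (g, z) \<Rightarrow> indicator F z *\<^sub>R h (act g z))) \<partial>(count_space \<Gamma> \<Otimes>\<^sub>M siegel_measure)) =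
      (\<integral>\<^sup>+ g. \<integral>\<^sup>+ z. indicator F z * u (act g z) \<partial>siegel_measure \<partial>count_space \<Gamma>)"
      using m by (subst M2.nn_integral_fst [symmetric]) (auto simp: n1 simp del: norm_scaleR)
    also have "\<dots> = (\<integral>\<^sup>+ g. \<integral>\<^sup>+ z. indicator F (act (matrix_inv g) z) * u z \<partial>siegel_measure \<partial>count_space \<Gamma>)"
      by (rule nn_integral_cong) (simp add: nn_integral_shift [OF F u])
    finally show "(\<integral>\<^sup>+ p. ennreal (norm (case p of (g, z) \<Rightarrow> indicator F z *\<^sub>R h (act g z))) \<partial>(count_space \<Gamma> \<Otimes>\<^sub>M siegel_measure)) < \<infinity>"
      unfolding nn_integral_count_orbit [OF F u] using fin by simp
  qed
  have i2: "integrable (count_space \<Gamma> \<Otimes>\<^sub>M siegel_measure) (\<lambda>(g, z). indicator F (act (matrix_inv g) z) *\<^sub>R h z)"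
  proof (rule integrableI_bounded)
    show m: "(\<lambda>(g, z). indicator F (act (matrix_inv g) z) *\<^sub>R h z) \<in> borel_measurable (count_space \<Gamma> \<Otimes>\<^sub>M siegel_measure)"
      by (rule borel_group_pair [OF b2])
    have "(\<integral>\<^sup>+ p. ennreal (norm (case p of (g, z) \<Rightarrow> indicator F (act (matrix_inv g) z) *\<^sub>R h z)) \<partial>(count_space \<Gamma> \<Otimes>\<^sub>M siegel_measure)) =
      (\<integral>\<^sup>+ g. \<integral>\<^sup>+ z. indicator F (act (matrix_inv g) z) * u z \<partial>siegel_measure \<partial>count_space \<Gamma>)"
      using m by (subst M2.nn_integral_fst [symmetric]) (auto simp: n2 simp del: norm_scaleR)
    then show "(\<integral>\<^sup>+ p. ennreal (norm (case p of (g, z) \<Rightarrow> indicator F (act (matrix_inv g) z) *\<^sub>R h z)) \<partial>(count_space \<Gamma> \<Otimes>\<^sub>M siegel_measure)) < \<infinity>"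
      unfolding nn_integral_count_orbit [OF F u] using fin by simp
  qed
  have "(LINT z|siegel_measure. LINT g|count_space \<Gamma>. indicator F z *\<^sub>R h (act g z)) =
    (LINT g|count_space \<Gamma>. LINT z|siegel_measure. indicator F z *\<^sub>R h (act g z))"
    by (rule Fubini_integral [OF i1])
  also have "\<dots> = (LINT g|count_space \<Gamma>. LINT z|siegel_measure. indicator F (act (matrix_inv g) z) *\<^sub>R h z)"
  proof (rule Bochner_Integration.integral_cong [OF refl])
    fix g assume "g \<in> space (count_space \<Gamma>)"
    then have g: "g \<in> \<Gamma>" by simp
    have "(LINT z|siegel_measure. indicator F z *\<^sub>R h (act g z)) =
      (LINT z|siegel_measure. indicator F (act (matrix_inv g) z) *\<^sub>R h (act g (act (matrix_inv g) z)))"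
      by (rule integral_act [symmetric, OF symplectic [OF matrix_inv_closed(1) [OF g]] b1])
    also have "\<dots> = (LINT z|siegel_measure. indicator F (act (matrix_inv g) z) *\<^sub>R h z)"
    proof (rule integral_cong_AE)
      show "(\<lambda>z. indicator F (act (matrix_inv g) z) *\<^sub>R h (act g (act (matrix_inv g) z))) \<in> borel_measurable siegel_measure"
        using measurable_compose [OF a b1] by simp
      show "(\<lambda>z. indicator F (act (matrix_inv g) z) *\<^sub>R h z) \<in> borel_measurable siegel_measure" using b2 by simp
      show "AE z in siegel_measure. indicator F (act (matrix_inv g) z) *\<^sub>R h (act g (act (matrix_inv g) z)) =
          indicator F (act (matrix_inv g) z) *\<^sub>R h z"
        using AE_siegel by eventually_elim (simp add: act_matrix_inv [OF g])
    qed
    finally show "(LINT z|siegel_measure. indicator F z *\<^sub>R h (act g z)) = (LINT z|siegel_measure. indicator F (act (matrix_inv g) z) *\<^sub>R h z)" .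
  qed
  also have "\<dots> = (LINT z|siegel_measure. LINT g|count_space \<Gamma>. indicator F (act (matrix_inv g) z) *\<^sub>R h z)"
    by (rule Fubini_integral [OF i2, symmetric])
  also have "\<dots> = (LINT z|siegel_measure. of_nat center_order * h z)"
  proof (rule integral_cong_AE)
    show "(\<lambda>z. LINT g|count_space \<Gamma>. indicator F (act (matrix_inv g) z) *\<^sub>R h z) \<in> borel_measurable siegel_measure"
      by (rule borel_measurable_integrable [OF integrable_snd [OF i2]])
    show "(\<lambda>z. of_nat center_order * h z) \<in> borel_measurable siegel_measure"
      using h by (auto simp: of_nat_def)
    show "AE z in siegel_measure. (LINT g|count_space \<Gamma>. indicator F (act (matrix_inv g) z) *\<^sub>R h z) = of_nat center_order * h z"
      using AE_count_orbit [OF F]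
    proof eventually_elim
      case (elim z)
      let ?A = "{g \<in> \<Gamma>. act (matrix_inv g) z \<in> F}"
      have "(LINT g|count_space \<Gamma>. indicator F (act (matrix_inv g) z) *\<^sub>R h z) = (LINT g|count_space \<Gamma>. indicator ?A g *\<^sub>R h z)"
        by (rule Bochner_Integration.integral_cong) (auto simp: indicator_def)
      also have "\<dots> = (LINT g|count_space \<Gamma>. indicator ?A g) *\<^sub>R h z"
        by (rule integral_scaleR_left) (use elim in \<open>auto intro!: integrable_real_indicator simp: emeasure_count_space of_nat_less_top\<close>)
      also have "(LINT g|count_space \<Gamma>. indicator ?A g) = measure (count_space \<Gamma>) ?A"
        by (subst Bochner_Integration.integral_indicator) (auto intro: arg_cong2 [where f = measure])
      also have "measure (count_space \<Gamma>) ?A = real center_order"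
        using elim by (simp add: measure_count_space)
      finally show ?case by (simp add: scaleR_conv_of_real)
    qed
  qed
  also have "\<dots> = of_nat center_order * (LINT z|siegel_measure. h z)" using int by simp
  finally show "(LINT z|siegel_measure. LINT g|count_space \<Gamma>. indicator F z *\<^sub>R h (act g z)) =
      of_nat center_order * (LINT z|siegel_measure. h z)" .
qed

end

section \<open>The Petersson product with the Poincare series\<close>

lemma bounded_linear_ip_right:
  assumes "hermitian_inner ip"
  shows "bounded_linear (\<lambda>u. ip a u)"
proof (rule linear_conv_bounded_linear [THEN iffD1], rule linearI)
  fix u v :: "complex^'a"
  show "ip a (u + v) = ip a u + ip a v" by (simp add: hermitian_inner_simps [OF assms])
next
  fix r :: real and u :: "complex^'a"
  have "r *\<^sub>R u = complex_of_real r *s u" by (simp add: vec_eq_iff scaleR_conv_of_real [where 'a = complex])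
  then show "ip a (r *\<^sub>R u) = r *\<^sub>R ip a u"
    by (simp add: hermitian_inner_simps [OF assms] scaleR_conv_of_real)
qed

lemma norm_le_ip_norm:
  assumes ip: "hermitian_inner ip"
  shows "\<exists>K\<ge>0. \<forall>u. norm u \<le> K * ip_norm ip u"
proof -
  have "\<exists>m>0. \<forall>u. m * (norm u)\<^sup>2 \<le> Re (ip u u)"
  proof (rule homogeneous_lower_bound)
    show "continuous_on UNIV (\<lambda>u. Re (ip u u))" by (intro continuous_intros continuous_on_ip [OF ip])
    show "Re (ip u u) > 0" if "u \<noteq> 0" for u by (rule hermitian_inner_pos [OF ip that])
    fix c :: real and u :: "complex^'a"
    have "c *\<^sub>R u = complex_of_real c *s u" by (simp add: vec_eq_iff scaleR_conv_of_real [where 'a = complex])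
    then show "Re (ip (c *\<^sub>R u) (c *\<^sub>R u)) = c\<^sup>2 * Re (ip u u)"
      by (simp add: hermitian_inner_simps [OF ip] power2_eq_square)
  qed
  then obtain m where m: "m > 0" "\<And>u. m * (norm u)\<^sup>2 \<le> Re (ip u u)" by blast
  have "norm u \<le> (1 / sqrt m) * ip_norm ip u" for u
  proof -
    have "sqrt m * norm u = sqrt (m * (norm u)\<^sup>2)" using m(1) by (simp add: real_sqrt_mult)
    also have "\<dots> \<le> ip_norm ip u" unfolding ip_norm_def by (intro real_sqrt_le_mono m)
    finally show ?thesis using m(1) by (simp add: field_simps)
  qed
  then show ?thesis using m(1) by (intro exI [of _ "1 / sqrt m"]) auto
qed

context siegel_weight_inner
begin

text \<open>By \<open>Im_act\<close>, rho(Im z) is rho(Im gz) between rho(j^* ) and rho(j); these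
  two factors cancel the factors rho(j)^{-1} of the slash action.\<close>

lemma weighted_slash:
  assumes g: "symplectic g" and z: "z \<in> siegel"
  shows "ip (weighted \<rho> (slash \<rho> f1 g) z) (weighted \<rho> (slash \<rho> f2 g) z) =
    ip (weighted \<rho> f1 (act g z)) (weighted \<rho> f2 (act g z))"
proof -
  define j where "j = autf g z"
  define Y where "Y = cmat (map_matrix Im (act g z))"
  have gz: "act g z \<in> siegel" by (rule act_siegel [OF g z])
  have ij: "invertible j" unfolding j_def by (rule invertible_autf [OF g z])
  then have ic: "invertible (conj_transpose j)" by (rule invertible_conj_transpose)
  have iY: "invertible Y" unfolding Y_def invertible_cmat by (rule pos_def_invertible [OF siegel_Im [OF gz]])
  have r: "\<rho> j ** matrix_inv (\<rho> j) = mat 1" by (rule matrix_inv_right [OF rep_invertible [OF rep ij]])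
  have e: "\<rho> (cmat (map_matrix Im z)) = \<rho> (conj_transpose j) ** (\<rho> Y ** \<rho> j)"
    unfolding Im_act [OF g z, symmetric] j_def [symmetric] Y_def [symmetric]
    by (simp add: rep_mult [OF rep] ij ic iY invertible_mult matrix_mul_assoc)
  have s: "\<rho> j *v slash \<rho> f g z = f (act g z)" for f
    by (simp add: slash_def j_def [symmetric] matrix_vector_mul_assoc r)
  have "ip (weighted \<rho> (slash \<rho> f1 g) z) (weighted \<rho> (slash \<rho> f2 g) z) =
    ip (\<rho> (conj_transpose j) *v (\<rho> Y *v (\<rho> j *v slash \<rho> f1 g z))) (slash \<rho> f2 g z)"
    by (simp add: weighted_inner [OF z] e matrix_vector_mul_assoc matrix_mul_assoc)
  also have "\<dots> = ip (\<rho> Y *v f1 (act g z)) (\<rho> j *v slash \<rho> f2 g z)"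
    by (simp add: adjoint [OF ic] s)
  also have "\<dots> = ip (weighted \<rho> f1 (act g z)) (weighted \<rho> f2 (act g z))"
    by (simp add: s weighted_inner [OF gz] Y_def)
  finally show ?thesis .
qed

text \<open>K may depend on z but not on g, so at a fixed z summability of \<open>kappa\<close> over
  the orbit gives absolute convergence of the Poincare series.\<close>

lemma slash_f_one_bound:
  assumes z: "z \<in> siegel"
  shows "\<exists>K\<ge>0. \<forall>g. symplectic g \<longrightarrow> norm (slash \<rho> (f_one \<rho> v) g z) \<le> K * kappa (act g z)"
proof -
  define s where "s = cmat (sqrt_mat (map_matrix Im z))"
  have "invertible s" unfolding s_def invertible_cmat
    by (rule pos_def_invertible [OF pos_def_sqrt_mat [OF siegel_Im [OF z]]])
  then have "invertible (\<rho> s)" by (rule rep_invertible [OF rep])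
  then have si: "u = matrix_inv (\<rho> s) *v (\<rho> s *v u)" for u
    by (simp add: matrix_vector_mul_assoc matrix_inv_left)
  obtain A where A: "A > 0" "\<And>u. norm (matrix_inv (\<rho> s) *v u) \<le> A * norm u" using matrix_op_bound by blast
  obtain B where B: "B \<ge> 0" "\<And>u. norm u \<le> B * ip_norm ip u" using norm_le_ip_norm [OF ip] by blast
  obtain C where C: "C \<ge> 0" "\<And>z. z \<in> siegel \<Longrightarrow> ip_norm ip (weighted \<rho> (f_one \<rho> v) z) \<le> C * kappa z"
    using weighted_f_one_bound [of v] by blast
  have "norm (slash \<rho> (f_one \<rho> v) g z) \<le> (A * (B * C)) * kappa (act g z)" if g: "symplectic g" for g
  proof -
    let ?s = "slash \<rho> (f_one \<rho> v) g"
    have "norm (?s z) = norm (matrix_inv (\<rho> s) *v weighted \<rho> ?s z)"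
      using si by (simp add: weighted_def s_def [symmetric])
    also have "\<dots> \<le> A * norm (weighted \<rho> ?s z)" by (rule A)
    also have "\<dots> \<le> A * (B * ip_norm ip (weighted \<rho> ?s z))" using A B by (intro mult_left_mono) auto
    also have "ip_norm ip (weighted \<rho> ?s z) = ip_norm ip (weighted \<rho> (f_one \<rho> v) (act g z))"
      unfolding ip_norm_def by (simp add: weighted_slash [OF g z])
    also have "A * (B * \<dots>) \<le> A * (B * (C * kappa (act g z)))"
      using A B C(2) [OF act_siegel [OF g z]] by (intro mult_left_mono) auto
    finally show ?thesis by (simp add: mult.assoc)
  qed
  then show ?thesis using A(1) B(1) C(1) by (intro exI [of _ "A * (B * C)"]) auto
qed

lemma borel_slash_f_one:
  assumes g: "symplectic g"
  shows "(\<lambda>z. indicator siegel z *\<^sub>R slash \<rho> (f_one \<rho> v) g z) \<in> borel_measurable borel"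
proof -
  have "continuous_on siegel (f_one \<rho> v)"
    unfolding f_one_alt [abs_def]
    by (intro continuous_on_mvmult continuous_on_minv continuous_on_rep [OF rep] continuous_on_zeta
        continuous_on_const invertible_zeta rep_invertible [OF rep])
  then have "continuous_on siegel (\<lambda>z. f_one \<rho> v (act g z))"
    by (rule continuous_on_compose2 [OF _ continuous_on_act [OF g]]) (use act_siegel [OF g] in auto)
  then have "continuous_on siegel (slash \<rho> (f_one \<rho> v) g)"
    unfolding slash_def [abs_def]
    by (intro continuous_on_mvmult continuous_on_minv continuous_on_rep [OF rep] continuous_on_autf
        continuous_on_id rep_invertible [OF rep] invertible_autf [OF g])
  then show ?thesis by (intro borel_measurable_continuous_on_indicator borel_siegel)
qed

text \<open>Unfolding \<open>kappa\<close> shows that for almost every z in F the sum of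
  \<open>kappa\<close> over the group is finite. There the Poincare series converges absolutely and
  the pairing with f passes through the sum term by term; unfolding the pairing and
  \<open>pairing_integral\<close> finish the computation.\<close>

theorem petersson_poincare:
  assumes D: "discrete_group \<Gamma>" and f: "f \<in> cusp_forms \<rho> ip \<Gamma>"
  shows "petersson \<rho> ip \<Gamma> f (poincare \<rho> \<Gamma> (f_one \<rho> v)) = average_scalar * ip (f iI) v"
proof -
  interpret discrete_group \<Gamma> by (rule D)
  interpret P: pair_sigma_finite "count_space \<Gamma>" siegel_measure by (rule pair_sigma_finite_group)
  define F where "F = (SOME F. orbit_reps \<Gamma> F)"
  have F: "orbit_reps \<Gamma> F" unfolding F_def by (rule someI_ex [OF orbit_reps_exists])
  then have Fs: "F \<subseteq> siegel" and Fb: "F \<in> sets borel" by (auto simp: orbit_reps_def)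
  have hol: "holomorphic_siegel f" and inv: "\<And>g z. g \<in> \<Gamma> \<Longrightarrow> z \<in> siegel \<Longrightarrow> slash \<rho> f g z = f z"
    and bdd: "bdd_above ((\<lambda>z. ip_norm ip (weighted \<rho> f z)) ` siegel)"
    using f by (auto simp: cusp_forms_def)
  from bdd obtain M where M: "\<And>z. z \<in> siegel \<Longrightarrow> ip_norm ip (weighted \<rho> f z) \<le> M"
    by (auto simp: bdd_above_def)
  note pi = pairing_integral [OF hol M]
  \<comment> \<open>The two arguments of the inner product, extended by 0 so as to be Borel on all
    matrices.\<close>
  define a where "a z = indicator siegel z *\<^sub>R (\<rho> (cmat (map_matrix Im z)) *v f z)" for z
  define b where "b z = (\<Sum>\<^sub>\<infinity>g\<in>\<Gamma>. indicator siegel z *\<^sub>R slash \<rho> (f_one \<rho> v) g z)" for z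
  let ?P = "poincare \<rho> \<Gamma> (f_one \<rho> v)"
  have ab: "indicator F z *\<^sub>R ip (weighted \<rho> f z) (weighted \<rho> ?P z) = indicator F z *\<^sub>R ip (a z) (b z)" for z
    using Fs by (cases "z \<in> F") (auto simp: weighted_inner a_def b_def poincare_def)
  have ba: "a \<in> borel_measurable borel"
  proof -
    have "continuous_on siegel (\<lambda>z. cmat (map_matrix Im z) :: complex^'n::{finite,linorder}^'n::{finite,linorder})"
      by (intro continuous_intros)
    then have "continuous_on siegel (\<lambda>z. \<rho> (cmat (map_matrix Im z)))"
      by (rule continuous_on_rep [OF rep]) (auto simp: invertible_cmat intro: pos_def_invertible siegel_Im)
    then show ?thesis unfolding a_def [abs_def]
      by (intro borel_measurable_continuous_on_indicator borel_siegel continuous_on_mvmult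
          holomorphic_siegel_continuous hol)
  qed
  have bb: "b \<in> borel_measurable borel"
    unfolding b_def [abs_def] by (intro borel_measurable_infsum countable_group borel_slash_f_one symplectic)
  have "continuous_on UNIV (\<lambda>p::(complex^'d) \<times> (complex^'d). ip (fst p) (snd p))"
    by (intro continuous_on_ip [OF ip] continuous_intros)
  then have "(\<lambda>z. ip (a z) (b z)) \<in> borel_measurable borel"
    by (rule borel_measurable_continuous_Pair [OF ba bb])
  then have mab: "(\<lambda>z. indicator F z *\<^sub>R ip (a z) (b z)) \<in> borel_measurable borel"
    using Fb by (intro borel_measurable_scaleR borel_measurable_indicator)
  have ik: "integrable (count_space \<Gamma> \<Otimes>\<^sub>M siegel_measure) (\<lambda>(g, z). indicator F z *\<^sub>R kappa (act g z))"
    by (rule unfold_integral(1) [OF F borel_kappa kappa_integrable])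
  have ip1: "integrable (count_space \<Gamma> \<Otimes>\<^sub>M siegel_measure) (\<lambda>(g, z). indicator F z *\<^sub>R pairing f v (act g z))"
    by (rule unfold_integral(1) [OF F borel_pairing [OF hol] pi(1)])
  have eq: "indicator F z *\<^sub>R ip (a z) (b z) = (LINT g|count_space \<Gamma>. indicator F z *\<^sub>R pairing f v (act g z))"
    if ig: "integrable (count_space \<Gamma>) (\<lambda>g. indicator F z *\<^sub>R kappa (act g z))" for z
  proof (cases "z \<in> F")
    case True
    then have z: "z \<in> siegel" using Fs by auto
    let ?s = "\<lambda>g. slash \<rho> (f_one \<rho> v) g z"
    obtain K where K: "K \<ge> 0" "\<And>g. symplectic g \<Longrightarrow> norm (?s g) \<le> K * kappa (act g z)"
      using slash_f_one_bound [OF z] by blast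
    have "integrable (count_space \<Gamma>) (\<lambda>g. kappa (act g z))" using ig True by simp
    then have "(\<lambda>g. kappa (act g z)) summable_on \<Gamma>"
      using abs_summable_equivalent [of "\<lambda>g. kappa (act g z)" \<Gamma>] summable_on_iff_abs_summable_on_real
      by (auto simp: abs_summable_on_def)
    then have "(\<lambda>g. K * kappa (act g z)) summable_on \<Gamma>" by (rule summable_on_cmult_right)
    then have "(\<lambda>g. norm (?s g)) summable_on \<Gamma>"
      by (rule Infinite_Sum.abs_summable_on_comparison_test') (rule K symplectic)+
    then have "?s summable_on \<Gamma>" by (rule abs_summable_summable)
    then have "(\<Sum>\<^sub>\<infinity>g\<in>\<Gamma>. ip (a z) (?s g)) = ip (a z) (\<Sum>\<^sub>\<infinity>g\<in>\<Gamma>. ?s g)"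
      by (intro infsumI has_sum_bounded_linear [OF bounded_linear_ip_right [OF ip]] has_sum_infsum)
    moreover have "ip (a z) (?s g) = pairing f v (act g z)" if g: "g \<in> \<Gamma>" for g
    proof -
      have sg: "symplectic g" by (rule symplectic [OF g])
      have "ip (a z) (?s g) = ip (weighted \<rho> f z) (weighted \<rho> (slash \<rho> (f_one \<rho> v) g) z)"
        by (simp add: weighted_inner [OF z] a_def z)
      \<comment> \<open>Here the invariance of f enters: with g slashed onto both arguments,
        \<open>weighted_slash\<close> moves the pairing to gz.\<close>
      also have "weighted \<rho> f z = weighted \<rho> (slash \<rho> f g) z" by (simp add: weighted_def inv [OF g z])
      finally show ?thesis
        unfolding weighted_slash [OF sg z] weighted_inner_f_one [OF act_siegel [OF sg z]] .
    qed
    then have "(\<Sum>\<^sub>\<infinity>g\<in>\<Gamma>. ip (a z) (?s g)) = (\<Sum>\<^sub>\<infinity>g\<in>\<Gamma>. pairing f v (act g z))" by (rule infsum_cong)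
    ultimately show ?thesis using True z by (simp add: b_def infsum_complex_integral)
  qed simp
  have "quotient_integral \<Gamma> (\<lambda>z. ip (weighted \<rho> f z) (weighted \<rho> ?P z)) =
    (LINT z|siegel_measure. indicator F z *\<^sub>R ip (a z) (b z))"
    by (simp only: quotient_integral_def F_def [symmetric] set_lebesgue_integral_def ab)
  also have "\<dots> = (LINT z|siegel_measure. LINT g|count_space \<Gamma>. indicator F z *\<^sub>R pairing f v (act g z))"
  proof (rule integral_cong_AE)
    show "(\<lambda>z. indicator F z *\<^sub>R ip (a z) (b z)) \<in> borel_measurable siegel_measure" using mab by simp
    show "(\<lambda>z. LINT g|count_space \<Gamma>. indicator F z *\<^sub>R pairing f v (act g z)) \<in> borel_measurable siegel_measure"
      by (rule borel_measurable_integrable [OF P.integrable_snd [OF ip1]])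
    show "AE z in siegel_measure. indicator F z *\<^sub>R ip (a z) (b z) =
        (LINT g|count_space \<Gamma>. indicator F z *\<^sub>R pairing f v (act g z))"
      using P.AE_integrable_snd [OF ik] by eventually_elim (rule eq)
  qed
  also have "\<dots> = of_nat center_order * (average_scalar * ip (f iI) v)"
    by (simp only: unfold_integral(2) [OF F borel_pairing [OF hol] pi(1)] pi(2))
  finally have "petersson \<rho> ip \<Gamma> f ?P = 1 / of_nat center_order * (of_nat center_order * (average_scalar * ip (f iI) v))"
    by (simp only: petersson_def center_order_def)
  then show ?thesis using center_order_pos by simp
qed

end

theorem lemma1p2:
  fixes \<rho> :: "complex^'n::{finite,linorder}^'n::{finite,linorder} \<Rightarrow> complex^'d^'d"
    and \<omega> :: "'n \<Rightarrow> int"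
  assumes "polynomial_rep \<rho>"
    and "irreducible_rep \<rho>"
    and "highest_weight \<rho> \<omega>"
    and "antimono \<omega>"
    and "\<omega> (Max UNIV) > 2 * int CARD('n)"
  shows "\<exists>c::complex. c \<noteq> 0 \<and>
    (\<forall>ip \<Gamma> f v. hermitian_inner ip \<longrightarrow> unitary_on_U \<rho> ip \<longrightarrow>
       subgroup \<Gamma> Sp \<longrightarrow> commensurable Sp \<Gamma> Sp_Z \<longrightarrow> f \<in> cusp_forms \<rho> ip \<Gamma> \<longrightarrow>
       ip (f iI) v = c * petersson \<rho> ip \<Gamma> f (poincare \<rho> \<Gamma> (f_one \<rho> v)))"
proof -
  interpret siegel_weight \<rho> \<omega> by (rule siegel_weight.intro) (rule assms)+
  \<comment> \<open>\<open>average_scalar_nonzero\<close> is proved with an invariant inner product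
    at hand, whereas c is chosen before \<open>ip\<close> is quantified; the conditional makes c
    nonzero in any case.\<close>
  define c where "c = (if average_scalar = 0 then 1 else 1 / average_scalar)"
  have "ip (f iI) v = c * petersson \<rho> ip \<Gamma> f (poincare \<rho> \<Gamma> (f_one \<rho> v))"
    if ip: "hermitian_inner ip" "unitary_on_U \<rho> ip" and \<Gamma>: "subgroup \<Gamma> Sp" "commensurable Sp \<Gamma> Sp_Z"
      and f: "f \<in> cusp_forms \<rho> ip \<Gamma>" for ip \<Gamma> f v
  proof -
    interpret siegel_weight_inner \<rho> \<omega> ip by unfold_locales (rule ip)+
    show ?thesis
      using petersson_poincare [OF discrete_group.intro [OF \<Gamma>] f, of v] average_scalar_nonzero by (simp add: c_def)
  qed
  moreover have "c \<noteq> 0" by (simp add: c_def)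
  ultimately show ?thesis by blast
qed

end
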